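(* Fix $k\in\mathbb{Z}_{\ge1}$ and $a\in\mathbb Z$. For $n>k$ let $(s_t)_{t\in\mathbb Z}$ be the periodic extension of a uniformly random sorting network in $\Omega_n$, and let $\widehat{\mathrm{Sp}}_{k,n}$ be a random variable whose law is the conditional law of $Y-a$ given the event $\{s_a=k\}$, where $Y=\min\{t>a:s_t=k\}$. Then as $n\to\infty$, $$\frac{\widehat{\mathrm{Sp}}_{k,n}}{n^{3/2}}\longrightarrow\frac12\widehat Z_k\quad\text{in distribution},$$ where $\widehat Z_k$ is a positive random variable with density $$\widehat g_k(x)=\frac{\sqrt\pi}{2}\,\frac{(2k-2)!!}{(2k-1)!!}\,\frac{\partial^2}{\partial x^2}\Big(\mathbb P\big(\mathbf{T}_{FS}(k)>x\big)\Big),\qquad x>0,$$ and $\mathbf{T}_{FS}(k)$ is the smallest positive eigenvalue of a $2k\times 2k$ aGUE matrix.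
   Context: For $n\ge2$, $N=\binom n2$, $1\le k\le n-1$, $\tau_k=(k,k+1)\in\mathfrak S_n$. A sorting network of size $n$ is a sequence $(s_1,\dots,s_N)$ with $s_i\in\{1,\dots,n-1\}$ and $\tau_{s_1}\cdots\tau_{s_N}=(n\ n-1\ \dots\ 2\ 1)$; $\Omega_n$ is the set of them, with the uniform measure. The periodic extension is $(s_t)_{t\in\mathbb Z}$ with $s_{t+N}=n-s_t$ for all $t$. An $\ell\times\ell$ aGUE matrix is $\frac{\mathbf i}{2}(Y-Y^T)$ with $Y$ having i.i.d. $N(0,1)$ entries. *)

theory Defs
  imports "HOL-Probability.Probability" "HOL-Combinatorics.Transposition"
    "Jordan_Normal_Form.Char_Poly"
begin

fun dfact :: "nat \<Rightarrow> nat" where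
  "dfact 0 = 1"
| "dfact (Suc 0) = 1"
| "dfact (Suc (Suc m)) = Suc (Suc m) * dfact m"

definition net_prod :: "nat list \<Rightarrow> nat \<Rightarrow> nat" where
  "net_prod s = foldr (\<lambda>i f. Transposition.transpose i (Suc i) \<circ> f) s id"

definition rev_perm :: "nat \<Rightarrow> nat \<Rightarrow> nat" where
  "rev_perm n = (\<lambda>j. if 1 \<le> j \<and> j \<le> n then n + 1 - j else j)"

text \<open>Sorting networks of size n; a list s represents (s_1,...,s_N) with s_i = s ! (i - 1).\<close>
definition sorting_networks :: "nat \<Rightarrow> nat list set" where
  "sorting_networks n = {s. length s = n choose 2 \<and> (\<forall>i\<in>set s. 1 \<le> i \<and> i \<le> n - 1)
      \<and> net_prod s = rev_perm n}"

text \<open>Periodic extension: s_t for t in Z, with s_{t+N} = n - s_t.\<close>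
definition per_ext :: "nat \<Rightarrow> nat list \<Rightarrow> int \<Rightarrow> int" where
  "per_ext n s t = (let N = int (n choose 2); q = (t - 1) div N; r = nat ((t - 1) mod N) in
      if even q then int (s ! r) else int n - int (s ! r))"

definition next_gap :: "nat \<Rightarrow> nat \<Rightarrow> int \<Rightarrow> nat list \<Rightarrow> nat" where
  "next_gap n k a s = (LEAST m. m > 0 \<and> per_ext n s (a + int m) = int k)"

definition scaled_gap_law :: "nat \<Rightarrow> int \<Rightarrow> nat \<Rightarrow> real measure" where
  "scaled_gap_law k a n = distr
     (measure_pmf (pmf_of_set {s \<in> sorting_networks n. per_ext n s a = int k})) borel
     (\<lambda>s. real (next_gap n k a s) / real n powr (3/2))"

definition gauss_entries :: "nat \<Rightarrow> (nat \<times> nat \<Rightarrow> real) measure" where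
  "gauss_entries l = PiM ({..<l} \<times> {..<l}) (\<lambda>_. std_normal_distribution)"

definition aGUE_mat :: "nat \<Rightarrow> (nat \<times> nat \<Rightarrow> real) \<Rightarrow> complex Matrix.mat" where
  "aGUE_mat l Y = Matrix.mat l l (\<lambda>(i, j). (\<i> / 2) * complex_of_real (Y (i, j) - Y (j, i)))"

definition smallest_pos_eig :: "complex Matrix.mat \<Rightarrow> real" where
  "smallest_pos_eig A = Inf {x::real. x > 0 \<and> eigenvalue A (complex_of_real x)}"

definition TFS_tail :: "nat \<Rightarrow> real \<Rightarrow> real" where
  "TFS_tail k x = measure (gauss_entries (2 * k))
      {Y \<in> space (gauss_entries (2 * k)). smallest_pos_eig (aGUE_mat (2 * k) Y) > x}"

definition ghat :: "nat \<Rightarrow> real \<Rightarrow> real" where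
  "ghat k x = (if x > 0 then sqrt pi / 2 * (real (dfact (2 * k - 2)) / real (dfact (2 * k - 1)))
      * deriv (deriv (TFS_tail k)) x else 0)"

end

theory Submission
  imports Defs "Jordan_Normal_Form.Schur_Decomposition" "HOL-Real_Asymp.Real_Asymp"
begin

text \<open>
  Applying divided differences along a word of length $\binom n2$ to the monomial $\prod_{i<j} z_j$ gives 1 for a
  sorting network and 0 otherwise. The exponential generating function of the networks whose first m letters
  avoid k is therefore the solution of a linear evolution equation, and that solution is an explicit determinant.
  At z = 0 it factors through the k x k Hankel determinant of the moments of $(1-u^2)^{n-2k}$ on $[s,1]$, where s is
  the Poissonization parameter. With $s = x/\sqrt n$ this converges to $H(x)$, the Hankel determinant of the moments
  $\int_x^\infty v^{2j} e^{-v^2} dv$, so the first occurrence of k after time 0 has, on the scale $n^{3/2}/2$, the limiting tail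
  $H(x)/H(0)$. Rotation of networks makes the periodic extension stationary, hence the tail of the first occurrence
  is convex and its discrete derivative is, up to normalisation, the tail of the gap; convexity lets the limit
  pass to the derivative.

  The same ratio $H(x)/H(0)$ is the tail of the smallest positive eigenvalue of the aGUE matrix. Gaussian
  integration by parts shows that the moments of the traces of powers of the matrix and the moments of the
  power sums of the squares of k Gaussian points with a squared Vandermonde weight satisfy the same
  recursion; these moments determine the law of the point configuration, and the weighted model is evaluated
  by the Andreief identity. This avoids the joint eigenvalue density.
\<close>

section \<open>Determinants of functions\<close>

text \<open>Let L be the sum of all divided differences and L' the same sum without index k. The
  first letter of a word acts last, so exp(s L') exp(t L) applied to the monomial generates the
  words whose first letters avoid k, and at z = 0 homogeneity keeps exactly the words of full length
  N. On the line t + s = 1 the coefficients become Binomial(N, s) weights; this is the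
  Poissonization, and since the counts decrease in m it can be undone by Chebyshev's inequality. On
  the same line the matrix rows from k on no longer depend on s. The Hankel block then splits off
  because the polynomials x^c (2 - x)^c are symmetric about x = 1 and have no odd derivatives there.

  On the random matrix side the obstacle is that eigenvalues come as an arbitrarily ordered list,
  about whose measurability nothing is known. Hence only power sums, and limits of symmetric
  functions built from them, are integrated.

  The constant sqrt(pi)/2 (2k-2)!!/(2k-1)!! is -1/G'(0) for G = H/H(0), the quotient of the Hankel
  determinant by its minor without first row and column. It turns -G' into a function with value 1
  at 0, that is, into a tail.\<close>

definition fdet :: "nat \<Rightarrow> (nat \<Rightarrow> nat \<Rightarrow> real) \<Rightarrow> real" where
  "fdet n a = Determinant.det (Matrix.mat n n (\<lambda>(i, j). a i j))"

lemma fdet_leibniz: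
  "fdet n a = (\<Sum>p | p permutes {0..<n}. of_int (sign p) * (\<Prod>i<n. a i (p i)))"
proof -
  have "(\<Prod>i = 0..<n. Matrix.mat n n (\<lambda>(i, j). a i j) $$ (i, p i)) = (\<Prod>i<n. a i (p i))"
    if "p permutes {0..<n}" for p
  proof -
    have "p i < n" if "i < n" for i
      using permutes_in_image[OF \<open>p permutes _\<close>, of i] that by auto
    then show ?thesis by (intro prod.cong) auto
  qed
  then show ?thesis
    unfolding fdet_def by (subst det_def'[of _ n]) (auto intro!: sum.cong simp: sign_def)
qed

lemma fdet_cong:
  assumes "\<And>i j. i < n \<Longrightarrow> j < n \<Longrightarrow> a i j = b i j"
  shows "fdet n a = fdet n b"
  unfolding fdet_def using assms by (intro arg_cong[where f = Determinant.det] eq_matI) auto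

lemma prod_upd_split:
  fixes f :: "nat \<Rightarrow> nat \<Rightarrow> real"
  assumes "r < n"
  shows "(\<Prod>i<n. (f(r := u)) i (p i)) = u (p r) * (\<Prod>i\<in>{..<n} - {r}. f i (p i))"
proof -
  have "(\<Prod>i<n. (f(r := u)) i (p i)) = (f(r := u)) r (p r) * (\<Prod>i\<in>{..<n} - {r}. (f(r := u)) i (p i))"
    using assms by (intro prod.remove) auto
  also have "(\<Prod>i\<in>{..<n} - {r}. (f(r := u)) i (p i)) = (\<Prod>i\<in>{..<n} - {r}. f i (p i))"
    by (intro prod.cong) auto
  finally show ?thesis by simp
qed

lemma fdet_row_linear:
  assumes "r < n"
  shows "fdet n (a(r := (\<lambda>j. x * u j + y * v j))) = x * fdet n (a(r := u)) + y * fdet n (a(r := v))"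
  unfolding fdet_leibniz prod_upd_split[OF assms] sum_distrib_left sum.distrib[symmetric]
  by (intro sum.cong) (auto simp: algebra_simps)

lemma fdet_rows_eq:
  assumes "r < n" "q < n" "r \<noteq> q"
  shows "fdet n (a(r := a q)) = 0"
  unfolding fdet_def
  by (rule det_identical_rows[of _ n r q]) (use assms in \<open>auto simp: row_def intro!: eq_vecI\<close>)

lemma fdet_row_zero:
  assumes "r < n"
  shows "fdet n (a(r := (\<lambda>j. 0))) = 0"
  unfolding fdet_leibniz prod_upd_split[OF assms] by simp

lemma fdet_has_derivative:
  fixes a :: "real \<Rightarrow> nat \<Rightarrow> nat \<Rightarrow> real"
  assumes "\<And>i j. i < n \<Longrightarrow> j < n \<Longrightarrow> ((\<lambda>s. a s i j) has_real_derivative a' i j) (at s)"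
  shows "((\<lambda>s. fdet n (a s)) has_real_derivative (\<Sum>r<n. fdet n ((a s)(r := a' r)))) (at s)"
proof -
  have lt: "p i < n" if "p permutes {0..<n}" "i < n" for p i
    using permutes_in_image[OF that(1), of i] that by auto
  have "((\<lambda>s. fdet n (a s)) has_real_derivative
      (\<Sum>p | p permutes {0..<n}. of_int (sign p) * (\<Sum>r<n. a' r (p r) * (\<Prod>i\<in>{..<n} - {r}. a s i (p i))))) (at s)"
    unfolding fdet_leibniz
  proof (rule DERIV_sum, rule DERIV_cmult)
    fix p assume "p \<in> {p. p permutes {0..<n}}"
    then show "((\<lambda>s. \<Prod>i<n. a s i (p i)) has_real_derivative
        (\<Sum>r<n. a' r (p r) * (\<Prod>i\<in>{..<n} - {r}. a s i (p i)))) (at s)"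
      using lt by (intro has_field_derivative_prod assms) blast+
  qed
  also have "(\<Sum>p | p permutes {0..<n}. of_int (sign p) * (\<Sum>r<n. a' r (p r) * (\<Prod>i\<in>{..<n} - {r}. a s i (p i))))
      = (\<Sum>r<n. \<Sum>p | p permutes {0..<n}. of_int (sign p) * (a' r (p r) * (\<Prod>i\<in>{..<n} - {r}. a s i (p i))))"
    unfolding sum_distrib_left by (rule sum.swap)
  also have "\<dots> = (\<Sum>r<n. fdet n ((a s)(r := a' r)))"
    unfolding fdet_leibniz by (intro sum.cong refl, subst prod_upd_split) auto
  finally show ?thesis .
qed

lemma fdet_tendsto:
  assumes "\<And>i j. i < n \<Longrightarrow> j < n \<Longrightarrow> ((\<lambda>s. a s i j) \<longlongrightarrow> b i j) F"
  shows "((\<lambda>s. fdet n (a s)) \<longlongrightarrow> fdet n b) F"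
proof -
  have lt: "p i < n" if "p permutes {0..<n}" "i < n" for p i
    using permutes_in_image[OF that(1), of i] that by auto
  show ?thesis unfolding fdet_leibniz
  proof (rule tendsto_sum, rule tendsto_mult[OF tendsto_const], rule tendsto_prod)
    fix p i assume "p \<in> {p. p permutes {0..<n}}" "i \<in> {..<n}"
    then show "((\<lambda>s. a s i (p i)) \<longlongrightarrow> b i (p i)) F"
      by (intro assms) (auto intro: lt)
  qed
qed

lemma fdet_mult:
  "fdet n (\<lambda>i j. \<Sum>m<n. a i m * b m j) = fdet n a * fdet n b"
proof -
  have "Matrix.mat n n (\<lambda>(i, j). \<Sum>m<n. a i m * b m j)
      = Matrix.mat n n (\<lambda>(i, j). a i j) * Matrix.mat n n (\<lambda>(i, j). b i j)"
    by (intro eq_matI) (auto simp: scalar_prod_def atLeast0LessThan)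
  then show ?thesis unfolding fdet_def by (simp add: det_mult[of _ n])
qed

lemma fdet_transpose: "fdet n (\<lambda>i j. a j i) = fdet n a"
proof -
  have "Matrix.mat n n (\<lambda>(i, j). a j i) = transpose_mat (Matrix.mat n n (\<lambda>(i, j). a i j))"
    by (intro eq_matI) auto
  then show ?thesis unfolding fdet_def by (simp add: det_transpose[of _ n])
qed

lemma fdet_lower_triangular:
  assumes "\<And>i j. i < j \<Longrightarrow> j < n \<Longrightarrow> a i j = 0"
  shows "fdet n a = (\<Prod>i<n. a i i)"
proof -
  have "fdet n a = prod_list (diag_mat (Matrix.mat n n (\<lambda>(i, j). a i j)))"
    unfolding fdet_def using assms by (intro det_lower_triangular[of n]) auto
  also have "diag_mat (Matrix.mat n n (\<lambda>(i, j). a i j)) = map (\<lambda>i. a i i) [0..<n]"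
    unfolding diag_mat_def by auto
  also have "prod_list (map (\<lambda>i. a i i) [0..<n]) = (\<Prod>i<n. a i i)"
    by (simp add: prod.distinct_set_conv_list[symmetric] atLeast0LessThan)
  finally show ?thesis .
qed

lemma fdet_upper_triangular:
  assumes "\<And>i j. j < i \<Longrightarrow> i < n \<Longrightarrow> a i j = 0"
  shows "fdet n a = (\<Prod>i<n. a i i)"
  using fdet_lower_triangular[of n "\<lambda>i j. a j i"] assms unfolding fdet_transpose[of n a] by blast

lemma fdet_block_lower_left_zero:
  assumes "\<And>i j. i < m \<Longrightarrow> j < k \<Longrightarrow> a (k + i) j = 0"
  shows "fdet (k + m) a = fdet k a * fdet m (\<lambda>i j. a (k + i) (k + j))"
proof -
  have "Matrix.mat (k + m) (k + m) (\<lambda>(i, j). a i j) =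
      four_block_mat (Matrix.mat k k (\<lambda>(i, j). a i j)) (Matrix.mat k m (\<lambda>(i, j). a i (k + j)))
        (0\<^sub>m m k) (Matrix.mat m m (\<lambda>(i, j). a (k + i) (k + j)))"
  proof (intro eq_matI, goal_cases)
    case (1 i j)
    then show ?case using assms[of "i - k" j] by (cases "i < k"; cases "j < k") auto
  qed auto
  then show ?thesis unfolding fdet_def
    by (simp add: det_four_block_mat_lower_left_zero[where n = k and m = m])
qed

section \<open>Divided differences along sorting networks\<close>

abbreviation pinv :: "('a \<Rightarrow> 'b) \<Rightarrow> 'b \<Rightarrow> 'a" where
  "pinv f \<equiv> inv_into UNIV f"

abbreviation tau :: "nat \<Rightarrow> nat \<Rightarrow> nat" where
  "tau r \<equiv> Transposition.transpose r (Suc r)"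

text \<open>The denominator has the opposite sign to the usual divided difference, so that
  \<open>z (Suc r)\<close> is sent to 1, which suits a monomial whose exponents increase with the
  index. Where \<open>z r = z (Suc r)\<close>, division by zero makes the value 0; hence the
  assumption \<open>inj z\<close> in the polynomial identities below.\<close>

definition dd :: "nat \<Rightarrow> ((nat \<Rightarrow> real) \<Rightarrow> real) \<Rightarrow> (nat \<Rightarrow> real) \<Rightarrow> real" where
  "dd r f z = (f z - f (z \<circ> tau r)) / (z (Suc r) - z r)"

text \<open>The first letter is the outermost operator. A condition on an initial segment of the
  word is therefore a condition on the operators applied last.\<close>

abbreviation dd_word :: "nat list \<Rightarrow> ((nat \<Rightarrow> real) \<Rightarrow> real) \<Rightarrow> (nat \<Rightarrow> real) \<Rightarrow> real" where
  "dd_word w f \<equiv> foldr dd w f"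

lemma dd_word_Cons:
  "dd_word (a # w) f z = (dd_word w f z - dd_word w f (z \<circ> tau a)) / (z (Suc a) - z a)"
  unfolding foldr.simps comp_apply dd_def ..

lemma net_prod_simps:
  "net_prod [] = id" "net_prod (a # w) = tau a \<circ> net_prod w"
  by (simp_all add: net_prod_def)

lemma tau_permutes: "1 \<le> a \<Longrightarrow> a < n \<Longrightarrow> tau a permutes {1..n}"
  by (rule permutes_swap_id) auto

lemma net_prod_permutes:
  "\<forall>a\<in>set w. 1 \<le> a \<and> a < n \<Longrightarrow> net_prod w permutes {1..n}"
proof (induction w)
  case (Cons a w)
  then show ?case unfolding net_prod_simps by (intro permutes_compose tau_permutes) simp_all
qed (simp add: permutes_id net_prod_simps)

section \<open>Inversion sets under adjacent transpositions\<close>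

definition invset :: "nat \<Rightarrow> (nat \<Rightarrow> nat) \<Rightarrow> (nat \<times> nat) set" where
  "invset n p = {(c, b). 1 \<le> c \<and> c < b \<and> b \<le> n \<and> p b < p c}"

lemma finite_invset [simp]: "finite (invset n p)"
  by (rule finite_subset[of _ "{..n} \<times> {..n}"]) (auto simp: invset_def)

lemma invset_id [simp]: "invset n id = {}"
  by (auto simp: invset_def)

lemma tau_less_iff:
  assumes "u \<noteq> v" "{u, v} \<noteq> {a, Suc a}"
  shows "tau a u < tau a v \<longleftrightarrow> u < v"
  using assms by (auto simp: Transposition.transpose_def doubleton_eq_iff split: if_splits)

text \<open>Composing with \<open>tau a\<close> exchanges the values a and a + 1. Only the two
  positions that hold these values change their relative order; every other comparison is unaffected
  by \<open>tau_less_iff\<close>.\<close>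

lemma invset_tau:
  assumes p: "p permutes {1..n}" and a: "1 \<le> a" "a < n"
    and cb: "pinv p (Suc a) < pinv p a"
  shows "invset n p = insert (pinv p (Suc a), pinv p a) (invset n (tau a \<circ> p))"
    and "(pinv p (Suc a), pinv p a) \<notin> invset n (tau a \<circ> p)"
proof -
  let ?b = "pinv p a" and ?c = "pinv p (Suc a)"
  have pb: "p ?b = a" and pc: "p ?c = Suc a"
    using permutes_inverses(1)[OF p] by auto
  have rng: "?b \<in> {1..n}" "?c \<in> {1..n}"
    using permutes_in_image[OF permutes_inv[OF p], of a] permutes_in_image[OF permutes_inv[OF p], of "Suc a"] a by auto
  have inj: "p x = p y \<longleftrightarrow> x = y" for x y
    using permutes_inj[OF p] by (auto dest: injD)
  show "(?c, ?b) \<notin> invset n (tau a \<circ> p)"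
    by (simp add: invset_def pb pc)
  have key: "(x, y) \<in> invset n p \<longleftrightarrow> (x, y) \<in> insert (?c, ?b) (invset n (tau a \<circ> p))" for x y
  proof (cases "{p x, p y} = {a, Suc a}")
    case True
    then have "(x = ?b \<and> y = ?c) \<or> (x = ?c \<and> y = ?b)"
      using inj pb pc by (metis doubleton_eq_iff)
    then show ?thesis
    proof
      assume "x = ?b \<and> y = ?c"
      then show ?thesis using cb by (simp add: invset_def)
    next
      assume "x = ?c \<and> y = ?b"
      then show ?thesis using cb rng pb pc by (simp add: invset_def)
    qed
  next
    case False
    then have ne: "(x, y) \<noteq> (?c, ?b)" using pb pc by auto
    have "x \<noteq> y \<Longrightarrow> tau a (p y) < tau a (p x) \<longleftrightarrow> p y < p x"
      using tau_less_iff[of "p y" "p x" a] False inj by (metis insert_commute)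
    then show ?thesis using ne by (auto simp: invset_def)
  qed
  show "invset n p = insert (?c, ?b) (invset n (tau a \<circ> p))"
    using key by (auto simp del: insert_iff)
qed

lemma inv_tau_comp:
  assumes "p permutes {1..n}"
  shows "pinv (tau a \<circ> p) = pinv p \<circ> tau a"
  using assms by (subst o_inv_distrib) (auto intro: permutes_bij)

lemma pinv_Suc_neq:
  assumes "p permutes S"
  shows "pinv p (Suc a) \<noteq> pinv p a"
  using injD[OF permutes_inj[OF permutes_inv[OF assms]], of "Suc a" a] by linarith

lemma tau_tau [simp]: "tau a \<circ> (tau a \<circ> p) = p"
  by (auto simp: fun_eq_iff)

lemma card_invset_tau_le:
  assumes p: "p permutes {1..n}" and a: "1 \<le> a" "a < n"
  shows "card (invset n (tau a \<circ> p)) \<le> Suc (card (invset n p))"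
proof -
  have ne: "pinv p (Suc a) \<noteq> pinv p a"
    by (rule pinv_Suc_neq[OF p])
  show ?thesis
  proof (cases "pinv p (Suc a) < pinv p a")
    case True
    show ?thesis
      by (rule le_SucI, rule card_mono) (auto simp: invset_tau(1)[OF p a True])
  next
    case False
    let ?q = "tau a \<circ> p"
    have q: "?q permutes {1..n}" by (intro permutes_compose p tau_permutes a)
    have "pinv ?q (Suc a) < pinv ?q a"
      unfolding inv_tau_comp[OF p] using False ne by simp
    from invset_tau(1)[OF q a this] have "invset n ?q = insert (pinv ?q (Suc a), pinv ?q a) (invset n p)"
      by simp
    then show ?thesis by (simp add: card_insert_if)
  qed
qed

lemma card_invset_net_prod:
  "\<forall>a\<in>set w. 1 \<le> a \<and> a < n \<Longrightarrow> card (invset n (net_prod w)) \<le> length w"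
proof (induction w)
  case (Cons a w)
  then have "card (invset n (tau a \<circ> net_prod w)) \<le> Suc (card (invset n (net_prod w)))"
    by (intro card_invset_tau_le net_prod_permutes) auto
  also have "\<dots> \<le> length (a # w)" using Cons by simp
  finally show ?case unfolding net_prod_simps .
qed (simp add: net_prod_simps)

definition pairs :: "nat \<Rightarrow> (nat \<times> nat) set" where
  "pairs n = {(i, j). 1 \<le> i \<and> i < j \<and> j \<le> n}"

lemma finite_pairs [simp]: "finite (pairs n)"
  by (rule finite_subset[of _ "{..n} \<times> {..n}"]) (auto simp: pairs_def)

lemma card_pairs: "card (pairs n) = n choose 2"
proof (induction n)
  case (Suc n)
  have "pairs (Suc n) = pairs n \<union> (\<lambda>i. (i, Suc n)) ` {1..n}"
    by (auto simp: pairs_def)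
  moreover have "pairs n \<inter> (\<lambda>i. (i, Suc n)) ` {1..n} = {}" by (auto simp: pairs_def)
  ultimately have "card (pairs (Suc n)) = card (pairs n) + n"
    by (simp add: card_Un_disjoint card_image inj_on_def)
  then show ?case using Suc by (simp add: numeral_2_eq_2)
next
  case 0
  have "pairs 0 = {}" by (auto simp: pairs_def)
  then show ?case by simp
qed

lemma rev_perm_permutes: "rev_perm n permutes {1..n}"
proof -
  have "bij_betw (rev_perm n) {1..n} {1..n}"
    by (rule bij_betwI[where g = "rev_perm n"]) (auto simp: rev_perm_def)
  then show ?thesis by (rule bij_imp_permutes) (auto simp: rev_perm_def)
qed

lemma rev_perm_rev_perm [simp]: "rev_perm n (rev_perm n i) = i"
  by (auto simp: rev_perm_def)

lemma inv_rev_perm [simp]: "pinv (rev_perm n) = rev_perm n"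
  by (rule inv_unique_comp) auto

lemma invset_rev_perm: "invset n (rev_perm n) = pairs n"
  by (auto simp: invset_def pairs_def rev_perm_def)

text \<open>The double Schubert polynomial of the longest permutation, with the z-variables in
  reversed order. It has the same leading form as \<open>top_mono\<close> but vanishes at every
  nontrivial permutation of y.\<close>

definition delta_fun :: "nat \<Rightarrow> (nat \<Rightarrow> real) \<Rightarrow> (nat \<Rightarrow> real) \<Rightarrow> real" where
  "delta_fun n y z = (\<Prod>(i, j)\<in>pairs n. z j - y i)"

text \<open>A permutation preserves the sum of all indices, so one that is not the identity must
  lower some index j. The factor belonging to the pair (p j, j) is then
  \<open>y (p j) - y (p j)\<close>.\<close>

lemma delta_fun_eq_0:
  assumes p: "p permutes {1..n}" and "p \<noteq> id"
  shows "delta_fun n y (y \<circ> p) = 0"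
proof -
  have "\<exists>j\<in>{1..n}. p j < j"
  proof (rule ccontr)
    assume "\<not> ?thesis"
    then have ge: "p j \<ge> j" if "j \<in> {1..n}" for j using that by (meson not_le)
    have "(\<Sum>j\<in>{1..n}. p j) = (\<Sum>j\<in>{1..n}. j)"
      using sum.permute[OF p, of id] by simp
    then have "\<forall>j\<in>{1..n}. p j = j"
      using ge by (intro ballI sym[OF sum_mono_inv[where f = "\<lambda>j. j" and g = p and I = "{1..n}"]]) auto
    then have "p = id" using p by (auto simp: permutes_def fun_eq_iff)
    with assms show False by simp
  qed
  then obtain j where j: "j \<in> {1..n}" "p j < j" by auto
  have "p j \<in> {1..n}" using permutes_in_image[OF p, of j] j by simp
  then have "(p j, j) \<in> pairs n" using j by (auto simp: pairs_def)
  then show ?thesis unfolding delta_fun_def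
    by (intro prod_zero[OF finite_pairs] bexI[of _ "(p j, j)"]) auto
qed

text \<open>Unfolding the operators gives values of \<open>delta_fun\<close> at permutations of y,
  of which only the identity survives. Since the word has at most as many letters as p has
  inversions, p can be brought to the identity only by letting every letter swap.\<close>

lemma dd_word_delta:
  assumes "\<forall>a\<in>set w. 1 \<le> a \<and> a < n" "p permutes {1..n}" "length w \<le> card (invset n p)" "inj y"
  shows "dd_word w (delta_fun n y) (y \<circ> pinv p) =
    (if p = net_prod w then delta_fun n y y / (\<Prod>(c, b)\<in>invset n p. y b - y c) else 0)"
  using assms(1-3)
proof (induction w arbitrary: p)
  case Nil
  show ?case
  proof (cases "p = id")
    case False
    then have "pinv p \<noteq> id" using Nil by (metis inv_id permutes_inv_inv)
    then have "delta_fun n y (y \<circ> pinv p) = 0" by (intro delta_fun_eq_0 permutes_inv Nil)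
    then show ?thesis using False unfolding net_prod_simps foldr.simps by (metis id_apply)
  next
    case True
    then show ?thesis unfolding net_prod_simps True foldr.simps inv_id invset_id by simp
  qed
next
  case (Cons a w)
  then have a: "1 \<le> a" "a < n" by auto
  let ?q = "tau a \<circ> p"
  have p: "p permutes {1..n}" by fact
  have q: "?q permutes {1..n}" by (intro permutes_compose p tau_permutes a)
  have cw: "card (invset n (net_prod w)) \<le> length w"
    using Cons by (intro card_invset_net_prod) auto
  \<comment> \<open>By the length hypothesis p has at least \<open>length w + 1\<close> inversions,
    more than \<open>net_prod w\<close> can have; so the unswapped term of the divided difference is
    zero.\<close>
  then have pne: "p \<noteq> net_prod w" using Cons.prems by auto
  have 1: "dd_word w (delta_fun n y) (y \<circ> pinv p) = 0"
    by (rule trans[OF Cons.IH]) (use Cons.prems pne in auto)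
  have "card (invset n p) \<le> Suc (card (invset n ?q))"
    using card_invset_tau_le[OF q a] by simp
  then have len: "length w \<le> card (invset n ?q)" using Cons.prems(3) by simp
  have 2: "dd_word w (delta_fun n y) (y \<circ> pinv ?q) =
    (if ?q = net_prod w then delta_fun n y y / (\<Prod>(c, b)\<in>invset n ?q. y b - y c) else 0)"
    using Cons.prems(1) by (intro Cons.IH[OF _ q len]) simp
  have eq: "?q = net_prod w \<longleftrightarrow> p = net_prod (a # w)"
    by (metis net_prod_simps(2) tau_tau)
  have *: "y \<circ> pinv p \<circ> tau a = y \<circ> pinv ?q"
    unfolding inv_tau_comp[OF p] by (simp add: o_assoc)
  show ?case
  proof (cases "?q = net_prod w")
    case False
    then show ?thesis using eq unfolding dd_word_Cons * 1 2 by simp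
  next
    case True
    \<comment> \<open>This fixes the sign of the new factor: otherwise \<open>?q\<close>, the
      product of w, would have at least as many inversions as p, hence more than
      \<open>length w\<close>.\<close>
    have lt: "pinv p (Suc a) < pinv p a"
    proof (rule ccontr)
      assume "\<not> ?thesis"
      moreover have "pinv p (Suc a) \<noteq> pinv p a"
        by (rule pinv_Suc_neq[OF p])
      ultimately have "pinv ?q (Suc a) < pinv ?q a"
        unfolding inv_tau_comp[OF p] by simp
      from invset_tau(1)[OF q a this] have "card (invset n p) \<le> card (invset n ?q)"
        by (intro card_mono) auto
      then show False using True cw Cons.prems by auto
    qed
    let ?c = "pinv p (Suc a)" and ?b = "pinv p a"
    have prod: "(\<Prod>(c, b)\<in>invset n p. y b - y c) = (y ?b - y ?c) * (\<Prod>(c, b)\<in>invset n ?q. y b - y c)"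
      unfolding invset_tau(1)[OF p a lt]
      by (subst prod.insert) (use invset_tau(2)[OF p a lt] in auto)
    have "dd_word (a # w) (delta_fun n y) (y \<circ> pinv p)
      = (0 - delta_fun n y y / (\<Prod>(c, b)\<in>invset n ?q. y b - y c)) / (y ?c - y ?b)"
      unfolding dd_word_Cons * 1 2 using True by simp
    also have "\<dots> = delta_fun n y y / (\<Prod>(c, b)\<in>invset n p. y b - y c)"
    proof -
      have neg: "(0 - u / v) / (c - b) = u / ((b - c) * v)" for u v b c :: real
      proof -
        have "(0 - u / v) / (c - b) = u / v / (b - c)"
          using minus_divide_divide[of "u / v" "b - c"] by simp
        then show ?thesis by (simp add: mult.commute)
      qed
      show ?thesis unfolding prod by (rule neg)
    qed
    finally have val: "dd_word (a # w) (delta_fun n y) (y \<circ> pinv p)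
        = delta_fun n y y / (\<Prod>(c, b)\<in>invset n p. y b - y c)" .
    have "p = net_prod (a # w)" using True eq by blast
    then show ?thesis using val by (subst if_P)
  qed
qed

section \<open>Degrees of polynomial functions under divided differences\<close>

text \<open>Polynomial functions of total degree less than d.\<close>
inductive low_degree :: "nat \<Rightarrow> ((nat \<Rightarrow> real) \<Rightarrow> real) \<Rightarrow> bool" where
  zero: "low_degree d (\<lambda>z. 0)"
| const: "low_degree (Suc d) (\<lambda>z. c)"
| add: "low_degree d f \<Longrightarrow> low_degree d g \<Longrightarrow> low_degree d (\<lambda>z. f z + g z)"
| coord: "low_degree d f \<Longrightarrow> low_degree (Suc d) (\<lambda>z. z i * f z)"

lemma low_degree_0: "low_degree d f \<Longrightarrow> d = 0 \<Longrightarrow> f z = 0"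
  by (induction rule: low_degree.induct) auto

lemma low_degree_cmult: "low_degree d f \<Longrightarrow> low_degree d (\<lambda>z. c * f z)"
proof (induction rule: low_degree.induct)
  case (coord d f i)
  then show ?case using low_degree.coord[of d "\<lambda>z. c * f z" i] by (simp add: mult.left_commute)
qed (auto simp: distrib_left intro: low_degree.intros)

lemma low_degree_Suc: "low_degree d f \<Longrightarrow> low_degree (Suc d) f"
  by (induction rule: low_degree.induct) (auto intro: low_degree.intros)

lemma dd_add: "dd r (\<lambda>z. f z + g z) z = dd r f z + dd r g z"
  by (simp add: dd_def add_divide_distrib[symmetric])

text \<open>The product case is the twisted Leibniz rule dd (z_i f) = c f + z_(tau i) dd f, where c
  is the divided difference of the coordinate itself. The result is again given by a polynomial
  function, but only at injective points.\<close>

lemma dd_low_degree: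
  "low_degree d f \<Longrightarrow> \<exists>g. low_degree (d - 1) g \<and> (\<forall>z. inj z \<longrightarrow> dd r f z = g z)"
proof (induction rule: low_degree.induct)
  case (zero d)
  then show ?case by (intro exI[of _ "\<lambda>z. 0"]) (auto simp: dd_def intro: low_degree.intros)
next
  case (const d c)
  then show ?case by (intro exI[of _ "\<lambda>z. 0"]) (auto simp: dd_def intro: low_degree.intros)
next
  case (add d f g)
  then obtain f' g' where "low_degree (d - 1) f'" "\<forall>z. inj z \<longrightarrow> dd r f z = f' z"
    "low_degree (d - 1) g'" "\<forall>z. inj z \<longrightarrow> dd r g z = g' z" by auto
  then show ?case
    by (intro exI[of _ "\<lambda>z. f' z + g' z"])
       (auto intro: low_degree.intros simp: dd_add)
next
  case (coord d f i)
  then obtain g where g: "low_degree (d - 1) g" "\<forall>z. inj z \<longrightarrow> dd r f z = g z" by auto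
  define c :: real where "c = (if i = Suc r then 1 else if i = r then -1 else 0)"
  have eq: "dd r (\<lambda>z. z i * f z) z = c * f z + z (tau r i) * g z" if "inj z" for z
  proof -
    have ne: "z (Suc r) - z r \<noteq> 0" using that by (auto dest: injD)
    have ci: "c * (z (Suc r) - z r) = z i - z (tau r i)"
      by (auto simp: c_def Transposition.transpose_def)
    have gz: "g z * (z (Suc r) - z r) = f z - f (z \<circ> tau r)"
      using g(2) that ne by (auto simp: dd_def field_simps)
    have "(c * f z + z (tau r i) * g z) * (z (Suc r) - z r)
        = (c * (z (Suc r) - z r)) * f z + z (tau r i) * (g z * (z (Suc r) - z r))"
      by (simp add: algebra_simps)
    also have "\<dots> = z i * f z - z (tau r i) * f (z \<circ> tau r)"
      unfolding ci gz by (simp add: algebra_simps)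
    finally show ?thesis using ne by (simp add: dd_def field_simps)
  qed
  show ?case
  proof (cases d)
    case 0
    then have "f = (\<lambda>z. 0)" using low_degree_0 coord by auto
    then show ?thesis by (intro exI[of _ "\<lambda>z. 0"]) (auto simp: dd_def intro: low_degree.intros)
  next
    case (Suc d')
    have "low_degree d (\<lambda>z. z (tau r i) * g z)"
      using low_degree.coord[OF g(1)] Suc by simp
    then have "low_degree d (\<lambda>z. c * f z + z (tau r i) * g z)"
      by (intro low_degree.add low_degree_cmult coord.hyps)
    then show ?thesis using eq by (intro exI[of _ "\<lambda>z. c * f z + z (tau r i) * g z"]) auto
  qed
qed

lemma dd_cong_inj:
  assumes "\<And>z. inj z \<Longrightarrow> f z = g z" "inj z"
  shows "dd r f z = dd r g z"
proof -
  have "inj (z \<circ> tau r)" using assms(2) by (intro inj_compose) auto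
  then show ?thesis using assms by (simp add: dd_def)
qed

lemma dd_word_low_degree:
  assumes "low_degree d f"
  shows "\<exists>g. low_degree (d - length w) g \<and> (\<forall>z. inj z \<longrightarrow> dd_word w f z = g z)"
proof (induction w)
  case Nil then show ?case using assms by auto
next
  case (Cons a w)
  then obtain g where g: "low_degree (d - length w) g" "\<And>z. inj z \<Longrightarrow> dd_word w f z = g z" by auto
  from dd_low_degree[OF g(1), of a] obtain h where
    h: "low_degree (d - length w - 1) h" "\<And>z. inj z \<Longrightarrow> dd a g z = h z" by auto
  have "dd_word (a # w) f z = h z" if "inj z" for z
    using dd_cong_inj[of "dd_word w f" g z a] g(2) h(2) that by simp
  then show ?case using h(1) by (intro exI[of _ h]) auto
qed

lemma dd_word_eq_0:
  assumes "low_degree (length w) f" "inj z"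
  shows "dd_word w f z = 0"
  using dd_word_low_degree[OF assms(1), of w] assms(2) low_degree_0 by auto

lemma dd_diff: "dd r (\<lambda>z. f z - g z) z = dd r f z - dd r g z"
  by (simp add: dd_def diff_divide_distrib[symmetric])

lemma dd_word_diff: "dd_word w (\<lambda>z. f z - g z) z = dd_word w f z - dd_word w g z"
proof (induction w arbitrary: z)
  case (Cons a w)
  then have "dd_word w (\<lambda>z. f z - g z) = (\<lambda>z. dd_word w f z - dd_word w g z)" by auto
  then show ?case by (simp add: dd_diff)
qed simp

definition top_mono :: "nat \<Rightarrow> (nat \<Rightarrow> real) \<Rightarrow> real" where
  "top_mono n z = (\<Prod>(i, j)\<in>pairs n. z j)"

text \<open>Both bounds are proved together: multiplying out one more factor expresses the new
  difference through the old difference and the full old product. The lemma makes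
  \<open>delta_fun\<close> and \<open>top_mono\<close> equal up to terms of lower degree.\<close>

lemma low_degree_prod_diff:
  assumes "finite E"
  shows "low_degree (card E) (\<lambda>z. (\<Prod>e\<in>E. z (v e) - c e) - (\<Prod>e\<in>E. z (v e)))
    \<and> low_degree (Suc (card E)) (\<lambda>z. \<Prod>e\<in>E. z (v e) - c e)"
  using assms
proof (induction E rule: finite_induct)
  case empty
  then show ?case by (auto intro: low_degree.intros)
next
  case (insert e E)
  let ?P = "\<lambda>z. \<Prod>e\<in>E. z (v e) - c e" and ?Q = "\<lambda>z. \<Prod>e\<in>E. z (v e)"
  have "low_degree (Suc (card E)) (\<lambda>z. z (v e) * (?P z - ?Q z) + (- c e) * ?P z)"
    using insert.IH by (intro low_degree.add low_degree.coord low_degree_cmult) simp_all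
  moreover have "low_degree (Suc (Suc (card E))) (\<lambda>z. z (v e) * ?P z + (- c e) * ?P z)"
    using insert.IH by (intro low_degree.add low_degree.coord low_degree_cmult, simp)
      (intro low_degree_cmult low_degree_Suc[of "Suc (card E)"], simp)
  ultimately show ?case using insert.hyps by (simp add: algebra_simps)
qed

lemma low_degree_top_mono: "low_degree (Suc (n choose 2)) (top_mono n)"
  using low_degree_prod_diff[OF finite_pairs[of n], of snd "\<lambda>_. 0"]
  by (simp add: card_pairs top_mono_def[abs_def] case_prod_beta)

text \<open>N divided differences do not see terms of degree below N, so
  \<open>delta_fun n y\<close> may replace the monomial. Taking y to be z in reversed order makes z
  the point \<open>y \<circ> pinv (rev_perm n)\<close>, where the interpolation formula applies and
  its quotient equals 1.\<close>

lemma dd_word_top_mono: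
  assumes w: "\<forall>a\<in>set w. 1 \<le> a \<and> a < n" "length w = n choose 2" and z: "inj z"
  shows "dd_word w (top_mono n) z = (if net_prod w = rev_perm n then 1 else 0)"
proof -
  define y where "y = z \<circ> rev_perm n"
  have y: "inj y" unfolding y_def
    using z permutes_inj[OF rev_perm_permutes] by (intro inj_compose) auto
  have zy: "z = y \<circ> pinv (rev_perm n)" by (auto simp: y_def)
  have "low_degree (length w) (\<lambda>z. delta_fun n y z - top_mono n z)"
    using low_degree_prod_diff[OF finite_pairs[of n], of snd "\<lambda>e. y (fst e)"]
    by (simp add: card_pairs w(2) top_mono_def[abs_def] delta_fun_def[abs_def] case_prod_beta)
  from dd_word_eq_0[OF this z] have "dd_word w (top_mono n) z = dd_word w (delta_fun n y) z"
    by (simp add: dd_word_diff)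
  also have "\<dots> = (if rev_perm n = net_prod w then
      delta_fun n y y / (\<Prod>(c, b)\<in>invset n (rev_perm n). y b - y c) else 0)"
    unfolding zy using w y rev_perm_permutes
    by (intro dd_word_delta) (auto simp: invset_rev_perm card_pairs)
  also have "delta_fun n y y / (\<Prod>(c, b)\<in>invset n (rev_perm n). y b - y c) = 1"
  proof -
    have "delta_fun n y y \<noteq> 0"
      unfolding delta_fun_def prod_zero_iff[OF finite_pairs] using y
      by (auto simp: pairs_def dest: injD)
    then show ?thesis by (simp add: invset_rev_perm delta_fun_def)
  qed
  finally show ?thesis by (auto simp: eq_commute)
qed

text \<open>Bubble sort: as long as inversions remain, some adjacent pair of values stands in the
  wrong order, and swapping it removes exactly one inversion. Applied to the reversal it shows that
  there is a network at all, so that the uniform measure makes sense.\<close>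

lemma exists_reduced_word:
  assumes "p permutes {1..n}"
  shows "\<exists>w. length w = card (invset n p) \<and> (\<forall>a\<in>set w. 1 \<le> a \<and> a < n) \<and> net_prod w = p"
  using assms
proof (induction "card (invset n p)" arbitrary: p)
  case 0
  have p: "pinv p permutes {1..n}" by (rule permutes_inv[OF 0(2)])
  have emp: "invset n p = {}" using 0 by simp
  have mono: "x < y \<Longrightarrow> 1 \<le> x \<Longrightarrow> y \<le> n \<Longrightarrow> p x < p y" for x y
  proof -
    assume xy: "x < y" "1 \<le> x" "y \<le> n"
    have "p x \<noteq> p y" using injD[OF permutes_inj[OF 0(2)], of x y] xy by auto
    moreover have "(x, y) \<notin> invset n p" using emp by simp
    ultimately show ?thesis using xy unfolding invset_def by auto
  qed
  have "p = id"
  proof (rule ccontr)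
    assume "p \<noteq> id"
    have "x \<le> p x" if "x \<in> {1..n}" for x
      using that
    proof (induction x)
      case (Suc x)
      show ?case
      proof (cases "x = 0")
        case True
        then show ?thesis using permutes_in_image[OF 0(2), of "Suc 0"] Suc.prems by auto
      next
        case False
        then show ?thesis using Suc mono[of x "Suc x"] by auto
      qed
    qed auto
    moreover have "(\<Sum>j\<in>{1..n}. p j) = (\<Sum>j\<in>{1..n}. j)"
      using sum.permute[OF 0(2), of id] by simp
    ultimately have "\<forall>j\<in>{1..n}. p j = j"
      by (intro ballI sym[OF sum_mono_inv[where f = "\<lambda>j. j" and g = p and I = "{1..n}"]]) auto
    then have "p = id" using 0(2) by (auto simp: permutes_def fun_eq_iff)
    with \<open>p \<noteq> id\<close> show False by simp
  qed
  then show ?case by (intro exI[of _ "[]"]) (simp add: net_prod_simps flip: id_def)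
next
  case (Suc m)
  note p = Suc.prems
  have "\<exists>a. 1 \<le> a \<and> a < n \<and> pinv p (Suc a) < pinv p a"
  proof (rule ccontr)
    assume con: "\<not> ?thesis"
    have step: "pinv p a < pinv p (Suc a)" if "1 \<le> a" "a < n" for a
      using con that permutes_inj[OF permutes_inv[OF p]] by (metis injD linorder_neqE_nat n_not_Suc_n)
    have mono: "1 \<le> u \<Longrightarrow> u < v \<Longrightarrow> v \<le> n \<Longrightarrow> pinv p u < pinv p v" for u v
    proof (induction v)
      case (Suc v)
      then show ?case using step[of v] by (cases "u = v") auto
    qed auto
    obtain c b where cb: "(c, b) \<in> invset n p" using Suc.hyps(2) by (metis card.empty all_not_in_conv surj_pair nat.distinct(1))
    then have "p b \<in> {1..n}" "p c \<in> {1..n}" using permutes_in_image[OF p, of b] permutes_in_image[OF p, of c] by (auto simp: invset_def)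
    then have "pinv p (p b) < pinv p (p c)" using cb by (intro mono) (auto simp: invset_def)
    then show False using cb permutes_inverses(2)[OF p] by (auto simp: invset_def)
  qed
  then obtain a where a: "1 \<le> a" "a < n" "pinv p (Suc a) < pinv p a" by auto
  have "m = card (invset n (tau a \<circ> p))"
    using Suc.hyps(2) invset_tau[OF p a] by simp
  from Suc.hyps(1)[OF this permutes_compose[OF p tau_permutes[OF a(1,2)]]]
  obtain w where w: "length w = m" "\<forall>a\<in>set w. 1 \<le> a \<and> a < n" "net_prod w = tau a \<circ> p"
    using \<open>m = _\<close> by auto
  moreover have "net_prod (a # w) = p" unfolding net_prod_simps w(3) by (rule tau_tau)
  ultimately show ?case using a Suc.hyps(2) by (intro exI[of _ "a # w"]) simp
qed

lemma sorting_networks_nonempty: "sorting_networks n \<noteq> {}"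
proof -
  obtain w where w: "length w = card (invset n (rev_perm n))" "\<forall>a\<in>set w. 1 \<le> a \<and> a < n" "net_prod w = rev_perm n"
    using exists_reduced_word[OF rev_perm_permutes] by blast
  then have "w \<in> sorting_networks n"
    by (auto simp: sorting_networks_def invset_rev_perm card_pairs)
  then show ?thesis by auto
qed

lemma finite_sorting_networks [simp]: "finite (sorting_networks n)"
proof (rule finite_subset)
  show "sorting_networks n \<subseteq> {w. set w \<subseteq> {..n} \<and> length w = n choose 2}"
    by (force simp: sorting_networks_def)
  show "finite {w. set w \<subseteq> {..n} \<and> length w = n choose 2}"
    by (rule finite_lists_length_eq) auto
qed

section \<open>A determinant solving the evolution equation\<close>

text \<open>Divided powers t^m / m!, extended by 0 to negative m so that differentiation in t lowers
  the index by one without exception.\<close>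

definition pw :: "real \<Rightarrow> int \<Rightarrow> real" where
  "pw t m = (if m < 0 then 0 else t ^ nat m / fact (nat m))"

lemma pw_neg [simp]: "m < 0 \<Longrightarrow> pw t m = 0"
  by (simp add: pw_def)

lemma pw_has_derivative: "((\<lambda>t. pw t m) has_real_derivative pw t (m - 1)) (at t)"
proof (cases "m \<le> 0")
  case True
  then have "(\<lambda>t. pw t m) = (\<lambda>t. if m < 0 then 0 else 1)" by (auto simp: pw_def fun_eq_iff)
  then show ?thesis using True by (auto simp: pw_def)
next
  case False
  define p where "p = nat (m - 1)"
  have m: "m = int (Suc p)" using False by (simp add: p_def)
  have "((\<lambda>t. t ^ Suc p / fact (Suc p)) has_real_derivative (real (Suc p) * t ^ p) / fact (Suc p)) (at t)"
    by (intro DERIV_cdivide) (use DERIV_pow[of "Suc p" t] in simp)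
  also have "(real (Suc p) * t ^ p) / fact (Suc p) = t ^ p / fact p"
    unfolding fact_Suc of_nat_mult by (rule mult_divide_mult_cancel_left) simp
  finally show ?thesis unfolding m pw_def by (simp add: nat_add_distrib)
qed

text \<open>The coefficient of $q^m$ in $e^{tq} \prod_{i \in A} (1 + z_i q)$.\<close>
definition eta :: "int \<Rightarrow> real \<Rightarrow> nat set \<Rightarrow> (nat \<Rightarrow> real) \<Rightarrow> real" where
  "eta m t A z = (\<Sum>B\<in>Pow A. pw t (m - int (card B)) * prod z B)"

lemma eta_empty [simp]: "eta m t {} z = pw t m"
  by (simp add: eta_def)

lemma eta_neg [simp]: "m < 0 \<Longrightarrow> eta m t A z = 0"
  by (simp add: eta_def)

lemma eta_insert:
  assumes "finite A" "a \<notin> A"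
  shows "eta m t (insert a A) z = eta m t A z + z a * eta (m - 1) t A z"
proof -
  have inj: "inj_on (insert a) (Pow A)" using assms by (auto simp: inj_on_def)
  have disj: "Pow A \<inter> insert a ` Pow A = {}" using assms by auto
  have "eta m t (insert a A) z = eta m t A z + (\<Sum>B\<in>insert a ` Pow A. pw t (m - int (card B)) * prod z B)"
    unfolding eta_def Pow_insert using assms disj by (intro sum.union_disjoint) auto
  also have "(\<Sum>B\<in>insert a ` Pow A. pw t (m - int (card B)) * prod z B)
      = (\<Sum>B\<in>Pow A. pw t (m - int (card (insert a B))) * prod z (insert a B))"
    by (simp add: sum.reindex[OF inj])
  also have "\<dots> = (\<Sum>B\<in>Pow A. z a * (pw t (m - 1 - int (card B)) * prod z B))"
  proof (intro sum.cong refl)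
    fix B assume "B \<in> Pow A"
    then have "finite B" "a \<notin> B" using assms finite_subset by auto
    then show "pw t (m - int (card (insert a B))) * prod z (insert a B)
        = z a * (pw t (m - 1 - int (card B)) * prod z B)"
      by (simp add: algebra_simps)
  qed
  also have "\<dots> = z a * eta (m - 1) t A z" by (simp add: eta_def sum_distrib_left)
  finally show ?thesis .
qed

lemma eta_has_derivative: "((\<lambda>t. eta m t A z) has_real_derivative eta (m - 1) t A z) (at t)"
proof -
  have "((\<lambda>t. pw t (m - int (card B)) * prod z B) has_real_derivative pw t (m - int (card B) - 1) * prod z B) (at t)" for B
    by (intro DERIV_cmult_right pw_has_derivative)
  then show ?thesis unfolding eta_def by (intro DERIV_sum) (simp add: algebra_simps)
qed

lemma eta_cong: "(\<And>i. i \<in> A \<Longrightarrow> z i = z' i) \<Longrightarrow> eta m t A z = eta m t A z'"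
  unfolding eta_def by (intro sum.cong refl arg_cong2[where f = "(*)"] prod.cong) auto

lemma eta_permutes:
  assumes p: "p permutes A"
  shows "eta m t A (z \<circ> p) = eta m t A z"
proof -
  have inj: "inj p" using permutes_inj[OF p] .
  have bij: "bij_betw ((`) p) (Pow A) (Pow A)"
    using bij_betw_Pow[OF permutes_imp_bij[OF p]] .
  have "eta m t A z = (\<Sum>B\<in>Pow A. pw t (m - int (card (p ` B))) * prod z (p ` B))"
    unfolding eta_def by (rule sum.reindex_bij_betw[OF bij, symmetric])
  also have "\<dots> = eta m t A (z \<circ> p)"
    unfolding eta_def
    by (intro sum.cong refl) (simp add: card_image inj_on_subset[OF inj] prod.reindex[OF inj_on_subset[OF inj]])
  finally show ?thesis by simp
qed

lemma eta_tau:
  assumes "r \<in> A \<longleftrightarrow> Suc r \<in> A"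
  shows "eta m t A (z \<circ> tau r) = eta m t A z"
proof (cases "r \<in> A")
  case True
  then show ?thesis using assms by (intro eta_permutes permutes_swap_id) auto
next
  case False
  then show ?thesis using assms by (intro eta_cong) (auto simp: Transposition.transpose_def)
qed

lemma eta_tau_insert:
  assumes "finite A" "r \<notin> A" "Suc r \<notin> A"
  shows "eta m t (insert (Suc r) A) z - eta m t (insert (Suc r) A) (z \<circ> tau r)
    = (z (Suc r) - z r) * eta (m - 1) t A z"
  using assms by (simp add: eta_insert eta_tau algebra_simps)

text \<open>Generating functions over disjoint sets of variables multiply. With parameter 0 the
  factor of A is a polynomial in q of degree at most \<open>card A\<close>, so a convolution cut off
  at C loses nothing.\<close>

lemma eta_0_conv:
  assumes "finite A" "finite B" "A \<inter> B = {}" "card A \<le> C"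
  shows "(\<Sum>a\<le>C. eta (int a) 0 A z * eta (m - int a) t B z) = eta m t (A \<union> B) z"
  using assms(1,3,4)
proof (induction A arbitrary: m C rule: finite_induct)
  case empty
  have "(\<Sum>a\<le>C. eta (int a) 0 {} z * eta (m - int a) t B z) = (\<Sum>a\<in>{0}. eta (int a) 0 {} z * eta (m - int a) t B z)"
    by (intro sum.mono_neutral_right) (auto simp: pw_def)
  then show ?case by (simp add: pw_def)
next
  case (insert x A)
  then obtain C' where C: "C = Suc C'" by (cases C) auto
  have "(\<Sum>a\<le>C. eta (int a) 0 (insert x A) z * eta (m - int a) t B z)
     = (\<Sum>a\<le>C. eta (int a) 0 A z * eta (m - int a) t B z)
      + z x * (\<Sum>a\<le>C. eta (int a - 1) 0 A z * eta (m - int a) t B z)"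
    using insert by (simp add: eta_insert sum.distrib algebra_simps sum_distrib_left)
  also have "(\<Sum>a\<le>C. eta (int a - 1) 0 A z * eta (m - int a) t B z)
      = (\<Sum>a\<le>C'. eta (int a) 0 A z * eta (m - 1 - int a) t B z)"
    unfolding C by (simp add: sum.atMost_Suc_shift algebra_simps del: sum.atMost_Suc)
  also have "\<dots> = eta (m - 1) t (A \<union> B) z" using insert C by (intro insert.IH) auto
  also have "(\<Sum>a\<le>C. eta (int a) 0 A z * eta (m - int a) t B z) = eta m t (A \<union> B) z"
    using insert by (intro insert.IH) auto
  also have "eta m t (A \<union> B) z + z x * eta (m - 1) t (A \<union> B) z = eta m t (insert x A \<union> B) z"
    using insert assms by (simp add: eta_insert)
  finally show ?case .
qed

lemma low_degree_mult:
  assumes "low_degree (Suc e) g"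
  shows "low_degree d f \<Longrightarrow> low_degree (d + e) (\<lambda>z. f z * g z)"
proof (induction rule: low_degree.induct)
  case (const d c)
  have lift: "low_degree (Suc e) h \<Longrightarrow> low_degree (Suc e + d) h" for h d
    by (induction d) (auto dest: low_degree_Suc)
  show ?case using lift[OF low_degree_cmult[OF assms, of c], of d] by (simp add: add.commute)
next
  case (coord d f i)
  then show ?case using low_degree.coord[of "d + e" "\<lambda>z. f z * g z" i] by (simp add: mult.assoc)
qed (auto simp: distrib_right intro: low_degree.intros)

lemma low_degree_sum:
  "finite A \<Longrightarrow> (\<And>x. x \<in> A \<Longrightarrow> low_degree d (f x)) \<Longrightarrow> low_degree d (\<lambda>z. \<Sum>x\<in>A. f x z)"
  by (induction A rule: finite_induct) (auto intro: low_degree.intros)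

lemma low_degree_prod:
  "finite A \<Longrightarrow> (\<And>x. x \<in> A \<Longrightarrow> low_degree (Suc (d x)) (f x)) \<Longrightarrow>
    low_degree (Suc (sum d A)) (\<lambda>z. \<Prod>x\<in>A. f x z)"
proof (induction A rule: finite_induct)
  case (insert x A)
  then show ?case using low_degree_mult[of "sum d A" "\<lambda>z. \<Prod>x\<in>A. f x z" "Suc (d x)" "f x"] by simp
qed (auto intro: low_degree.intros)

lemma low_degree_eta: "finite A \<Longrightarrow> low_degree (Suc (card A)) (eta m t A)"
proof (induction A arbitrary: m rule: finite_induct)
  case empty
  then show ?case by (auto simp: eta_def[abs_def] intro: low_degree.intros)
next
  case (insert x A)
  have "low_degree (Suc (Suc (card A))) (\<lambda>z. eta m t A z + z x * eta (m - 1) t A z)"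
    using insert by (intro low_degree.add low_degree.coord low_degree_Suc[of "Suc (card A)"]) auto
  moreover have "eta m t (insert x A) = (\<lambda>z. eta m t A z + z x * eta (m - 1) t A z)"
    using insert by (intro ext eta_insert)
  ultimately show ?case using insert by simp
qed

text \<open>
  The ansatz for the evolution equation: each operator $\partial_r$ with $r \<noteq> k$ acts on a single row and reproduces, modulo
  the next row, the derivative of that row in s. Truncating the sum over a freezes the row of index k - 1 in s, which
  removes $\partial_k$ from the equation.
\<close>
definition mrow :: "nat \<Rightarrow> nat \<Rightarrow> real \<Rightarrow> real \<Rightarrow> (nat \<Rightarrow> real) \<Rightarrow> nat \<Rightarrow> nat \<Rightarrow> real" where
  "mrow n k t s z i j = (let m = int n - 1 - 2 * int i + int j in
     if i < k then (\<Sum>a\<le>2 * (k - 1 - i). eta (int a) s {i + 2..k} z * eta (m - int a) t {k + 1..n} z)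
     else eta m (t + s) {i + 2..n} z)"

definition mrow' :: "nat \<Rightarrow> nat \<Rightarrow> real \<Rightarrow> real \<Rightarrow> (nat \<Rightarrow> real) \<Rightarrow> nat \<Rightarrow> nat \<Rightarrow> real" where
  "mrow' n k t s z i j = (let m = int n - 1 - 2 * int i + int j in
     if i < k then (\<Sum>a\<le>2 * (k - 1 - i). eta (int a - 1) s {i + 2..k} z * eta (m - int a) t {k + 1..n} z)
     else eta (m - 1) (t + s) {i + 2..n} z)"

definition Mdet :: "nat \<Rightarrow> nat \<Rightarrow> real \<Rightarrow> real \<Rightarrow> (nat \<Rightarrow> real) \<Rightarrow> real" where
  "Mdet n k t s z = fdet (n - 1) (mrow n k t s z)"

lemma mrow_has_derivative: "((\<lambda>s. mrow n k t s z i j) has_real_derivative mrow' n k t s z i j) (at s)"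
proof (cases "i < k")
  case True
  then show ?thesis unfolding mrow_def mrow'_def Let_def
    by (simp, intro DERIV_sum DERIV_cmult_right eta_has_derivative)
next
  case False
  have "((\<lambda>s. eta m (t + s) A z) has_real_derivative eta (m - 1) (t + s) A z) (at s)" for m A
    using DERIV_shift[of "\<lambda>s. eta m s A z" "eta (m - 1) (t + s) A z" s t] eta_has_derivative[of m A z "t + s"]
    by (simp add: add.commute)
  then show ?thesis using False unfolding mrow_def mrow'_def Let_def by (simp only: if_False)
qed

text \<open>Row i uses the variables from i + 2 on, symmetrically within the block up to k and
  within the block beyond k. For r other than k, only row r - 1 contains z_(r+1) without
  z_r.\<close>

lemma mrow_tau:
  assumes "r \<noteq> k" "i \<noteq> r - 1" "1 \<le> r" "r < n" "k < n"
  shows "mrow n k t s (z \<circ> tau r) i j = mrow n k t s z i j"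
proof -
  have 1: "eta m x {i + 2..k} (z \<circ> tau r) = eta m x {i + 2..k} z" if "i < k" for m x
    using assms that by (intro eta_tau) auto
  have 2: "eta m x {k + 1..n} (z \<circ> tau r) = eta m x {k + 1..n} z" for m x
    using assms by (intro eta_tau) auto
  have 3: "eta m x {i + 2..n} (z \<circ> tau r) = eta m x {i + 2..n} z" for m x
    using assms by (intro eta_tau) auto
  show ?thesis unfolding mrow_def Let_def using 1 2 3 by simp
qed

text \<open>The divided difference removes the variable r + 1 and lowers the order by one; putting
  the variable back to form \<open>mrow'\<close> costs a term of order lowered by two. The order
  drops by 2 from one row to the next precisely so that this term is a multiple of the row
  below.\<close>

lemma mrow_dd:
  assumes r: "r \<noteq> k" "1 \<le> r" "r < n" "k < n" "j < n - 1"
  shows "mrow n k t s z (r - 1) j - mrow n k t s (z \<circ> tau r) (r - 1) j =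
    (z (Suc r) - z r) * (mrow' n k t s z (r - 1) j - z (Suc r) * (if r < n - 1 then mrow n k t s z r j else 0))"
proof -
  define m where "m = int n - 1 - 2 * int (r - 1) + int j"
  have m': "int n - 1 - 2 * int r + int j = m - 2" using r by (simp add: m_def of_nat_diff)
  show ?thesis
  proof (cases "r - 1 < k")
    case True
    then have rk: "r < k" using r by auto
    then have rn: "r < n - 1" using r by auto
    have set: "{r - 1 + 2..k} = insert (Suc r) {Suc r + 1..k}" using rk r by auto
    have fin: "finite {Suc r + 1..k}" "r \<notin> {Suc r + 1..k}" "Suc r \<notin> {Suc r + 1..k}" by auto
    have inv: "eta x t {k + 1..n} (z \<circ> tau r) = eta x t {k + 1..n} z" for x
      using rk by (intro eta_tau) auto
    \<comment> \<open>The cut-off also drops by 2 from row r - 1 to row r, in step with the order,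
      so that truncation is compatible with the relation between the rows.\<close>
    have K: "2 * (k - 1 - (r - 1)) = Suc (Suc (2 * (k - 1 - r)))" using rk r by auto
    have "mrow n k t s z (r - 1) j - mrow n k t s (z \<circ> tau r) (r - 1) j
       = (\<Sum>a\<le>2 * (k - 1 - (r - 1)). (eta (int a) s (insert (Suc r) {Suc r + 1..k}) z
           - eta (int a) s (insert (Suc r) {Suc r + 1..k}) (z \<circ> tau r)) * eta (m - int a) t {k + 1..n} z)"
      unfolding mrow_def Let_def m_def[symmetric] if_P[OF True] inv set sum_subtractf[symmetric]
      by (simp only: left_diff_distrib)
    also have "\<dots> = (z (Suc r) - z r) * (\<Sum>a\<le>2 * (k - 1 - (r - 1)). eta (int a - 1) s {Suc r + 1..k} z * eta (m - int a) t {k + 1..n} z)"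
      unfolding eta_tau_insert[OF fin] by (simp add: sum_distrib_left mult.assoc)
    also have "(\<Sum>a\<le>2 * (k - 1 - (r - 1)). eta (int a - 1) s {Suc r + 1..k} z * eta (m - int a) t {k + 1..n} z)
       = mrow' n k t s z (r - 1) j - z (Suc r) * (\<Sum>a\<le>2 * (k - 1 - (r - 1)). eta (int a - 2) s {Suc r + 1..k} z * eta (m - int a) t {k + 1..n} z)"
      unfolding mrow'_def Let_def m_def[symmetric] if_P[OF True] set eta_insert[OF fin(1,3)]
      by (simp add: sum_subtractf[symmetric] sum_distrib_left algebra_simps)
    also have "(\<Sum>a\<le>2 * (k - 1 - (r - 1)). eta (int a - 2) s {Suc r + 1..k} z * eta (m - int a) t {k + 1..n} z)
       = (\<Sum>a\<le>2 * (k - 1 - r). eta (int a) s {Suc r + 1..k} z * eta (m - 2 - int a) t {k + 1..n} z)"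
      unfolding K by (simp add: sum.atMost_Suc_shift algebra_simps del: sum.atMost_Suc)
    also have "\<dots> = mrow n k t s z r j"
      unfolding mrow_def Let_def m' using rk by (simp add: numeral_2_eq_2)
    finally show ?thesis unfolding if_P[OF rn] .
  next
    case False
    then have rk: "k < r" using r by auto
    have set: "{r - 1 + 2..n} = insert (Suc r) {Suc r + 1..n}" using r by auto
    have fin: "finite {Suc r + 1..n}" "r \<notin> {Suc r + 1..n}" "Suc r \<notin> {Suc r + 1..n}" by auto
    \<comment> \<open>The last row has nothing below it; there the correction is a coefficient of
      negative order and vanishes.\<close>
    have nxt: "eta (m - 2) (t + s) {Suc r + 1..n} z = (if r < n - 1 then mrow n k t s z r j else 0)"
    proof (cases "r < n - 1")
      case True
      then show ?thesis unfolding mrow_def Let_def m' using rk by (simp add: numeral_2_eq_2)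
    next
      case False
      then have "r = n - 1" using r by auto
      then have "{Suc r + 1..n} = {}" "m - 2 < 0" using r by (auto simp: m_def of_nat_diff)
      then show ?thesis using False by simp
    qed
    have "mrow n k t s z (r - 1) j - mrow n k t s (z \<circ> tau r) (r - 1) j
        = (z (Suc r) - z r) * eta (m - 1) (t + s) {Suc r + 1..n} z"
      unfolding mrow_def Let_def m_def[symmetric] if_not_P[OF False] set
      by (rule eta_tau_insert[OF fin])
    also have "eta (m - 1) (t + s) {Suc r + 1..n} z = mrow' n k t s z (r - 1) j - z (Suc r) * eta (m - 2) (t + s) {Suc r + 1..n} z"
      unfolding mrow'_def Let_def m_def[symmetric] if_not_P[OF False] set eta_insert[OF fin(1,3)]
      by simp
    finally show ?thesis unfolding nxt .
  qed
qed

text \<open>Only one row changes under the swap, so the divided difference acts on it by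
  multilinearity. The multiple of the following row drops out, as it produces two equal
  rows.\<close>

lemma dd_Mdet:
  assumes r: "r \<noteq> k" "1 \<le> r" "r < n" "k < n" and z: "inj z"
  shows "dd r (Mdet n k t s) z = fdet (n - 1) ((mrow n k t s z)(r - 1 := mrow' n k t s z (r - 1)))"
proof -
  let ?a = "mrow n k t s z" and ?r = "r - 1" and ?b = "mrow n k t s (z \<circ> tau r)"
  define d where "d = z (Suc r) - z r"
  have d: "d \<noteq> 0" using z by (auto simp: d_def dest: injD)
  have rn: "?r < n - 1" using r by auto
  define nx where "nx = (\<lambda>j. if r < n - 1 then ?a r j else 0)"
  have 1: "Mdet n k t s (z \<circ> tau r) = fdet (n - 1) (?a(?r := ?b ?r))"
    unfolding Mdet_def by (intro fdet_cong) (use r mrow_tau in auto)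
  have "dd r (Mdet n k t s) z = (1 / d) * fdet (n - 1) (?a(?r := ?a ?r)) + (- 1 / d) * fdet (n - 1) (?a(?r := ?b ?r))"
    unfolding dd_def d_def[symmetric] 1 by (simp add: Mdet_def diff_divide_distrib)
  also have "\<dots> = fdet (n - 1) (?a(?r := (\<lambda>j. (1 / d) * ?a ?r j + (- 1 / d) * ?b ?r j)))"
    by (rule fdet_row_linear[OF rn, symmetric])
  also have "\<dots> = fdet (n - 1) (?a(?r := (\<lambda>j. 1 * mrow' n k t s z ?r j + (- z (Suc r)) * nx j)))"
  proof (intro fdet_cong, goal_cases)
    case (1 i j)
    have "(1 / d) * ?a ?r j + (- 1 / d) * ?b ?r j = (?a ?r j - ?b ?r j) / d"
      by (simp add: diff_divide_distrib)
    also have "\<dots> = mrow' n k t s z ?r j - z (Suc r) * nx j"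
      using mrow_dd[OF r 1(2), of t s z] d unfolding d_def[symmetric] nx_def by simp
    finally show ?case by auto
  qed
  also have "\<dots> = 1 * fdet (n - 1) (?a(?r := mrow' n k t s z ?r)) + (- z (Suc r)) * fdet (n - 1) (?a(?r := nx))"
    by (rule fdet_row_linear[OF rn])
  also have nx0: "fdet (n - 1) (?a(?r := nx)) = 0"
  proof (cases "r < n - 1")
    case True
    then have "nx = ?a r" by (auto simp: nx_def)
    then show ?thesis using fdet_rows_eq[OF rn True, of ?a] r by auto
  next
    case False
    then have "nx = (\<lambda>j. 0)" by (auto simp: nx_def)
    then show ?thesis using fdet_row_zero[OF rn] by simp
  qed
  finally show ?thesis unfolding mult_zero_right mult_1 add_0_right .
qed

section \<open>The evolution equation and its exact Taylor expansion\<close>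

definition Dop :: "nat set \<Rightarrow> ((nat \<Rightarrow> real) \<Rightarrow> real) \<Rightarrow> (nat \<Rightarrow> real) \<Rightarrow> real" where
  "Dop S f z = (\<Sum>r\<in>S. dd r f z)"

text \<open>The derivative of a determinant is a sum over rows, and the row of index r - 1 accounts
  for the divided difference of index r. The row of index k - 1 is constant in s, which is the
  missing summand.\<close>

lemma Mdet_has_derivative:
  assumes "k < n" "inj z"
  shows "((\<lambda>s. Mdet n k t s z) has_real_derivative Dop ({1..n - 1} - {k}) (Mdet n k t s) z) (at s)"
proof -
  let ?f = "\<lambda>i. fdet (n - 1) ((mrow n k t s z)(i := mrow' n k t s z i))"
  have "((\<lambda>s. Mdet n k t s z) has_real_derivative (\<Sum>i<n - 1. ?f i)) (at s)"
    unfolding Mdet_def by (intro fdet_has_derivative mrow_has_derivative)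
  also have "(\<Sum>i<n - 1. ?f i) = (\<Sum>r\<in>{1..n - 1}. ?f (r - 1))"
    by (rule sum.reindex_bij_witness[of _ "\<lambda>r. r - 1" Suc]) auto
  also have "\<dots> = (\<Sum>r\<in>{1..n - 1} - {k}. ?f (r - 1))"
  proof (intro sum.mono_neutral_right ballI)
    fix r assume "r \<in> {1..n - 1} - ({1..n - 1} - {k})"
    then have rk: "r = k" and k: "1 \<le> k" by auto
    have "mrow' n k t s z (k - 1) = (\<lambda>j. 0)" using k by (auto simp: mrow'_def fun_eq_iff)
    then show "?f (r - 1) = 0" unfolding rk using fdet_row_zero[of "k - 1" "n - 1"] k assms by auto
  qed auto
  also have "\<dots> = Dop ({1..n - 1} - {k}) (Mdet n k t s) z"
    unfolding Dop_def by (intro sum.cong refl dd_Mdet[symmetric] assms) (use assms in auto)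
  finally show ?thesis .
qed

lemma inj_comp_tau: "inj z \<Longrightarrow> inj (z \<circ> tau r)"
  by (intro inj_compose) auto

lemma Dop_has_derivative:
  assumes "\<And>z. inj z \<Longrightarrow> ((\<lambda>s. f s z) has_real_derivative g z) (at s)" "inj z" "finite S"
  shows "((\<lambda>s. Dop S (f s) z) has_real_derivative Dop S g z) (at s)"
  unfolding Dop_def dd_def
  by (intro DERIV_sum DERIV_cdivide DERIV_diff assms inj_comp_tau)

lemma Dop_pow_has_derivative:
  assumes "\<And>z. inj z \<Longrightarrow> ((\<lambda>s. f s z) has_real_derivative g z) (at s)" "inj z" "finite S"
  shows "((\<lambda>s. (Dop S ^^ m) (f s) z) has_real_derivative (Dop S ^^ m) g z) (at s)"
  using assms(2)
proof (induction m arbitrary: z)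
  case (Suc m)
  show ?case unfolding funpow.simps comp_apply
    by (rule Dop_has_derivative[OF Suc.IH Suc.prems assms(3)])
qed (use assms in auto)

lemma dd_sum: "dd r (\<lambda>z. \<Sum>x\<in>A. f x z) z = (\<Sum>x\<in>A. dd r (f x) z)"
  by (simp add: dd_def sum_subtractf[symmetric] sum_divide_distrib)

lemma dd_word_sum: "dd_word w (\<lambda>z. \<Sum>x\<in>A. f x z) z = (\<Sum>x\<in>A. dd_word w (f x) z)"
proof (induction w arbitrary: z)
  case (Cons a w)
  then have "dd_word w (\<lambda>z. \<Sum>x\<in>A. f x z) = (\<lambda>z. \<Sum>x\<in>A. dd_word w (f x) z)" by auto
  then show ?case by (simp add: dd_sum)
qed simp

lemma dd_word_cmult: "dd_word w (\<lambda>z. c * f z) z = c * dd_word w f z"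
proof (induction w arbitrary: z)
  case (Cons a w)
  then have "dd_word w (\<lambda>z. c * f z) = (\<lambda>z. c * dd_word w f z)" by auto
  then show ?case unfolding dd_word_Cons by (simp add: right_diff_distrib[symmetric])
qed simp

lemma dd_word_cong_inj:
  assumes "\<And>z. inj z \<Longrightarrow> f z = g z" "inj z"
  shows "dd_word w f z = dd_word w g z"
  using assms(2)
proof (induction w arbitrary: z)
  case (Cons a w)
  then show ?case using dd_cong_inj[of "dd_word w f" "dd_word w g" z a] by simp
qed (use assms in auto)

definition words :: "nat \<Rightarrow> nat set \<Rightarrow> nat list set" where
  "words m S = {w. length w = m \<and> set w \<subseteq> S}"

lemma finite_words [simp]: "finite S \<Longrightarrow> finite (words m S)"
  unfolding words_def using finite_lists_length_eq[of S m] by (simp add: conj_commute)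

lemma words_0 [simp]: "words 0 S = {[]}"
  by (auto simp: words_def)

lemma words_Suc: "words (Suc m) S = (\<lambda>(a, w). a # w) ` (S \<times> words m S)"
  by (auto simp: words_def length_Suc_conv image_iff)

lemma Dop_pow_eq:
  assumes "finite S"
  shows "(Dop S ^^ m) f z = (\<Sum>w\<in>words m S. dd_word w f z)"
proof (induction m arbitrary: z)
  case (Suc m)
  have "(Dop S ^^ m) f = (\<lambda>z. \<Sum>w\<in>words m S. dd_word w f z)" using Suc by auto
  then have "(Dop S ^^ Suc m) f z = (\<Sum>a\<in>S. \<Sum>w\<in>words m S. dd_word (a # w) f z)"
    by (simp add: Dop_def dd_sum)
  also have "\<dots> = (\<Sum>(a, w)\<in>S \<times> words m S. dd_word (a # w) f z)"
    by (rule sum.cartesian_product)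
  also have "\<dots> = (\<Sum>w\<in>words (Suc m) S. dd_word w f z)"
    unfolding words_Suc by (subst sum.reindex) (auto simp: inj_on_def case_prod_beta)
  finally show ?case .
qed simp

lemma low_degree_Mdet:
  assumes "k < n"
  shows "low_degree (Suc (n choose 2)) (Mdet n k t s)"
proof -
  have row: "low_degree (Suc (n - 1 - i)) (\<lambda>z. mrow n k t s z i j)" if i: "i < n - 1" for i j
  proof (cases "i < k")
    case True
    have "low_degree (Suc (card {i + 2..k}) + card {k + 1..n}) (\<lambda>z. eta x s {i + 2..k} z * eta y t {k + 1..n} z)" for x y
      by (intro low_degree_mult low_degree_eta) auto
    moreover have "Suc (card {i + 2..k}) + card {k + 1..n} = Suc (n - 1 - i)"
      using True assms by simp
    ultimately show ?thesis using True unfolding mrow_def Let_def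
      by (simp del: card_atLeastAtMost add: low_degree_sum)
  next
    case False
    have "low_degree (Suc (card {i + 2..n})) (eta x y {i + 2..n})" for x y
      by (intro low_degree_eta) auto
    moreover have "card {i + 2..n} = n - 1 - i" by simp
    ultimately show ?thesis using False unfolding mrow_def Let_def by (simp del: card_atLeastAtMost)
  qed
  have sum: "(\<Sum>i<n - 1. n - 1 - i) = n choose 2"
  proof -
    have "(\<Sum>i<n - 1. n - 1 - i) = (\<Sum>i<n - 1. Suc i)"
      by (rule sum.reindex_bij_witness[of _ "\<lambda>i. n - 2 - i" "\<lambda>i. n - 2 - i"]) auto
    also have "\<dots> = (\<Sum>i\<in>{1..n - 1}. i)"
      by (rule sum.reindex_bij_witness[of _ "\<lambda>i. i - 1" Suc]) auto
    also have "\<dots> = n choose 2"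
      using assms gauss_sum_from_Suc_0[of "n - 1", where 'a = nat] by (simp add: choose_two mult.commute)
    finally show ?thesis .
  qed
  have "low_degree (Suc (n choose 2)) (\<lambda>z. of_int (sign p) * (\<Prod>i<n - 1. mrow n k t s z i (p i)))" for p
    using low_degree_prod[of "{..<n - 1}" "\<lambda>i. n - 1 - i" "\<lambda>i z. mrow n k t s z i (p i)"] row sum
    by (intro low_degree_cmult) auto
  then show ?thesis unfolding Mdet_def[abs_def] fdet_leibniz
    by (intro low_degree_sum) (auto simp: finite_permutations)
qed

lemma Dop_pow_eq_0:
  assumes "low_degree m f" "finite S" "inj z"
  shows "(Dop S ^^ m) f z = 0"
  unfolding Dop_pow_eq[OF assms(2)]
  by (intro sum.neutral ballI dd_word_eq_0 assms) (use assms in \<open>auto simp: words_def\<close>)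

text \<open>The derivatives in s are powers of \<open>Dop\<close>, and the remainder of order N + 1
  is zero because the degree in z is at most N and each application lowers it by one.\<close>

lemma Mdet_taylor:
  assumes "k < n" "inj z"
  shows "Mdet n k t s z = (\<Sum>m\<le>n choose 2. s ^ m / fact m * (Dop ({1..n - 1} - {k}) ^^ m) (Mdet n k t 0) z)"
proof -
  let ?S = "{1..n - 1} - {k}" and ?N = "n choose 2"
  let ?f = "\<lambda>m s. (Dop ?S ^^ m) (Mdet n k t s) z"
  have "(?f m has_real_derivative ?f (Suc m) s) (at s)" for m s
    unfolding funpow_Suc_right comp_apply
    by (intro Dop_pow_has_derivative Mdet_has_derivative assms) auto
  then obtain u where "Mdet n k t s z = (\<Sum>m<Suc ?N. ?f m 0 / fact m * s ^ m) + ?f (Suc ?N) u / fact (Suc ?N) * s ^ Suc ?N"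
    using Maclaurin_all_le[of ?f "\<lambda>s. Mdet n k t s z" s "Suc ?N"] by auto
  moreover have "?f (Suc ?N) u = 0"
    by (intro Dop_pow_eq_0 low_degree_Mdet assms) auto
  ultimately show ?thesis by (simp only: lessThan_Suc_atMost) (simp add: mult.commute)
qed

text \<open>At s = 0 the truncated convolution is complete. What remains is the evolution by all
  divided differences for time t, which is the same determinant with k = 0, where no row is
  frozen.\<close>

lemma Mdet_0: assumes "k < n" shows "Mdet n k t 0 = Mdet n 0 0 t"
proof
  fix z
  show "Mdet n k t 0 z = Mdet n 0 0 t z"
    unfolding Mdet_def
  proof (intro fdet_cong, goal_cases)
    case (1 i j)
    show ?case
    proof (cases "i < k")
      case True
      have "{i + 2..k} \<union> {k + 1..n} = {i + 2..n}" using True assms by auto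
      then show ?thesis using True eta_0_conv[of "{i + 2..k}" "{k + 1..n}" "2 * (k - 1 - i)" z _ t]
        by (simp add: mrow_def)
    qed (simp add: mrow_def)
  qed
qed

lemma eta_0_top:
  assumes "finite A"
  shows "eta m 0 A z = (if m > int (card A) then 0 else if m = int (card A) then prod z A else eta m 0 A z)"
proof -
  have "pw 0 (m - int (card B)) = 0" if "B \<subseteq> A" "m > int (card A)" for B
    using card_mono[OF assms that(1)] that by (simp add: pw_def)
  moreover have "(\<Sum>B\<in>Pow A. pw 0 (int (card A) - int (card B)) * prod z B) = (\<Sum>B\<in>{A}. pw 0 (int (card A) - int (card B)) * prod z B)"
  proof (intro sum.mono_neutral_right ballI)
    fix B assume B: "B \<in> Pow A - {A}"
    then have "card B < card A" using assms by (intro psubset_card_mono) auto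
    then show "pw 0 (int (card A) - int (card B)) * prod z B = 0" by (simp add: pw_def)
  qed (use assms in auto)
  ultimately show ?thesis by (auto simp: eta_def pw_def)
qed

text \<open>At time 0 a coefficient of order beyond the number n - 1 - i of variables vanishes; this
  makes the matrix lower triangular, with the top coefficients, products of all variables of the
  row, on the diagonal.\<close>

lemma Mdet_top: "Mdet n 0 0 0 = top_mono n"
proof
  fix z
  have row: "mrow n 0 0 0 z i j = eta (int n - 1 - 2 * int i + int j) 0 {i + 2..n} z" for i j
    by (simp add: mrow_def)
  have "Mdet n 0 0 0 z = (\<Prod>i<n - 1. mrow n 0 0 0 z i i)"
    unfolding Mdet_def
  proof (rule fdet_lower_triangular)
    fix i j assume "i < j" "j < n - 1"
    then show "mrow n 0 0 0 z i j = 0" unfolding row by (subst eta_0_top) (auto simp: of_nat_diff)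
  qed
  also have "\<dots> = (\<Prod>i<n - 1. \<Prod>j\<in>{i + 2..n}. z j)"
    unfolding row by (intro prod.cong refl, subst eta_0_top) (auto simp: of_nat_diff)
  also have "\<dots> = (\<Prod>(i, j)\<in>Sigma {..<n - 1} (\<lambda>i. {i + 2..n}). z j)"
    by (subst prod.Sigma) auto
  also have "\<dots> = top_mono n z"
    unfolding top_mono_def
    by (rule prod.reindex_bij_witness[of _ "\<lambda>(i, j). (i - 1, j)" "\<lambda>(i, j). (Suc i, j)"]) (auto simp: pairs_def)
  finally show "Mdet n 0 0 0 z = top_mono n z" .
qed

text \<open>The coefficient of s^m t^j / (m! j!) in exp(s L') exp(t L) applied to the monomial,
  where L' omits the index k.\<close>

definition wsum :: "nat \<Rightarrow> nat \<Rightarrow> nat \<Rightarrow> nat \<Rightarrow> (nat \<Rightarrow> real) \<Rightarrow> real" where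
  "wsum n k m j z = (\<Sum>u\<in>words m ({1..n - 1} - {k}). \<Sum>v\<in>words j {1..n - 1}. dd_word (u @ v) (top_mono n) z)"

lemma Mdet_expand:
  assumes "k < n" "inj z"
  shows "Mdet n k t s z = (\<Sum>m\<le>n choose 2. \<Sum>j\<le>n choose 2. s ^ m / fact m * (t ^ j / fact j) * wsum n k m j z)"
proof -
  let ?S = "{1..n - 1} - {k}" and ?T = "{1..n - 1}" and ?N = "n choose 2"
  have T: "Mdet n 0 0 t z = (\<Sum>j\<le>?N. t ^ j / fact j * (\<Sum>v\<in>words j ?T. dd_word v (top_mono n) z))" if "inj z" for z
    using Mdet_taylor[of 0 n z 0 t] assms that Mdet_top by (simp add: Dop_pow_eq)
  have "(Dop ?S ^^ m) (Mdet n k t 0) z = (\<Sum>j\<le>?N. t ^ j / fact j * wsum n k m j z)" for m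
  proof -
    have "(Dop ?S ^^ m) (Mdet n k t 0) z = (\<Sum>u\<in>words m ?S. dd_word u (Mdet n 0 0 t) z)"
      unfolding Mdet_0[OF assms(1)] by (rule Dop_pow_eq) auto
    also have "\<dots> = (\<Sum>u\<in>words m ?S. dd_word u (\<lambda>z. \<Sum>j\<le>?N. t ^ j / fact j * (\<Sum>v\<in>words j ?T. dd_word v (top_mono n) z)) z)"
      by (intro sum.cong refl dd_word_cong_inj[OF T]) (use assms in auto)
    also have "\<dots> = (\<Sum>u\<in>words m ?S. \<Sum>j\<le>?N. t ^ j / fact j * (\<Sum>v\<in>words j ?T. dd_word (u @ v) (top_mono n) z))"
      unfolding dd_word_sum dd_word_cmult foldr_append comp_apply ..
    also have "\<dots> = (\<Sum>j\<le>?N. t ^ j / fact j * wsum n k m j z)"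
      unfolding wsum_def sum_distrib_left by (rule sum.swap)
    finally show ?thesis .
  qed
  then show ?thesis using Mdet_taylor[OF assms, of t s] by (simp add: sum_distrib_left mult.assoc)
qed

section \<open>Homogeneity and the value at the origin\<close>

lemma dd_word_scale:
  assumes "\<epsilon> \<noteq> 0" "\<And>z. f (\<lambda>i. \<epsilon> * z i) = \<epsilon> ^ d * f z"
  shows "\<epsilon> ^ length w * dd_word w f (\<lambda>i. \<epsilon> * z i) = \<epsilon> ^ d * dd_word w f z"
proof (induction w arbitrary: z)
  case (Cons a w)
  let ?g = "dd_word w f" and ?e = "\<lambda>z i. \<epsilon> * z i"
  have comp: "?e z \<circ> tau a = ?e (z \<circ> tau a)" by auto
  have "\<epsilon> ^ length (a # w) * dd_word (a # w) f (?e z)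
      = \<epsilon> * ((\<epsilon> ^ length w * ?g (?e z) - \<epsilon> ^ length w * ?g (?e (z \<circ> tau a))) / (\<epsilon> * (z (Suc a) - z a)))"
    unfolding dd_word_Cons comp by (simp add: right_diff_distrib[symmetric])
  also have "\<dots> = \<epsilon> ^ d * ((?g z - ?g (z \<circ> tau a)) / (z (Suc a) - z a))"
    unfolding Cons.IH right_diff_distrib[symmetric] using assms(1) by simp
  finally show ?case unfolding dd_word_Cons .
qed (use assms in auto)

text \<open>Each divided difference lowers the degree of homogeneity by one. The case of more than N
  letters is separate, since truncated subtraction would turn the negative exponent into 0 there;
  the degree bound gives zero instead.\<close>

lemma wsum_scale:
  assumes "\<epsilon> > 0" "inj z"
  shows "wsum n k m j (\<lambda>i. \<epsilon> * z i) =
    (if m + j > n choose 2 then 0 else \<epsilon> ^ ((n choose 2) - m - j) * wsum n k m j z)"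
proof -
  let ?N = "n choose 2"
  have inj: "inj (\<lambda>i. \<epsilon> * z i)" using assms by (auto simp: inj_def)
  have top: "top_mono n (\<lambda>i. \<epsilon> * z i) = \<epsilon> ^ ?N * top_mono n z" for z
    unfolding top_mono_def by (simp add: case_prod_beta prod.distrib card_pairs)
  have 1: "dd_word w (top_mono n) (\<lambda>i. \<epsilon> * z i) = (if length w > ?N then 0 else \<epsilon> ^ (?N - length w) * dd_word w (top_mono n) z)" for w
  proof (cases "length w > ?N")
    case True
    have "low_degree (Suc ?N + x) (top_mono n)" for x
      by (induction x) (use low_degree_top_mono low_degree_Suc in auto)
    from this[of "length w - Suc ?N"] have "low_degree (length w) (top_mono n)"
      using True by (metis Suc_leI le_add_diff_inverse)
    then show ?thesis using dd_word_eq_0 inj True by auto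
  next
    case False
    have "\<epsilon> ^ length w * dd_word w (top_mono n) (\<lambda>i. \<epsilon> * z i) = \<epsilon> ^ length w * (\<epsilon> ^ (?N - length w) * dd_word w (top_mono n) z)"
      using dd_word_scale[of \<epsilon> "top_mono n" ?N w z, OF _ top] assms False
      by (simp add: power_add[symmetric] mult.assoc[symmetric])
    then show ?thesis using assms False by simp
  qed
  have "wsum n k m j (\<lambda>i. \<epsilon> * z i) = (\<Sum>u\<in>words m ({1..n - 1} - {k}). \<Sum>v\<in>words j {1..n - 1}.
      if m + j > ?N then 0 else \<epsilon> ^ (?N - m - j) * dd_word (u @ v) (top_mono n) z)"
    unfolding wsum_def 1 by (intro sum.cong refl) (auto simp: words_def)
  then show ?thesis by (auto simp: wsum_def sum_distrib_left)
qed

definition first_count :: "nat \<Rightarrow> nat \<Rightarrow> nat \<Rightarrow> nat" where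
  "first_count n k m = card {w \<in> sorting_networks n. k \<notin> set (take m w)}"

lemma wsum_eq_count:
  assumes "inj z" "m + j = n choose 2"
  shows "wsum n k m j z = real (first_count n k m)"
proof -
  let ?S = "{1..n - 1} - {k}" and ?T = "{1..n - 1}"
  let ?P = "words m ?S \<times> words j ?T" and ?Q = "\<lambda>(u, v). net_prod (u @ v) = rev_perm n"
  have "wsum n k m j z = (\<Sum>(u, v)\<in>?P. dd_word (u @ v) (top_mono n) z)"
    unfolding wsum_def by (rule sum.cartesian_product)
  also have "\<dots> = (\<Sum>x\<in>?P. if ?Q x then 1 else 0)"
  proof (intro sum.cong refl, clarify)
    fix u v assume "u \<in> words m ?S" "v \<in> words j ?T"
    then show "dd_word (u @ v) (top_mono n) z = (if net_prod (u @ v) = rev_perm n then 1 else 0)"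
      using assms by (intro dd_word_top_mono) (force simp: words_def)+
  qed
  also have "\<dots> = real (card {x \<in> ?P. ?Q x})"
    by (simp add: sum.If_cases Int_def)
  also have "card {x \<in> ?P. ?Q x} = first_count n k m"
    unfolding first_count_def
  proof (rule bij_betw_same_card[of "\<lambda>(u, v). u @ v"], rule bij_betwI[where g = "\<lambda>w. (take m w, drop m w)"])
    show "(\<lambda>(u, v). u @ v) \<in> {x \<in> ?P. ?Q x} \<rightarrow> {w \<in> sorting_networks n. k \<notin> set (take m w)}"
      using assms by (fastforce simp: words_def sorting_networks_def)
    show "(\<lambda>w. (take m w, drop m w)) \<in> {w \<in> sorting_networks n. k \<notin> set (take m w)} \<rightarrow> {x \<in> ?P. ?Q x}"
      using assms set_take_subset[of m] set_drop_subset[of m]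
      by (fastforce simp: words_def sorting_networks_def)
  qed (use assms in \<open>auto simp: words_def\<close>)
  finally show ?thesis .
qed

text \<open>The origin is not an injective point, so its value is reached as a limit along
  \<open>\<epsilon> * z\<close> with injective z. In the limit coefficients with m + j < N die out,
  those with m + j > N are zero anyway, and those with m + j = N do not depend on the point and
  count networks.\<close>

theorem Mdet_at_0:
  assumes "k < n"
  shows "Mdet n k t s (\<lambda>i. 0) = (\<Sum>m\<le>n choose 2. s ^ m / fact m * (t ^ ((n choose 2) - m) / fact ((n choose 2) - m))
    * real (first_count n k m))"
proof -
  let ?N = "n choose 2"
  define z :: "nat \<Rightarrow> real" where "z = real"
  have z: "inj z" by (auto simp: z_def inj_def)
  let ?L = "\<lambda>m j. if m + j = ?N then real (first_count n k m) else 0"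
  have lim1: "((\<lambda>\<epsilon>. Mdet n k t s (\<lambda>i. \<epsilon> * z i)) \<longlongrightarrow> Mdet n k t s (\<lambda>i. 0)) (at_right 0)"
  proof -
    have e: "((\<lambda>\<epsilon>. eta m x A (\<lambda>i. \<epsilon> * z i)) \<longlongrightarrow> eta m x A (\<lambda>i. 0)) (at_right 0)" for m x A
    proof -
      have "((\<lambda>\<epsilon>. \<epsilon> * z i) \<longlongrightarrow> 0 * z i) (at_right 0)" for i by (intro tendsto_intros)
      then show ?thesis unfolding eta_def by (intro tendsto_sum tendsto_mult tendsto_const tendsto_prod) auto
    qed
    have "((\<lambda>\<epsilon>. mrow n k t s (\<lambda>i. \<epsilon> * z i) i j) \<longlongrightarrow> mrow n k t s (\<lambda>i. 0) i j) (at_right 0)" for i j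
      unfolding mrow_def Let_def by (cases "i < k") (simp_all add: tendsto_sum tendsto_mult e)
    then show ?thesis unfolding Mdet_def by (intro fdet_tendsto)
  qed
  have w: "((\<lambda>\<epsilon>. wsum n k m j (\<lambda>i. \<epsilon> * z i)) \<longlongrightarrow> ?L m j) (at_right 0)" for m j
  proof -
    have ev: "\<forall>\<^sub>F \<epsilon> in at_right 0. (if m + j > ?N then 0 else \<epsilon> ^ (?N - m - j) * wsum n k m j z)
        = wsum n k m j (\<lambda>i. \<epsilon> * z i)"
      using eventually_at_right_less[of "0::real"] by eventually_elim (simp add: wsum_scale z)
    have "((\<lambda>\<epsilon>::real. if m + j > ?N then 0 else \<epsilon> ^ (?N - m - j) * wsum n k m j z) \<longlongrightarrow> ?L m j) (at_right 0)"
    proof (cases "m + j < ?N")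
      case True
      have "((\<lambda>\<epsilon>::real. \<epsilon> ^ (?N - m - j) * wsum n k m j z) \<longlongrightarrow> 0 ^ (?N - m - j) * wsum n k m j z) (at_right 0)"
        by (intro tendsto_intros)
      then show ?thesis using True by (auto simp: zero_power)
    next
      case False
      then show ?thesis using wsum_eq_count[OF z, of m j n k] by auto
    qed
    then show ?thesis by (rule Lim_transform_eventually[OF _ ev])
  qed
  have ev: "\<forall>\<^sub>F \<epsilon> in at_right 0. (\<Sum>m\<le>?N. \<Sum>j\<le>?N. s ^ m / fact m * (t ^ j / fact j) * wsum n k m j (\<lambda>i. \<epsilon> * z i))
      = Mdet n k t s (\<lambda>i. \<epsilon> * z i)"
    using eventually_at_right_less[of "0::real"]
  proof eventually_elim
    case (elim \<epsilon>)
    then have "inj (\<lambda>i. \<epsilon> * z i)" using z by (auto simp: inj_def)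
    then show ?case using Mdet_expand[OF assms] by simp
  qed
  have "((\<lambda>\<epsilon>. \<Sum>m\<le>?N. \<Sum>j\<le>?N. s ^ m / fact m * (t ^ j / fact j) * wsum n k m j (\<lambda>i. \<epsilon> * z i)) \<longlongrightarrow>
      (\<Sum>m\<le>?N. \<Sum>j\<le>?N. s ^ m / fact m * (t ^ j / fact j) * ?L m j)) (at_right 0)"
    by (intro tendsto_sum tendsto_mult tendsto_const w)
  from Lim_transform_eventually[OF this ev]
  have "Mdet n k t s (\<lambda>i. 0) = (\<Sum>m\<le>?N. \<Sum>j\<le>?N. s ^ m / fact m * (t ^ j / fact j) * ?L m j)"
    using lim1 by (intro tendsto_unique[of "at_right (0::real)"]) auto
  also have "\<dots> = (\<Sum>m\<le>?N. s ^ m / fact m * (t ^ (?N - m) / fact (?N - m)) * real (first_count n k m))"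
  proof (intro sum.cong refl)
    fix m assume m: "m \<in> {..?N}"
    have "(\<Sum>j\<le>?N. s ^ m / fact m * (t ^ j / fact j) * ?L m j) = (\<Sum>j\<in>{?N - m}. s ^ m / fact m * (t ^ j / fact j) * ?L m j)"
      using m by (intro sum.mono_neutral_right) auto
    then show "(\<Sum>j\<le>?N. s ^ m / fact m * (t ^ j / fact j) * ?L m j)
        = s ^ m / fact m * (t ^ (?N - m) / fact (?N - m)) * real (first_count n k m)"
      using m by simp
  qed
  finally show ?thesis .
qed

section \<open>Reduction to a Hankel determinant\<close>

text \<open>For $e \<ge> 0$ the e-fold antiderivative of q based at 0, for $e < 0$ the derivative of order $-e$.\<close>
definition ant :: "real poly \<Rightarrow> int \<Rightarrow> real \<Rightarrow> real" where
  "ant q e x = (\<Sum>m\<le>degree q. coeff q m * fact m * pw x (int m + e))"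

lemma ant_has_derivative: "(ant q e has_real_derivative ant q (e - 1) x) (at x)"
proof -
  have "((\<lambda>x. coeff q m * fact m * pw x (int m + e)) has_real_derivative
      coeff q m * fact m * pw x (int m + (e - 1))) (at x)" for m
    using DERIV_cmult[OF pw_has_derivative[of "int m + e" x], of "coeff q m * fact m"]
    by (simp only: add_diff_eq)
  then show ?thesis unfolding ant_def[abs_def] by (intro DERIV_sum)
qed

lemma ant_0: "ant q 0 x = poly q x"
  by (simp add: ant_def pw_def poly_altdef)

lemma ant_at_0: "e \<ge> 1 \<Longrightarrow> ant q e 0 = 0"
  by (simp add: ant_def pw_def)

lemma ant_reflect:
  assumes "\<And>x. poly q (2 - x) = poly q x"
  shows "ant q (- int d) (2 - x) = (- 1) ^ d * ant q (- int d) x"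
proof (induction d arbitrary: x)
  case 0
  then show ?case by (simp add: ant_0 assms)
next
  case (Suc d)
  have e: "- int d - 1 = - int (Suc d)" by simp
  have "((\<lambda>x. ant q (- int d) (2 - x)) has_real_derivative ant q (- int (Suc d)) (2 - x) * (0 - 1)) (at x)"
    using DERIV_chain'[OF DERIV_diff[OF DERIV_const DERIV_ident] ant_has_derivative[of q "- int d"], of 2 x]
    unfolding e by (simp add: mult.commute)
  moreover have "((\<lambda>x. ant q (- int d) (2 - x)) has_real_derivative (- 1) ^ d * ant q (- int (Suc d)) x) (at x)"
    unfolding Suc.IH using DERIV_cmult[OF ant_has_derivative[of q "- int d" x]] unfolding e by simp
  ultimately have "ant q (- int (Suc d)) (2 - x) * (0 - 1) = (- 1) ^ d * ant q (- int (Suc d)) x"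
    by (rule DERIV_unique)
  then show ?case by simp
qed

text \<open>At the centre of symmetry a derivative of odd order equals its own negative. This is
  what clears the lower-left block in the reduction to the Hankel determinant.\<close>

lemma ant_odd_derivative:
  assumes "\<And>x. poly q (2 - x) = poly q x" "odd d"
  shows "ant q (- int d) 1 = 0"
  using ant_reflect[OF assms(1), where d = d and x = 1] assms(2) by simp

text \<open>The derivative in s of the left-hand side telescopes to the negative of the integrand,
  and at s = 1 every summand is an antiderivative of order at least 1 evaluated at its base point
  0.\<close>

lemma truncated_taylor_integral:
  assumes "s \<le> 1"
  shows "(\<Sum>a\<le>K. pw s (int a) * ant q (int K + 1 - int a) (1 - s))
    = integral {s..1} (\<lambda>u. u ^ K / fact K * poly q (1 - u))"
proof -
  define L where "L = (\<lambda>s. \<Sum>a\<le>K. pw s (int a) * ant q (int K + 1 - int a) (1 - s))"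
  have dL: "(L has_real_derivative - (u ^ K / fact K * poly q (1 - u))) (at u)" for u
  proof -
    let ?T = "\<lambda>a. pw u (int a - 1) * ant q (int K + 1 - int a) (1 - u)"
    have "((\<lambda>s. ant q e (1 - s)) has_real_derivative ant q (e - 1) (1 - u) * (0 - 1)) (at u)" for e
      using DERIV_chain'[OF DERIV_diff[OF DERIV_const DERIV_ident] ant_has_derivative[of q e], of 1 u]
      by (simp add: mult.commute)
    then have "((\<lambda>s. pw s (int a) * ant q (int K + 1 - int a) (1 - s)) has_real_derivative
       pw u (int a) * (ant q (int K + 1 - int a - 1) (1 - u) * (0 - 1)) + pw u (int a - 1) * ant q (int K + 1 - int a) (1 - u)) (at u)" for a
      by (intro DERIV_mult' pw_has_derivative)
    then have "((\<lambda>s. pw s (int a) * ant q (int K + 1 - int a) (1 - s)) has_real_derivative ?T a - ?T (Suc a)) (at u)" for a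
      by (simp add: algebra_simps)
    then have "(L has_real_derivative (\<Sum>a\<le>K. ?T a - ?T (Suc a))) (at u)"
      unfolding L_def by (intro DERIV_sum)
    also have "(\<Sum>a\<le>K. ?T a - ?T (Suc a)) = ?T 0 - ?T (Suc K)" by (rule sum_telescope)
    also have "\<dots> = - (u ^ K / fact K * poly q (1 - u))" by (simp add: ant_0 pw_def)
    finally show ?thesis .
  qed
  have "((\<lambda>u. u ^ K / fact K * poly q (1 - u)) has_integral (- L 1) - (- L s)) {s..1}"
  proof (rule fundamental_theorem_of_calculus[OF assms])
    fix u assume "u \<in> {s..1}"
    have "((\<lambda>u. - L u) has_real_derivative u ^ K / fact K * poly q (1 - u)) (at u)"
      using DERIV_minus[OF dL] by simp
    then show "((\<lambda>u. - L u) has_vector_derivative u ^ K / fact K * poly q (1 - u)) (at u within {s..1})"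
      by (simp add: has_real_derivative_iff_has_vector_derivative[symmetric] has_field_derivative_at_within)
  qed
  moreover have "L 1 = 0" unfolding L_def by (intro sum.neutral ballI) (simp add: ant_at_0)
  ultimately have "integral {s..1} (\<lambda>u. u ^ K / fact K * poly q (1 - u)) = L s"
    by (intro integral_unique) simp
  then show ?thesis unfolding L_def by simp
qed

text \<open>The polynomial (x (2 - x))^b. In u = 1 - x it is the weight (1 - u^2)^b, so it is
  symmetric about x = 1; the factor x^b makes all coefficients below b vanish.\<close>

definition wpoly :: "nat \<Rightarrow> real poly" where
  "wpoly b = monom 1 b * [:2, - 1:] ^ b"

lemma poly_wpoly: "poly (wpoly b) x = (1 - (1 - x)\<^sup>2) ^ b"
proof -
  have "poly (wpoly b) x = (x * (2 - x)) ^ b" by (simp add: wpoly_def poly_monom poly_power power_mult_distrib)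
  also have "x * (2 - x) = 1 - (1 - x)\<^sup>2" by (simp add: power2_eq_square algebra_simps)
  finally show ?thesis .
qed

lemma coeff_wpoly_low: "m < b \<Longrightarrow> coeff (wpoly b) m = 0"
  by (simp add: wpoly_def coeff_monom_mult)

lemma coeff_wpoly_self: "coeff (wpoly b) b = 2 ^ b"
  by (simp add: wpoly_def coeff_monom_mult coeff_0_power)

lemma degree_wpoly_le: "degree (wpoly b) \<le> 2 * b"
proof -
  have "degree ([:2, - 1 :: real:] ^ b) \<le> 1 * b"
    by (rule order_trans[OF degree_power_le]) simp
  then have "degree (wpoly b) \<le> b + 1 * b"
    unfolding wpoly_def by (intro order_trans[OF degree_mult_le] add_mono) (simp_all add: degree_monom_eq)
  then show ?thesis by simp
qed

definition wmom :: "nat \<Rightarrow> nat \<Rightarrow> real \<Rightarrow> real" where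
  "wmom b j s = integral {s..1} (\<lambda>u. u ^ (2 * j) * (1 - u\<^sup>2) ^ b)"

definition Hn :: "nat \<Rightarrow> nat \<Rightarrow> real \<Rightarrow> real" where
  "Hn n k s = fdet k (\<lambda>i j. wmom (n - 2 * k) (i + j) s)"

lemma wmom_binomial:
  assumes "s \<le> 1"
  shows "integral {s..1} (\<lambda>u. u ^ (2 * j) * (1 - u\<^sup>2) ^ (b + l))
    = (\<Sum>m\<le>l. wmom b (j + m) s * (real (l choose m) * (- 1) ^ m))"
proof -
  have int: "(\<lambda>u. u ^ (2 * i) * (1 - u\<^sup>2) ^ b) integrable_on {s..1}" for i :: nat
    by (intro integrable_continuous_interval continuous_intros)
  have "u ^ (2 * j) * (1 - u\<^sup>2) ^ (b + l) = (\<Sum>m\<le>l. u ^ (2 * (j + m)) * (1 - u\<^sup>2) ^ b * (real (l choose m) * (- 1) ^ m))" for u :: real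
  proof -
    have "(1 - u\<^sup>2) ^ l = (- u\<^sup>2 + 1) ^ l" by (simp add: algebra_simps)
    also have "\<dots> = (\<Sum>m\<le>l. real (l choose m) * (- u\<^sup>2) ^ m * 1 ^ (l - m))" by (rule binomial_ring)
    also have "\<dots> = (\<Sum>m\<le>l. u ^ (2 * m) * (real (l choose m) * (- 1) ^ m))"
      by (intro sum.cong refl) (simp add: power_mult[of u 2] power_minus[of "u\<^sup>2"] del: power_mult_numeral)
    finally have "u ^ (2 * j) * (1 - u\<^sup>2) ^ (b + l) = u ^ (2 * j) * (1 - u\<^sup>2) ^ b * (\<Sum>m\<le>l. u ^ (2 * m) * (real (l choose m) * (- 1) ^ m))"
      by (simp add: power_add mult.assoc)
    then show ?thesis by (simp add: sum_distrib_left power_add distrib_left mult_ac)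
  qed
  then have "integral {s..1} (\<lambda>u. u ^ (2 * j) * (1 - u\<^sup>2) ^ (b + l))
     = integral {s..1} (\<lambda>u. \<Sum>m\<le>l. u ^ (2 * (j + m)) * (1 - u\<^sup>2) ^ b * (real (l choose m) * (- 1) ^ m))"
    by simp
  also have "\<dots> = (\<Sum>m\<le>l. integral {s..1} (\<lambda>u. u ^ (2 * (j + m)) * (1 - u\<^sup>2) ^ b * (real (l choose m) * (- 1) ^ m)))"
    by (intro integral_sum finite_atMost integrable_on_mult_left int)
  also have "\<dots> = (\<Sum>m\<le>l. wmom b (j + m) s * (real (l choose m) * (- 1) ^ m))"
    unfolding wmom_def by (intro sum.cong refl integral_mult_left)
  finally show ?thesis .
qed

lemma eta_at_0: "finite A \<Longrightarrow> eta m t A (\<lambda>i. 0) = pw t m"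
  by (induction A arbitrary: m rule: finite_induct) (auto simp: eta_insert)

text \<open>The column operation \<open>C\<close> forms the combinations whose entries are iterated
  antiderivatives or derivatives of \<open>wpoly (b + l)\<close>. In rows from k on these are odd
  derivatives at 1 and vanish; in the first k rows they are integrals over [s, 1]. The other
  diagonal block and the determinant of \<open>C\<close> are free of s, so they only enter the
  constant.\<close>

lemma Mdet_eq_Hn:
  assumes k: "1 \<le> k" "k < n" and n: "2 * k \<le> n"
  shows "\<exists>\<kappa>. \<forall>s\<le>1. Mdet n k (1 - s) s (\<lambda>i. 0) = \<kappa> * Hn n k s"
proof -
  define b where "b = n - 2 * k"
  define q where "q = n - 1"
  have qk: "q = k + (q - k)" using k by (simp add: q_def)
  define M where "M = (\<lambda>s i j. mrow n k (1 - s) s (\<lambda>i. 0) i j)"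
  define cf where "cf = (\<lambda>l j. coeff (wpoly (b + l)) (b + j) * fact (b + j))"
  define C where "C = (\<lambda>j l. if l < k then cf l j else if j = l then 1 else 0 :: real)"
  have Mrow1: "M s i j = (\<Sum>a\<le>2 * (k - 1 - i). pw s (int a) * pw (1 - s) (int n - 1 - 2 * int i + int j - int a))"
    if "i < k" for s i j
    using that by (simp add: M_def mrow_def eta_at_0)
  have Mrow2: "M s i j = pw 1 (int n - 1 - 2 * int i + int j)" if "\<not> i < k" for s i j
    using that by (simp add: M_def mrow_def eta_at_0)
  \<comment> \<open>As n = b + 2 k, the order n - 1 - e + j is (b + j) + (2 k - 1 - e): the
    coefficient of x^(b+j) is moved to an antiderivative of order 2 k - 1 - e.\<close>
  have combine: "(\<Sum>j<q. pw x (int n - 1 - e + int j) * cf l j) = ant (wpoly (b + l)) (2 * int k - 1 - e) x"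
    if l: "l < k" for x e l
  proof -
    have bn: "int n = int b + 2 * int k" using n by (simp add: b_def)
    have "(\<Sum>j<q. pw x (int n - 1 - e + int j) * cf l j)
      = (\<Sum>m\<in>{b..<b + q}. coeff (wpoly (b + l)) m * fact m * pw x (int m + (2 * int k - 1 - e)))"
      by (rule sum.reindex_bij_witness[of _ "\<lambda>m. m - b" "\<lambda>j. b + j"]) (auto simp: cf_def bn algebra_simps)
    also have "\<dots> = (\<Sum>m<b + q. coeff (wpoly (b + l)) m * fact m * pw x (int m + (2 * int k - 1 - e)))"
      by (intro sum.mono_neutral_left) (auto simp: coeff_wpoly_low)
    also have "\<dots> = ant (wpoly (b + l)) (2 * int k - 1 - e) x"
      unfolding ant_def
    proof (intro sum.mono_neutral_right ballI)
      \<comment> \<open>The degree is at most 2 (b + l), hence at most 2 b + 2 k - 2 = b + q - 1: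
        the q available columns hold all coefficients. This is why the exponent b is n - 2
        k.\<close>
      show "{..degree (wpoly (b + l))} \<subseteq> {..<b + q}"
        using degree_wpoly_le[of "b + l"] l n k by (auto simp: b_def q_def)
    qed (auto simp: coeff_eq_0)
    finally show ?thesis .
  qed
  have refl': "poly (wpoly c) (2 - x) = poly (wpoly c) x" for c x
    by (simp add: poly_wpoly power2_eq_square algebra_simps)
  have low: "(\<Sum>j<q. M s i j * C j l) = 0" if "\<not> i < k" "l < k" for s i l
  proof -
    have "(\<Sum>j<q. M s i j * C j l) = ant (wpoly (b + l)) (2 * int k - 1 - 2 * int i) 1"
      unfolding combine[OF that(2), symmetric] using that by (simp add: Mrow2 C_def)
    also have "2 * int k - 1 - 2 * int i = - int (2 * (i - k) + 1)" using that by (simp add: of_nat_diff)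
    also have "ant (wpoly (b + l)) \<dots> 1 = 0" by (intro ant_odd_derivative refl') auto
    finally show ?thesis .
  qed
  have top: "(\<Sum>j<q. M s i j * C j l) = 1 / fact (2 * (k - 1 - i)) * (\<Sum>m\<le>l. wmom b (k - 1 - i + m) s * (real (l choose m) * (- 1) ^ m))"
    if il: "i < k" "l < k" and s: "s \<le> 1" for s i l
  proof -
    let ?K = "2 * (k - 1 - i)"
    have "(\<Sum>j<q. M s i j * C j l) = (\<Sum>j<q. \<Sum>a\<le>?K. pw s (int a) * (pw (1 - s) (int n - 1 - (2 * int i + int a) + int j) * cf l j))"
    proof (intro sum.cong refl)
      fix j
      show "M s i j * C j l = (\<Sum>a\<le>?K. pw s (int a) * (pw (1 - s) (int n - 1 - (2 * int i + int a) + int j) * cf l j))"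
        unfolding Mrow1[OF il(1)] C_def if_P[OF il(2)] sum_distrib_right
        by (intro sum.cong refl) (simp add: mult.assoc, simp add: algebra_simps)
    qed
    also have "\<dots> = (\<Sum>a\<le>?K. pw s (int a) * (\<Sum>j<q. pw (1 - s) (int n - 1 - (2 * int i + int a) + int j) * cf l j))"
      unfolding sum_distrib_left by (rule sum.swap)
    also have "\<dots> = (\<Sum>a\<le>?K. pw s (int a) * ant (wpoly (b + l)) (int ?K + 1 - int a) (1 - s))"
      unfolding combine[OF il(2)] using il by (simp add: of_nat_diff algebra_simps)
    also have "\<dots> = integral {s..1} (\<lambda>u. u ^ ?K / fact ?K * poly (wpoly (b + l)) (1 - u))"
      by (rule truncated_taylor_integral[OF s])
    also have "\<dots> = integral {s..1} (\<lambda>u. (1 / fact ?K) * (u ^ ?K * (1 - u\<^sup>2) ^ (b + l)))"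
      by (simp add: poly_wpoly)
    also have "\<dots> = 1 / fact ?K * integral {s..1} (\<lambda>u. u ^ ?K * (1 - u\<^sup>2) ^ (b + l))"
      by (rule integral_mult_right)
    finally show ?thesis unfolding wmom_binomial[OF s] .
  qed
  have rest: "(\<Sum>j<q. M s (k + i) j * C j (k + l)) = pw 1 (int n - 1 - 2 * int (k + i) + int (k + l))" if "k + l < q" for s i l
  proof -
    have "(\<Sum>j<q. M s (k + i) j * C j (k + l)) = (\<Sum>j\<in>{k + l}. M s (k + i) j * C j (k + l))"
      using that by (intro sum.mono_neutral_right) (auto simp: C_def)
    then show ?thesis by (simp add: C_def Mrow2)
  qed
  have detC: "fdet q C \<noteq> 0"
  proof -
    have "fdet q C = (\<Prod>i<q. C i i)"
      by (rule fdet_lower_triangular) (auto simp: C_def cf_def coeff_wpoly_low)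
    also have "\<dots> \<noteq> 0" by (auto simp: C_def cf_def coeff_wpoly_self)
    finally show ?thesis .
  qed
  define \<beta> where "\<beta> = fdet (q - k) (\<lambda>i l. pw 1 (int n - 1 - 2 * int (k + i) + int (k + l)))"
  \<comment> \<open>\<open>P\<close> reverses the order of the rows and carries the factorials;
    \<open>T\<close> expands (1 - u^2)^l in powers of u^2. Between them stands the Hankel matrix of
    the moments.\<close>
  define P where "P = (\<lambda>i j. if j = k - 1 - i then 1 / fact (2 * (k - 1 - i)) else 0 :: real)"
  define T where "T = (\<lambda>m l. real (l choose m) * (- 1) ^ m)"
  have "Mdet n k (1 - s) s (\<lambda>i. 0) = (fdet k P * fdet k T * \<beta> / fdet q C) * Hn n k s" if s: "s \<le> 1" for s
  proof -
    have "fdet q (M s) * fdet q C = fdet q (\<lambda>i l. \<Sum>j<q. M s i j * C j l)"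
      by (rule fdet_mult[symmetric])
    also have "\<dots> = fdet (k + (q - k)) (\<lambda>i l. \<Sum>j<q. M s i j * C j l)" using qk by simp
    also have "\<dots> = fdet k (\<lambda>i l. \<Sum>j<q. M s i j * C j l) * fdet (q - k) (\<lambda>i l. \<Sum>j<q. M s (k + i) j * C j (k + l))"
      by (rule fdet_block_lower_left_zero) (use low in auto)
    also have "fdet (q - k) (\<lambda>i l. \<Sum>j<q. M s (k + i) j * C j (k + l)) = \<beta>"
      unfolding \<beta>_def by (intro fdet_cong rest) auto
    also have "fdet k (\<lambda>i l. \<Sum>j<q. M s i j * C j l)
       = fdet k (\<lambda>i l. \<Sum>i'<k. P i i' * (\<Sum>m<k. wmom b (i' + m) s * T m l))"
    proof (intro fdet_cong, goal_cases)
      case (1 i l)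
      have "(\<Sum>i'<k. P i i' * (\<Sum>m<k. wmom b (i' + m) s * T m l)) = (\<Sum>i'\<in>{k - 1 - i}. P i i' * (\<Sum>m<k. wmom b (i' + m) s * T m l))"
        using 1 by (intro sum.mono_neutral_right) (auto simp: P_def)
      also have "\<dots> = 1 / fact (2 * (k - 1 - i)) * (\<Sum>m<k. wmom b (k - 1 - i + m) s * T m l)" by (simp add: P_def)
      also have "(\<Sum>m<k. wmom b (k - 1 - i + m) s * T m l) = (\<Sum>m\<le>l. wmom b (k - 1 - i + m) s * T m l)"
        using 1 by (intro sum.mono_neutral_right) (auto simp: T_def)
      finally show ?case using top[OF 1 s] by (simp add: T_def)
    qed
    also have "\<dots> = fdet k P * (Hn n k s * fdet k T)"
      unfolding Hn_def b_def[symmetric] by (simp only: fdet_mult)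
    finally have "fdet q (M s) * fdet q C = fdet k P * (Hn n k s * fdet k T) * \<beta>" .
    moreover have "Mdet n k (1 - s) s (\<lambda>i. 0) = fdet q (M s)"
      unfolding Mdet_def M_def q_def by (rule fdet_cong) simp
    ultimately show ?thesis using detC by (simp add: field_simps)
  qed
  then show ?thesis by blast
qed

definition Fr :: "nat \<Rightarrow> nat \<Rightarrow> nat \<Rightarrow> real" where
  "Fr n k m = real (first_count n k m) / real (card (sorting_networks n))"

lemma card_sorting_networks_pos: "card (sorting_networks n) > 0"
  using sorting_networks_nonempty by (simp add: card_gt_0_iff)

text \<open>The constant of proportionality is fixed at s = 0, where only the term m = 0 survives
  and equals 1. No lower bound is put on s, because \<open>Fr_first_step\<close> differentiates the
  identity at 0 from both sides.\<close>

theorem poissonized_first_count: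
  assumes k: "1 \<le> k" "k < n" and n: "2 * k \<le> n"
  shows "Hn n k 0 \<noteq> 0"
    and "s \<le> 1 \<Longrightarrow> (\<Sum>m\<le>n choose 2. real ((n choose 2) choose m) * s ^ m * (1 - s) ^ ((n choose 2) - m) * Fr n k m)
      = Hn n k s / Hn n k 0"
proof -
  let ?N = "n choose 2" and ?W = "real (card (sorting_networks n))"
  obtain \<kappa> where \<kappa>: "\<And>s. s \<le> 1 \<Longrightarrow> Mdet n k (1 - s) s (\<lambda>i. 0) = \<kappa> * Hn n k s"
    using Mdet_eq_Hn[OF assms] by blast
  have W: "?W > 0" using card_sorting_networks_pos by simp
  have main: "(\<Sum>m\<le>?N. real (?N choose m) * s ^ m * (1 - s) ^ (?N - m) * Fr n k m) = fact ?N / ?W * \<kappa> * Hn n k s"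
    if "s \<le> 1" for s
  proof -
    have "fact ?N / ?W * (\<kappa> * Hn n k s) = fact ?N / ?W * Mdet n k (1 - s) s (\<lambda>i. 0)" using \<kappa>[OF that] by simp
    also have "\<dots> = (\<Sum>m\<le>?N. fact ?N / ?W * (s ^ m / fact m * ((1 - s) ^ (?N - m) / fact (?N - m)) * real (first_count n k m)))"
      unfolding Mdet_at_0[OF k(2)] by (rule sum_distrib_left)
    also have "\<dots> = (\<Sum>m\<le>?N. real (?N choose m) * s ^ m * (1 - s) ^ (?N - m) * Fr n k m)"
      by (intro sum.cong refl) (simp add: binomial_fact Fr_def mult_ac)
    finally show ?thesis by simp
  qed
  have "(\<Sum>m\<le>?N. real (?N choose m) * 0 ^ m * (1 - 0) ^ (?N - m) * Fr n k m)
      = (\<Sum>m\<in>{0}. real (?N choose m) * 0 ^ m * (1 - 0) ^ (?N - m) * Fr n k m)"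
    by (intro sum.mono_neutral_right) auto
  also have "\<dots> = 1" using sorting_networks_nonempty[of n] by (simp add: Fr_def first_count_def)
  finally have one: "fact ?N / ?W * \<kappa> * Hn n k 0 = 1" unfolding main[OF zero_le_one] .
  then show H0: "Hn n k 0 \<noteq> 0" by (metis mult_zero_right zero_neq_one)
  show "(\<Sum>m\<le>?N. real (?N choose m) * s ^ m * (1 - s) ^ (?N - m) * Fr n k m) = Hn n k s / Hn n k 0" if "s \<le> 1"
  proof -
    have "fact ?N / ?W * \<kappa> = 1 / Hn n k 0" using one H0 by (metis nonzero_eq_divide_eq)
    then show ?thesis unfolding main[OF that] by simp
  qed
qed

section \<open>Asymptotics of the first occurrence\<close>

definition gm :: "nat \<Rightarrow> real \<Rightarrow> real" where
  "gm j x = (LINT v|lborel. indicator {x..} v * (v ^ (2 * j) * exp (- v\<^sup>2)))"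

definition HH :: "nat \<Rightarrow> real \<Rightarrow> real" where
  "HH k x = fdet k (\<lambda>i j. gm (i + j) x)"

definition smom :: "nat \<Rightarrow> nat \<Rightarrow> nat \<Rightarrow> real \<Rightarrow> real" where
  "smom n b j x = (LINT v|lborel. indicator {x..sqrt (real n)} v * (v ^ (2 * j) * (1 - v\<^sup>2 / real n) ^ b))"

lemma integrable_power_gauss_half: "integrable lborel (\<lambda>v::real. v ^ m * exp (- v\<^sup>2 / 2))"
proof -
  have "integrable lborel (\<lambda>v. sqrt (2 * pi) * (std_normal_density v * v ^ m))"
    by (intro integrable_mult_right integrable_std_normal_moment)
  also have "(\<lambda>v. sqrt (2 * pi) * (std_normal_density v * v ^ m)) = (\<lambda>v. v ^ m * exp (- v\<^sup>2 / 2))"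
    by (auto simp: std_normal_density_def fun_eq_iff field_simps)
  finally show ?thesis .
qed

lemma integrable_power_gauss: "integrable lborel (\<lambda>v::real. v ^ m * exp (- v\<^sup>2))"
proof (rule Bochner_Integration.integrable_bound[OF integrable_power_gauss_half[of m]])
  show "AE v::real in lborel. norm (v ^ m * exp (- v\<^sup>2)) \<le> norm (v ^ m * exp (- v\<^sup>2 / 2))"
    by (intro AE_I2) (auto simp: abs_mult intro!: mult_left_mono)
qed measurable

lemma integrable_gm: "integrable lborel (\<lambda>v::real. indicator {x..} v * (v ^ (2 * j) * exp (- v\<^sup>2)))"
  using integrable_real_mult_indicator[OF _ integrable_power_gauss[of "2 * j"], of "{x..}"]
  by (simp add: mult_ac)

lemma gm_eq_minus_integral:
  assumes "a \<le> x"
  shows "gm j x = gm j a - integral {a..x} (\<lambda>v. v ^ (2 * j) * exp (- v\<^sup>2))"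
proof -
  let ?f = "\<lambda>v::real. v ^ (2 * j) * exp (- v\<^sup>2)"
  have si: "set_integrable lborel {a..x} ?f"
    by (intro borel_integrable_atLeastAtMost' continuous_intros)
  have "gm j a = (LINT v|lborel. indicator {a..x} v * ?f v + indicator {x..} v * ?f v)"
    unfolding gm_def
  proof (rule integral_cong_AE)
    show "AE v in lborel. indicator {a..} v * ?f v = indicator {a..x} v * ?f v + indicator {x..} v * ?f v"
      using AE_lborel_singleton[of x] by eventually_elim (use assms in \<open>auto simp: indicator_def\<close>)
  qed measurable
  also have "\<dots> = (LINT v|lborel. indicator {a..x} v * ?f v) + gm j x"
    unfolding gm_def
    by (intro Bochner_Integration.integral_add integrable_gm) (use si in \<open>simp add: set_integrable_def\<close>)
  also have "(LINT v|lborel. indicator {a..x} v * ?f v) = integral {a..x} ?f"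
    using set_borel_integral_eq_integral(2)[OF si] by (simp add: set_lebesgue_integral_def)
  finally show ?thesis by simp
qed

lemma gm_has_derivative: "(gm j has_real_derivative - (x ^ (2 * j) * exp (- x\<^sup>2))) (at x)"
proof -
  let ?f = "\<lambda>v::real. v ^ (2 * j) * exp (- v\<^sup>2)"
  let ?I = "\<lambda>u. integral {x - 1..u} ?f"
  have "(?I has_vector_derivative ?f x) (at x within {x - 1..x + 1})"
    by (intro integral_has_vector_derivative continuous_intros) auto
  then have "(?I has_real_derivative ?f x) (at x)"
    by (simp add: has_real_derivative_iff_has_vector_derivative at_within_Icc_at)
  then have "((\<lambda>u. gm j (x - 1) - ?I u) has_real_derivative - ?f x) (at x)"
    by (auto intro!: derivative_eq_intros)
  moreover have "\<forall>\<^sub>F u in nhds x. gm j u = gm j (x - 1) - ?I u"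
  proof -
    have "\<forall>\<^sub>F u in nhds x. x - 1 < u" by (rule order_tendstoD(1)[OF filterlim_ident]) simp
    then show ?thesis by eventually_elim (auto intro!: gm_eq_minus_integral)
  qed
  ultimately show ?thesis by (subst DERIV_cong_ev[OF refl _ refl])
qed

lemma fdet_scale:
  "fdet n (\<lambda>i j. u i * a i j * v j) = (\<Prod>i<n. u i) * (\<Prod>j<n. v j) * fdet n a"
proof -
  have "(\<Prod>i<n. u i * a i (p i) * v (p i)) = (\<Prod>i<n. u i) * (\<Prod>j<n. v j) * (\<Prod>i<n. a i (p i))"
    if "p permutes {0..<n}" for p
  proof -
    have "(\<Prod>i<n. v (p i)) = (\<Prod>j<n. v j)"
      using prod.permute[OF that, of v] by (simp add: atLeast0LessThan)
    then show ?thesis by (simp add: prod.distrib)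
  qed
  then show ?thesis unfolding fdet_leibniz sum_distrib_left by (intro sum.cong) auto
qed

lemma wmom_scaled:
  assumes n: "n > 0"
  shows "wmom b j (x / sqrt (real n)) = (1 / sqrt (real n)) ^ (2 * j + 1) * smom n b j x"
proof -
  define r where "r = sqrt (real n)"
  have r: "r > 0" "r\<^sup>2 = real n" using n by (auto simp: r_def)
  let ?f = "\<lambda>u::real. u ^ (2 * j) * (1 - u\<^sup>2) ^ b"
  have "set_integrable lborel {x / r..1} ?f"
    by (intro borel_integrable_atLeastAtMost' continuous_intros)
  then have "wmom b j (x / r) = (LINT u|lborel. indicator {x / r..1} u * ?f u)"
    unfolding wmom_def using set_borel_integral_eq_integral(2) by (fastforce simp: set_lebesgue_integral_def)
  also have "\<dots> = \<bar>1 / r\<bar> *\<^sub>R (LINT v|lborel. indicator {x / r..1} (0 + 1 / r * v) * ?f (0 + 1 / r * v))"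
    using r by (intro lborel_integral_real_affine) auto
  also have "\<dots> = 1 / r * (LINT v|lborel. (1 / r) ^ (2 * j) * (indicator {x..r} v * (v ^ (2 * j) * (1 - v\<^sup>2 / real n) ^ b)))"
    using r by (simp add: indicator_def field_simps power_divide flip: r(2))
  also have "\<dots> = (1 / r) ^ (2 * j + 1) * smom n b j x"
    unfolding smom_def r_def[symmetric] by (subst integral_mult_right_zero) simp
  finally show ?thesis unfolding r_def .
qed

text \<open>Dominated convergence with (1 - v^2/n)^(n - 2k) \<le> exp(-v^2 (n - 2k)/n) \<le>
  exp(-v^2/2). The last step requires n \<ge> 4 k, which the offset guarantees together with n >
  0.\<close>

lemma smom_tendsto:
  assumes x: "x \<ge> 0"
  shows "(\<lambda>n. smom n (n - 2 * k) j x) \<longlonglongrightarrow> gm j x"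
proof (rule LIMSEQ_offset[where k = "4 * k + 1"])
  let ?g = "\<lambda>n v. indicator {x..sqrt (real n)} v * (v ^ (2 * j) * (1 - v\<^sup>2 / real n) ^ (n - 2 * k)) :: real"
  let ?m = "\<lambda>n. n + (4 * k + 1)"
  have pt: "(\<lambda>n. ?g n v) \<longlonglongrightarrow> indicator {x..} v * (v ^ (2 * j) * exp (- v\<^sup>2))" for v
  proof (cases "v \<ge> x")
    case True
    have e1: "(\<lambda>n. (1 - v\<^sup>2 / real n) ^ n / (1 - v\<^sup>2 / real n) ^ (2 * k)) \<longlonglongrightarrow> exp (- v\<^sup>2) / (1 - 0) ^ (2 * k)"
    proof (rule tendsto_divide)
      show "(\<lambda>n. (1 - v\<^sup>2 / real n) ^ n) \<longlonglongrightarrow> exp (- v\<^sup>2)"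
        using tendsto_exp_limit_sequentially[of "- v\<^sup>2"] by simp
      have "(\<lambda>n. v\<^sup>2 / real n) \<longlonglongrightarrow> 0" by real_asymp
      then show "(\<lambda>n. (1 - v\<^sup>2 / real n) ^ (2 * k)) \<longlonglongrightarrow> (1 - 0) ^ (2 * k)" by (intro tendsto_intros)
    qed auto
    have ev: "\<forall>\<^sub>F n in sequentially. real n > v\<^sup>2 \<and> n \<ge> 2 * k"
      by (intro eventually_conj eventually_ge_at_top filterlim_real_sequentially[unfolded filterlim_at_top_dense, rule_format])
    have "(\<lambda>n. 1 * (v ^ (2 * j) * ((1 - v\<^sup>2 / real n) ^ n / (1 - v\<^sup>2 / real n) ^ (2 * k)))) \<longlonglongrightarrow> 1 * (v ^ (2 * j) * (exp (- v\<^sup>2) / (1 - 0) ^ (2 * k)))"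
      by (intro tendsto_mult tendsto_const e1)
    moreover from ev have "\<forall>\<^sub>F n in sequentially. 1 * (v ^ (2 * j) * ((1 - v\<^sup>2 / real n) ^ n / (1 - v\<^sup>2 / real n) ^ (2 * k))) = ?g n v"
    proof eventually_elim
      case (elim n)
      then have n: "real n > v\<^sup>2" "n \<ge> 2 * k" by auto
      have "v\<^sup>2 \<le> real n" using n by simp
      then have "v \<le> sqrt (real n)" by (rule real_le_rsqrt)
      moreover have "1 - v\<^sup>2 / real n \<noteq> 0" using n by (auto simp: field_simps)
      then have "(1 - v\<^sup>2 / real n) ^ n / (1 - v\<^sup>2 / real n) ^ (2 * k) = (1 - v\<^sup>2 / real n) ^ (n - 2 * k)"
        using n by (simp add: power_diff)
      ultimately show ?case using True by simp
    qed
    ultimately show ?thesis using True by (auto elim: Lim_transform_eventually)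
  qed auto
  show "(\<lambda>n. smom (?m n) (?m n - 2 * k) j x) \<longlonglongrightarrow> gm j x"
    unfolding smom_def gm_def
  proof (rule integral_dominated_convergence[where w = "\<lambda>v::real. norm (v ^ (2 * j) * exp (- v\<^sup>2 / 2))"])
    show "integrable lborel (\<lambda>v::real. norm (v ^ (2 * j) * exp (- v\<^sup>2 / 2)))"
      by (intro integrable_norm integrable_power_gauss_half)
    show "AE v in lborel. (\<lambda>n. ?g (?m n) v) \<longlonglongrightarrow> indicator {x..} v * (v ^ (2 * j) * exp (- v\<^sup>2))"
      using LIMSEQ_ignore_initial_segment[OF pt] by (intro AE_I2) 
    fix n
    show "AE v in lborel. norm (?g (?m n) v) \<le> norm (v ^ (2 * j) * exp (- v\<^sup>2 / 2))"
    proof (intro AE_I2)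
      fix v :: real
      let ?n = "?m n"
      show "norm (?g ?n v) \<le> norm (v ^ (2 * j) * exp (- v\<^sup>2 / 2))"
      proof (cases "v \<in> {x..sqrt (real ?n)}")
        case True
        then have v2: "v\<^sup>2 \<le> real ?n" using x by (metis atLeastAtMost_iff order_trans power_mono real_sqrt_pow2 of_nat_0_le_iff)
        have n0: "real ?n > 0" by simp
        have q: "0 \<le> 1 - v\<^sup>2 / real ?n" using v2 n0 by (simp add: field_simps)
        have "(1 - v\<^sup>2 / real ?n) ^ (?n - 2 * k) \<le> exp (- v\<^sup>2 / real ?n) ^ (?n - 2 * k)"
          using q exp_ge_add_one_self[of "- v\<^sup>2 / real ?n"] by (intro power_mono) auto
        also have "\<dots> = exp (real (?n - 2 * k) * (- v\<^sup>2 / real ?n))" by (rule exp_of_nat_mult[symmetric])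
        also have "\<dots> \<le> exp (- v\<^sup>2 / 2)"
        proof -
          have "v\<^sup>2 * real ?n \<le> 2 * (real (?n - 2 * k) * v\<^sup>2)"
            using mult_right_mono[of "real ?n" "2 * real (?n - 2 * k)" "v\<^sup>2"] by (simp add: algebra_simps of_nat_diff)
          then show ?thesis using n0 by (simp add: field_simps)
        qed
        finally have "(1 - v\<^sup>2 / real ?n) ^ (?n - 2 * k) \<le> exp (- v\<^sup>2 / 2)" .
        then have "\<bar>v ^ (2 * j)\<bar> * (1 - v\<^sup>2 / real ?n) ^ (?n - 2 * k) \<le> \<bar>v ^ (2 * j)\<bar> * exp (- v\<^sup>2 / 2)"
          by (intro mult_left_mono) auto
        then show ?thesis using True q by (simp add: abs_mult)
      qed auto
    qed
  qed measurable
qed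

text \<open>Row 0 replaced by the first unit vector. At 0 only the tail moment of order 0 has a
  nonzero derivative, namely -1, so the derivative of the Hankel determinant there is minus the
  determinant of this matrix.\<close>

definition e0row :: "(nat \<Rightarrow> nat \<Rightarrow> real) \<Rightarrow> nat \<Rightarrow> nat \<Rightarrow> real" where
  "e0row a = a(0 := (\<lambda>j. if j = 0 then 1 else 0))"

lemma wmom_has_derivative_0:
  "(wmom b j has_real_derivative (if j = 0 then - 1 else 0)) (at 0)"
proof -
  let ?f = "\<lambda>v::real. v ^ (2 * j) * (1 - v\<^sup>2) ^ b"
  let ?I = "\<lambda>u. integral {-1..u} ?f"
  have int: "?f integrable_on {c..d}" for c d by (intro integrable_continuous_interval continuous_intros)
  have "(?I has_vector_derivative ?f 0) (at 0 within {-1..1})"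
    by (intro integral_has_vector_derivative continuous_intros) auto
  then have "(?I has_real_derivative ?f 0) (at 0)"
    by (simp add: has_real_derivative_iff_has_vector_derivative at_within_Icc_at)
  then have "((\<lambda>u. ?I 1 - ?I u) has_real_derivative - ?f 0) (at 0)"
    by (auto intro!: derivative_eq_intros)
  moreover have "\<forall>\<^sub>F u in nhds 0. wmom b j u = ?I 1 - ?I u"
  proof -
    have "\<forall>\<^sub>F u in nhds (0::real). -1 < u \<and> u < 1"
      by (intro eventually_conj order_tendstoD[OF filterlim_ident]) auto
    then show ?thesis
    proof eventually_elim
      case (elim u)
      then have "?I u + integral {u..1} ?f = ?I 1" by (intro Henstock_Kurzweil_Integration.integral_combine int) auto
      then show ?case unfolding wmom_def by simp
    qed
  qed
  ultimately have "(wmom b j has_real_derivative - ?f 0) (at 0)" by (subst DERIV_cong_ev[OF refl _ refl])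
  then show ?thesis by (cases "j = 0") (auto simp: power_0_left)
qed

lemma Hn_has_derivative_0:
  assumes "k \<ge> 1"
  shows "(Hn n k has_real_derivative - fdet k (e0row (\<lambda>i j. wmom (n - 2 * k) (i + j) 0))) (at 0)"
proof -
  let ?a = "\<lambda>s i j. wmom (n - 2 * k) (i + j) s" and ?a' = "\<lambda>i j. if i + j = 0 then - 1 else 0 :: real"
  have "((\<lambda>s. fdet k (?a s)) has_real_derivative (\<Sum>r<k. fdet k ((?a 0)(r := ?a' r)))) (at 0)"
    by (intro fdet_has_derivative wmom_has_derivative_0)
  also have "(\<Sum>r<k. fdet k ((?a 0)(r := ?a' r))) = (\<Sum>r\<in>{0}. fdet k ((?a 0)(r := ?a' r)))"
  proof (intro sum.mono_neutral_right ballI)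
    fix r assume r: "r \<in> {..<k} - {0}"
    then have "?a' r = (\<lambda>j. 0)" by auto
    then show "fdet k ((?a 0)(r := ?a' r)) = 0" using fdet_row_zero[of r k] r by simp
  qed (use assms in auto)
  also have "\<dots> = fdet k ((?a 0)(0 := (\<lambda>j. (- 1) * (if j = 0 then 1 else 0) + 0 * 0)))"
    by (simp, intro fdet_cong) auto
  also have "\<dots> = (- 1) * fdet k (e0row (?a 0)) + 0 * fdet k ((?a 0)(0 := (\<lambda>j. 0)))"
    unfolding e0row_def using assms by (intro fdet_row_linear) auto
  finally show ?thesis unfolding Hn_def[abs_def] by simp
qed

lemma Hn_scaled:
  assumes "n > 0"
  shows "Hn n k (x / sqrt (real n)) = (\<Prod>i<k. (1 / sqrt (real n)) ^ (2 * i + 1)) * (\<Prod>i<k. (1 / sqrt (real n)) ^ (2 * i))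
    * fdet k (\<lambda>i j. smom n (n - 2 * k) (i + j) x)"
  unfolding Hn_def fdet_scale[symmetric]
  by (intro fdet_cong) (simp add: wmom_scaled[OF assms] power_add power_mult distrib_left mult_ac)

text \<open>The replaced row does not scale. Compared with \<open>Hn_scaled\<close> its factor 1 /
  sqrt n is missing, which leaves sqrt n over.\<close>

lemma e0_scaled:
  assumes "n > 0" "k \<ge> 1"
  shows "fdet k (e0row (\<lambda>i j. wmom (n - 2 * k) (i + j) 0)) =
    sqrt (real n) * ((\<Prod>i<k. (1 / sqrt (real n)) ^ (2 * i + 1)) * (\<Prod>i<k. (1 / sqrt (real n)) ^ (2 * i))
    * fdet k (e0row (\<lambda>i j. smom n (n - 2 * k) (i + j) 0)))"
proof -
  let ?r = "1 / sqrt (real n)"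
  let ?u = "\<lambda>i. if i = 0 then 1 else ?r ^ (2 * i + 1)"
  have "fdet k (e0row (\<lambda>i j. wmom (n - 2 * k) (i + j) 0))
     = fdet k (\<lambda>i j. ?u i * e0row (\<lambda>i j. smom n (n - 2 * k) (i + j) 0) i j * ?r ^ (2 * j))"
  proof (intro fdet_cong, goal_cases)
    case (1 i j)
    have "wmom (n - 2 * k) (i + j) 0 = ?r ^ (2 * (i + j) + 1) * smom n (n - 2 * k) (i + j) 0"
      using wmom_scaled[OF assms(1), of "n - 2 * k" "i + j" 0] by (simp only: div_0)
    also have "2 * (i + j) + 1 = (2 * i + 1) + 2 * j" by simp
    finally have "wmom (n - 2 * k) (i + j) 0 = ?r ^ (2 * i + 1) * smom n (n - 2 * k) (i + j) 0 * ?r ^ (2 * j)"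
      unfolding power_add[of ?r "2 * i + 1" "2 * j"] by (simp only: mult_ac)
    then show ?case by (cases "i = 0") (simp_all only: e0row_def fun_upd_apply if_True if_False, simp)
  qed
  also have "\<dots> = (\<Prod>i<k. ?u i) * (\<Prod>i<k. ?r ^ (2 * i)) * fdet k (e0row (\<lambda>i j. smom n (n - 2 * k) (i + j) 0))"
    by (rule fdet_scale)
  also have "(\<Prod>i<k. ?u i) = sqrt (real n) * (\<Prod>i<k. ?r ^ (2 * i + 1))"
  proof -
    have "(\<Prod>i<k. ?u i) = ?u 0 * (\<Prod>i\<in>{..<k} - {0}. ?u i)" using assms by (intro prod.remove) auto
    also have "(\<Prod>i\<in>{..<k} - {0}. ?u i) = (\<Prod>i\<in>{..<k} - {0}. ?r ^ (2 * i + 1))" by (intro prod.cong) auto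
    also have "?u 0 * \<dots> = sqrt (real n) * (?r ^ (2 * 0 + 1) * \<dots>)" using assms by simp
    also have "?r ^ (2 * 0 + 1) * (\<Prod>i\<in>{..<k} - {0}. ?r ^ (2 * i + 1)) = (\<Prod>i<k. ?r ^ (2 * i + 1))"
      using assms by (intro prod.remove[symmetric]) auto
    finally show ?thesis .
  qed
  finally show ?thesis by (simp only: mult.assoc)
qed

lemma Hn_ratio_tendsto:
  assumes "x \<ge> 0" "HH k 0 \<noteq> 0"
  shows "(\<lambda>n. Hn n k (x / sqrt (real n)) / Hn n k 0) \<longlonglongrightarrow> HH k x / HH k 0"
proof -
  have lim: "(\<lambda>n. fdet k (\<lambda>i j. smom n (n - 2 * k) (i + j) y)) \<longlonglongrightarrow> HH k y" if "y \<ge> 0" for y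
    unfolding HH_def by (intro fdet_tendsto smom_tendsto that)
  have "(\<lambda>n. fdet k (\<lambda>i j. smom n (n - 2 * k) (i + j) x) / fdet k (\<lambda>i j. smom n (n - 2 * k) (i + j) 0)) \<longlonglongrightarrow> HH k x / HH k 0"
    by (intro tendsto_divide lim assms) auto
  moreover have "\<forall>\<^sub>F n in sequentially. fdet k (\<lambda>i j. smom n (n - 2 * k) (i + j) x) / fdet k (\<lambda>i j. smom n (n - 2 * k) (i + j) 0)
      = Hn n k (x / sqrt (real n)) / Hn n k 0"
    using eventually_gt_at_top[of 0]
  proof eventually_elim
    case (elim n)
    define c where "c = (\<Prod>i<k. (1 / sqrt (real n)) ^ (2 * i + 1)) * (\<Prod>i<k. (1 / sqrt (real n)) ^ (2 * i))"
    have "c \<noteq> 0" using elim by (auto simp: c_def)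
    then show ?case
      using Hn_scaled[OF elim, of k x] Hn_scaled[OF elim, of k 0] unfolding c_def[symmetric] div_0 by simp
  qed
  ultimately show ?thesis by (rule Lim_transform_eventually)
qed

section \<open>Removing the Poissonization\<close>

lemma Fr_nonneg: "Fr n k m \<ge> 0" by (simp add: Fr_def)

lemma Fr_0 [simp]: "Fr n k 0 = 1"
  using sorting_networks_nonempty[of n] by (simp add: Fr_def first_count_def)

lemma Fr_antimono: "m \<le> m' \<Longrightarrow> Fr n k m' \<le> Fr n k m"
  unfolding Fr_def first_count_def
  by (intro divide_right_mono of_nat_mono card_mono) (auto dest: set_take_subset_set_take[THEN subsetD])

lemma Fr_le_1: "Fr n k m \<le> 1"
  using Fr_antimono[of 0 m n k] by simp

text \<open>Chebyshev's inequality for a binomial variable, with its variance N s (1 - s) bounded by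
  N s.\<close>

lemma Bernstein_tail:
  assumes s: "0 \<le> s" "s \<le> 1" and a: "a > 0"
  shows "(\<Sum>m | m \<le> N \<and> a \<le> \<bar>real m - real N * s\<bar>. Bernstein N m s) \<le> real N * s / a\<^sup>2"
proof -
  have var: "(\<Sum>m\<le>N. (real m - real N * s)\<^sup>2 * Bernstein N m s) = real N * s * (1 - s)"
  proof -
    have "(\<Sum>m\<le>N. (real m - real N * s)\<^sup>2 * Bernstein N m s)
      = (\<Sum>m\<le>N. real m * (real m - 1) * Bernstein N m s + (1 - 2 * real N * s) * (real m * Bernstein N m s) + (real N * s)\<^sup>2 * Bernstein N m s)"
      by (intro sum.cong refl) (simp add: power2_eq_square algebra_simps)
    also have "\<dots> = real N * (real N - 1) * s\<^sup>2 + (1 - 2 * real N * s) * (real N * s) + (real N * s)\<^sup>2"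
      by (simp add: sum.distrib sum_distrib_left[symmetric])
    also have "\<dots> = real N * s * (1 - s)" by (simp add: power2_eq_square algebra_simps)
    finally show ?thesis .
  qed
  have "a\<^sup>2 * (\<Sum>m | m \<le> N \<and> a \<le> \<bar>real m - real N * s\<bar>. Bernstein N m s)
     \<le> (\<Sum>m | m \<le> N \<and> a \<le> \<bar>real m - real N * s\<bar>. (real m - real N * s)\<^sup>2 * Bernstein N m s)"
    unfolding sum_distrib_left
  proof (intro sum_mono mult_right_mono)
    fix m assume "m \<in> {m. m \<le> N \<and> a \<le> \<bar>real m - real N * s\<bar>}"
    then show "a\<^sup>2 \<le> (real m - real N * s)\<^sup>2" using a by (metis (no_types, lifting) abs_le_square_iff abs_of_pos mem_Collect_eq)
  qed (use s in \<open>auto intro: Bernstein_nonneg\<close>)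
  also have "\<dots> \<le> (\<Sum>m\<le>N. (real m - real N * s)\<^sup>2 * Bernstein N m s)"
    using s by (intro sum_mono2) (auto intro!: mult_nonneg_nonneg Bernstein_nonneg)
  also have "\<dots> \<le> real N * s" unfolding var using s by (simp add: mult_left_le)
  finally show ?thesis using a by (simp add: field_simps)
qed

text \<open>Indices closer to the mean N s than M lie below M, and there the decreasing F is at
  least F M. The remaining indices carry only the Chebyshev mass, and F M \<le> 1 bounds what they
  could have contributed.\<close>

lemma Bernstein_avg_ge:
  assumes s: "0 \<le> s" "s \<le> 1" and M: "real N * s < real M"
    and F: "\<And>m. F m \<ge> 0" "\<And>m. F m \<le> 1" "\<And>m m'. m \<le> m' \<Longrightarrow> F m' \<le> F m"
  shows "F M - real N * s / (real M - real N * s)\<^sup>2 \<le> (\<Sum>m\<le>N. Bernstein N m s * F m)"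
proof -
  define A where "A = {m. m \<le> N \<and> real M - real N * s \<le> \<bar>real m - real N * s\<bar>}"
  have fin: "finite A" "A \<subseteq> {..N}" by (auto simp: A_def)
  have tail: "(\<Sum>m\<in>A. Bernstein N m s) \<le> real N * s / (real M - real N * s)\<^sup>2"
    unfolding A_def using M by (intro Bernstein_tail s) auto
  have "F M - real N * s / (real M - real N * s)\<^sup>2 \<le> F M * (\<Sum>m\<le>N. Bernstein N m s) - (\<Sum>m\<in>A. Bernstein N m s)"
    using tail by simp
  also have "\<dots> \<le> F M * (\<Sum>m\<le>N. Bernstein N m s) - F M * (\<Sum>m\<in>A. Bernstein N m s)"
    using F s by (intro diff_left_mono mult_left_le_one_le) (auto intro!: sum_nonneg Bernstein_nonneg)
  also have "\<dots> = F M * (\<Sum>m\<in>{..N} - A. Bernstein N m s)"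
    using fin by (simp add: sum_diff right_diff_distrib)
  also have "\<dots> = (\<Sum>m\<in>{..N} - A. Bernstein N m s * F M)" by (simp add: sum_distrib_left mult.commute)
  also have "\<dots> \<le> (\<Sum>m\<in>{..N} - A. Bernstein N m s * F m)"
  proof (intro sum_mono mult_left_mono F)
    fix m assume "m \<in> {..N} - A"
    then have "real m < real M" by (auto simp: A_def)
    then show "m \<le> M" by simp
  qed (use s in \<open>auto intro: Bernstein_nonneg\<close>)
  also have "\<dots> \<le> (\<Sum>m\<le>N. Bernstein N m s * F m)"
    using s F by (intro sum_mono2) (auto intro!: mult_nonneg_nonneg Bernstein_nonneg)
  finally show ?thesis .
qed

lemma Bernstein_avg_le:
  assumes s: "0 \<le> s" "s \<le> 1" and M: "real M < real N * s"
    and F: "\<And>m. F m \<ge> 0" "\<And>m. F m \<le> 1" "\<And>m m'. m \<le> m' \<Longrightarrow> F m' \<le> F m"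
  shows "(\<Sum>m\<le>N. Bernstein N m s * F m) \<le> F M + real N * s / (real N * s - real M)\<^sup>2"
proof -
  define A where "A = {m. m \<le> N \<and> real N * s - real M \<le> \<bar>real m - real N * s\<bar>}"
  have fin: "finite A" "A \<subseteq> {..N}" by (auto simp: A_def)
  have tail: "(\<Sum>m\<in>A. Bernstein N m s) \<le> real N * s / (real N * s - real M)\<^sup>2"
    unfolding A_def using M by (intro Bernstein_tail s) auto
  have "(\<Sum>m\<le>N. Bernstein N m s * F m) = (\<Sum>m\<in>A. Bernstein N m s * F m) + (\<Sum>m\<in>{..N} - A. Bernstein N m s * F m)"
    using fin by (simp add: sum.subset_diff)
  also have "\<dots> \<le> (\<Sum>m\<in>A. Bernstein N m s * 1) + (\<Sum>m\<in>{..N} - A. Bernstein N m s * F M)"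
  proof (intro add_mono sum_mono mult_left_mono F)
    fix m assume "m \<in> {..N} - A"
    then have "real M < real m" using M by (auto simp: A_def abs_if split: if_splits)
    then show "M \<le> m" by simp
  qed (use s in \<open>auto intro: Bernstein_nonneg\<close>)
  also have "(\<Sum>m\<in>{..N} - A. Bernstein N m s * F M) \<le> (\<Sum>m\<le>N. Bernstein N m s * F M)"
    using s F by (intro sum_mono2) (auto intro!: mult_nonneg_nonneg Bernstein_nonneg)
  also have "(\<Sum>m\<le>N. Bernstein N m s * F M) = F M" by (simp add: sum_distrib_right[symmetric])
  finally show ?thesis using tail by simp
qed

lemma Bernstein_avg_Fr:
  assumes "1 \<le> k" "k < n" "2 * k \<le> n" "s \<le> 1"
  shows "(\<Sum>m\<le>n choose 2. Bernstein (n choose 2) m s * Fr n k m) = Hn n k s / Hn n k 0"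
  using poissonized_first_count(2)[OF assms] by (simp add: Bernstein_def)

lemma choose_two_asymp: "(\<lambda>n. real (n choose 2) / (real n powr (3/2) * sqrt (real n))) \<longlonglongrightarrow> 1 / 2"
proof -
  have "(\<lambda>n. (real n * (real n - 1) / 2) / (real n powr (3/2) * sqrt (real n))) \<longlonglongrightarrow> 1 / 2" by real_asymp
  moreover have "\<forall>\<^sub>F n in sequentially. (real n * (real n - 1) / 2) / (real n powr (3/2) * sqrt (real n)) = real (n choose 2) / (real n powr (3/2) * sqrt (real n))"
    using eventually_ge_at_top[of 2]
  proof eventually_elim
    case (elim n)
    have "even (n * (n - 1))" by (cases "even n") auto
    then have "real (n choose 2) = real n * (real n - 1) / 2"
      using elim by (simp add: choose_two real_of_nat_div of_nat_diff)
    then show ?case by (simp only:)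
  qed
  ultimately show ?thesis by (rule Lim_transform_eventually)
qed

lemma HH_continuous: "isCont (HH k) x"
proof -
  have "((\<lambda>x. fdet k (\<lambda>i j. gm (i + j) x)) \<longlongrightarrow> fdet k (\<lambda>i j. gm (i + j) x)) (at x)"
  proof (intro fdet_tendsto)
    show "gm (i + j) \<midarrow>x\<rightarrow> gm (i + j) x" for i j
      using DERIV_isCont[OF gm_has_derivative] by (simp add: isCont_def)
  qed
  then show ?thesis by (simp add: isCont_def HH_def[abs_def])
qed

text \<open>With s = y / sqrt n the binomial mean is asymptotic to (y/2) n^(3/2), while its
  deviations have the smaller order n^(3/4). Monotonicity compares the value at M n with averages
  for y slightly below and slightly above \<open>2 * \<xi>\<close>, and the limit function is
  continuous.\<close>

theorem Fr_tendsto: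
  assumes k: "1 \<le> k" and H0: "HH k 0 \<noteq> 0"
    and M: "(\<lambda>n. real (M n) / real n powr (3/2)) \<longlonglongrightarrow> \<xi>" and \<xi>: "\<xi> \<ge> 0"
  shows "(\<lambda>n. Fr n k (M n)) \<longlonglongrightarrow> HH k (2 * \<xi>) / HH k 0"
proof -
  define G where "G = (\<lambda>x. HH k x / HH k 0)"
  define N where "N = (\<lambda>n. n choose 2)"
  have contG: "isCont G x" for x unfolding G_def using H0 by (intro continuous_intros HH_continuous)
  have pois: "(\<lambda>n. \<Sum>m\<le>N n. Bernstein (N n) m (y / sqrt (real n)) * Fr n k m) \<longlonglongrightarrow> G y" if "y \<ge> 0" for y
  proof (rule Lim_transform_eventually)
    show "(\<lambda>n. Hn n k (y / sqrt (real n)) / Hn n k 0) \<longlonglongrightarrow> G y"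
      unfolding G_def by (rule Hn_ratio_tendsto[OF that H0])
    have "\<forall>\<^sub>F n in sequentially. y / sqrt (real n) < 1"
      by (rule order_tendstoD(2)[of _ 0]) (real_asymp, simp)
    with eventually_ge_at_top[of "2 * k + 1"]
    show "\<forall>\<^sub>F n in sequentially. Hn n k (y / sqrt (real n)) / Hn n k 0 = (\<Sum>m\<le>N n. Bernstein (N n) m (y / sqrt (real n)) * Fr n k m)"
      unfolding N_def by eventually_elim (use k in \<open>simp add: Bernstein_avg_Fr\<close>)
  qed
  have mean: "(\<lambda>n. real (N n) * (y / sqrt (real n)) / real n powr (3/2)) \<longlonglongrightarrow> y / 2" for y
    using tendsto_mult_left[OF choose_two_asymp, of y] by (simp add: N_def field_simps)
  \<comment> \<open>Variance over squared distance to the mean: order n^(3/2) over order n^3, as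
    long as y differs from \<open>2 * \<xi>\<close>.\<close>
  have err: "(\<lambda>n. real (N n) * (y / sqrt (real n)) / (real (M n) - real (N n) * (y / sqrt (real n)))\<^sup>2) \<longlonglongrightarrow> 0" if "y \<noteq> 2 * \<xi>" for y
  proof -
    let ?m = "\<lambda>n. real (N n) * (y / sqrt (real n))" and ?p = "\<lambda>n. real n powr (3/2)"
    have "(\<lambda>n. (?m n / ?p n) / (real (M n) / ?p n - ?m n / ?p n)\<^sup>2 * (1 / ?p n)) \<longlonglongrightarrow> (y / 2) / (\<xi> - y / 2)\<^sup>2 * 0"
    proof (rule tendsto_mult[OF tendsto_divide[OF mean tendsto_power[OF tendsto_diff[OF M mean]]]])
      show "(\<lambda>n. 1 / real n powr (3/2)) \<longlonglongrightarrow> 0" by real_asymp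
    qed (use that in auto)
    moreover have "\<forall>\<^sub>F n in sequentially. (?m n / ?p n) / (real (M n) / ?p n - ?m n / ?p n)\<^sup>2 * (1 / ?p n) = ?m n / (real (M n) - ?m n)\<^sup>2"
      using eventually_gt_at_top[of 0]
    proof eventually_elim
      case (elim n)
      have p: "?p n > 0" using elim by simp
      have "(real (M n) / ?p n - ?m n / ?p n)\<^sup>2 = (real (M n) - ?m n)\<^sup>2 / (?p n)\<^sup>2"
        unfolding diff_divide_distrib[symmetric] by (rule power_divide)
      moreover have "P > 0 \<Longrightarrow> (a / P) / (d / P\<^sup>2) * (1 / P) = a / d" for a d P :: real
        by (simp add: power2_eq_square)
      ultimately show ?case using p by (simp only:)
    qed
    ultimately show ?thesis using Lim_transform_eventually by fastforce
  qed
  have s01: "\<forall>\<^sub>F n in sequentially. 0 \<le> y / sqrt (real n) \<and> y / sqrt (real n) \<le> 1" if "y \<ge> 0" for y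
  proof -
    have "\<forall>\<^sub>F n in sequentially. y / sqrt (real n) < 1"
      by (rule order_tendstoD(2)[of _ 0]) (real_asymp, simp)
    then show ?thesis by eventually_elim (use that in auto)
  qed
  have cmp: "0 < a / p - b / p \<Longrightarrow> p > 0 \<Longrightarrow> b < a" for a b p :: real
    by (simp add: diff_divide_distrib[symmetric] zero_less_divide_iff)
  have up: "\<forall>\<^sub>F n in sequentially. Fr n k (M n) < c" if c: "G (2 * \<xi>) < c" for c
  proof (cases "\<xi> = 0")
    \<comment> \<open>No positive y below \<open>2 * \<xi>\<close> exists here; the claim follows
      instead from \<open>Fr_le_1\<close> and from G having value 1 at 0.\<close>
    case True
    then have "1 < c" using c H0 by (simp add: G_def)
    then show ?thesis using Fr_le_1[of _ k] by (intro always_eventually allI) (metis le_less_trans)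
  next
    case False
    have "\<forall>\<^sub>F y in at_left (2 * \<xi>). G y < c"
      using contG c by (intro order_tendstoD(2)[of G "G (2 * \<xi>)"]) (auto simp: isCont_def intro: filterlim_mono at_le)
    moreover have "\<forall>\<^sub>F y in at_left (2 * \<xi>). 0 < y \<and> y < 2 * \<xi>"
      using False \<xi> eventually_at_left_real[of 0 "2 * \<xi>"] by simp
    ultimately have "\<forall>\<^sub>F y in at_left (2 * \<xi>). G y < c \<and> 0 < y \<and> y < 2 * \<xi>" by eventually_elim auto
    then obtain y where y: "G y < c" "0 < y" "y < 2 * \<xi>"
      using eventually_happens'[OF trivial_limit_at_left_real] by blast
    let ?m = "\<lambda>n. real (N n) * (y / sqrt (real n))"
    have "(\<lambda>n. (\<Sum>m\<le>N n. Bernstein (N n) m (y / sqrt (real n)) * Fr n k m) + ?m n / (real (M n) - ?m n)\<^sup>2) \<longlonglongrightarrow> G y + 0"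
      using y by (intro tendsto_add pois err) auto
    then have 1: "\<forall>\<^sub>F n in sequentially. (\<Sum>m\<le>N n. Bernstein (N n) m (y / sqrt (real n)) * Fr n k m) + ?m n / (real (M n) - ?m n)\<^sup>2 < c"
      by (rule order_tendstoD(2)) (use y in auto)
    have "(\<lambda>n. real (M n) / real n powr (3/2) - ?m n / real n powr (3/2)) \<longlonglongrightarrow> \<xi> - y / 2"
      by (intro tendsto_diff M mean)
    then have 2: "\<forall>\<^sub>F n in sequentially. 0 < real (M n) / real n powr (3/2) - ?m n / real n powr (3/2)"
      by (rule order_tendstoD(1)) (use y in auto)
    from 1 2 s01[OF less_imp_le[OF y(2)]] eventually_gt_at_top[of 0] show ?thesis
    proof eventually_elim
      case (elim n)
      have "?m n < real (M n)" by (rule cmp[OF elim(2)]) (use elim in simp)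
      then have "Fr n k (M n) - ?m n / (real (M n) - ?m n)\<^sup>2 \<le> (\<Sum>m\<le>N n. Bernstein (N n) m (y / sqrt (real n)) * Fr n k m)"
        using elim y by (intro Bernstein_avg_ge Fr_nonneg Fr_le_1 Fr_antimono) auto
      then show ?case using elim by linarith
    qed
  qed
  have low: "\<forall>\<^sub>F n in sequentially. c < Fr n k (M n)" if c: "c < G (2 * \<xi>)" for c
  proof -
    have "\<forall>\<^sub>F y in at_right (2 * \<xi>). c < G y"
      using contG c by (intro order_tendstoD(1)[of G "G (2 * \<xi>)"]) (auto simp: isCont_def intro: filterlim_mono at_le)
    moreover have "\<forall>\<^sub>F y in at_right (2 * \<xi>). 2 * \<xi> < y" by (rule eventually_at_right_less)
    ultimately have "\<forall>\<^sub>F y in at_right (2 * \<xi>). c < G y \<and> 2 * \<xi> < y" by eventually_elim auto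
    then obtain y where y: "c < G y" "2 * \<xi> < y"
      using eventually_happens'[OF trivial_limit_at_right_real] by blast
    let ?m = "\<lambda>n. real (N n) * (y / sqrt (real n))"
    have "(\<lambda>n. (\<Sum>m\<le>N n. Bernstein (N n) m (y / sqrt (real n)) * Fr n k m) - ?m n / (real (M n) - ?m n)\<^sup>2) \<longlonglongrightarrow> G y - 0"
      using y \<xi> by (intro tendsto_diff pois err) auto
    then have 1: "\<forall>\<^sub>F n in sequentially. c < (\<Sum>m\<le>N n. Bernstein (N n) m (y / sqrt (real n)) * Fr n k m) - ?m n / (real (M n) - ?m n)\<^sup>2"
      by (rule order_tendstoD(1)) (use y in auto)
    have "(\<lambda>n. ?m n / real n powr (3/2) - real (M n) / real n powr (3/2)) \<longlonglongrightarrow> y / 2 - \<xi>"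
      by (intro tendsto_diff M mean)
    then have 2: "\<forall>\<^sub>F n in sequentially. 0 < ?m n / real n powr (3/2) - real (M n) / real n powr (3/2)"
      by (rule order_tendstoD(1)) (use y in auto)
    have y0: "y \<ge> 0" using y \<xi> by linarith
    from 1 2 s01[OF y0] eventually_gt_at_top[of 0] show ?thesis
    proof eventually_elim
      case (elim n)
      have "real (M n) < ?m n" by (rule cmp[OF elim(2)]) (use elim in simp)
      then have "(\<Sum>m\<le>N n. Bernstein (N n) m (y / sqrt (real n)) * Fr n k m) \<le> Fr n k (M n) + ?m n / (?m n - real (M n))\<^sup>2"
        using elim by (intro Bernstein_avg_le Fr_nonneg Fr_le_1 Fr_antimono) auto
      then show ?case using elim by (simp add: power2_commute)
    qed
  qed
  show ?thesis using order_tendstoI[OF low up] by (simp add: G_def)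
qed

text \<open>Differentiate the averaged identity at s = 0. Only the Bernstein polynomials of index 0
  and 1 have a nonzero derivative there, which isolates the probability that the first letter is k,
  the later normalisation of the gap law.\<close>

theorem Fr_first_step:
  assumes k: "1 \<le> k" and H0: "HH k 0 \<noteq> 0"
  shows "(\<lambda>n. real n powr (3/2) * (1 - Fr n k 1)) \<longlonglongrightarrow> 2 * (fdet k (e0row (\<lambda>i j. gm (i + j) 0)) / HH k 0)"
proof -
  let ?E = "\<lambda>n. fdet k (e0row (\<lambda>i j. smom n (n - 2 * k) (i + j) 0))" and ?H = "\<lambda>n. fdet k (\<lambda>i j. smom n (n - 2 * k) (i + j) 0)"
  have limE: "?E \<longlonglongrightarrow> fdet k (e0row (\<lambda>i j. gm (i + j) 0))"
    unfolding e0row_def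
    by (intro fdet_tendsto) (auto simp: smom_tendsto)
  have limH: "?H \<longlonglongrightarrow> HH k 0" unfolding HH_def by (intro fdet_tendsto smom_tendsto) auto
  have eq: "real (n choose 2) * (1 - Fr n k 1) = sqrt (real n) * (?E n / ?H n)" if n: "n \<ge> 2 * k + 1" for n
  proof -
    let ?N = "n choose 2"
    have kn: "k < n" "2 * k \<le> n" "n > 0" using n k by auto
    have N: "?N \<ge> 1" using n k by (simp add: Suc_le_eq zero_less_binomial)
    have h0: "Hn n k 0 \<noteq> 0" using poissonized_first_count(1)[OF k kn(1,2)] .
    have "((\<lambda>s. \<Sum>m\<le>?N. Bernstein ?N m s * Fr n k m) has_real_derivative
        (\<Sum>m\<le>?N. (if m = 0 then - real ?N else if m = 1 then real ?N else 0) * Fr n k m)) (at 0)"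
    proof (intro DERIV_sum DERIV_cmult_right)
      fix m
      have pows: "((\<lambda>s::real. s ^ m) has_real_derivative real m * 0 ^ (m - Suc 0)) (at 0)" using DERIV_pow[of m 0] by simp
      have pows2: "((\<lambda>s::real. (1 - s) ^ (?N - m)) has_real_derivative - real (?N - m)) (at 0)"
        by (auto intro!: derivative_eq_intros)
      have "((\<lambda>s. real (?N choose m) * (s ^ m * (1 - s) ^ (?N - m))) has_real_derivative
         real (?N choose m) * (0 ^ m * (- real (?N - m)) + real m * 0 ^ (m - Suc 0) * (1 - 0) ^ (?N - m))) (at 0)"
        by (intro DERIV_cmult DERIV_mult' pows pows2)
      also have "real (?N choose m) * (0 ^ m * (- real (?N - m)) + real m * 0 ^ (m - Suc 0) * (1 - 0) ^ (?N - m))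
         = (if m = 0 then - real ?N else if m = 1 then real ?N else 0)"
        by (auto simp: power_0_left)
      finally show "((\<lambda>s. Bernstein ?N m s) has_real_derivative (if m = 0 then - real ?N else if m = 1 then real ?N else 0)) (at 0)"
        by (simp add: Bernstein_def mult.assoc)
    qed
    also have "(\<Sum>m\<le>?N. (if m = 0 then - real ?N else if m = 1 then real ?N else 0) * Fr n k m)
       = (\<Sum>m\<in>{0, 1}. (if m = 0 then - real ?N else if m = 1 then real ?N else 0) * Fr n k m)"
      using N by (intro sum.mono_neutral_right) auto
    also have "\<dots> = - (real ?N * (1 - Fr n k 1))" by (simp add: algebra_simps)
    finally have d1: "((\<lambda>s. \<Sum>m\<le>?N. Bernstein ?N m s * Fr n k m) has_real_derivative - (real ?N * (1 - Fr n k 1))) (at 0)" .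
    have "((\<lambda>s. Hn n k s / Hn n k 0) has_real_derivative - fdet k (e0row (\<lambda>i j. wmom (n - 2 * k) (i + j) 0)) / Hn n k 0) (at 0)"
      using Hn_has_derivative_0[OF k] by (intro DERIV_cdivide)
    \<comment> \<open>A full neighbourhood of 0 is available, since the identity also covers
      negative s.\<close>
    moreover have "\<forall>\<^sub>F s in nhds 0. (\<Sum>m\<le>?N. Bernstein ?N m s * Fr n k m) = Hn n k s / Hn n k 0"
    proof -
      have "\<forall>\<^sub>F s in nhds (0::real). s < 1" by (rule order_tendstoD(2)[OF filterlim_ident]) simp
      then show ?thesis by eventually_elim (use Bernstein_avg_Fr[OF k kn(1,2)] in auto)
    qed
    ultimately have d2: "((\<lambda>s. \<Sum>m\<le>?N. Bernstein ?N m s * Fr n k m) has_real_derivative - fdet k (e0row (\<lambda>i j. wmom (n - 2 * k) (i + j) 0)) / Hn n k 0) (at 0)"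
      by (subst DERIV_cong_ev[OF refl _ refl])
    have "real ?N * (1 - Fr n k 1) = fdet k (e0row (\<lambda>i j. wmom (n - 2 * k) (i + j) 0)) / Hn n k 0"
      using DERIV_unique[OF d1 d2] by simp
    also have "\<dots> = sqrt (real n) * (?E n / ?H n)"
    proof -
      let ?c = "(\<Prod>i<k. (1 / sqrt (real n)) ^ (2 * i + 1)) * (\<Prod>i<k. (1 / sqrt (real n)) ^ (2 * i))"
      have c: "?c \<noteq> 0" using kn by auto
      have "Hn n k 0 = ?c * ?H n" using Hn_scaled[OF kn(3), of k 0] by simp
      then have "fdet k (e0row (\<lambda>i j. wmom (n - 2 * k) (i + j) 0)) / Hn n k 0 = sqrt (real n) * (?c * ?E n) / (?c * ?H n)"
        using e0_scaled[OF kn(3) k] by simp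
      also have "\<dots> = sqrt (real n) * (?E n / ?H n)"
      proof -
        have "y \<noteq> 0 \<Longrightarrow> u * (y * e) / (y * h) = u * (e / h)" for y u e h :: real by simp
        from this[OF c] show ?thesis .
      qed
      finally show ?thesis .
    qed
    finally show ?thesis .
  qed
  have "(\<lambda>n. (?E n / ?H n) / (real (n choose 2) / (real n powr (3/2) * sqrt (real n)))) \<longlonglongrightarrow> (fdet k (e0row (\<lambda>i j. gm (i + j) 0)) / HH k 0) / (1 / 2)"
    by (intro tendsto_divide limE limH choose_two_asymp) (use H0 in auto)
  note trans = Lim_transform_eventually[OF this]
  have ev: "\<forall>\<^sub>F n in sequentially. (?E n / ?H n) / (real (n choose 2) / (real n powr (3/2) * sqrt (real n))) = real n powr (3/2) * (1 - Fr n k 1)"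
    using eventually_ge_at_top[of "2 * k + 1"]
  proof eventually_elim
    case (elim n)
    have N: "real (n choose 2) > 0" using elim k by simp
    have n: "real n > 0" using elim by simp
    have "?E n / ?H n = real (n choose 2) * (1 - Fr n k 1) / sqrt (real n)" using eq[OF elim] n by simp
    moreover have "u > 0 \<Longrightarrow> p > 0 \<Longrightarrow> q > 0 \<Longrightarrow> (u * y / q) / (u / (p * q)) = p * y" for u p q y :: real
      by (simp add: field_simps)
    ultimately show ?case using N n by simp
  qed
  show ?thesis using trans[OF ev] by (simp add: mult.commute)
qed

section \<open>The normalising constant\<close>

text \<open>Chu-Vandermonde, in the shape of an LU decomposition of the Hankel matrix of Gaussian moments.\<close>
lemma pochhammer_add_expand:
  fixes \<alpha> :: real
  assumes "\<alpha> > 0"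
  shows "pochhammer \<alpha> (i + l) = pochhammer \<alpha> i * pochhammer \<alpha> l *
    (\<Sum>m\<le>l. real (i choose m) * real (l choose m) * fact m / pochhammer \<alpha> m)"
  using assms
proof (induction i arbitrary: \<alpha> l)
  case 0
  have "(\<Sum>m\<le>l. real (0 choose m) * real (l choose m) * fact m / pochhammer \<alpha> m)
      = (\<Sum>m\<in>{0}. real (0 choose m) * real (l choose m) * fact m / pochhammer \<alpha> m)"
    by (intro sum.mono_neutral_right) auto
  then show ?case by simp
next
  case (Suc i)
  have pos: "pochhammer \<beta> m > 0" if "\<beta> > 0" for \<beta> :: real and m using that by (rule pochhammer_pos)
  let ?S = "\<lambda>\<alpha> i l. \<Sum>m\<le>l. real (i choose m) * real (l choose m) * fact m / pochhammer \<alpha> m"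
  show ?case
  proof (cases l)
    case (Suc l')
    have "?S \<alpha> (Suc i) l = (\<Sum>m\<le>l. real (i choose m) * real (l choose m) * fact m / pochhammer \<alpha> m
        + (if m = 0 then 0 else real (i choose (m - 1)) * real (l choose m) * fact m / pochhammer \<alpha> m))"
    proof (intro sum.cong refl)
      fix m
      show "real (Suc i choose m) * real (l choose m) * fact m / pochhammer \<alpha> m = real (i choose m) * real (l choose m) * fact m / pochhammer \<alpha> m
        + (if m = 0 then 0 else real (i choose (m - 1)) * real (l choose m) * fact m / pochhammer \<alpha> m)"
        by (cases m) (auto simp: add_divide_distrib distrib_right)
    qed
    also have "\<dots> = ?S \<alpha> i l + (\<Sum>m\<le>l. if m = 0 then 0 else real (i choose (m - 1)) * real (l choose m) * fact m / pochhammer \<alpha> m)"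
      by (rule sum.distrib)
    also have "(\<Sum>m\<le>l. if m = 0 then 0 else real (i choose (m - 1)) * real (l choose m) * fact m / pochhammer \<alpha> m)
        = (\<Sum>m\<le>l'. real (i choose m) * real (l choose Suc m) * fact (Suc m) / pochhammer \<alpha> (Suc m))"
      unfolding Suc by (simp add: sum.atMost_Suc_shift del: sum.atMost_Suc fact_Suc binomial_Suc_Suc)
    also have "\<dots> = (\<Sum>m\<le>l'. real l / \<alpha> * (real (i choose m) * real (l' choose m) * fact m / pochhammer (\<alpha> + 1) m))"
    proof (intro sum.cong refl)
      fix m
      have "real (Suc m) * real (l choose Suc m) = real l * real (l' choose m)"
        unfolding Suc using Suc_times_binomial_eq[of l' m] by (metis of_nat_mult mult.commute)
      then have "real (l choose Suc m) * fact (Suc m) = real l * real (l' choose m) * fact m"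
        by (simp only: fact_Suc of_nat_mult) (simp add: mult_ac)
      then show "real (i choose m) * real (l choose Suc m) * fact (Suc m) / pochhammer \<alpha> (Suc m)
         = real l / \<alpha> * (real (i choose m) * real (l' choose m) * fact m / pochhammer (\<alpha> + 1) m)"
        unfolding pochhammer_rec by (simp add: mult.assoc)
    qed
    also have "\<dots> = real l / \<alpha> * ?S (\<alpha> + 1) i l'" by (simp add: sum_distrib_left)
    finally have S: "?S \<alpha> (Suc i) l = ?S \<alpha> i l + real l / \<alpha> * ?S (\<alpha> + 1) i l'" .
    define P where "P = pochhammer \<alpha> (i + l)"
    have 1: "pochhammer \<alpha> i * pochhammer \<alpha> l * ?S \<alpha> i l = P"
      unfolding P_def using Suc.IH[OF Suc.prems, of l] by simp
    have 2: "pochhammer (\<alpha> + 1) i * pochhammer (\<alpha> + 1) l' * ?S (\<alpha> + 1) i l' = pochhammer (\<alpha> + 1) (i + l')"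
      using Suc.IH[of "\<alpha> + 1" l'] Suc.prems by simp
    have "pochhammer \<alpha> (Suc i) * pochhammer \<alpha> l * ?S \<alpha> (Suc i) l
       = (\<alpha> + real i) * (pochhammer \<alpha> i * pochhammer \<alpha> l * ?S \<alpha> i l) + pochhammer \<alpha> (Suc i) * pochhammer \<alpha> l * (real l / \<alpha> * ?S (\<alpha> + 1) i l')"
      unfolding S pochhammer_Suc by (simp add: algebra_simps)
    also have "pochhammer \<alpha> (Suc i) * pochhammer \<alpha> l * (real l / \<alpha> * ?S (\<alpha> + 1) i l')
       = \<alpha> * real l * (pochhammer (\<alpha> + 1) i * pochhammer (\<alpha> + 1) l' * ?S (\<alpha> + 1) i l')"
      unfolding Suc pochhammer_rec using Suc.prems by (simp add: field_simps)
    also have "\<dots> = real l * P"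
      unfolding 2 P_def Suc using pochhammer_rec[of \<alpha> "i + l'"] by simp
    also have "(\<alpha> + real i) * (pochhammer \<alpha> i * pochhammer \<alpha> l * ?S \<alpha> i l) + real l * P = (\<alpha> + real (i + l)) * P"
      unfolding 1 by (simp add: algebra_simps)
    also have "\<dots> = pochhammer \<alpha> (Suc i + l)" by (simp add: P_def pochhammer_Suc mult.commute)
    finally show ?thesis by simp
  qed simp
qed

lemma pochhammer_hankel_det:
  fixes \<alpha> :: real
  assumes "\<alpha> > 0"
  shows "fdet k (\<lambda>i j. pochhammer \<alpha> (i + j)) = (\<Prod>i<k. fact i * pochhammer \<alpha> i)"
proof -
  define L where "L = (\<lambda>i m. pochhammer \<alpha> i * real (i choose m))"
  define U where "U = (\<lambda>m l. real (l choose m) * fact m / pochhammer \<alpha> m * pochhammer \<alpha> l)"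
  have pos: "pochhammer \<alpha> m > 0" for m using assms by (rule pochhammer_pos)
  have "fdet k (\<lambda>i j. pochhammer \<alpha> (i + j)) = fdet k (\<lambda>i j. \<Sum>m<k. L i m * U m j)"
  proof (intro fdet_cong, goal_cases)
    case (1 i j)
    have "(\<Sum>m<k. L i m * U m j) = (\<Sum>m\<le>j. L i m * U m j)"
      using 1 by (intro sum.mono_neutral_right) (auto simp: U_def)
    then show ?case unfolding pochhammer_add_expand[OF assms]
      by (simp add: L_def U_def sum_distrib_left mult_ac)
  qed
  also have "\<dots> = fdet k L * fdet k U" by (rule fdet_mult)
  also have "fdet k L = (\<Prod>i<k. pochhammer \<alpha> i)"
    by (subst fdet_lower_triangular) (auto simp: L_def)
  also have "fdet k U = (\<Prod>i<k. fact i)"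
    using pos by (subst fdet_upper_triangular) (auto simp: U_def less_imp_neq[symmetric])
  finally show ?thesis by (simp add: prod.distrib mult.commute)
qed

lemma pochhammer_half: "fact (2 * j) / (2 ^ (2 * j) * fact j) = pochhammer (1 / 2 :: real) j"
proof (induction j)
  case (Suc j)
  have "pochhammer (1 / 2 :: real) (Suc j) = (fact (2 * j) / (2 ^ (2 * j) * fact j)) * (1 / 2 + real j)"
    unfolding pochhammer_Suc Suc.IH ..
  also have "\<dots> = fact (2 * Suc j) / (2 ^ (2 * Suc j) * fact (Suc j))"
    by (simp add: divide_simps) (simp add: algebra_simps)
  finally show ?case by simp
qed simp

lemma gm_0: "gm j 0 = sqrt pi / 2 * pochhammer (1 / 2) j"
proof -
  have "gm j 0 = (LINT v|lborel. indicator {0..} v *\<^sub>R (exp (- v\<^sup>2) * v ^ (2 * j)))"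
    unfolding gm_def by (simp add: mult_ac)
  also have "\<dots> = sqrt pi / 2 * (fact (2 * j) / (2 ^ (2 * j) * fact j))"
    by (rule has_bochner_integral_integral_eq[OF gaussian_moment_even_pos])
  finally show ?thesis unfolding pochhammer_half .
qed

lemma fdet_cmult: "fdet n (\<lambda>i j. c * a i j) = c ^ n * fdet n a"
  using fdet_scale[of n "\<lambda>i. c" a "\<lambda>j. 1"] by simp

lemma HH_0: "HH k 0 = (sqrt pi / 2) ^ k * (\<Prod>i<k. fact i * pochhammer (1 / 2) i)"
  unfolding HH_def gm_0 fdet_cmult by (subst pochhammer_hankel_det) auto

lemma HH_0_pos: "HH k 0 > 0"
  unfolding HH_0 by (intro mult_pos_pos zero_less_power prod_pos) (auto intro!: pochhammer_pos)

lemma fdet_e0row: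
  assumes "k \<ge> 1"
  shows "fdet k (e0row a) = fdet (k - 1) (\<lambda>i j. a (Suc i) (Suc j))"
proof -
  let ?b = "\<lambda>i j. e0row a j i"
  have "fdet k (e0row a) = fdet (1 + (k - 1)) ?b" using assms by (simp add: fdet_transpose[of _ "e0row a"])
  also have "\<dots> = fdet 1 ?b * fdet (k - 1) (\<lambda>i j. ?b (1 + i) (1 + j))"
    by (rule fdet_block_lower_left_zero) (auto simp: e0row_def)
  also have "fdet 1 ?b = 1" by (subst fdet_lower_triangular) (auto simp: e0row_def)
  also have "fdet (k - 1) (\<lambda>i j. ?b (1 + i) (1 + j)) = fdet (k - 1) (\<lambda>i j. a (Suc i) (Suc j))"
    using fdet_transpose[of "k - 1" "\<lambda>i j. a (Suc i) (Suc j)"] by (simp add: e0row_def)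
  finally show ?thesis by simp
qed

lemma dfact_odd: "real (dfact (2 * k + 1)) = 2 ^ (k + 1) * pochhammer (1 / 2) (k + 1)"
proof (induction k)
  case (Suc k)
  have "real (dfact (2 * Suc k + 1)) = (2 * real k + 3) * real (dfact (2 * k + 1))" by (simp add: algebra_simps)
  also have "\<dots> = 2 ^ (Suc k + 1) * pochhammer (1 / 2) (Suc k + 1)"
    unfolding Suc.IH using pochhammer_Suc[of "1 / 2 :: real" "Suc k"] by (simp add: algebra_simps)
  finally show ?case .
qed (simp add: pochhammer_Suc)

lemma dfact_even: "real (dfact (2 * k)) = 2 ^ k * fact k"
proof (induction k)
  case (Suc k)
  have "real (dfact (2 * Suc k)) = (2 * real k + 2) * real (dfact (2 * k))" by (simp add: algebra_simps)
  then show ?case unfolding Suc.IH by (simp add: algebra_simps)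
qed simp

definition ck :: "nat \<Rightarrow> real" where
  "ck k = sqrt pi / 2 * (real (dfact (2 * k - 2)) / real (dfact (2 * k - 1)))"

lemma ck_pos: "k \<ge> 1 \<Longrightarrow> ck k > 0"
proof -
  assume "k \<ge> 1"
  then obtain k' where "k = Suc k'" by (cases k) auto
  then show ?thesis
    using dfact_even[of k'] dfact_odd[of k'] pochhammer_pos[of "1/2 :: real" "k' + 1"]
    by (simp add: ck_def del: pochhammer_Suc)
qed

text \<open>Deleting the first row and column shifts the moments by 2, and (1/2)_(m+2) = (3/4)
  (5/2)_m. The minor is therefore a Hankel determinant of the same Pochhammer type, and most factors
  of the quotient cancel.\<close>

theorem e0_ratio:
  assumes k: "k \<ge> 1"
  shows "fdet k (e0row (\<lambda>i j. gm (i + j) 0)) / HH k 0 = 1 / ck k"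
proof -
  obtain k' where k': "k = Suc k'" using k by (cases k) auto
  let ?h = "pochhammer (1 / 2 :: real)" and ?c = "sqrt pi / 2"
  have pos: "?h m > 0" for m by (rule pochhammer_pos) simp
  have hh: "?h (m + 2) = 3 / 4 * pochhammer (5 / 2) m" for m
    using pochhammer_product'[of "1/2 :: real" 2 m] by (simp add: add.commute numeral_2_eq_2 pochhammer_Suc)
  have "fdet k (e0row (\<lambda>i j. gm (i + j) 0)) = fdet k' (\<lambda>i j. (?c * (3 / 4)) * pochhammer (5 / 2) (i + j))"
    unfolding fdet_e0row[OF k]
  proof (simp only: k' diff_Suc_1, intro fdet_cong)
    fix i j
    have "Suc i + Suc j = i + j + 2" by simp
    then show "gm (Suc i + Suc j) 0 = ?c * (3 / 4) * pochhammer (5 / 2) (i + j)"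
      unfolding gm_0 by (simp only: hh mult.assoc)
  qed
  also have "\<dots> = (?c * (3 / 4)) ^ k' * (\<Prod>i<k'. fact i * pochhammer (5 / 2) i)"
    unfolding fdet_cmult by (subst pochhammer_hankel_det) auto
  also have "\<dots> = ?c ^ k' * (\<Prod>i<k'. fact i * (3 / 4 * pochhammer (5 / 2) i))"
    by (simp only: power_mult_distrib prod.distrib prod_constant card_lessThan mult_ac)
  also have "\<dots> = ?c ^ k' * ((\<Prod>i<k'. fact i) * (\<Prod>i<k'. ?h (i + 2)))"
    by (simp only: hh prod.distrib)
  finally have num: "fdet k (e0row (\<lambda>i j. gm (i + j) 0)) = ?c ^ k' * ((\<Prod>i<k'. fact i) * (\<Prod>i<k'. ?h (i + 2)))" .
  \<comment> \<open>Shifting the index by 2 trades the first two factors for the two after the last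
    one. The product \<open>?h 0 * ?h 1\<close> is 1/2, the origin of the 2 in
    \<open>sh\<close>.\<close>
  have shift: "(\<Prod>i<k'. ?h (i + 2)) * (?h 0 * ?h 1) = (\<Prod>i<k'. ?h i) * (?h k' * ?h (k' + 1))"
    by (induction k') (auto simp: mult_ac)
  have den: "HH k 0 = ?c ^ k' * ?c * (((\<Prod>i<k'. fact i) * fact k') * ((\<Prod>i<k'. ?h i) * ?h k'))"
    unfolding HH_0 k' by (simp add: prod.distrib mult_ac)
  define A B C where "A = ?c ^ k'" and "B = (\<Prod>i<k'. fact i :: real)" and "C = (\<Prod>i<k'. ?h i)"
  have ABC: "A \<noteq> 0" "B \<noteq> 0" "C \<noteq> 0" using pos unfolding A_def B_def C_def by (auto simp: less_imp_neq[symmetric])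
  have sh: "(\<Prod>i<k'. ?h (i + 2)) = C * ?h k' * (2 * ?h (k' + 1))" using shift by (simp add: C_def)
  have "fdet k (e0row (\<lambda>i j. gm (i + j) 0)) / HH k 0 = (A * (B * (C * ?h k' * (2 * ?h (k' + 1))))) / (A * ?c * ((B * fact k') * (C * ?h k')))"
    unfolding num den sh A_def B_def C_def ..
  also have "\<dots> = 2 * ?h (k' + 1) / (?c * fact k')"
  proof -
    have "?h k' \<noteq> 0" using pos[of k'] by simp
    then show ?thesis using ABC by (simp add: field_simps)
  qed
  also have "\<dots> = 1 / ck k"
  proof -
    have "2 * k - 2 = 2 * k'" "2 * k - 1 = 2 * k' + 1" using k' by auto
    then have ck: "ck k = ?c * (2 ^ k' * fact k' / (2 ^ (k' + 1) * ?h (k' + 1)))"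
      unfolding ck_def by (simp only: dfact_even dfact_odd)
    show ?thesis unfolding ck by simp
  qed
  finally show ?thesis .
qed

section \<open>Gaussian integration by parts and loop equations\<close>

abbreviation gauss :: "'i set \<Rightarrow> ('i \<Rightarrow> real) measure" where
  "gauss I \<equiv> PiM I (\<lambda>_. std_normal_distribution)"

lemma prob_space_std_normal: "prob_space std_normal_distribution"
  by (rule prob_space_normal_density) simp

interpretation std_gauss: product_sigma_finite "\<lambda>_. std_normal_distribution"
  by (intro product_sigma_finite.intro prob_space_imp_sigma_finite prob_space_std_normal)

lemma prob_space_gauss: "prob_space (gauss I)"
  by (intro prob_space_PiM prob_space_std_normal)

lemma integrable_std_normal_iff:
  assumes [measurable]: "f \<in> borel_measurable borel"
  shows "integrable std_normal_distribution f \<longleftrightarrow> integrable lborel (\<lambda>x. std_normal_density x * f x)"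
  by (subst integrable_density) (auto simp: normal_density_nonneg)

lemma integral_std_normal:
  fixes f :: "real \<Rightarrow> real"
  assumes [measurable]: "f \<in> borel_measurable borel"
  shows "integral\<^sup>L std_normal_distribution f = (LINT x|lborel. std_normal_density x * f x)"
  by (subst integral_density) (auto simp: normal_density_nonneg)

lemma integrable_std_normal_power: "integrable std_normal_distribution (\<lambda>x. x ^ m)"
  by (subst integrable_std_normal_iff) (auto intro: integrable_std_normal_moment)

text \<open>Gaussian integration by parts for a monomial in one variable, read off the explicit even
  and odd moments. At m = 0 the factor \<open>real m\<close> neutralises the truncated
  exponent.\<close>

lemma std_normal_moment_rec:
  "integral\<^sup>L std_normal_distribution (\<lambda>x. x ^ Suc m) = real m * integral\<^sup>L std_normal_distribution (\<lambda>x. x ^ (m - 1))"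
proof -
  have even: "integral\<^sup>L std_normal_distribution (\<lambda>x. x ^ (2 * j)) = fact (2 * j) / (2 ^ j * fact j)" for j
    by (subst integral_std_normal) (auto simp: integral_std_normal_moment_even)
  have odd: "integral\<^sup>L std_normal_distribution (\<lambda>x. x ^ (2 * j + 1)) = 0" for j
    by (subst integral_std_normal) (auto simp only: integral_std_normal_moment_odd, measurable)
  show ?thesis
  proof (cases "even m")
    case True
    then obtain j where j: "m = 2 * j" by (elim evenE)
    show ?thesis
    proof (cases j)
      case (Suc j')
      have "m - 1 = 2 * j' + 1" "Suc m = 2 * j + 1" using j Suc by auto
      then show ?thesis by (simp only: odd)
    next
      case 0
      then show ?thesis using j odd[of 0] by simp
    qed
  next
    case False
    then obtain j where j: "m = 2 * j + 1" by (elim oddE)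
    have "Suc m = 2 * Suc j" "m - 1 = 2 * j" using j by auto
    moreover have "fact (2 * Suc j) / (2 ^ Suc j * fact (Suc j)) = real (2 * j + 1) * (fact (2 * j) / (2 ^ j * fact j))"
    proof -
      have "fact (2 * Suc j) = (2 * real j + 2) * ((2 * real j + 1) * fact (2 * j))" by (simp add: algebra_simps)
      moreover have "2 ^ Suc j * fact (Suc j) = (2 * real j + 2) * (2 ^ j * fact j)" by (simp add: algebra_simps)
      moreover have "2 * real j + 2 \<noteq> 0" by linarith
      ultimately show ?thesis by (simp only: mult_divide_mult_cancel_left) simp
    qed
    ultimately show ?thesis unfolding j by (simp only: even)
  qed
qed

text \<open>Polynomial functions as sums of monomials. With monomials as generators a Gaussian
  integral factors over the coordinates; closure under products is proved afterwards.\<close>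

inductive pf :: "'i set \<Rightarrow> (('i \<Rightarrow> real) \<Rightarrow> real) \<Rightarrow> bool" for I where
  mono: "pf I (\<lambda>Y. c * (\<Prod>i\<in>I. Y i ^ m i))"
| add: "pf I f \<Longrightarrow> pf I g \<Longrightarrow> pf I (\<lambda>Y. f Y + g Y)"

lemma pf_const: "pf I (\<lambda>Y. c)"
  using pf.mono[of I c "\<lambda>_. 0"] by simp

lemma pf_coord:
  assumes "finite I" "e \<in> I"
  shows "pf I (\<lambda>Y. Y e)"
proof -
  have "(\<Prod>i\<in>I. Y i ^ (if i = e then 1 else 0)) = Y e" for Y :: "'a \<Rightarrow> real"
  proof -
    have "(\<Prod>i\<in>I. Y i ^ (if i = e then 1 else 0)) = (\<Prod>i\<in>I. if i = e then Y i else 1)"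
      by (intro prod.cong) auto
    then show ?thesis using assms by simp
  qed
  then show ?thesis using pf.mono[of I 1 "\<lambda>i. if i = e then 1 else 0"] by simp
qed

lemma pf_mult: "pf I f \<Longrightarrow> pf I g \<Longrightarrow> pf I (\<lambda>Y. f Y * g Y)"
proof (induction rule: pf.induct)
  case (mono c m)
  from \<open>pf I g\<close> show ?case
  proof (induction rule: pf.induct)
    case (mono c' m')
    have "(\<lambda>Y. c * (\<Prod>i\<in>I. Y i ^ m i) * (c' * (\<Prod>i\<in>I. Y i ^ m' i))) = (\<lambda>Y. (c * c') * (\<Prod>i\<in>I. Y i ^ (m i + m' i)))"
      by (auto simp: power_add prod.distrib mult_ac)
    then show ?case using pf.mono[of I "c * c'" "\<lambda>i. m i + m' i"] by simp
  qed (auto simp: distrib_left intro: pf.add)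
qed (auto simp: distrib_right intro: pf.add)

lemma pf_cmult: "pf I f \<Longrightarrow> pf I (\<lambda>Y. c * f Y)"
  by (intro pf_mult pf_const)

lemma pf_diff: "pf I f \<Longrightarrow> pf I g \<Longrightarrow> pf I (\<lambda>Y. f Y - g Y)"
  using pf.add[of I f "\<lambda>Y. (- 1) * g Y"] pf_cmult[of I g "- 1"] by simp

lemma pf_sum: "(\<And>x. x \<in> A \<Longrightarrow> pf I (f x)) \<Longrightarrow> pf I (\<lambda>Y. \<Sum>x\<in>A. f x Y)"
  by (induction A rule: infinite_finite_induct) (auto intro: pf_const pf.add)

lemma pf_prod: "(\<And>x. x \<in> A \<Longrightarrow> pf I (f x)) \<Longrightarrow> pf I (\<lambda>Y. \<Prod>x\<in>A. f x Y)"
  by (induction A rule: infinite_finite_induct) (auto intro: pf_const pf_mult)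

lemma pf_power: "pf I f \<Longrightarrow> pf I (\<lambda>Y. f Y ^ n)"
  by (induction n) (auto intro: pf_const pf_mult)

lemma pf_prod_list: "(\<And>x. x \<in> set xs \<Longrightarrow> pf I (f x)) \<Longrightarrow> pf I (\<lambda>Y. prod_list (map (\<lambda>x. f x Y) xs))"
  by (induction xs) (auto intro: pf_const pf_mult)

lemma integrable_mono:
  assumes "finite I"
  shows "integrable (gauss I) (\<lambda>Y. c * (\<Prod>i\<in>I. Y i ^ m i))"
  by (intro integrable_mult_right std_gauss.product_integrable_prod assms integrable_std_normal_power)

lemma integral_mono_prod:
  assumes "finite I"
  shows "(LINT Y|gauss I. c * (\<Prod>i\<in>I. Y i ^ m i)) = c * (\<Prod>i\<in>I. LINT x|std_normal_distribution. x ^ m i)"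
  by (simp, subst std_gauss.product_integral_prod[OF assms integrable_std_normal_power]) simp

lemma pf_integrable: "pf I f \<Longrightarrow> finite I \<Longrightarrow> integrable (gauss I) f"
proof (induction rule: pf.induct)
  case (mono c m)
  then show ?case by (intro integrable_mono)
qed (auto intro: Bochner_Integration.integrable_add)

lemma pf_stein_aux:
  assumes "pf I f" "finite I" "e \<in> I"
  shows "\<exists>g. pf I g \<and> (\<forall>Y. ((\<lambda>t. f (Y(e := t))) has_real_derivative g Y) (at (Y e)))
    \<and> (LINT Y|gauss I. Y e * f Y) = (LINT Y|gauss I. g Y)"
  using assms
proof (induction rule: pf.induct)
  case (mono c m)
  note fin = \<open>finite I\<close> and e = \<open>e \<in> I\<close>
  define g where "g = (\<lambda>Y. (c * real (m e)) * (\<Prod>i\<in>I. Y i ^ (m(e := m e - 1)) i))"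
  have split: "(\<Prod>i\<in>I. f i) = f e * (\<Prod>i\<in>I - {e}. f i)" for f :: "'a \<Rightarrow> real"
    using fin e by (intro prod.remove)
  have "((\<lambda>t. c * (\<Prod>i\<in>I. (Y(e := t)) i ^ m i)) has_real_derivative g Y) (at (Y e))" for Y
  proof -
    define R where "R = (\<Prod>i\<in>I - {e}. Y i ^ m i)"
    have "(\<Prod>i\<in>I. (Y(e := t)) i ^ m i) = t ^ m e * R" for t
      unfolding split R_def by (intro arg_cong2[where f = "(*)"] prod.cong) auto
    moreover have "(\<Prod>i\<in>I. Y i ^ (m(e := m e - 1)) i) = Y e ^ (m e - 1) * R"
      unfolding split R_def by (intro arg_cong2[where f = "(*)"] prod.cong) auto
    moreover have "((\<lambda>t. c * (t ^ m e * R)) has_real_derivative c * (real (m e) * Y e ^ (m e - Suc 0) * R)) (at (Y e))"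
      by (intro DERIV_cmult DERIV_cmult_right DERIV_pow)
    ultimately show ?thesis by (simp add: g_def mult_ac)
  qed
  moreover have "(LINT Y|gauss I. Y e * (c * (\<Prod>i\<in>I. Y i ^ m i))) = (LINT Y|gauss I. g Y)"
  proof -
    let ?M = "\<lambda>j. LINT x|std_normal_distribution. x ^ j"
    have "Y e * (c * (\<Prod>i\<in>I. Y i ^ m i)) = c * (\<Prod>i\<in>I. Y i ^ (m(e := Suc (m e))) i)" for Y :: "'a \<Rightarrow> real"
    proof -
      have "(\<Prod>i\<in>I - {e}. Y i ^ (m(e := Suc (m e))) i) = (\<Prod>i\<in>I - {e}. Y i ^ m i)" by (intro prod.cong) auto
      then show ?thesis unfolding split by (simp add: mult_ac)
    qed
    then have "(LINT Y|gauss I. Y e * (c * (\<Prod>i\<in>I. Y i ^ m i))) = c * (\<Prod>i\<in>I. ?M ((m(e := Suc (m e))) i))"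
      using integral_mono_prod[OF fin, of c "m(e := Suc (m e))"] by (simp only:)
    also have "(\<Prod>i\<in>I. ?M ((m(e := Suc (m e))) i)) = real (m e) * (\<Prod>i\<in>I. ?M ((m(e := m e - 1)) i))"
    proof -
      have "(\<Prod>i\<in>I - {e}. ?M ((m(e := Suc (m e))) i)) = (\<Prod>i\<in>I - {e}. ?M ((m(e := m e - 1)) i))"
        by (intro prod.cong) auto
      then show ?thesis unfolding split[of "\<lambda>i. ?M ((m(e := Suc (m e))) i)"] split[of "\<lambda>i. ?M ((m(e := m e - 1)) i)"]
        using std_normal_moment_rec[of "m e"] by simp
    qed
    also have "c * (real (m e) * (\<Prod>i\<in>I. ?M ((m(e := m e - 1)) i))) = (LINT Y|gauss I. g Y)"
      unfolding g_def integral_mono_prod[OF fin] by simp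
    finally show ?thesis .
  qed
  moreover have "pf I g" unfolding g_def by (rule pf.mono)
  ultimately show ?case by blast
next
  case (add f1 f2)
  then obtain g1 g2 where
    1: "pf I g1" "\<And>Y. ((\<lambda>t. f1 (Y(e := t))) has_real_derivative g1 Y) (at (Y e))" "(LINT Y|gauss I. Y e * f1 Y) = (LINT Y|gauss I. g1 Y)"
    and 2: "pf I g2" "\<And>Y. ((\<lambda>t. f2 (Y(e := t))) has_real_derivative g2 Y) (at (Y e))" "(LINT Y|gauss I. Y e * f2 Y) = (LINT Y|gauss I. g2 Y)"
    by blast
  have int: "integrable (gauss I) f" if "pf I f" for f using pf_integrable that add by auto
  have "(LINT Y|gauss I. Y e * (f1 Y + f2 Y)) = (LINT Y|gauss I. Y e * f1 Y) + (LINT Y|gauss I. Y e * f2 Y)"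
    unfolding distrib_left using add by (intro Bochner_Integration.integral_add int pf_mult pf_coord) auto
  also have "\<dots> = (LINT Y|gauss I. g1 Y + g2 Y)"
    unfolding 1 2 by (intro Bochner_Integration.integral_add[symmetric] int 1 2)
  finally show ?case using 1 2
    by (intro exI[of _ "\<lambda>Y. g1 Y + g2 Y"] conjI allI pf.add DERIV_add)
qed

text \<open>The derivative is taken as a hypothesis, so that callers may supply it in whatever form
  their calculus produces. Uniqueness of derivatives identifies it with the polynomial function
  found by induction.\<close>

lemma stein:
  assumes "pf I f" "finite I" "e \<in> I"
    and "\<And>Y. ((\<lambda>t. f (Y(e := t))) has_real_derivative g Y) (at (Y e))"
  shows "pf I g" "(LINT Y|gauss I. Y e * f Y) = (LINT Y|gauss I. g Y)"
proof -
  obtain g' where g': "pf I g'" "\<And>Y. ((\<lambda>t. f (Y(e := t))) has_real_derivative g' Y) (at (Y e))"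
    "(LINT Y|gauss I. Y e * f Y) = (LINT Y|gauss I. g' Y)"
    using pf_stein_aux[OF assms(1-3)] by blast
  have "g = g'" using DERIV_unique[OF assms(4) g'(2)] by auto
  then show "pf I g" "(LINT Y|gauss I. Y e * f Y) = (LINT Y|gauss I. g Y)" using g' by auto
qed

definition del_nth :: "nat \<Rightarrow> 'a list \<Rightarrow> 'a list" where
  "del_nth u xs = take u xs @ drop (Suc u) xs"

lemma prod_list_has_derivative:
  fixes f :: "'a \<Rightarrow> real \<Rightarrow> real"
  assumes "\<And>q. (f q has_real_derivative f' q) (at t)"
  shows "((\<lambda>t. prod_list (map (\<lambda>q. f q t) qs)) has_real_derivative
    (\<Sum>u<length qs. f' (qs ! u) * prod_list (map (\<lambda>q. f q t) (del_nth u qs)))) (at t)"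
proof (induction qs)
  case (Cons q qs)
  have "(\<Sum>u<length (q # qs). f' ((q # qs) ! u) * prod_list (map (\<lambda>q. f q t) (del_nth u (q # qs))))
     = f' q * prod_list (map (\<lambda>q. f q t) qs) + f q t * (\<Sum>u<length qs. f' (qs ! u) * prod_list (map (\<lambda>q. f q t) (del_nth u qs)))"
    by (simp add: sum.lessThan_Suc_shift del_nth_def sum_distrib_left mult_ac del: sum.lessThan_Suc)
  moreover have "((\<lambda>t. f q t * prod_list (map (\<lambda>q. f q t) qs)) has_real_derivative
     f q t * (\<Sum>u<length qs. f' (qs ! u) * prod_list (map (\<lambda>q. f q t) (del_nth u qs))) + f' q * prod_list (map (\<lambda>q. f q t) qs)) (at t)"
    by (intro DERIV_mult' assms Cons.IH)
  ultimately show ?case by (simp add: add.commute)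
qed simp

text \<open>Loop equations in the sense of random matrix theory; a list stands for the expectation
  of a product of power sums. After a single lowered term come the splitting of one power sum into
  two and the merging of two into one. The size of the model does not occur; it enters only through
  the value of the power sum of order 0.\<close>

definition loop_rec :: "(nat list \<Rightarrow> real) \<Rightarrow> bool" where
  "loop_rec T \<longleftrightarrow> (\<forall>p qs. p \<ge> 1 \<longrightarrow> T (p # qs) =
     2 * (- T ((p - 1) # qs) + (\<Sum>a<p. T (a # (p - 1 - a) # qs)))
     + 8 * (\<Sum>u<length qs. real (qs ! u) * T ((p + qs ! u - 1) # del_nth u qs)))"

lemma sum_list_del_nth: "u < length qs \<Longrightarrow> sum_list (del_nth u qs) + qs ! u = sum_list (qs :: nat list)"
  by (subst (3) id_take_nth_drop[of u qs]) (auto simp: del_nth_def)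

text \<open>Every list on the right of the recursion has an entry sum smaller by one, and a leading
  0 is removed at the price of the factor c, which shortens the list without raising the sum. So the
  induction is lexicographic in sum and length.\<close>

lemma loop_rec_unique:
  assumes "loop_rec T1" "loop_rec T2" "T1 [] = T2 []"
    and "\<And>qs. T1 (0 # qs) = c * T1 qs" "\<And>qs. T2 (0 # qs) = c * T2 qs"
  shows "T1 qs = T2 qs"
proof (induction qs rule: wf_induct[OF wf_measures[of "[sum_list, length]"], rule_format])
  case (1 qs)
  show ?case
  proof (cases qs)
    case (Cons p ps)
    show ?thesis
    proof (cases "p = 0")
      case True
      then show ?thesis using 1 Cons assms(4,5) by simp
    next
      case False
      then have p: "p \<ge> 1" by simp
      have a: "T1 ((p - 1) # ps) = T2 ((p - 1) # ps)" using 1 Cons p by simp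
      have b: "T1 (a # (p - 1 - a) # ps) = T2 (a # (p - 1 - a) # ps)" if "a < p" for a using 1 Cons that by simp
      have c: "real (ps ! u) * T1 ((p + ps ! u - 1) # del_nth u ps) = real (ps ! u) * T2 ((p + ps ! u - 1) # del_nth u ps)" if "u < length ps" for u
      proof -
        have "p + ps ! u - 1 + sum_list (del_nth u ps) < p + sum_list ps"
          using sum_list_del_nth[OF that] p by simp
        then have "T1 ((p + ps ! u - 1) # del_nth u ps) = T2 ((p + ps ! u - 1) # del_nth u ps)"
          using 1 Cons by simp
        then show ?thesis by simp
      qed
      have b': "(\<Sum>a<p. T1 (a # (p - 1 - a) # ps)) = (\<Sum>a<p. T2 (a # (p - 1 - a) # ps))"
        using b by (intro sum.cong) auto
      have c': "(\<Sum>u<length ps. real (ps ! u) * T1 ((p + ps ! u - 1) # del_nth u ps))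
          = (\<Sum>u<length ps. real (ps ! u) * T2 ((p + ps ! u - 1) # del_nth u ps))"
        using c by (intro sum.cong refl) blast
      show ?thesis unfolding Cons
        using assms(1,2)[unfolded loop_rec_def, rule_format, OF p, of ps] unfolding a b' c' by (simp only:)
    qed
  qed (use assms in simp)
qed

section \<open>Traces of powers of a random antisymmetric matrix\<close>

primrec mp :: "nat \<Rightarrow> (nat \<Rightarrow> nat \<Rightarrow> real) \<Rightarrow> nat \<Rightarrow> nat \<Rightarrow> nat \<Rightarrow> real" where
  "mp l Z 0 = (\<lambda>i j. if i = j then 1 else 0)"
| "mp l Z (Suc q) = (\<lambda>i j. \<Sum>r<l. Z i r * mp l Z q r j)"

lemma mp_add: "i < l \<Longrightarrow> mp l Z (a + b) i j = (\<Sum>r<l. mp l Z a i r * mp l Z b r j)"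
proof (induction a arbitrary: i)
  case 0
  have "(\<Sum>r<l. (if i = r then 1 else 0) * mp l Z b r j) = (\<Sum>r<l. if r = i then mp l Z b r j else 0)"
    by (intro sum.cong) auto
  then show ?case using 0 by simp
next
  case (Suc a)
  have "mp l Z (Suc a + b) i j = (\<Sum>s<l. Z i s * (\<Sum>r<l. mp l Z a s r * mp l Z b r j))"
    using Suc by simp
  also have "\<dots> = (\<Sum>s<l. \<Sum>r<l. Z i s * mp l Z a s r * mp l Z b r j)"
    by (simp add: sum_distrib_left mult.assoc)
  also have "\<dots> = (\<Sum>r<l. \<Sum>s<l. Z i s * mp l Z a s r * mp l Z b r j)" by (rule sum.swap)
  finally show ?case by (simp add: sum_distrib_right)
qed

lemma mp_1: "i < l \<Longrightarrow> j < l \<Longrightarrow> mp l Z (Suc 0) i j = Z i j"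
proof -
  assume "i < l" "j < l"
  have "(\<Sum>r<l. Z i r * (if r = j then 1 else 0)) = (\<Sum>r<l. if r = j then Z i r else 0)" by (intro sum.cong) auto
  then show ?thesis using \<open>j < l\<close> by simp
qed

lemma mp_transpose:
  assumes "\<And>i j. Z j i = - Z i j"
  shows "i < l \<Longrightarrow> j < l \<Longrightarrow> mp l Z q j i = (- 1) ^ q * mp l Z q i j"
proof (induction q arbitrary: i j)
  case (Suc q)
  have "mp l Z (Suc q) j i = (\<Sum>r<l. Z j r * mp l Z q r i)" by simp
  also have "\<dots> = (\<Sum>r<l. (- 1) ^ Suc q * (mp l Z q i r * mp l Z (Suc 0) r j))"
  proof (intro sum.cong refl)
    fix r assume r: "r \<in> {..<l}"
    have "mp l Z q r i = (- 1) ^ q * mp l Z q i r" using Suc.IH[of i r] Suc.prems(1) r by blast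
    moreover have "mp l Z (Suc 0) r j = - Z j r" using r Suc mp_1[of r l j Z] assms[of j r] by simp
    ultimately show "Z j r * mp l Z q r i = (- 1) ^ Suc q * (mp l Z q i r * mp l Z (Suc 0) r j)"
      by (simp del: mp.simps)
  qed
  also have "\<dots> = (- 1) ^ Suc q * mp l Z (q + Suc 0) i j"
    unfolding mp_add[OF Suc.prems(1)] by (simp add: sum_distrib_left)
  finally show ?case by simp
qed simp

lemma mp_has_derivative:
  assumes "\<And>i j. i < l \<Longrightarrow> j < l \<Longrightarrow> ((\<lambda>t. Z t i j) has_real_derivative D i j) (at t)"
  shows "i < l \<Longrightarrow> j < l \<Longrightarrow> ((\<lambda>t. mp l (Z t) q i j) has_real_derivative
    (\<Sum>a<q. \<Sum>r<l. \<Sum>s<l. mp l (Z t) a i r * D r s * mp l (Z t) (q - 1 - a) s j)) (at t)"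
proof (induction q arbitrary: i)
  case (Suc q)
  let ?d = "\<lambda>q i. \<Sum>a<q. \<Sum>r<l. \<Sum>s<l. mp l (Z t) a i r * D r s * mp l (Z t) (q - 1 - a) s j"
  have "((\<lambda>t. \<Sum>r<l. Z t i r * mp l (Z t) q r j) has_real_derivative
     (\<Sum>r<l. Z t i r * ?d q r + D i r * mp l (Z t) q r j)) (at t)"
    by (intro DERIV_sum DERIV_mult' assms Suc) (use Suc in auto)
  also have "(\<Sum>r<l. Z t i r * ?d q r + D i r * mp l (Z t) q r j) = ?d (Suc q) i"
  proof -
    have "?d (Suc q) i = (\<Sum>r<l. \<Sum>s<l. (if i = r then 1 else 0) * D r s * mp l (Z t) q s j)
       + (\<Sum>a<q. \<Sum>r<l. \<Sum>s<l. (\<Sum>v<l. Z t i v * mp l (Z t) a v r) * D r s * mp l (Z t) (q - 1 - a) s j)"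
      by (simp add: sum.lessThan_Suc_shift del: sum.lessThan_Suc)
    also have "(\<Sum>r<l. \<Sum>s<l. (if i = r then 1 else 0) * D r s * mp l (Z t) q s j) = (\<Sum>r<l. if r = i then \<Sum>s<l. D r s * mp l (Z t) q s j else 0)"
      by (intro sum.cong) auto
    also have "\<dots> = (\<Sum>s<l. D i s * mp l (Z t) q s j)" using Suc by simp
    also have "(\<Sum>a<q. \<Sum>r<l. \<Sum>s<l. (\<Sum>v<l. Z t i v * mp l (Z t) a v r) * D r s * mp l (Z t) (q - 1 - a) s j)
       = (\<Sum>v<l. Z t i v * ?d q v)"
    proof -
      have "(\<Sum>r<l. \<Sum>s<l. (\<Sum>v<l. Z t i v * mp l (Z t) a v r) * D r s * mp l (Z t) (q - 1 - a) s j)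
        = (\<Sum>v<l. Z t i v * (\<Sum>r<l. \<Sum>s<l. mp l (Z t) a v r * D r s * mp l (Z t) (q - 1 - a) s j))" for a
      proof -
        have "(\<Sum>r<l. \<Sum>s<l. (\<Sum>v<l. Z t i v * mp l (Z t) a v r) * D r s * mp l (Z t) (q - 1 - a) s j)
          = (\<Sum>r<l. \<Sum>s<l. \<Sum>v<l. Z t i v * (mp l (Z t) a v r * D r s * mp l (Z t) (q - 1 - a) s j))"
          by (simp add: sum_distrib_right mult.assoc)
        also have "\<dots> = (\<Sum>r<l. \<Sum>v<l. \<Sum>s<l. Z t i v * (mp l (Z t) a v r * D r s * mp l (Z t) (q - 1 - a) s j))"
          by (intro sum.cong refl sum.swap)
        also have "\<dots> = (\<Sum>v<l. \<Sum>r<l. \<Sum>s<l. Z t i v * (mp l (Z t) a v r * D r s * mp l (Z t) (q - 1 - a) s j))"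
          by (rule sum.swap)
        finally show ?thesis by (simp add: sum_distrib_left)
      qed
      then have "(\<Sum>a<q. \<Sum>r<l. \<Sum>s<l. (\<Sum>v<l. Z t i v * mp l (Z t) a v r) * D r s * mp l (Z t) (q - 1 - a) s j)
         = (\<Sum>a<q. \<Sum>v<l. Z t i v * (\<Sum>r<l. \<Sum>s<l. mp l (Z t) a v r * D r s * mp l (Z t) (q - 1 - a) s j))" by simp
      also have "\<dots> = (\<Sum>v<l. \<Sum>a<q. Z t i v * (\<Sum>r<l. \<Sum>s<l. mp l (Z t) a v r * D r s * mp l (Z t) (q - 1 - a) s j))" by (rule sum.swap)
      finally show ?thesis by (simp add: sum_distrib_left)
    qed
    finally show ?thesis by (simp add: sum.distrib)
  qed
  finally show ?case by simp
qed simp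

definition Zm :: "(nat \<times> nat \<Rightarrow> real) \<Rightarrow> nat \<Rightarrow> nat \<Rightarrow> real" where
  "Zm Y i j = Y (i, j) - Y (j, i)"

definition trm :: "nat \<Rightarrow> nat \<Rightarrow> (nat \<times> nat \<Rightarrow> real) \<Rightarrow> real" where
  "trm l q Y = (\<Sum>i<l. mp l (Zm Y) q i i)"

text \<open>The trace of (2 A)^(2q) for the aGUE matrix A = (i/2) Z, since (2 A)^2 = - Z^2. In this
  form the whole recursion stays real.\<close>

definition Sm :: "nat \<Rightarrow> nat \<Rightarrow> (nat \<times> nat \<Rightarrow> real) \<Rightarrow> real" where
  "Sm l q Y = (- 1) ^ q * trm l (2 * q) Y"

lemma Zm_antisym: "Zm Y j i = - Zm Y i j" by (simp add: Zm_def)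

lemma trm_odd: "odd q \<Longrightarrow> trm l q Y = 0"
proof -
  assume q: "odd q"
  have "mp l (Zm Y) q i i = 0" if "i < l" for i
    using mp_transpose[of "Zm Y" i l i q, OF Zm_antisym that that] q by simp
  then show ?thesis by (simp add: trm_def)
qed

abbreviation sq :: "nat \<Rightarrow> (nat \<times> nat) set" where "sq l \<equiv> {..<l} \<times> {..<l}"

lemma pf_mp: "i < l \<Longrightarrow> j < l \<Longrightarrow> pf (sq l) (\<lambda>Y. mp l (Zm Y) q i j)"
proof (induction q arbitrary: i)
  case (Suc q)
  then show ?case unfolding mp.simps Zm_def
    by (intro pf_sum pf_mult pf_diff pf_coord) auto
qed (auto intro: pf_const)

lemma pf_Sm: "pf (sq l) (Sm l q)"
  unfolding Sm_def[abs_def] trm_def by (intro pf_cmult pf_sum pf_mp) auto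

lemma Zm_has_derivative:
  assumes "i < l" "j < l"
  shows "((\<lambda>t. Zm (Y((i, j) := t)) r s) has_real_derivative
     (if r = i \<and> s = j then 1 else 0) - (if r = j \<and> s = i then 1 else 0)) (at (Y (i, j)))"
proof -
  have c: "((\<lambda>t. (Y((i, j) := t)) x) has_real_derivative (if x = (i, j) then 1 else 0)) (at (Y (i, j)))" for x
    by (cases "x = (i, j)") auto
  show ?thesis unfolding Zm_def using DERIV_diff[OF c[of "(r, s)"] c[of "(s, r)"]] by (auto simp: conj_commute)
qed

lemma mp_Zm_has_derivative:
  assumes "i < l" "j < l" "u < l" "v < l"
  shows "((\<lambda>t. mp l (Zm (Y((i, j) := t))) q u v) has_real_derivative
     (\<Sum>a<q. mp l (Zm Y) a u i * mp l (Zm Y) (q - 1 - a) j v - mp l (Zm Y) a u j * mp l (Zm Y) (q - 1 - a) i v)) (at (Y (i, j)))"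
proof -
  let ?D = "\<lambda>r s. (if r = i \<and> s = j then 1 else 0) - (if r = j \<and> s = i then 1 else 0) :: real"
  have pick: "(\<Sum>r<l. \<Sum>s<l. f r * (if r = x \<and> s = y then 1 else 0) * g s) = f x * g y" if "x < l" "y < l" for f g :: "nat \<Rightarrow> real" and x y
  proof -
    have "(\<Sum>r<l. \<Sum>s<l. f r * (if r = x \<and> s = y then 1 else 0) * g s) = (\<Sum>r<l. if r = x then (\<Sum>s<l. if s = y then f r * g s else 0) else 0)"
    proof (intro sum.cong refl)
      fix r
      show "(\<Sum>s<l. f r * (if r = x \<and> s = y then 1 else 0) * g s) = (if r = x then (\<Sum>s<l. if s = y then f r * g s else 0) else 0)"
      proof (cases "r = x")
        case True
        then show ?thesis by (simp only: if_True simp_thms) (intro sum.cong, auto)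
      qed simp
    qed
    then show ?thesis using that by simp
  qed
  have "((\<lambda>t. mp l (Zm (Y((i, j) := t))) q u v) has_real_derivative
     (\<Sum>a<q. \<Sum>r<l. \<Sum>s<l. mp l (Zm (Y((i, j) := Y (i, j)))) a u r * ?D r s * mp l (Zm (Y((i, j) := Y (i, j)))) (q - 1 - a) s v)) (at (Y (i, j)))"
    using assms by (intro mp_has_derivative Zm_has_derivative)
  also have "(\<Sum>a<q. \<Sum>r<l. \<Sum>s<l. mp l (Zm (Y((i, j) := Y (i, j)))) a u r * ?D r s * mp l (Zm (Y((i, j) := Y (i, j)))) (q - 1 - a) s v)
    = (\<Sum>a<q. mp l (Zm Y) a u i * mp l (Zm Y) (q - 1 - a) j v - mp l (Zm Y) a u j * mp l (Zm Y) (q - 1 - a) i v)"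
    unfolding fun_upd_triv right_diff_distrib left_diff_distrib sum_subtractf
    using assms by (simp only: pick)
  finally show ?thesis .
qed

text \<open>By cyclicity all 2 r positions contribute alike, and \<open>Y (i, j)\<close> enters Z
  twice with opposite signs, at (i, j) and (j, i); the odd power is antisymmetric, so both agree.
  This gives 2 * 2 r = 4 r.\<close>

lemma trm_has_derivative:
  assumes "i < l" "j < l"
  shows "((\<lambda>t. trm l (2 * r) (Y((i, j) := t))) has_real_derivative 4 * real r * mp l (Zm Y) (2 * r - 1) j i) (at (Y (i, j)))"
proof -
  let ?Z = "Zm Y" and ?q = "2 * r"
  have "((\<lambda>t. trm l ?q (Y((i, j) := t))) has_real_derivative
     (\<Sum>u<l. \<Sum>a<?q. mp l ?Z a u i * mp l ?Z (?q - 1 - a) j u - mp l ?Z a u j * mp l ?Z (?q - 1 - a) i u)) (at (Y (i, j)))"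
    unfolding trm_def using assms by (intro DERIV_sum mp_Zm_has_derivative) auto
  also have "(\<Sum>u<l. \<Sum>a<?q. mp l ?Z a u i * mp l ?Z (?q - 1 - a) j u - mp l ?Z a u j * mp l ?Z (?q - 1 - a) i u)
     = (\<Sum>a<?q. \<Sum>u<l. mp l ?Z a u i * mp l ?Z (?q - 1 - a) j u - mp l ?Z a u j * mp l ?Z (?q - 1 - a) i u)"
    by (rule sum.swap)
  also have "\<dots> = (\<Sum>a<?q. mp l ?Z (?q - 1) j i - mp l ?Z (?q - 1) i j)"
  proof (intro sum.cong refl)
    fix a assume "a \<in> {..<?q}"
    then have e: "?q - 1 = (?q - 1 - a) + a" by auto
    have m: "mp l ?Z (?q - 1) x y = (\<Sum>u<l. mp l ?Z (?q - 1 - a) x u * mp l ?Z a u y)" if "x < l" for x y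
      by (subst e, rule mp_add[OF that])
    show "(\<Sum>u<l. mp l ?Z a u i * mp l ?Z (?q - 1 - a) j u - mp l ?Z a u j * mp l ?Z (?q - 1 - a) i u) = mp l ?Z (?q - 1) j i - mp l ?Z (?q - 1) i j"
      unfolding m[OF assms(1)] m[OF assms(2)] by (simp add: sum_subtractf mult.commute)
  qed
  also have "\<dots> = 4 * real r * mp l ?Z (2 * r - 1) j i"
  proof (cases "r = 0")
    case False
    then have "mp l ?Z (2 * r - 1) i j = - mp l ?Z (2 * r - 1) j i"
      using mp_transpose[of ?Z j l i "2 * r - 1", OF Zm_antisym assms(2,1)] by simp
    then show ?thesis by simp
  qed simp
  finally show ?thesis .
qed

definition T1 :: "nat \<Rightarrow> nat list \<Rightarrow> real" where
  "T1 l qs = (LINT Y|gauss (sq l). prod_list (map (\<lambda>q. Sm l q Y) qs))"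

text \<open>Integration by parts in every entry of Y. Differentiating the matrix power itself gives
  products of two traces and, through the transposed position, single traces with alternating signs;
  differentiating the other factors merges two traces.\<close>

lemma loop_T1: "loop_rec (T1 l)"
  unfolding loop_rec_def
proof (intro allI impI)
  fix p :: nat and qs :: "nat list" assume p: "p \<ge> 1"
  define I where "I = sq l"
  have fin: "finite I" by (simp add: I_def)
  define Pi where "Pi = (\<lambda>Y. prod_list (map (\<lambda>q. Sm l q Y) qs))"
  define Pu where "Pu = (\<lambda>u Y. prod_list (map (\<lambda>q. Sm l q Y) (del_nth u qs)))"
  define m where "m = (\<lambda>q Y. mp l (Zm Y) q)"
  have pfPi: "pf I Pi" unfolding Pi_def I_def by (intro pf_prod_list pf_Sm)
  have pfPu: "pf I (Pu u)" for u unfolding Pu_def I_def by (intro pf_prod_list pf_Sm)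
  have pfm: "i < l \<Longrightarrow> j < l \<Longrightarrow> pf I (\<lambda>Y. m q Y i j)" for q i j unfolding m_def I_def by (rule pf_mp)
  have pfS: "pf I (Sm l q)" for q unfolding I_def by (rule pf_Sm)
  have int: "integrable (gauss I) f" if "pf I f" for f using pf_integrable[OF that fin] .
  have tr: "m q Y j i = (- 1) ^ q * m q Y i j" if "i < l" "j < l" for q Y i j
    unfolding m_def by (rule mp_transpose[OF Zm_antisym that])
  define g where "g = (\<lambda>i j Y. m (2 * p - 1) Y j i * (\<Sum>u<length qs. ((- 1) ^ (qs ! u) * (4 * real (qs ! u) * m (2 * (qs ! u) - 1) Y j i)) * Pu u Y)
      + (\<Sum>a<2 * p - 1. m a Y j i * m (2 * p - 1 - 1 - a) Y j i - m a Y j j * m (2 * p - 1 - 1 - a) Y i i) * Pi Y)"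
  have st: "pf I (g i j)" "(LINT Y|gauss I. Y (i, j) * (m (2 * p - 1) Y j i * Pi Y)) = (LINT Y|gauss I. g i j Y)" if ij: "i < l" "j < l" for i j
  proof -
    have d: "((\<lambda>t. m (2 * p - 1) (Y((i, j) := t)) j i * Pi (Y((i, j) := t))) has_real_derivative g i j Y) (at (Y (i, j)))" for Y
    proof -
      have "((\<lambda>t. Sm l q (Y((i, j) := t))) has_real_derivative (- 1) ^ q * (4 * real q * m (2 * q - 1) Y j i)) (at (Y (i, j)))" for q
        unfolding Sm_def m_def by (intro DERIV_cmult trm_has_derivative ij)
      from prod_list_has_derivative[of "\<lambda>q t. Sm l q (Y((i, j) := t))", OF this, of qs]
      have 1: "((\<lambda>t. Pi (Y((i, j) := t))) has_real_derivative (\<Sum>u<length qs. ((- 1) ^ (qs ! u) * (4 * real (qs ! u) * m (2 * (qs ! u) - 1) Y j i)) * Pu u Y)) (at (Y (i, j)))"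
        by (simp add: Pi_def Pu_def)
      have 2: "((\<lambda>t. m (2 * p - 1) (Y((i, j) := t)) j i) has_real_derivative
         (\<Sum>a<2 * p - 1. m a Y j i * m (2 * p - 1 - 1 - a) Y j i - m a Y j j * m (2 * p - 1 - 1 - a) Y i i)) (at (Y (i, j)))"
        unfolding m_def by (intro mp_Zm_has_derivative ij)
      show ?thesis using DERIV_mult'[OF 2 1] by (simp add: g_def)
    qed
    have pff: "pf I (\<lambda>Y. m (2 * p - 1) Y j i * Pi Y)" by (intro pf_mult pfm pfPi ij)
    show "pf I (g i j)" by (rule stein(1)[OF pff fin _ d]) (use ij in \<open>auto simp: I_def\<close>)
    show "(LINT Y|gauss I. Y (i, j) * (m (2 * p - 1) Y j i * Pi Y)) = (LINT Y|gauss I. g i j Y)"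
      by (rule stein(2)[OF pff fin _ d]) (use ij in \<open>auto simp: I_def\<close>)
  qed
  \<comment> \<open>Both halves of Z = Y - Y^T contribute the same amount because the odd power is
    antisymmetric; hence the factor 2.\<close>
  have point: "trm l (2 * p) Y * Pi Y = 2 * (\<Sum>i<l. \<Sum>j<l. Y (i, j) * (m (2 * p - 1) Y j i * Pi Y))" for Y
  proof -
    have e: "2 * p = Suc (2 * p - 1)" using p by simp
    have "trm l (2 * p) Y = (\<Sum>i<l. \<Sum>j<l. Zm Y i j * m (2 * p - 1) Y j i)"
      unfolding trm_def m_def by (subst e, subst mp.simps) simp
    also have "\<dots> = (\<Sum>i<l. \<Sum>j<l. Y (i, j) * m (2 * p - 1) Y j i) - (\<Sum>i<l. \<Sum>j<l. Y (j, i) * m (2 * p - 1) Y j i)"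
      by (simp add: Zm_def left_diff_distrib sum_subtractf)
    also have "(\<Sum>i<l. \<Sum>j<l. Y (j, i) * m (2 * p - 1) Y j i) = (\<Sum>j<l. \<Sum>i<l. Y (j, i) * m (2 * p - 1) Y j i)"
      by (rule sum.swap)
    also have "\<dots> = - (\<Sum>i<l. \<Sum>j<l. Y (i, j) * m (2 * p - 1) Y j i)"
      unfolding sum_negf[symmetric]
    proof (intro sum.cong refl)
      fix i j assume "i \<in> {..<l}" "j \<in> {..<l}"
      then show "Y (i, j) * m (2 * p - 1) Y i j = - (Y (i, j) * m (2 * p - 1) Y j i)"
        using tr[of j i "2 * p - 1" Y] p by simp
    qed
    finally show ?thesis by (simp add: sum_distrib_right mult.assoc)
  qed
  have sumg: "(\<Sum>i<l. \<Sum>j<l. g i j Y) = (trm l (2 * (p - 1)) Y - (\<Sum>a<p. trm l (2 * a) Y * trm l (2 * (p - 1 - a)) Y)) * Pi Y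
     - 4 * (\<Sum>u<length qs. (- 1) ^ (qs ! u) * real (qs ! u) * trm l (2 * (p + qs ! u - 1)) Y * Pu u Y)" for Y
  proof -
    have mm: "(\<Sum>i<l. \<Sum>j<l. m a Y j i * m b Y j i) = (- 1) ^ b * trm l (a + b) Y" for a b
    proof -
      have "(\<Sum>i<l. \<Sum>j<l. m a Y j i * m b Y j i) = (\<Sum>j<l. \<Sum>i<l. m a Y j i * m b Y j i)" by (rule sum.swap)
      also have "\<dots> = (\<Sum>j<l. \<Sum>i<l. (- 1) ^ b * (m a Y j i * m b Y i j))"
      proof (intro sum.cong refl)
        fix i j assume "i \<in> {..<l}" "j \<in> {..<l}"
        then show "m a Y j i * m b Y j i = (- 1) ^ b * (m a Y j i * m b Y i j)" using tr[of i j b Y] by simp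
      qed
      also have "\<dots> = (- 1) ^ b * (\<Sum>j<l. m (a + b) Y j j)"
        unfolding m_def by (simp add: mp_add sum_distrib_left)
      finally show ?thesis by (simp add: trm_def m_def)
    qed
    have A: "(\<Sum>i<l. \<Sum>j<l. \<Sum>a<2 * p - 1. m a Y j i * m (2 * p - 1 - 1 - a) Y j i - m a Y j j * m (2 * p - 1 - 1 - a) Y i i)
       = trm l (2 * (p - 1)) Y - (\<Sum>a<p. trm l (2 * a) Y * trm l (2 * (p - 1 - a)) Y)"
    proof -
      have "(\<Sum>i<l. \<Sum>j<l. \<Sum>a<2 * p - 1. m a Y j i * m (2 * p - 1 - 1 - a) Y j i - m a Y j j * m (2 * p - 1 - 1 - a) Y i i)
        = (\<Sum>a<2 * p - 1. \<Sum>i<l. \<Sum>j<l. m a Y j i * m (2 * p - 1 - 1 - a) Y j i - m a Y j j * m (2 * p - 1 - 1 - a) Y i i)"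
        by (subst sum.swap[of _ "{..<2 * p - 1}"], intro sum.cong refl sum.swap)
      also have "\<dots> = (\<Sum>a<2 * p - 1. (- 1) ^ (2 * p - 1 - 1 - a) * trm l (2 * (p - 1)) Y - trm l a Y * trm l (2 * p - 1 - 1 - a) Y)"
      proof (intro sum.cong refl)
        fix a assume "a \<in> {..<2 * p - 1}"
        then have e: "a + (2 * p - 1 - 1 - a) = 2 * (p - 1)" by auto
        have "(\<Sum>i<l. \<Sum>j<l. m a Y j j * m (2 * p - 1 - 1 - a) Y i i) = trm l a Y * trm l (2 * p - 1 - 1 - a) Y"
          unfolding trm_def m_def by (subst sum.swap) (simp add: sum_product)
        then show "(\<Sum>i<l. \<Sum>j<l. m a Y j i * m (2 * p - 1 - 1 - a) Y j i - m a Y j j * m (2 * p - 1 - 1 - a) Y i i)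
            = (- 1) ^ (2 * p - 1 - 1 - a) * trm l (2 * (p - 1)) Y - trm l a Y * trm l (2 * p - 1 - 1 - a) Y"
          using mm[of a "2 * p - 1 - 1 - a"] unfolding e by (simp add: sum_subtractf)
      qed
      also have "\<dots> = (\<Sum>a<2 * p - 1. (- 1) ^ (2 * p - 1 - 1 - a)) * trm l (2 * (p - 1)) Y - (\<Sum>a<2 * p - 1. trm l a Y * trm l (2 * p - 1 - 1 - a) Y)"
        by (simp add: sum_subtractf sum_distrib_right)
      \<comment> \<open>An odd number of alternating signs that starts and ends with +1: of all the
        transposed terms a single trace is left.\<close>
      also have "(\<Sum>a<2 * p - 1. (- 1) ^ (2 * p - 1 - 1 - a)) = (1 :: real)"
      proof -
        have "(\<Sum>a<2 * p - 1. (- 1 :: real) ^ (2 * p - 1 - 1 - a)) = (\<Sum>a<2 * p - 1. (- 1) ^ a)"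
          by (rule sum.reindex_bij_witness[of _ "\<lambda>a. 2 * p - 1 - 1 - a" "\<lambda>a. 2 * p - 1 - 1 - a"]) auto
        also have "\<dots> = (\<Sum>a<Suc (2 * (p - 1)). (- 1) ^ a)" using p by (intro sum.cong) auto
        also have "(\<Sum>a<Suc (2 * q). (- 1 :: real) ^ a) = 1" for q
          by (induction q) auto
        finally show ?thesis .
      qed
      \<comment> \<open>Traces of odd powers vanish, so only even a remain, and with them only the
        quantities that \<open>Sm\<close> describes.\<close>
      also have "(\<Sum>a<2 * p - 1. trm l a Y * trm l (2 * p - 1 - 1 - a) Y) = (\<Sum>a<p. trm l (2 * a) Y * trm l (2 * (p - 1 - a)) Y)"
      proof -
        have "(\<Sum>a<2 * p - 1. trm l a Y * trm l (2 * p - 1 - 1 - a) Y) = (\<Sum>a\<in>(\<lambda>a. 2 * a) ` {..<p}. trm l a Y * trm l (2 * p - 1 - 1 - a) Y)"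
        proof (intro sum.mono_neutral_right ballI)
          fix a assume "a \<in> {..<2 * p - 1} - (\<lambda>a. 2 * a) ` {..<p}"
          then have "odd a" using p by (auto elim!: evenE)
          then show "trm l a Y * trm l (2 * p - 1 - 1 - a) Y = 0" by (simp add: trm_odd)
        qed (use p in auto)
        also have "\<dots> = (\<Sum>a<p. trm l (2 * a) Y * trm l (2 * p - 1 - 1 - 2 * a) Y)"
          by (subst sum.reindex) (auto simp: inj_on_def)
        also have "\<dots> = (\<Sum>a<p. trm l (2 * a) Y * trm l (2 * (p - 1 - a)) Y)"
          by (intro sum.cong refl arg_cong2[where f = "(*)"] arg_cong2[where f = "trm l"]) auto
        finally show ?thesis .
      qed
      finally show ?thesis by simp
    qed
    have B: "(\<Sum>i<l. \<Sum>j<l. m (2 * p - 1) Y j i * (\<Sum>u<length qs. ((- 1) ^ (qs ! u) * (4 * real (qs ! u) * m (2 * (qs ! u) - 1) Y j i)) * Pu u Y))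
      = - 4 * (\<Sum>u<length qs. (- 1) ^ (qs ! u) * real (qs ! u) * trm l (2 * (p + qs ! u - 1)) Y * Pu u Y)"
    proof -
      have "(\<Sum>i<l. \<Sum>j<l. m (2 * p - 1) Y j i * (\<Sum>u<length qs. ((- 1) ^ (qs ! u) * (4 * real (qs ! u) * m (2 * (qs ! u) - 1) Y j i)) * Pu u Y))
        = (\<Sum>i<l. \<Sum>j<l. \<Sum>u<length qs. ((- 1) ^ (qs ! u) * 4 * real (qs ! u) * Pu u Y) * (m (2 * p - 1) Y j i * m (2 * (qs ! u) - 1) Y j i))"
        by (simp add: sum_distrib_left mult_ac)
      also have "\<dots> = (\<Sum>u<length qs. \<Sum>i<l. \<Sum>j<l. ((- 1) ^ (qs ! u) * 4 * real (qs ! u) * Pu u Y) * (m (2 * p - 1) Y j i * m (2 * (qs ! u) - 1) Y j i))"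
        by (subst sum.swap[of _ "{..<length qs}"], intro sum.cong refl sum.swap)
      also have "\<dots> = (\<Sum>u<length qs. - 4 * ((- 1) ^ (qs ! u) * real (qs ! u) * trm l (2 * (p + qs ! u - 1)) Y * Pu u Y))"
      proof (intro sum.cong refl)
        fix u assume "u \<in> {..<length qs}"
        show "(\<Sum>i<l. \<Sum>j<l. ((- 1) ^ (qs ! u) * 4 * real (qs ! u) * Pu u Y) * (m (2 * p - 1) Y j i * m (2 * (qs ! u) - 1) Y j i))
           = - 4 * ((- 1) ^ (qs ! u) * real (qs ! u) * trm l (2 * (p + qs ! u - 1)) Y * Pu u Y)"
        proof (cases "qs ! u = 0")
          case False
          then have e: "2 * p - 1 + (2 * (qs ! u) - 1) = 2 * (p + qs ! u - 1)" and o: "odd (2 * (qs ! u) - 1)" using p by auto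
          show ?thesis unfolding sum_distrib_left[symmetric] mm e using o by simp
        qed simp
      qed
      finally show ?thesis by (simp add: sum_distrib_left)
    qed
    show ?thesis unfolding g_def sum.distrib B sum_distrib_right[symmetric] A by simp
  qed
  have intsum: "(LINT Y|gauss I. (\<Sum>i<l. \<Sum>j<l. f i j Y)) = (\<Sum>i<l. \<Sum>j<l. (LINT Y|gauss I. f i j Y))" if "\<And>i j. i < l \<Longrightarrow> j < l \<Longrightarrow> pf I (f i j)" for f
    using that by (subst Bochner_Integration.integral_sum; (intro int pf_sum Bochner_Integration.integral_sum sum.cong refl)?) auto
  have "(LINT Y|gauss I. trm l (2 * p) Y * Pi Y) = 2 * (LINT Y|gauss I. (\<Sum>i<l. \<Sum>j<l. Y (i, j) * (m (2 * p - 1) Y j i * Pi Y)))"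
    unfolding point by simp
  also have "\<dots> = 2 * (\<Sum>i<l. \<Sum>j<l. (LINT Y|gauss I. Y (i, j) * (m (2 * p - 1) Y j i * Pi Y)))"
    by (subst intsum) (auto intro!: pf_mult pf_coord pfm[unfolded I_def] pfPi[unfolded I_def] simp: I_def)
  also have "\<dots> = 2 * (\<Sum>i<l. \<Sum>j<l. (LINT Y|gauss I. g i j Y))" using st(2) by simp
  also have "\<dots> = 2 * (LINT Y|gauss I. (\<Sum>i<l. \<Sum>j<l. g i j Y))" by (subst intsum) (auto intro: st(1))
  finally have main: "(LINT Y|gauss I. trm l (2 * p) Y * Pi Y) = 2 * (LINT Y|gauss I. (\<Sum>i<l. \<Sum>j<l. g i j Y))" .
  define rhs where "rhs = (\<lambda>Y. - (Sm l (p - 1) Y * Pi Y) + (\<Sum>a<p. Sm l a Y * (Sm l (p - 1 - a) Y * Pi Y))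
     + 4 * (\<Sum>u<length qs. real (qs ! u) * (Sm l (p + qs ! u - 1) Y * Pu u Y)))"
  have sg: "(- 1) ^ p * (\<Sum>i<l. \<Sum>j<l. g i j Y) = rhs Y" for Y
  proof -
    have pm: "(- 1 :: real) ^ p = - ((- 1) ^ (p - 1))" using p by (cases p) auto
    have "(\<Sum>a<p. Sm l a Y * (Sm l (p - 1 - a) Y * Pi Y)) = (- 1) ^ (p - 1) * (\<Sum>a<p. trm l (2 * a) Y * trm l (2 * (p - 1 - a)) Y) * Pi Y"
      unfolding sum_distrib_left sum_distrib_right
    proof (intro sum.cong refl)
      fix a assume "a \<in> {..<p}"
      then have "(- 1 :: real) ^ (p - 1) = (- 1) ^ a * (- 1) ^ (p - 1 - a)" unfolding power_add[symmetric] by (intro arg_cong2[where f = "(^)"]) auto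
      then show "Sm l a Y * (Sm l (p - 1 - a) Y * Pi Y) = (- 1) ^ (p - 1) * (trm l (2 * a) Y * trm l (2 * (p - 1 - a)) Y) * Pi Y"
        by (simp add: Sm_def mult_ac)
    qed
    moreover have "(\<Sum>u<length qs. real (qs ! u) * (Sm l (p + qs ! u - 1) Y * Pu u Y))
       = (- 1) ^ (p - 1) * (\<Sum>u<length qs. (- 1) ^ (qs ! u) * real (qs ! u) * trm l (2 * (p + qs ! u - 1)) Y * Pu u Y)"
      unfolding sum_distrib_left
    proof (intro sum.cong refl)
      fix u
      have "(- 1 :: real) ^ (p + qs ! u - 1) = (- 1) ^ (p - 1) * (- 1) ^ (qs ! u)"
        unfolding power_add[symmetric] using p by (intro arg_cong2[where f = "(^)"]) auto
      then show "real (qs ! u) * (Sm l (p + qs ! u - 1) Y * Pu u Y) = (- 1) ^ (p - 1) * ((- 1) ^ (qs ! u) * real (qs ! u) * trm l (2 * (p + qs ! u - 1)) Y * Pu u Y)"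
        by (simp add: Sm_def mult_ac)
    qed
    ultimately show ?thesis unfolding rhs_def sumg pm by (simp add: Sm_def algebra_simps)
  qed
  have "T1 l (p # qs) = (- 1) ^ p * (LINT Y|gauss I. trm l (2 * p) Y * Pi Y)"
    unfolding T1_def I_def Pi_def by (simp add: Sm_def mult.assoc)
  also have "\<dots> = 2 * (LINT Y|gauss I. (- 1) ^ p * (\<Sum>i<l. \<Sum>j<l. g i j Y))" unfolding main by simp
  also have "\<dots> = 2 * (LINT Y|gauss I. rhs Y)" unfolding sg ..
  also have "(LINT Y|gauss I. rhs Y) = - (LINT Y|gauss I. Sm l (p - 1) Y * Pi Y) + (\<Sum>a<p. (LINT Y|gauss I. Sm l a Y * (Sm l (p - 1 - a) Y * Pi Y)))
     + 4 * (\<Sum>u<length qs. real (qs ! u) * (LINT Y|gauss I. Sm l (p + qs ! u - 1) Y * Pu u Y))"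
  proof -
    have i1: "integrable (gauss I) (\<lambda>Y. Sm l (p - 1) Y * Pi Y)" by (intro int pf_mult pfS pfPi)
    have i2: "integrable (gauss I) (\<lambda>Y. Sm l a Y * (Sm l (p - 1 - a) Y * Pi Y))" for a by (intro int pf_mult pfS pfPi)
    have i3: "integrable (gauss I) (\<lambda>Y. Sm l (p + qs ! u - 1) Y * Pu u Y)" for u by (intro int pf_mult pfS pfPu)
    show ?thesis unfolding rhs_def using i1 i2 i3
      by (simp add: Bochner_Integration.integral_add Bochner_Integration.integral_sum)
  qed
  also have "2 * (- (LINT Y|gauss I. Sm l (p - 1) Y * Pi Y) + (\<Sum>a<p. (LINT Y|gauss I. Sm l a Y * (Sm l (p - 1 - a) Y * Pi Y)))
     + 4 * (\<Sum>u<length qs. real (qs ! u) * (LINT Y|gauss I. Sm l (p + qs ! u - 1) Y * Pu u Y)))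
     = 2 * (- T1 l ((p - 1) # qs) + (\<Sum>a<p. T1 l (a # (p - 1 - a) # qs))) + 8 * (\<Sum>u<length qs. real (qs ! u) * T1 l ((p + qs ! u - 1) # del_nth u qs))"
    unfolding T1_def I_def Pi_def Pu_def by (simp add: algebra_simps)
  finally show "T1 l (p # qs) = 2 * (- T1 l ((p - 1) # qs) + (\<Sum>a<p. T1 l (a # (p - 1 - a) # qs)))
     + 8 * (\<Sum>u<length qs. real (qs ! u) * T1 l ((p + qs ! u - 1) # del_nth u qs))" .
qed

section \<open>Weighted Gaussian points and their loop recursion\<close>

definition Pp :: "nat \<Rightarrow> nat \<Rightarrow> (nat \<Rightarrow> real) \<Rightarrow> real" where
  "Pp k q g = (\<Sum>i<k. g i ^ (2 * q))"

text \<open>Each value 2 g_i^2 is counted twice, in imitation of eigenvalues that come in pairs of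
  opposite sign: this is the power sum of order q of 2 k points.\<close>

definition Sg :: "nat \<Rightarrow> nat \<Rightarrow> (nat \<Rightarrow> real) \<Rightarrow> real" where
  "Sg k q g = 2 ^ (q + 1) * Pp k q g"

definition lpairs :: "nat \<Rightarrow> (nat \<times> nat) set" where
  "lpairs k = {(i, j). i < j \<and> j < k}"

lemma finite_lpairs [simp]: "finite (lpairs k)"
  by (rule finite_subset[of _ "{..<k} \<times> {..<k}"]) (auto simp: lpairs_def)

text \<open>The squared Vandermonde determinant in the squares, as in the eigenvalue density of aGUE
  matrices of even size. Here the weight is only posited; the common recursion is what ties it to
  the matrices.\<close>

definition Wg :: "nat \<Rightarrow> (nat \<Rightarrow> real) \<Rightarrow> real" where
  "Wg k g = (\<Prod>(i, j)\<in>lpairs k. ((g j)\<^sup>2 - (g i)\<^sup>2)\<^sup>2)"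

lemma pf_Pp: "pf {..<k} (Pp k q)"
  unfolding Pp_def[abs_def] by (intro pf_sum pf_power pf_coord) auto

lemma pf_Sg: "pf {..<k} (Sg k q)"
  unfolding Sg_def[abs_def] by (intro pf_cmult pf_Pp)

lemma pf_Wg: "pf {..<k} (Wg k)"
  unfolding Wg_def[abs_def] case_prod_beta
  by (intro pf_prod pf_power pf_diff pf_coord) (auto simp: lpairs_def)

lemma coord_pow_has_derivative:
  "((\<lambda>t. (g(i := t)) j ^ n) has_real_derivative (if j = i then real n * g i ^ (n - 1) else 0)) (at (g i))"
proof (cases "j = i")
  case True
  then show ?thesis using DERIV_pow[of n "g i"] by simp
qed simp

lemma Pp_has_derivative:
  assumes "i < k"
  shows "((\<lambda>t. Pp k q (g(i := t))) has_real_derivative real (2 * q) * g i ^ (2 * q - 1)) (at (g i))"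
proof -
  have "((\<lambda>t. Pp k q (g(i := t))) has_real_derivative (\<Sum>j<k. if j = i then real (2 * q) * g i ^ (2 * q - 1) else 0)) (at (g i))"
    unfolding Pp_def by (intro DERIV_sum coord_pow_has_derivative)
  then show ?thesis using assms by simp
qed

lemma Wg_has_derivative:
  "((\<lambda>t. Wg k (g(i := t))) has_real_derivative
     (\<Sum>e\<in>lpairs k. (2 * ((g (snd e))\<^sup>2 - (g (fst e))\<^sup>2) * ((if snd e = i then 2 * g i else 0) - (if fst e = i then 2 * g i else 0)))
        * (\<Prod>e'\<in>lpairs k - {e}. ((g (snd e'))\<^sup>2 - (g (fst e'))\<^sup>2)\<^sup>2))) (at (g i))"
proof -
  let ?h = "\<lambda>e t. (((g(i := t)) (snd e))\<^sup>2 - ((g(i := t)) (fst e))\<^sup>2)\<^sup>2"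
  have h: "(?h e has_real_derivative 2 * ((g (snd e))\<^sup>2 - (g (fst e))\<^sup>2) * ((if snd e = i then 2 * g i else 0) - (if fst e = i then 2 * g i else 0))) (at (g i))" for e
  proof -
    have sqd: "((\<lambda>t. ((g(i := t)) j)\<^sup>2) has_real_derivative (if j = i then 2 * g i else 0)) (at (g i))" for j
    proof (cases "j = i")
      case True
      then show ?thesis using DERIV_pow[of 2 "g i"] by simp
    qed simp
    have "((\<lambda>t. ((g(i := t)) (snd e))\<^sup>2 - ((g(i := t)) (fst e))\<^sup>2) has_real_derivative (if snd e = i then 2 * g i else 0) - (if fst e = i then 2 * g i else 0)) (at (g i))"
      by (intro DERIV_diff sqd)
    from DERIV_power[OF this, of 2] show ?thesis by (rule DERIV_cong) (simp only: fun_upd_triv, simp)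
  qed
  have "((\<lambda>t. \<Prod>e\<in>lpairs k. ?h e t) has_real_derivative
     (\<Sum>e\<in>lpairs k. (2 * ((g (snd e))\<^sup>2 - (g (fst e))\<^sup>2) * ((if snd e = i then 2 * g i else 0) - (if fst e = i then 2 * g i else 0)))
        * (\<Prod>e'\<in>lpairs k - {e}. ?h e' (g i)))) (at (g i))"
    by (intro has_field_derivative_prod h)
  then show ?thesis unfolding Wg_def case_prod_beta fun_upd_triv .
qed

text \<open>With x_i = g_i^2, a pair contributes 4 (x_j^p - x_i^p) / (x_j - x_i) times the weight, a
  sum of p monomials. Completing the sum over i < j to all pairs produces products of power sums,
  and the diagonal is the correction with the factor 2 p.\<close>

lemma Wg_euler:
  assumes p: "p \<ge> 1"
  shows "(\<Sum>i<k. g i ^ (2 * p - 1) * (\<Sum>e\<in>lpairs k. (2 * ((g (snd e))\<^sup>2 - (g (fst e))\<^sup>2) * ((if snd e = i then 2 * g i else 0) - (if fst e = i then 2 * g i else 0)))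
        * (\<Prod>e'\<in>lpairs k - {e}. ((g (snd e'))\<^sup>2 - (g (fst e'))\<^sup>2)\<^sup>2)))
     = Wg k g * (2 * (\<Sum>a<p. Pp k a g * Pp k (p - 1 - a) g) - 2 * real p * Pp k (p - 1) g)"
proof -
  let ?x = "\<lambda>i. (g i)\<^sup>2"
  let ?d = "\<lambda>e. ?x (snd e) - ?x (fst e)"
  let ?R = "\<lambda>e. \<Prod>e'\<in>lpairs k - {e}. (?d e')\<^sup>2"
  let ?s = "\<lambda>i j. \<Sum>a<p. ?x i ^ a * ?x j ^ (p - 1 - a)"
  have pw: "g i ^ (2 * p - 1) * g i = ?x i ^ p" for i
  proof -
    have "g i ^ (2 * p - 1) * g i = g i ^ (Suc (2 * p - 1))" by simp
    also have "Suc (2 * p - 1) = 2 * p" using p by simp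
    finally show ?thesis by (simp add: power_mult)
  qed
  have diff: "?x j ^ p - ?x i ^ p = (?x j - ?x i) * ?s i j" for i j
  proof -
    have "?s i j = (\<Sum>a<p. ?x i ^ (p - Suc a) * ?x j ^ a)"
      by (rule sum.reindex_bij_witness[of _ "\<lambda>a. p - 1 - a" "\<lambda>a. p - 1 - a"]) auto
    then show ?thesis using power_diff_sumr2[of "?x j" p "?x i"] by simp
  qed
  have "(\<Sum>i<k. g i ^ (2 * p - 1) * (\<Sum>e\<in>lpairs k. (2 * ?d e * ((if snd e = i then 2 * g i else 0) - (if fst e = i then 2 * g i else 0))) * ?R e))
     = (\<Sum>e\<in>lpairs k. \<Sum>i<k. 2 * ?d e * ?R e * ((if snd e = i then 2 * ?x i ^ p else 0) - (if fst e = i then 2 * ?x i ^ p else 0)))"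
    unfolding sum_distrib_left
    by (subst sum.swap, intro sum.cong refl) (auto simp: pw[symmetric] algebra_simps)
  also have "\<dots> = (\<Sum>e\<in>lpairs k. Wg k g * (4 * ?s (fst e) (snd e)))"
  proof (intro sum.cong refl)
    fix e assume e: "e \<in> lpairs k"
    then have lt: "fst e < k" "snd e < k" by (auto simp: lpairs_def)
    have "(\<Sum>i<k. 2 * ?d e * ?R e * ((if snd e = i then 2 * ?x i ^ p else 0) - (if fst e = i then 2 * ?x i ^ p else 0)))
       = 2 * ?d e * ?R e * ((\<Sum>i<k. if snd e = i then 2 * ?x i ^ p else 0) - (\<Sum>i<k. if fst e = i then 2 * ?x i ^ p else 0))"
      by (simp only: sum_distrib_left[symmetric] sum_subtractf)
    also have "\<dots> = 2 * ?d e * ?R e * (2 * (?x (snd e) ^ p - ?x (fst e) ^ p))" using lt by simp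
    also have "\<dots> = (?d e)\<^sup>2 * ?R e * (4 * ?s (fst e) (snd e))" unfolding diff by (simp add: power2_eq_square)
    also have "(?d e)\<^sup>2 * ?R e = Wg k g" unfolding Wg_def case_prod_beta using e by (intro prod.remove[symmetric]) auto
    finally show "(\<Sum>i<k. 2 * ?d e * ?R e * ((if snd e = i then 2 * ?x i ^ p else 0) - (if fst e = i then 2 * ?x i ^ p else 0))) = Wg k g * (4 * ?s (fst e) (snd e))" .
  qed
  also have "\<dots> = Wg k g * (4 * (\<Sum>e\<in>lpairs k. ?s (fst e) (snd e)))" by (simp add: sum_distrib_left)
  also have "4 * (\<Sum>e\<in>lpairs k. ?s (fst e) (snd e)) = 2 * (\<Sum>a<p. Pp k a g * Pp k (p - 1 - a) g) - 2 * real p * Pp k (p - 1) g"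
  proof -
    have sym: "?s i j = ?s j i" for i j
      by (rule sum.reindex_bij_witness[of _ "\<lambda>a. p - 1 - a" "\<lambda>a. p - 1 - a"]) auto
    define D where "D = (\<lambda>i. (i, i)) ` {..<k}"
    define U where "U = (\<lambda>(i, j). (j, i)) ` lpairs k"
    have all: "{..<k} \<times> {..<k} = lpairs k \<union> (U \<union> D)"
      by (auto simp: lpairs_def D_def U_def image_iff)
    have "(\<Sum>e\<in>{..<k} \<times> {..<k}. ?s (fst e) (snd e)) = (\<Sum>e\<in>lpairs k. ?s (fst e) (snd e)) + (\<Sum>e\<in>U \<union> D. ?s (fst e) (snd e))"
      unfolding all by (rule sum.union_disjoint) (auto simp: lpairs_def D_def U_def intro!: finite_imageI finite_lpairs[unfolded lpairs_def])
    also have "(\<Sum>e\<in>U \<union> D. ?s (fst e) (snd e)) = (\<Sum>e\<in>U. ?s (fst e) (snd e)) + (\<Sum>e\<in>D. ?s (fst e) (snd e))"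
      by (rule sum.union_disjoint) (auto simp: lpairs_def D_def U_def intro!: finite_imageI finite_lpairs[unfolded lpairs_def])
    also have "(\<Sum>e\<in>U. ?s (fst e) (snd e)) = (\<Sum>e\<in>lpairs k. ?s (snd e) (fst e))"
      unfolding U_def by (subst sum.reindex) (auto simp: inj_on_def case_prod_beta)
    also have "\<dots> = (\<Sum>e\<in>lpairs k. ?s (fst e) (snd e))" by (intro sum.cong refl sym)
    also have "(\<Sum>e\<in>D. ?s (fst e) (snd e)) = (\<Sum>i<k. ?s i i)"
      unfolding D_def by (subst sum.reindex) (auto simp: inj_on_def)
    also have "\<dots> = (\<Sum>i<k. real p * g i ^ (2 * (p - 1)))"
    proof (intro sum.cong refl)
      fix i
      have "?s i i = (\<Sum>a<p. ?x i ^ (p - 1))" by (intro sum.cong refl) (auto simp: power_add[symmetric])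
      then show "?s i i = real p * g i ^ (2 * (p - 1))" by (simp add: power_mult)
    qed
    also have "\<dots> = real p * Pp k (p - 1) g" by (simp add: Pp_def sum_distrib_left)
    finally have 1: "(\<Sum>e\<in>{..<k} \<times> {..<k}. ?s (fst e) (snd e)) = 2 * (\<Sum>e\<in>lpairs k. ?s (fst e) (snd e)) + real p * Pp k (p - 1) g" by simp
    have "(\<Sum>e\<in>{..<k} \<times> {..<k}. ?s (fst e) (snd e)) = (\<Sum>a<p. \<Sum>e\<in>{..<k} \<times> {..<k}. ?x (fst e) ^ a * ?x (snd e) ^ (p - 1 - a))"
      by (rule sum.swap)
    also have "\<dots> = (\<Sum>a<p. Pp k a g * Pp k (p - 1 - a) g)"
      unfolding Pp_def by (intro sum.cong refl) (simp add: sum_product sum.cartesian_product power_mult case_prod_beta)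
    finally show ?thesis using 1 by simp
  qed
  finally show ?thesis .
qed

definition T2 :: "nat \<Rightarrow> nat list \<Rightarrow> real" where
  "T2 k qs = (LINT g|gauss {..<k}. Wg k g * prod_list (map (\<lambda>q. Sg k q g) qs))"

text \<open>One factor g_i is split off from g_i^(2p) and integrated by parts. The weight
  contributes - 2 p and the remaining power 2 p - 1 copies of the power sum of order p - 1, which
  leaves the single term with coefficient -1 of the recursion.\<close>

lemma loop_T2: "loop_rec (T2 k)"
  unfolding loop_rec_def
proof (intro allI impI)
  fix p :: nat and qs :: "nat list" assume p: "p \<ge> 1"
  define I where "I = {..<k}"
  have fin: "finite I" by (simp add: I_def)
  define Pi where "Pi = (\<lambda>g. prod_list (map (\<lambda>q. Sg k q g) qs))"
  define Pu where "Pu = (\<lambda>u g. prod_list (map (\<lambda>q. Sg k q g) (del_nth u qs)))"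
  define W where "W = Wg k"
  define dW where "dW = (\<lambda>i g. \<Sum>e\<in>lpairs k. (2 * ((g (snd e))\<^sup>2 - (g (fst e))\<^sup>2) * ((if snd e = i then 2 * g i else 0) - (if fst e = i then 2 * g i else 0)))
        * (\<Prod>e'\<in>lpairs k - {e}. ((g (snd e'))\<^sup>2 - (g (fst e'))\<^sup>2)\<^sup>2) :: real)"
  have pfPi: "pf I Pi" unfolding Pi_def I_def by (intro pf_prod_list pf_Sg)
  have pfPu: "pf I (Pu u)" for u unfolding Pu_def I_def by (intro pf_prod_list pf_Sg)
  have pfW: "pf I W" unfolding W_def I_def by (rule pf_Wg)
  have pfS: "pf I (Sg k q)" for q unfolding I_def by (rule pf_Sg)
  have int: "integrable (gauss I) f" if "pf I f" for f using pf_integrable[OF that fin] .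
  define dPi where "dPi = (\<lambda>i g. \<Sum>u<length qs. (2 ^ (qs ! u + 1) * (real (2 * (qs ! u)) * g i ^ (2 * (qs ! u) - 1))) * Pu u g)"
  define G where "G = (\<lambda>i g. g i ^ (2 * p - 1) * (Pi g * dW i g + dPi i g * W g) + real (2 * p - 1) * g i ^ (2 * p - 1 - 1) * (Pi g * W g))"
  have st: "pf I (G i)" "(LINT g|gauss I. g i * (g i ^ (2 * p - 1) * (Pi g * W g))) = (LINT g|gauss I. G i g)" if i: "i < k" for i
  proof -
    have d: "((\<lambda>t. (g(i := t)) i ^ (2 * p - 1) * (Pi (g(i := t)) * W (g(i := t)))) has_real_derivative G i g) (at (g i))" for g
    proof -
      have "((\<lambda>t. Sg k q (g(i := t))) has_real_derivative 2 ^ (q + 1) * (real (2 * q) * g i ^ (2 * q - 1))) (at (g i))" for q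
        unfolding Sg_def by (intro DERIV_cmult Pp_has_derivative i)
      from prod_list_has_derivative[of "\<lambda>q t. Sg k q (g(i := t))", OF this, of qs]
      have 1: "((\<lambda>t. Pi (g(i := t))) has_real_derivative dPi i g) (at (g i))"
        unfolding Pi_def Pu_def dPi_def by (simp only: fun_upd_triv)
      have 2: "((\<lambda>t. W (g(i := t))) has_real_derivative dW i g) (at (g i))"
        unfolding W_def dW_def by (rule Wg_has_derivative)
      have 3: "((\<lambda>t. (g(i := t)) i ^ (2 * p - 1)) has_real_derivative real (2 * p - 1) * g i ^ (2 * p - 1 - 1)) (at (g i))"
        using coord_pow_has_derivative[of g i i "2 * p - 1"] by simp
      show ?thesis using DERIV_mult'[OF 3 DERIV_mult'[OF 1 2]] unfolding G_def by (simp only: fun_upd_triv)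
    qed
    have pff: "pf I (\<lambda>g. g i ^ (2 * p - 1) * (Pi g * W g))"
      using i by (intro pf_mult pf_power pf_coord pfPi pfW fin) (auto simp: I_def)
    show "pf I (G i)" by (rule stein(1)[OF pff fin _ d]) (use i in \<open>auto simp: I_def\<close>)
    show "(LINT g|gauss I. g i * (g i ^ (2 * p - 1) * (Pi g * W g))) = (LINT g|gauss I. G i g)"
      by (rule stein(2)[OF pff fin _ d]) (use i in \<open>auto simp: I_def\<close>)
  qed
  have point: "Pp k p g * (Pi g * W g) = (\<Sum>i<k. g i * (g i ^ (2 * p - 1) * (Pi g * W g)))" for g
  proof -
    have "g i ^ (2 * p) = g i * g i ^ (2 * p - 1)" for i
    proof -
      have "2 * p = Suc (2 * p - 1)" using p by simp
      then show ?thesis by (metis power_Suc)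
    qed
    then show ?thesis by (simp add: Pp_def sum_distrib_right mult.assoc)
  qed
  define rhs where "rhs = (\<lambda>g. - (Pp k (p - 1) g * (Pi g * W g)) + 2 * (\<Sum>a<p. Pp k a g * Pp k (p - 1 - a) g * (Pi g * W g))
     + (\<Sum>u<length qs. 2 ^ (qs ! u + 1) * (real (2 * (qs ! u)) * Pp k (p + qs ! u - 1) g * (Pu u g * W g))))"
  have sumG: "(\<Sum>i<k. G i g) = rhs g" for g
  proof -
    have A: "(\<Sum>i<k. g i ^ (2 * p - 1) * dW i g) = W g * (2 * (\<Sum>a<p. Pp k a g * Pp k (p - 1 - a) g) - 2 * real p * Pp k (p - 1) g)"
      unfolding dW_def W_def by (rule Wg_euler[OF p])
    have B: "(\<Sum>i<k. g i ^ (2 * p - 1) * dPi i g) = (\<Sum>u<length qs. 2 ^ (qs ! u + 1) * (real (2 * (qs ! u)) * Pp k (p + qs ! u - 1) g * Pu u g))"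
    proof -
      have "(\<Sum>i<k. g i ^ (2 * p - 1) * dPi i g) = (\<Sum>u<length qs. \<Sum>i<k. g i ^ (2 * p - 1) * ((2 ^ (qs ! u + 1) * (real (2 * (qs ! u)) * g i ^ (2 * (qs ! u) - 1))) * Pu u g))"
        unfolding dPi_def sum_distrib_left by (rule sum.swap)
      also have "\<dots> = (\<Sum>u<length qs. 2 ^ (qs ! u + 1) * (real (2 * (qs ! u)) * Pp k (p + qs ! u - 1) g * Pu u g))"
      proof (intro sum.cong refl)
        fix u
        show "(\<Sum>i<k. g i ^ (2 * p - 1) * ((2 ^ (qs ! u + 1) * (real (2 * (qs ! u)) * g i ^ (2 * (qs ! u) - 1))) * Pu u g))
           = 2 ^ (qs ! u + 1) * (real (2 * (qs ! u)) * Pp k (p + qs ! u - 1) g * Pu u g)"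
        proof (cases "qs ! u = 0")
          case False
          then have "2 * p - 1 + (2 * (qs ! u) - 1) = 2 * (p + qs ! u - 1)" using p by auto
          then have e: "g i ^ (2 * p - 1) * g i ^ (2 * (qs ! u) - 1) = g i ^ (2 * (p + qs ! u - 1))" for i
            by (metis power_add)
          show ?thesis unfolding Pp_def e[symmetric] sum_distrib_left sum_distrib_right by (intro sum.cong refl) (simp add: mult_ac)
        qed simp
      qed
      finally show ?thesis .
    qed
    have C: "(\<Sum>i<k. g i ^ (2 * p - 1 - 1)) = Pp k (p - 1) g"
      unfolding Pp_def by (intro sum.cong refl arg_cong2[where f = "(^)"]) auto
    have "(\<Sum>i<k. G i g) = (\<Sum>i<k. g i ^ (2 * p - 1) * dW i g) * Pi g + (\<Sum>i<k. g i ^ (2 * p - 1) * dPi i g) * W g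
        + real (2 * p - 1) * (\<Sum>i<k. g i ^ (2 * p - 1 - 1)) * (Pi g * W g)"
      unfolding G_def by (simp add: sum.distrib distrib_left sum_distrib_left sum_distrib_right mult_ac)
    also have "\<dots> = rhs g"
    proof -
      have r: "real (2 * p - 1) = 2 * real p - 1" using p by (simp add: of_nat_diff)
      have s1: "2 * (\<Sum>a<p. Pp k a g * Pp k (p - 1 - a) g * (Pi g * W g)) = W g * (2 * (\<Sum>a<p. Pp k a g * Pp k (p - 1 - a) g)) * Pi g"
        by (simp add: sum_distrib_left sum_distrib_right mult_ac)
      have s2: "(\<Sum>u<length qs. 2 ^ (qs ! u + 1) * (real (2 * (qs ! u)) * Pp k (p + qs ! u - 1) g * (Pu u g * W g)))
         = (\<Sum>u<length qs. 2 ^ (qs ! u + 1) * (real (2 * (qs ! u)) * Pp k (p + qs ! u - 1) g * Pu u g)) * W g"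
        unfolding sum_distrib_right by (intro sum.cong refl) (simp only: mult.assoc)
      define X Y Z where "X = (\<Sum>a<p. Pp k a g * Pp k (p - 1 - a) g)" and "Y = Pp k (p - 1) g" 
        and "Z = (\<Sum>u<length qs. 2 ^ (qs ! u + 1) * (real (2 * (qs ! u)) * Pp k (p + qs ! u - 1) g * Pu u g))"
      show ?thesis unfolding rhs_def A B C r s1 s2 X_def[symmetric] Y_def[symmetric] Z_def[symmetric] by (simp add: algebra_simps)
    qed
    finally show ?thesis .
  qed
  have pPp: "pf I (Pp k q)" for q unfolding I_def by (rule pf_Pp)
  have "(LINT g|gauss I. Pp k p g * (Pi g * W g)) = (\<Sum>i<k. (LINT g|gauss I. g i * (g i ^ (2 * p - 1) * (Pi g * W g))))"
    unfolding point
    by (intro Bochner_Integration.integral_sum int pf_mult pf_power pf_coord pfPi pfW fin) (auto simp: I_def)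
  also have "\<dots> = (\<Sum>i<k. (LINT g|gauss I. G i g))" using st(2) by simp
  also have "\<dots> = (LINT g|gauss I. (\<Sum>i<k. G i g))" by (intro Bochner_Integration.integral_sum[symmetric] int st(1)) auto
  finally have main: "(LINT g|gauss I. Pp k p g * (Pi g * W g)) = (LINT g|gauss I. rhs g)" unfolding sumG .
  have rhs_int: "(LINT g|gauss I. rhs g) = - (LINT g|gauss I. Pp k (p - 1) g * (Pi g * W g)) + 2 * (\<Sum>a<p. (LINT g|gauss I. Pp k a g * Pp k (p - 1 - a) g * (Pi g * W g)))
     + (\<Sum>u<length qs. 2 ^ (qs ! u + 1) * (real (2 * (qs ! u)) * (LINT g|gauss I. Pp k (p + qs ! u - 1) g * (Pu u g * W g))))"
  proof -
    have i1: "integrable (gauss I) (\<lambda>g. Pp k (p - 1) g * (Pi g * W g))" by (intro int pf_mult pPp pfPi pfW)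
    have i2: "integrable (gauss I) (\<lambda>g. Pp k a g * Pp k (p - 1 - a) g * (Pi g * W g))" for a by (intro int pf_mult pPp pfPi pfW)
    have i3: "integrable (gauss I) (\<lambda>g. Pp k (p + qs ! u - 1) g * (Pu u g * W g))" for u by (intro int pf_mult pPp pfPu pfW)
    show ?thesis unfolding rhs_def using i1 i2 i3
      by (simp add: Bochner_Integration.integral_add Bochner_Integration.integral_sum mult.assoc)
  qed
  have tt: "T2 k (q # qs') = 2 ^ (q + 1) * (LINT g|gauss I. Pp k q g * (prod_list (map (\<lambda>q. Sg k q g) qs') * W g))" for q qs'
    unfolding T2_def I_def W_def by (subst integral_mult_right_zero[symmetric]) (simp add: Sg_def mult_ac)
  have t1: "T2 k (p # qs) = 2 ^ (p + 1) * (LINT g|gauss I. Pp k p g * (Pi g * W g))" unfolding tt Pi_def ..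
  have t2: "2 ^ p * (LINT g|gauss I. Pp k (p - 1) g * (Pi g * W g)) = T2 k ((p - 1) # qs)"
    unfolding tt Pi_def using p by simp
  have t3: "2 ^ (p + 1) * (LINT g|gauss I. Pp k a g * Pp k (p - 1 - a) g * (Pi g * W g)) = T2 k (a # (p - 1 - a) # qs)" if "a < p" for a
  proof -
    have "T2 k (a # (p - 1 - a) # qs) = 2 ^ (a + 1) * (2 ^ (p - 1 - a + 1) * (LINT g|gauss I. Pp k a g * Pp k (p - 1 - a) g * (Pi g * W g)))"
      unfolding tt Pi_def by (subst (2) integral_mult_right_zero[symmetric]) (simp add: Sg_def mult_ac)
    also have "\<dots> = 2 ^ (a + 1 + (p - 1 - a + 1)) * (LINT g|gauss I. Pp k a g * Pp k (p - 1 - a) g * (Pi g * W g))"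
      by (simp only: power_add mult.assoc)
    also have "a + 1 + (p - 1 - a + 1) = p + 1" using that by simp
    finally show ?thesis by simp
  qed
  have t4: "real (qs ! u) * (2 ^ (p + 1) * (2 ^ (qs ! u + 1) * (LINT g|gauss I. Pp k (p + qs ! u - 1) g * (Pu u g * W g)))) = 4 * (real (qs ! u) * T2 k ((p + qs ! u - 1) # del_nth u qs))" for u
  proof -
    have "(2::real) ^ (p + 1) * 2 ^ (qs ! u + 1) = 4 * 2 ^ (p + qs ! u - 1 + 1)"
      unfolding power_add[symmetric] using p by (simp add: power_add)
    then show ?thesis unfolding tt Pu_def by (simp add: mult.assoc[symmetric])
  qed
  have "T2 k (p # qs) = - (2 * (2 ^ p * (LINT g|gauss I. Pp k (p - 1) g * (Pi g * W g)))) + 2 * (\<Sum>a<p. 2 ^ (p + 1) * (LINT g|gauss I. Pp k a g * Pp k (p - 1 - a) g * (Pi g * W g)))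
     + 2 * (\<Sum>u<length qs. real (qs ! u) * (2 ^ (p + 1) * (2 ^ (qs ! u + 1) * (LINT g|gauss I. Pp k (p + qs ! u - 1) g * (Pu u g * W g)))))"
  proof -
    have "2 ^ (p + 1) * (- x + 2 * (\<Sum>a<p. f a) + (\<Sum>u<n. 2 ^ (e u + 1) * (real (2 * e u) * h u)))
       = - (2 * (2 ^ p * x)) + 2 * (\<Sum>a<p. 2 ^ (p + 1) * f a) + 2 * (\<Sum>u<n. real (e u) * (2 ^ (p + 1) * (2 ^ (e u + 1) * h u)))"
      for x :: real and f h :: "nat \<Rightarrow> real" and e n
      unfolding distrib_left sum_distrib_left
      by (intro arg_cong2[where f = "(+)"] sum.cong refl) simp_all
    then show ?thesis unfolding t1 main rhs_int .
  qed
  also have "\<dots> = - (2 * T2 k ((p - 1) # qs)) + 2 * (\<Sum>a<p. T2 k (a # (p - 1 - a) # qs)) + 2 * (\<Sum>u<length qs. 4 * (real (qs ! u) * T2 k ((p + qs ! u - 1) # del_nth u qs)))"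
    unfolding t2 t4 using t3 by simp
  finally show "T2 k (p # qs) = 2 * (- T2 k ((p - 1) # qs) + (\<Sum>a<p. T2 k (a # (p - 1 - a) # qs)))
     + 8 * (\<Sum>u<length qs. real (qs ! u) * T2 k ((p + qs ! u - 1) # del_nth u qs))"
    by (simp add: sum_distrib_left[symmetric])
qed

text \<open>Size 2 k is what makes the initial values agree: the trace of the identity is 2 k, and
  so is \<open>Sg k 0\<close>.\<close>

lemma T1_eq_T2:
  assumes "T2 k [] \<noteq> 0"
  shows "T1 (2 * k) qs = T2 k qs / T2 k []"
proof (rule loop_rec_unique[of "T1 (2 * k)" "\<lambda>qs. T2 k qs / T2 k []" "2 * real k"])
  show "loop_rec (T1 (2 * k))" by (rule loop_T1)
  show "loop_rec (\<lambda>qs. T2 k qs / T2 k [])"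
    unfolding loop_rec_def
  proof (intro allI impI)
    fix p :: nat and qs :: "nat list" assume "p \<ge> 1"
    then have "T2 k (p # qs) = 2 * (- T2 k ((p - 1) # qs) + (\<Sum>a<p. T2 k (a # (p - 1 - a) # qs))) + 8 * (\<Sum>u<length qs. real (qs ! u) * T2 k ((p + qs ! u - 1) # del_nth u qs))"
      using loop_T2[of k] unfolding loop_rec_def by blast
    then show "T2 k (p # qs) / T2 k [] = 2 * (- (T2 k ((p - 1) # qs) / T2 k []) + (\<Sum>a<p. T2 k (a # (p - 1 - a) # qs) / T2 k [])) + 8 * (\<Sum>u<length qs. real (qs ! u) * (T2 k ((p + qs ! u - 1) # del_nth u qs) / T2 k []))"
      by (simp add: add_divide_distrib sum_divide_distrib[symmetric] diff_divide_distrib)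
  qed
  interpret prob_space "gauss (sq (2 * k))" by (rule prob_space_gauss)
  show "T1 (2 * k) [] = T2 k [] / T2 k []" using assms by (simp add: T1_def prob_space)
  have "Sm (2 * k) 0 Y = 2 * real k" for Y by (simp add: Sm_def trm_def)
  then show "T1 (2 * k) (0 # qs) = 2 * real k * T1 (2 * k) qs" for qs by (simp add: T1_def)
  have "Sg k 0 g = 2 * real k" for g by (simp add: Sg_def Pp_def)
  then have "T2 k (0 # qs) = (LINT g|gauss {..<k}. 2 * real k * (Wg k g * prod_list (map (\<lambda>q. Sg k q g) qs)))" for qs
    unfolding T2_def by (intro Bochner_Integration.integral_cong) (simp_all add: mult_ac)
  then have "T2 k (0 # qs) = 2 * real k * T2 k qs" for qs
    unfolding T2_def by (simp only: integral_mult_right_zero)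
  then show "T2 k (0 # qs) / T2 k [] = 2 * real k * (T2 k qs / T2 k [])" for qs by simp
qed

section \<open>Determinacy of point configurations by moments\<close>

text \<open>Power sums with exponential damping. The damping grows in steps of 1/16, small enough
  for the growth condition to hold in the Gaussian models, see \<open>T2_growth\<close>.\<close>

definition st :: "(nat \<Rightarrow> 'a \<Rightarrow> real) \<Rightarrow> nat \<Rightarrow> nat \<Rightarrow> nat \<Rightarrow> 'a \<Rightarrow> real" where
  "st X d a i \<omega> = (\<Sum>j<d. X j \<omega> ^ a * exp (- (real i / 16 * X j \<omega>)))"

definition pl :: "(nat \<Rightarrow> 'a \<Rightarrow> real) \<Rightarrow> nat \<Rightarrow> (nat \<times> nat) list \<Rightarrow> 'a \<Rightarrow> real" where
  "pl X d ps \<omega> = prod_list (map (\<lambda>(a, i). st X d a i \<omega>) ps)"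

lemma exp_taylor_bound:
  fixes y :: real
  assumes "y \<ge> 0"
  shows "\<bar>exp (- y) - (\<Sum>p<P. (- y) ^ p / fact p)\<bar> \<le> y ^ P / fact P"
proof (cases "y = 0 \<or> P = 0")
  case True
  then show ?thesis
  proof
    assume "y = 0"
    then show ?thesis
      by (cases P) (auto simp: sum.lessThan_Suc_shift simp del: sum.lessThan_Suc)
  qed (use assms in auto)
next
  case False
  then have "- y < 0" "0 < P" using assms by auto
  then obtain t where t: "- y < t" "t < 0" "exp (- y) = (\<Sum>m<P. exp 0 / fact m * (- y) ^ m) + exp t / fact P * (- y) ^ P"
    using Maclaurin_minus[of "- y" P "\<lambda>_. exp" exp] by auto
  then have "exp (- y) - (\<Sum>p<P. (- y) ^ p / fact p) = exp t / fact P * (- y) ^ P" by simp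
  then have "\<bar>exp (- y) - (\<Sum>p<P. (- y) ^ p / fact p)\<bar> = exp t * (y ^ P / fact P)"
    using assms by (simp add: abs_mult power_abs)
  also have "\<dots> \<le> 1 * (y ^ P / fact P)" using t assms by (intro mult_right_mono) auto
  finally show ?thesis by simp
qed

lemma power_over_fact_tendsto_0: "(\<lambda>n. x ^ n / fact n :: real) \<longlonglongrightarrow> 0"
  using summable_LIMSEQ_zero[OF summable_exp[of x]] by (simp add: field_simps)

text \<open>
  The growth condition allows the Taylor expansion of $e^{-\lambda/16}$ to be integrated term by term; iterating this step
  reaches all polynomials in $e^{-\lambda/16}$, which are dense by the Weierstrass theorem.
\<close>
locale pmodel = prob_space M for M :: "'a measure" +
  fixes X :: "nat \<Rightarrow> 'a \<Rightarrow> real" and d :: nat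
  assumes X_nonneg: "j < d \<Longrightarrow> \<omega> \<in> space M \<Longrightarrow> X j \<omega> \<ge> 0"
    and meas0: "(\<lambda>\<omega>. \<Sum>j<d. X j \<omega> ^ q) \<in> borel_measurable M"
    and int0: "integrable M (\<lambda>\<omega>. prod_list (map (\<lambda>q. \<Sum>j<d. X j \<omega> ^ q) qs))"
    and growth: "(\<lambda>P. (1 / 16) ^ P / fact P * (LINT \<omega>|M. (\<Sum>j<d. X j \<omega> ^ (a + P)) * prod_list (map (\<lambda>q. \<Sum>j<d. X j \<omega> ^ q) qs))) \<longlonglongrightarrow> 0"
begin

lemma st_0: "st X d a 0 \<omega> = (\<Sum>j<d. X j \<omega> ^ a)"
  by (simp add: st_def)

lemma st_nonneg: "\<omega> \<in> space M \<Longrightarrow> st X d a i \<omega> \<ge> 0"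
  unfolding st_def by (intro sum_nonneg mult_nonneg_nonneg zero_le_power) (auto intro: X_nonneg)

lemma st_le: "\<omega> \<in> space M \<Longrightarrow> st X d a i \<omega> \<le> st X d a 0 \<omega>"
  unfolding st_def by (intro sum_mono mult_left_mono zero_le_power) (auto intro!: mult_nonneg_nonneg X_nonneg)

lemma st_taylor:
  assumes "\<omega> \<in> space M"
  shows "\<bar>st X d a (Suc i) \<omega> - (\<Sum>p<P. (- 1 / 16) ^ p / fact p * st X d (a + p) i \<omega>)\<bar> \<le> (1 / 16) ^ P / fact P * st X d (a + P) 0 \<omega>"
proof -
  let ?e = "\<lambda>j. exp (- (real i / 16 * X j \<omega>))" and ?y = "\<lambda>j. X j \<omega> / 16"
  have X: "X j \<omega> \<ge> 0" if "j < d" for j using X_nonneg[OF that assms] .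
  have "(\<Sum>p<P. (- 1 / 16) ^ p / fact p * st X d (a + p) i \<omega>) = (\<Sum>p<P. \<Sum>j<d. X j \<omega> ^ a * ?e j * ((- ?y j) ^ p / fact p))"
    unfolding st_def sum_distrib_left
    by (intro sum.cong refl) (simp add: power_add power_divide power_minus[of "X _ _"] power_minus[of "X _ _ / 16"] power_minus[of "1 / 16"] mult_ac)
  also have "\<dots> = (\<Sum>j<d. X j \<omega> ^ a * ?e j * (\<Sum>p<P. (- ?y j) ^ p / fact p))"
    unfolding sum_distrib_left by (rule sum.swap)
  finally have E: "(\<Sum>p<P. (- 1 / 16) ^ p / fact p * st X d (a + p) i \<omega>) = (\<Sum>j<d. X j \<omega> ^ a * ?e j * (\<Sum>p<P. (- ?y j) ^ p / fact p))" .
  have ex: "exp (- (real (Suc i) / 16 * X j \<omega>)) = ?e j * exp (- ?y j)" for j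
    by (simp add: exp_add[symmetric] field_simps)
  have "st X d a (Suc i) \<omega> - (\<Sum>p<P. (- 1 / 16) ^ p / fact p * st X d (a + p) i \<omega>)
      = (\<Sum>j<d. X j \<omega> ^ a * ?e j * (exp (- ?y j) - (\<Sum>p<P. (- ?y j) ^ p / fact p)))"
    unfolding E st_def[of X d a "Suc i"] ex by (simp only: right_diff_distrib sum_subtractf mult.assoc)
  then have "\<bar>st X d a (Suc i) \<omega> - (\<Sum>p<P. (- 1 / 16) ^ p / fact p * st X d (a + p) i \<omega>)\<bar>
      = \<bar>\<Sum>j<d. X j \<omega> ^ a * ?e j * (exp (- ?y j) - (\<Sum>p<P. (- ?y j) ^ p / fact p))\<bar>" by (simp only:)
  also have "\<dots> \<le> (\<Sum>j<d. \<bar>X j \<omega> ^ a * ?e j * (exp (- ?y j) - (\<Sum>p<P. (- ?y j) ^ p / fact p))\<bar>)"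
    by (rule sum_abs)
  also have "\<dots> \<le> (\<Sum>j<d. X j \<omega> ^ a * 1 * (?y j ^ P / fact P))"
    unfolding abs_mult
    by (intro sum_mono mult_mono exp_taylor_bound) (auto simp: X)
  also have "\<dots> = (1 / 16) ^ P / fact P * st X d (a + P) 0 \<omega>"
    unfolding st_0 sum_distrib_left by (intro sum.cong refl) (simp add: power_add power_divide)
  finally show ?thesis .
qed

lemma st_measurable [measurable]: "st X d a i \<in> borel_measurable M"
proof (induction i arbitrary: a)
  case 0
  have "st X d a 0 = (\<lambda>\<omega>. \<Sum>j<d. X j \<omega> ^ a)" by (auto simp: st_0)
  then show ?case using meas0 by simp
next
  case (Suc i)
  show ?case
  proof (rule borel_measurable_LIMSEQ_real)
    fix \<omega> assume \<omega>: "\<omega> \<in> space M"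
    have "(\<lambda>P. \<Sum>j<d. X j \<omega> ^ a * ((X j \<omega> / 16) ^ P / fact P)) \<longlonglongrightarrow> (\<Sum>j<d. X j \<omega> ^ a * 0)"
      by (intro tendsto_sum tendsto_mult tendsto_const power_over_fact_tendsto_0)
    moreover have "(\<Sum>j<d. X j \<omega> ^ a * ((X j \<omega> / 16) ^ P / fact P)) = (1 / 16) ^ P / fact P * st X d (a + P) 0 \<omega>" for P
      unfolding st_0 sum_distrib_left by (intro sum.cong refl) (simp add: power_add power_divide)
    ultimately have lim: "(\<lambda>P. (1 / 16) ^ P / fact P * st X d (a + P) 0 \<omega>) \<longlonglongrightarrow> 0" by simp
    have "(\<lambda>P. st X d a (Suc i) \<omega> - (\<Sum>p<P. (- 1 / 16) ^ p / fact p * st X d (a + p) i \<omega>)) \<longlonglongrightarrow> 0"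
      by (rule Lim_null_comparison[OF _ lim]) (use st_taylor[OF \<omega>] in auto)
    from tendsto_diff[OF tendsto_const this, of "st X d a (Suc i) \<omega>"]
    show "(\<lambda>P. \<Sum>p<P. (- 1 / 16) ^ p / fact p * st X d (a + p) i \<omega>) \<longlonglongrightarrow> st X d a (Suc i) \<omega>" by simp
  qed (use Suc in measurable)
qed

lemma pl_measurable [measurable]: "pl X d ps \<in> borel_measurable M"
proof -
  have "(\<lambda>\<omega>. prod_list (map (\<lambda>(a, i). st X d a i \<omega>) ps)) \<in> borel_measurable M"
    by (induction ps) (auto simp: case_prod_beta)
  then show ?thesis by (simp add: pl_def[abs_def])
qed

lemma pl_nonneg: "\<omega> \<in> space M \<Longrightarrow> pl X d ps \<omega> \<ge> 0"
  unfolding pl_def by (induction ps) (auto simp: st_nonneg)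

lemma pl_le: "\<omega> \<in> space M \<Longrightarrow> pl X d ps \<omega> \<le> prod_list (map (\<lambda>q. \<Sum>j<d. X j \<omega> ^ q) (map fst ps))"
proof (induction ps)
  case (Cons p ps)
  have "st X d (fst p) (snd p) \<omega> * pl X d ps \<omega> \<le> (\<Sum>j<d. X j \<omega> ^ fst p) * prod_list (map (\<lambda>q. \<Sum>j<d. X j \<omega> ^ q) (map fst ps))"
    using Cons st_le[of \<omega> "fst p" "snd p"] st_nonneg[of \<omega> "fst p" 0] pl_nonneg[of \<omega> ps] by (intro mult_mono) (auto simp: st_0)
  then show ?case by (simp add: pl_def case_prod_beta)
qed (simp add: pl_def)

lemma pl_integrable: "integrable M (pl X d ps)"
proof (rule Bochner_Integration.integrable_bound[OF int0[of "map fst ps"]])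
  show "AE \<omega> in M. norm (pl X d ps \<omega>) \<le> norm (prod_list (map (\<lambda>q. \<Sum>j<d. X j \<omega> ^ q) (map fst ps)))"
    using pl_le pl_nonneg by (intro AE_I2) (smt (verit) real_norm_def)
qed measurable

lemma st_pl: "st X d a i \<omega> * pl X d ps \<omega> = pl X d ((a, i) # ps) \<omega>"
  by (simp add: pl_def)

text \<open>One more step of damping is a power series in moments with one step less. The Taylor
  remainder is bounded by an undamped moment, which the growth condition sends to 0.\<close>

lemma st_sums:
  "(\<lambda>p. (- 1 / 16) ^ p / fact p * (LINT \<omega>|M. st X d (a + p) i \<omega> * pl X d ps \<omega>)) sums (LINT \<omega>|M. st X d a (Suc i) \<omega> * pl X d ps \<omega>)"
  unfolding sums_def
proof -
  let ?Q = "\<lambda>\<omega>. prod_list (map (\<lambda>q. \<Sum>j<d. X j \<omega> ^ q) (map fst ps))"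
  let ?D = "\<lambda>P. (LINT \<omega>|M. st X d a (Suc i) \<omega> * pl X d ps \<omega>) - (\<Sum>p<P. (- 1 / 16) ^ p / fact p * (LINT \<omega>|M. st X d (a + p) i \<omega> * pl X d ps \<omega>))"
  have int: "integrable M (\<lambda>\<omega>. st X d a i \<omega> * pl X d ps \<omega>)" for a i
    unfolding st_pl by (rule pl_integrable)
  have "norm (?D P) \<le> (1 / 16) ^ P / fact P * (LINT \<omega>|M. (\<Sum>j<d. X j \<omega> ^ (a + P)) * ?Q \<omega>)" for P
  proof -
    let ?f = "\<lambda>\<omega>. st X d a (Suc i) \<omega> * pl X d ps \<omega> - (\<Sum>p<P. (- 1 / 16) ^ p / fact p * (st X d (a + p) i \<omega> * pl X d ps \<omega>))"
    have intQ: "integrable M (\<lambda>\<omega>. (\<Sum>j<d. X j \<omega> ^ (a + P)) * ?Q \<omega>)"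
      using int0[of "(a + P) # map fst ps"] by simp
    have intf: "integrable M ?f"
      by (intro Bochner_Integration.integrable_diff Bochner_Integration.integrable_sum integrable_mult_right int)
    have D: "?D P = (LINT \<omega>|M. ?f \<omega>)"
      using int by (simp add: Bochner_Integration.integral_diff Bochner_Integration.integral_sum)
    have "norm (LINT \<omega>|M. ?f \<omega>) \<le> (LINT \<omega>|M. (1 / 16) ^ P / fact P * ((\<Sum>j<d. X j \<omega> ^ (a + P)) * ?Q \<omega>))"
    proof (rule order_trans[OF integral_norm_bound], rule integral_mono)
      fix \<omega> assume \<omega>: "\<omega> \<in> space M"
      have "?f \<omega> = (st X d a (Suc i) \<omega> - (\<Sum>p<P. (- 1 / 16) ^ p / fact p * st X d (a + p) i \<omega>)) * pl X d ps \<omega>"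
        by (simp add: left_diff_distrib sum_distrib_right mult.assoc)
      then have "norm (?f \<omega>) = \<bar>st X d a (Suc i) \<omega> - (\<Sum>p<P. (- 1 / 16) ^ p / fact p * st X d (a + p) i \<omega>)\<bar> * pl X d ps \<omega>"
        using pl_nonneg[OF \<omega>] by (simp add: abs_mult)
      also have "\<dots> \<le> ((1 / 16) ^ P / fact P * st X d (a + P) 0 \<omega>) * ?Q \<omega>"
        using st_nonneg[OF \<omega>] pl_nonneg[OF \<omega>] by (intro mult_mono st_taylor[OF \<omega>] pl_le[OF \<omega>]) auto
      finally show "norm (?f \<omega>) \<le> (1 / 16) ^ P / fact P * ((\<Sum>j<d. X j \<omega> ^ (a + P)) * ?Q \<omega>)"
        unfolding st_0 by (simp add: mult.assoc)
    qed (use intf intQ in auto)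
    then show ?thesis unfolding D by simp
  qed
  from Lim_null_comparison[OF always_eventually[OF allI[OF this]] growth]
  have "?D \<longlonglongrightarrow> 0" .
  from tendsto_diff[OF tendsto_const this, of "LINT \<omega>|M. st X d a (Suc i) \<omega> * pl X d ps \<omega>"]
  show "(\<lambda>n. \<Sum>p<n. (- 1 / 16) ^ p / fact p * (LINT \<omega>|M. st X d (a + p) i \<omega> * pl X d ps \<omega>)) \<longlonglongrightarrow> (LINT \<omega>|M. st X d a (Suc i) \<omega> * pl X d ps \<omega>)"
    by simp
qed

lemma lin_power_integrable:
  "integrable M (\<lambda>\<omega>. (\<Sum>i\<le>D. c i * st X d 0 i \<omega>) ^ m * pl X d ps \<omega>)"
proof (induction m arbitrary: ps)
  case 0
  then show ?case using pl_integrable by simp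
next
  case (Suc m)
  have "integrable M (\<lambda>\<omega>. \<Sum>i\<le>D. c i * ((\<Sum>i\<le>D. c i * st X d 0 i \<omega>) ^ m * pl X d ((0, i) # ps) \<omega>))"
    by (intro Bochner_Integration.integrable_sum integrable_mult_right Suc)
  also have "(\<lambda>\<omega>. \<Sum>i\<le>D. c i * ((\<Sum>i\<le>D. c i * st X d 0 i \<omega>) ^ m * pl X d ((0, i) # ps) \<omega>))
     = (\<lambda>\<omega>. (\<Sum>i\<le>D. c i * st X d 0 i \<omega>) ^ Suc m * pl X d ps \<omega>)"
    by (auto simp: st_pl[symmetric] sum_distrib_left sum_distrib_right mult_ac intro!: sum.cong)
  finally show ?case .
qed

lemma lin_power_Suc:
  "(LINT \<omega>|M. (\<Sum>i\<le>D. c i * st X d 0 i \<omega>) ^ Suc m * pl X d ps \<omega>)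
    = (\<Sum>i\<le>D. c i * (LINT \<omega>|M. (\<Sum>i\<le>D. c i * st X d 0 i \<omega>) ^ m * pl X d ((0, i) # ps) \<omega>))"
proof -
  have "(LINT \<omega>|M. (\<Sum>i\<le>D. c i * st X d 0 i \<omega>) ^ Suc m * pl X d ps \<omega>)
     = (LINT \<omega>|M. (\<Sum>i\<le>D. c i * ((\<Sum>i\<le>D. c i * st X d 0 i \<omega>) ^ m * pl X d ((0, i) # ps) \<omega>)))"
    by (intro Bochner_Integration.integral_cong refl)
       (auto simp: st_pl[symmetric] sum_distrib_left sum_distrib_right mult_ac intro!: sum.cong)
  also have "\<dots> = (\<Sum>i\<le>D. (LINT \<omega>|M. c i * ((\<Sum>i\<le>D. c i * st X d 0 i \<omega>) ^ m * pl X d ((0, i) # ps) \<omega>)))"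
    by (intro Bochner_Integration.integral_sum integrable_mult_right lin_power_integrable)
  finally show ?thesis by simp
qed

lemma bounded_limit:
  fixes S :: "nat \<Rightarrow> 'a \<Rightarrow> real"
  assumes lim: "\<And>\<omega>. \<omega> \<in> space M \<Longrightarrow> (\<lambda>r. S r \<omega>) \<longlonglongrightarrow> S' \<omega>"
    and bd: "\<And>r \<omega>. \<omega> \<in> space M \<Longrightarrow> \<bar>S r \<omega>\<bar> \<le> B"
    and ms [measurable]: "\<And>r. S r \<in> borel_measurable M"
  shows "S' \<in> borel_measurable M" "(\<lambda>r. LINT \<omega>|M. S r \<omega> ^ m) \<longlonglongrightarrow> (LINT \<omega>|M. S' \<omega> ^ m)"
proof -
  show [measurable]: "S' \<in> borel_measurable M"
    by (rule borel_measurable_LIMSEQ_real[OF lim ms])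
  show "(\<lambda>r. LINT \<omega>|M. S r \<omega> ^ m) \<longlonglongrightarrow> (LINT \<omega>|M. S' \<omega> ^ m)"
  proof (rule integral_dominated_convergence[where w = "\<lambda>_. B ^ m"])
    show "AE \<omega> in M. (\<lambda>r. S r \<omega> ^ m) \<longlonglongrightarrow> S' \<omega> ^ m"
      by (intro AE_I2 tendsto_power lim)
    show "AE \<omega> in M. norm (S r \<omega> ^ m) \<le> B ^ m" for r
      by (intro AE_I2) (auto simp: power_abs intro!: power_mono bd)
  qed auto
qed

end

text \<open>Undamped factors are collected in \<open>qs\<close>. A leading factor without damping
  just lengthens \<open>qs\<close>; its damping is then raised step by step through the convergent
  series of \<open>st_sums\<close>, whose terms agree in both models.\<close>

lemma pmodel_pl_eq:
  assumes "pmodel M1 X1 d" "pmodel M2 X2 d"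
    and eq: "\<And>qs. (LINT \<omega>|M1. prod_list (map (\<lambda>q. \<Sum>j<d. X1 j \<omega> ^ q) qs)) = (LINT \<omega>|M2. prod_list (map (\<lambda>q. \<Sum>j<d. X2 j \<omega> ^ q) qs))"
  shows "(LINT \<omega>|M1. pl X1 d ps \<omega>) = (LINT \<omega>|M2. pl X2 d ps \<omega>)"
proof -
  interpret A: pmodel M1 X1 d by fact
  interpret B: pmodel M2 X2 d by fact
  let ?z = "map (\<lambda>q. (q, 0 :: nat))"
  have "(LINT \<omega>|M1. pl X1 d (ps @ ?z qs) \<omega>) = (LINT \<omega>|M2. pl X2 d (ps @ ?z qs) \<omega>)" for qs
  proof (induction ps arbitrary: qs)
    case Nil
    have "pl X1 d (?z qs) \<omega> = prod_list (map (\<lambda>q. \<Sum>j<d. X1 j \<omega> ^ q) qs)" for \<omega>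
      by (simp add: pl_def comp_def A.st_0)
    moreover have "pl X2 d (?z qs) \<omega> = prod_list (map (\<lambda>q. \<Sum>j<d. X2 j \<omega> ^ q) qs)" for \<omega>
      by (simp add: pl_def comp_def B.st_0)
    ultimately show ?case using eq by simp
  next
    case (Cons x ps)
    have "(LINT \<omega>|M1. st X1 d a i \<omega> * pl X1 d (ps @ ?z qs) \<omega>) = (LINT \<omega>|M2. st X2 d a i \<omega> * pl X2 d (ps @ ?z qs) \<omega>)" for a i
    proof (induction i arbitrary: a)
      case 0
      have 1: "st X1 d a 0 \<omega> * pl X1 d (ps @ ?z qs) \<omega> = pl X1 d (ps @ ?z (a # qs)) \<omega>" for \<omega> by (simp add: pl_def)
      have 2: "st X2 d a 0 \<omega> * pl X2 d (ps @ ?z qs) \<omega> = pl X2 d (ps @ ?z (a # qs)) \<omega>" for \<omega> by (simp add: pl_def)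
      show ?case unfolding 1 2 by (rule Cons.IH)
    next
      case (Suc i)
      show ?case
        using A.st_sums[of a i "ps @ ?z qs"] B.st_sums[of a i "ps @ ?z qs"] unfolding Suc.IH by (rule sums_unique2)
    qed
    from this[of "fst x" "snd x"] show ?case unfolding A.st_pl B.st_pl by simp
  qed
  from this[of "[]"] show ?thesis by simp
qed

lemma pmodel_lin_power_eq:
  assumes "pmodel M1 X1 d" "pmodel M2 X2 d"
    and eq: "\<And>qs. (LINT \<omega>|M1. prod_list (map (\<lambda>q. \<Sum>j<d. X1 j \<omega> ^ q) qs)) = (LINT \<omega>|M2. prod_list (map (\<lambda>q. \<Sum>j<d. X2 j \<omega> ^ q) qs))"
  shows "(LINT \<omega>|M1. (\<Sum>i\<le>D. c i * st X1 d 0 i \<omega>) ^ m) = (LINT \<omega>|M2. (\<Sum>i\<le>D. c i * st X2 d 0 i \<omega>) ^ m)"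
proof -
  interpret A: pmodel M1 X1 d by fact
  interpret B: pmodel M2 X2 d by fact
  have "(LINT \<omega>|M1. (\<Sum>i\<le>D. c i * st X1 d 0 i \<omega>) ^ m * pl X1 d ps \<omega>) = (LINT \<omega>|M2. (\<Sum>i\<le>D. c i * st X2 d 0 i \<omega>) ^ m * pl X2 d ps \<omega>)" for ps
  proof (induction m arbitrary: ps)
    case 0
    then show ?case using pmodel_pl_eq[OF assms] by simp
  next
    case (Suc m)
    then show ?case unfolding A.lin_power_Suc B.lin_power_Suc by simp
  qed
  from this[of "[]"] show ?thesis by (simp add: pl_def)
qed

text \<open>The map from X to exp(-X/16) takes the half-line into [0, 1], where f is approximated
  uniformly by polynomials. Measurability of the sum is obtained from the same limit, since a single
  X j is not assumed to be measurable.\<close>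

lemma pmodel_cont_eq:
  fixes f :: "real \<Rightarrow> real"
  assumes m1: "pmodel M1 X1 d" and m2: "pmodel M2 X2 d"
    and eq: "\<And>qs. (LINT \<omega>|M1. prod_list (map (\<lambda>q. \<Sum>j<d. X1 j \<omega> ^ q) qs)) = (LINT \<omega>|M2. prod_list (map (\<lambda>q. \<Sum>j<d. X2 j \<omega> ^ q) qs))"
    and f: "continuous_on {0..1} f"
  shows "(\<lambda>\<omega>. \<Sum>j<d. f (exp (- (X1 j \<omega> / 16)))) \<in> borel_measurable M1"
    and "(LINT \<omega>|M1. (\<Sum>j<d. f (exp (- (X1 j \<omega> / 16)))) ^ m) = (LINT \<omega>|M2. (\<Sum>j<d. f (exp (- (X2 j \<omega> / 16)))) ^ m)"
proof -
  interpret A: pmodel M1 X1 d by fact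
  interpret B: pmodel M2 X2 d by fact
  have "\<exists>c D. \<forall>u\<in>{0..1}. \<bar>f u - (\<Sum>i\<le>D. c i * u ^ i)\<bar> < 1 / real (Suc r)" for r
  proof -
    obtain g where g: "real_polynomial_function g" "\<And>x. x \<in> {0..1} \<Longrightarrow> \<bar>f x - g x\<bar> < 1 / real (Suc r)"
      using Stone_Weierstrass_real_polynomial_function[of "{0..1::real}" f "1 / real (Suc r)"] f by (auto)
    from g(1) obtain c D where "g = (\<lambda>x. \<Sum>i\<le>D. c i * x ^ i)"
      using real_polynomial_function_iff_sum[of g] by blast
    then show ?thesis using g(2) by (intro exI[of _ c] exI[of _ D]) auto
  qed
  then obtain c D where cD: "\<And>r u. u \<in> {0..1} \<Longrightarrow> \<bar>f u - (\<Sum>i\<le>D r. c r i * u ^ i)\<bar> < 1 / real (Suc r)"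
    by metis
  have "compact (f ` {0..1})" by (intro compact_continuous_image f) auto
  then obtain B where B: "\<And>u. u \<in> {0..1} \<Longrightarrow> \<bar>f u\<bar> \<le> B"
    by (meson bounded_real compact_imp_bounded imageI)
  have lin: "(\<Sum>i\<le>D r. c r i * st X d 0 i \<omega>) = (\<Sum>j<d. \<Sum>i\<le>D r. c r i * exp (- (X j \<omega> / 16)) ^ i)" for X :: "nat \<Rightarrow> 'c \<Rightarrow> real" and r \<omega>
  proof -
    have "exp (- (real i / 16 * X j \<omega>)) = exp (- (X j \<omega> / 16)) ^ i" for i j
      by (simp add: exp_of_nat_mult[symmetric])
    then show ?thesis unfolding st_def sum_distrib_left by (subst sum.swap) simp
  qed
  have close: "\<bar>(\<Sum>i\<le>D r. c r i * st X d 0 i \<omega>) - (\<Sum>j<d. f (exp (- (X j \<omega> / 16))))\<bar> \<le> real d * (1 / real (Suc r))"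
    if "\<And>j. j < d \<Longrightarrow> X j \<omega> \<ge> 0" for X :: "nat \<Rightarrow> 'c \<Rightarrow> real" and r \<omega>
  proof -
    have "\<bar>(\<Sum>i\<le>D r. c r i * st X d 0 i \<omega>) - (\<Sum>j<d. f (exp (- (X j \<omega> / 16))))\<bar>
       = \<bar>\<Sum>j<d. f (exp (- (X j \<omega> / 16))) - (\<Sum>i\<le>D r. c r i * exp (- (X j \<omega> / 16)) ^ i)\<bar>"
      unfolding lin by (simp add: sum_subtractf abs_minus_commute)
    also have "\<dots> \<le> (\<Sum>j<d. \<bar>f (exp (- (X j \<omega> / 16))) - (\<Sum>i\<le>D r. c r i * exp (- (X j \<omega> / 16)) ^ i)\<bar>)" by (rule sum_abs)
    also have "\<dots> \<le> (\<Sum>j<d. 1 / real (Suc r))"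
      using that by (intro sum_mono less_imp_le[OF cD]) auto
    finally show ?thesis by simp
  qed
  have Sbd: "\<bar>\<Sum>j<d. f (exp (- (X j \<omega> / 16)))\<bar> \<le> real d * B" if "\<And>j. j < d \<Longrightarrow> X j \<omega> \<ge> 0" for X :: "nat \<Rightarrow> 'c \<Rightarrow> real" and \<omega>
  proof -
    have "\<bar>\<Sum>j<d. f (exp (- (X j \<omega> / 16)))\<bar> \<le> (\<Sum>j<d. \<bar>f (exp (- (X j \<omega> / 16)))\<bar>)" by (rule sum_abs)
    also have "\<dots> \<le> (\<Sum>j<d. B)" using that by (intro sum_mono B) auto
    finally show ?thesis by simp
  qed
  have lim: "(\<lambda>r. \<Sum>i\<le>D r. c r i * st X d 0 i \<omega>) \<longlonglongrightarrow> (\<Sum>j<d. f (exp (- (X j \<omega> / 16))))"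
    if "\<And>j. j < d \<Longrightarrow> X j \<omega> \<ge> 0" for X :: "nat \<Rightarrow> 'c \<Rightarrow> real" and \<omega>
  proof (rule LIM_zero_cancel, rule Lim_null_comparison)
    show "\<forall>\<^sub>F r in sequentially. norm ((\<Sum>i\<le>D r. c r i * st X d 0 i \<omega>) - (\<Sum>j<d. f (exp (- (X j \<omega> / 16))))) \<le> real d * (1 / real (Suc r))"
      using close[of X \<omega>, OF that] by (intro always_eventually) auto
    show "(\<lambda>r. real d * (1 / real (Suc r))) \<longlonglongrightarrow> 0" by real_asymp
  qed
  have bd: "\<bar>\<Sum>i\<le>D r. c r i * st X d 0 i \<omega>\<bar> \<le> real d * B + real d"
    if "\<And>j. j < d \<Longrightarrow> X j \<omega> \<ge> 0" for X :: "nat \<Rightarrow> 'c \<Rightarrow> real" and \<omega> r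
  proof -
    have "real d * (1 / real (Suc r)) \<le> real d * 1" by (intro mult_left_mono) auto
    then show ?thesis using close[of X \<omega> r, OF that] Sbd[of X \<omega>, OF that] by linarith
  qed
  show "(\<lambda>\<omega>. \<Sum>j<d. f (exp (- (X1 j \<omega> / 16)))) \<in> borel_measurable M1"
    by (rule A.bounded_limit(1)[of "\<lambda>r \<omega>. \<Sum>i\<le>D r. c r i * st X1 d 0 i \<omega>" _ "real d * B + real d"])
       (auto intro!: lim bd A.X_nonneg borel_measurable_sum borel_measurable_times)
  have "(\<lambda>r. LINT \<omega>|M1. (\<Sum>i\<le>D r. c r i * st X1 d 0 i \<omega>) ^ m) \<longlonglongrightarrow> (LINT \<omega>|M1. (\<Sum>j<d. f (exp (- (X1 j \<omega> / 16)))) ^ m)"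
    by (rule A.bounded_limit(2)[where B = "real d * B + real d"])
       (auto intro!: lim bd A.X_nonneg borel_measurable_sum borel_measurable_times)
  moreover have "(\<lambda>r. LINT \<omega>|M2. (\<Sum>i\<le>D r. c r i * st X2 d 0 i \<omega>) ^ m) \<longlonglongrightarrow> (LINT \<omega>|M2. (\<Sum>j<d. f (exp (- (X2 j \<omega> / 16)))) ^ m)"
    by (rule B.bounded_limit(2)[where B = "real d * B + real d"])
       (auto intro!: lim bd B.X_nonneg borel_measurable_sum borel_measurable_times)
  ultimately show "(LINT \<omega>|M1. (\<Sum>j<d. f (exp (- (X1 j \<omega> / 16)))) ^ m) = (LINT \<omega>|M2. (\<Sum>j<d. f (exp (- (X2 j \<omega> / 16)))) ^ m)"
    unfolding pmodel_lin_power_eq[OF m1 m2 eq] by (rule LIMSEQ_unique)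
qed

section \<open>Counting functions and void probabilities\<close>

definition cnt :: "(nat \<Rightarrow> 'a \<Rightarrow> real) \<Rightarrow> nat \<Rightarrow> real \<Rightarrow> 'a \<Rightarrow> real" where
  "cnt X d x \<omega> = (\<Sum>j<d. if X j \<omega> \<le> x then 1 else 0)"

text \<open>The indicator of X \<le> x is the limit of continuous ramps in exp(-X/16). The ramps
  equal 1 from the threshold \<open>u0\<close> upwards and descend only below it, so points exactly
  at x are counted.\<close>

lemma pmodel_cnt_eq:
  assumes m1: "pmodel M1 X1 d" and m2: "pmodel M2 X2 d"
    and eq: "\<And>qs. (LINT \<omega>|M1. prod_list (map (\<lambda>q. \<Sum>j<d. X1 j \<omega> ^ q) qs)) = (LINT \<omega>|M2. prod_list (map (\<lambda>q. \<Sum>j<d. X2 j \<omega> ^ q) qs))"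
  shows "cnt X1 d x \<in> borel_measurable M1" "cnt X2 d x \<in> borel_measurable M2"
    and "(LINT \<omega>|M1. cnt X1 d x \<omega> ^ m) = (LINT \<omega>|M2. cnt X2 d x \<omega> ^ m)"
proof -
  interpret A: pmodel M1 X1 d by fact
  interpret B: pmodel M2 X2 d by fact
  define u0 where "u0 = exp (- (x / 16))"
  define f where "f = (\<lambda>(r::nat) u. max 0 (min 1 (1 + real r * (u - u0))))"
  have f: "continuous_on {0..1} (f r)" for r unfolding f_def by (intro continuous_intros)
  have f01: "0 \<le> f r u" "f r u \<le> 1" for r u by (auto simp: f_def)
  have lim1: "(\<lambda>r. f r (exp (- (y / 16)))) \<longlonglongrightarrow> (if y \<le> x then 1 else 0)" for y
  proof (cases "y \<le> x")
    case True
    then have "exp (- (y / 16)) \<ge> u0" by (simp add: u0_def)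
    then have "f r (exp (- (y / 16))) = 1" for r by (simp add: f_def)
    then show ?thesis using True by simp
  next
    case False
    then have "exp (- (y / 16)) < u0" by (simp add: u0_def)
    then have pos: "u0 - exp (- (y / 16)) > 0" by simp
    obtain r0 :: nat where r0: "1 / (u0 - exp (- (y / 16))) < real r0" using reals_Archimedean2 by blast
    have "\<forall>\<^sub>F r in sequentially. f r (exp (- (y / 16))) = 0"
      using eventually_ge_at_top[of r0]
    proof eventually_elim
      case (elim r)
      then have "1 / (u0 - exp (- (y / 16))) < real r" using r0 by linarith
      then have "1 < real r * (u0 - exp (- (y / 16)))" using pos by (simp add: field_simps)
      then show ?case by (simp add: f_def algebra_simps)
    qed
    then show ?thesis using False by (simp add: tendsto_eventually)
  qed
  have lim: "(\<lambda>r. \<Sum>j<d. f r (exp (- (X j \<omega> / 16)))) \<longlonglongrightarrow> cnt X d x \<omega>" for X :: "nat \<Rightarrow> 'c \<Rightarrow> real" and \<omega>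
    unfolding cnt_def by (intro tendsto_sum lim1)
  have bd: "\<bar>\<Sum>j<d. f r (exp (- (X j \<omega> / 16)))\<bar> \<le> real d" for X :: "nat \<Rightarrow> 'c \<Rightarrow> real" and \<omega> r
  proof -
    have "\<bar>\<Sum>j<d. f r (exp (- (X j \<omega> / 16)))\<bar> \<le> (\<Sum>j<d. \<bar>f r (exp (- (X j \<omega> / 16)))\<bar>)" by (rule sum_abs)
    also have "\<dots> \<le> (\<Sum>j<d. 1)" using f01 by (intro sum_mono) (auto simp: abs_le_iff intro: order_trans[of _ 0])
    finally show ?thesis by simp
  qed
  have ms1: "(\<lambda>\<omega>. \<Sum>j<d. f r (exp (- (X1 j \<omega> / 16)))) \<in> borel_measurable M1" for r
    by (rule pmodel_cont_eq(1)[OF m1 m2 eq f])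
  have ms2: "(\<lambda>\<omega>. \<Sum>j<d. f r (exp (- (X2 j \<omega> / 16)))) \<in> borel_measurable M2" for r
    by (rule pmodel_cont_eq(1)[OF m2 m1 eq[symmetric] f])
  show "cnt X1 d x \<in> borel_measurable M1"
    by (rule A.bounded_limit(1)[where B = "real d"], rule lim, rule bd, rule ms1)
  show "cnt X2 d x \<in> borel_measurable M2"
    by (rule B.bounded_limit(1)[where B = "real d"], rule lim, rule bd, rule ms2)
  have "(\<lambda>r. LINT \<omega>|M1. (\<Sum>j<d. f r (exp (- (X1 j \<omega> / 16)))) ^ m) \<longlonglongrightarrow> (LINT \<omega>|M1. cnt X1 d x \<omega> ^ m)"
    by (rule A.bounded_limit(2)[where B = "real d"], rule lim, rule bd, rule ms1)
  moreover have "(\<lambda>r. LINT \<omega>|M2. (\<Sum>j<d. f r (exp (- (X2 j \<omega> / 16)))) ^ m) \<longlonglongrightarrow> (LINT \<omega>|M2. cnt X2 d x \<omega> ^ m)"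
    by (rule B.bounded_limit(2)[where B = "real d"], rule lim, rule bd, rule ms2)
  ultimately show "(LINT \<omega>|M1. cnt X1 d x \<omega> ^ m) = (LINT \<omega>|M2. cnt X2 d x \<omega> ^ m)"
    unfolding pmodel_cont_eq(2)[OF m1 m2 eq f] by (rule LIMSEQ_unique)
qed

lemma cnt_eq_card: "cnt X d x \<omega> = real (card {j\<in>{..<d}. X j \<omega> \<le> x})"
  unfolding cnt_def by (simp add: sum.If_cases Int_def)

lemma measure_eq_LINT_indicator:
  "A \<in> sets M \<Longrightarrow> measure M A = (LINT \<omega>|M. indicator A \<omega>)"
  by (simp add: sets.Int_space_eq2)

text \<open>The counting function takes values in 0, ..., d only. On these values the polynomial Q,
  with value 1 at 0 and roots 1, ..., d, is the indicator of 0; the void probability is thus a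
  linear combination of moments of the count.\<close>

theorem pmodel_void_eq:
  assumes m1: "pmodel M1 X1 d" and m2: "pmodel M2 X2 d"
    and eq: "\<And>qs. (LINT \<omega>|M1. prod_list (map (\<lambda>q. \<Sum>j<d. X1 j \<omega> ^ q) qs)) = (LINT \<omega>|M2. prod_list (map (\<lambda>q. \<Sum>j<d. X2 j \<omega> ^ q) qs))"
  shows "{\<omega> \<in> space M1. \<forall>j<d. X1 j \<omega> > x} \<in> sets M1"
    and "measure M1 {\<omega> \<in> space M1. \<forall>j<d. X1 j \<omega> > x} = measure M2 {\<omega> \<in> space M2. \<forall>j<d. X2 j \<omega> > x}"
proof -
  interpret A: pmodel M1 X1 d by fact
  interpret B: pmodel M2 X2 d by fact
  note cm [measurable] = pmodel_cnt_eq(1,2)[OF m1 m2 eq, of x]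
  have ev: "(\<forall>j<d. X j \<omega> > x) \<longleftrightarrow> cnt X d x \<omega> = 0" for X :: "nat \<Rightarrow> 'c \<Rightarrow> real" and \<omega>
    unfolding cnt_eq_card by (auto simp: card_eq_0_iff not_le)
  define Q :: "real poly" where "Q = (\<Prod>j\<in>{1..d}. [:1, - 1 / real j:])"
  have Q: "poly Q (cnt X d x \<omega>) = (if cnt X d x \<omega> = 0 then 1 else 0)" for X :: "nat \<Rightarrow> 'c \<Rightarrow> real" and \<omega>
  proof -
    let ?n = "card {j\<in>{..<d}. X j \<omega> \<le> x}"
    have le: "?n \<le> d" using card_mono[of "{..<d}" "{j\<in>{..<d}. X j \<omega> \<le> x}"] by auto
    have "poly Q (real ?n) = (\<Prod>j\<in>{1..d}. 1 - real ?n / real j)" by (simp add: Q_def poly_prod)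
    also have "\<dots> = (if ?n = 0 then 1 else 0)"
    proof (cases "?n = 0")
      case False
      then have "?n \<in> {1..d}" unfolding atLeastAtMost_iff using le by linarith
      then show ?thesis using False by (subst prod_zero[OF _ bexI[of _ ?n]]) auto
    qed simp
    finally show ?thesis unfolding cnt_eq_card by simp
  qed
  show set1: "{\<omega> \<in> space M1. \<forall>j<d. X1 j \<omega> > x} \<in> sets M1" unfolding ev by measurable
  have set2: "{\<omega> \<in> space M2. \<forall>j<d. X2 j \<omega> > x} \<in> sets M2" unfolding ev by measurable
  have bd: "\<bar>cnt X d x \<omega>\<bar> \<le> real d" for X :: "nat \<Rightarrow> 'c \<Rightarrow> real" and \<omega>
    unfolding cnt_eq_card using card_mono[of "{..<d}" "{j\<in>{..<d}. X j \<omega> \<le> x}"] by auto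
  have i1: "integrable M1 (\<lambda>\<omega>. cnt X1 d x \<omega> ^ m)" for m
    by (rule A.integrable_const_bound[of _ "real d ^ m"]) (auto simp: power_abs intro!: power_mono bd)
  have i2: "integrable M2 (\<lambda>\<omega>. cnt X2 d x \<omega> ^ m)" for m
    by (rule B.integrable_const_bound[of _ "real d ^ m"]) (auto simp: power_abs intro!: power_mono bd)
  have "measure M1 {\<omega> \<in> space M1. \<forall>j<d. X1 j \<omega> > x} = (LINT \<omega>|M1. indicator {\<omega> \<in> space M1. \<forall>j<d. X1 j \<omega> > x} \<omega>)"
    by (rule measure_eq_LINT_indicator[OF set1])
  also have "\<dots> = (LINT \<omega>|M1. poly Q (cnt X1 d x \<omega>))"
    by (intro Bochner_Integration.integral_cong refl) (auto simp: Q ev indicator_def)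
  also have "\<dots> = (\<Sum>i\<le>degree Q. coeff Q i * (LINT \<omega>|M1. cnt X1 d x \<omega> ^ i))"
    unfolding poly_altdef using i1 by (simp add: Bochner_Integration.integral_sum)
  also have "\<dots> = (\<Sum>i\<le>degree Q. coeff Q i * (LINT \<omega>|M2. cnt X2 d x \<omega> ^ i))"
    unfolding pmodel_cnt_eq(3)[OF m1 m2 eq] ..
  also have "\<dots> = (LINT \<omega>|M2. poly Q (cnt X2 d x \<omega>))"
    unfolding poly_altdef using i2 by (simp add: Bochner_Integration.integral_sum)
  also have "\<dots> = (LINT \<omega>|M2. indicator {\<omega> \<in> space M2. \<forall>j<d. X2 j \<omega> > x} \<omega>)"
    by (intro Bochner_Integration.integral_cong refl) (auto simp: Q ev indicator_def)
  also have "\<dots> = measure M2 {\<omega> \<in> space M2. \<forall>j<d. X2 j \<omega> > x}"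
    by (rule measure_eq_LINT_indicator[OF set2, symmetric])
  finally show "measure M1 {\<omega> \<in> space M1. \<forall>j<d. X1 j \<omega> > x} = measure M2 {\<omega> \<in> space M2. \<forall>j<d. X2 j \<omega> > x}" .
qed

section \<open>The weighted Gaussian model\<close>

text \<open>Passing to the monic Newton polynomials with roots x_0, ..., x_(j-1) is a unitriangular
  column operation, after which the matrix is lower triangular.\<close>

lemma vandermonde_fdet: "fdet k (\<lambda>i j. x i ^ j) = (\<Prod>(i, j)\<in>lpairs k. x j - x i)"
proof -
  define p where "p = (\<lambda>j. \<Prod>m<j. [:- x m, 1:])"
  have deg: "degree (p j) = j" for j
    unfolding p_def by (subst degree_prod_eq_sum_degree) auto
  have lead: "coeff (p j) j = 1" for j
  proof -
    have "lead_coeff (p j) = 1" unfolding p_def by (simp add: lead_coeff_prod)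
    then show ?thesis unfolding deg .
  qed
  have ev: "poly (p j) y = (\<Prod>m<j. y - x m)" for j y by (simp add: p_def poly_prod)
  have "fdet k (\<lambda>i j. poly (p j) (x i)) = fdet k (\<lambda>i j. \<Sum>m<k. x i ^ m * coeff (p j) m)"
  proof (intro fdet_cong, goal_cases)
    case (1 i j)
    have "poly (p j) (x i) = (\<Sum>m\<le>j. coeff (p j) m * x i ^ m)" by (simp add: poly_altdef deg)
    also have "\<dots> = (\<Sum>m<k. coeff (p j) m * x i ^ m)"
      using 1 by (intro sum.mono_neutral_left) (auto simp: coeff_eq_0 deg)
    finally show ?case by (simp add: mult.commute)
  qed
  also have "\<dots> = fdet k (\<lambda>i j. x i ^ j) * fdet k (\<lambda>m j. coeff (p j) m)" by (rule fdet_mult)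
  also have "fdet k (\<lambda>m j. coeff (p j) m) = 1"
    by (subst fdet_upper_triangular) (auto simp: coeff_eq_0 deg lead)
  finally have "fdet k (\<lambda>i j. x i ^ j) = fdet k (\<lambda>i j. poly (p j) (x i))" by simp
  also have "\<dots> = (\<Prod>i<k. poly (p i) (x i))"
    by (rule fdet_lower_triangular) (auto simp: ev)
  also have "\<dots> = (\<Prod>i<k. \<Prod>m<i. x i - x m)" by (simp add: ev)
  also have "\<dots> = (\<Prod>(i, m)\<in>Sigma {..<k} (\<lambda>i. {..<i}). x i - x m)" by (rule prod.Sigma) auto
  also have "\<dots> = (\<Prod>(i, j)\<in>lpairs k. x j - x i)"
    by (rule prod.reindex_bij_witness[of _ "\<lambda>(i, j). (j, i)" "\<lambda>(i, j). (j, i)"]) (auto simp: lpairs_def)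
  finally show ?thesis .
qed

lemma Wg_eq_fdet: "Wg k g = (fdet k (\<lambda>i j. ((g i)\<^sup>2) ^ j))\<^sup>2"
  unfolding vandermonde_fdet Wg_def case_prod_beta by (rule prod_power_distrib[symmetric])

text \<open>Expanding both Vandermonde factors over permutations p and q lets the integral factor
  over the coordinates. Replacing q by \<open>q \<circ> p\<close> removes p from the summand, and
  the sum over p gives k!.\<close>

lemma andreief:
  fixes \<phi> :: "real \<Rightarrow> real"
  assumes int: "\<And>j. integrable std_normal_distribution (\<lambda>x. x ^ (2 * j) * \<phi> x)"
  shows "integrable (gauss {..<k}) (\<lambda>g. Wg k g * (\<Prod>i<k. \<phi> (g i)))"
    and "(LINT g|gauss {..<k}. Wg k g * (\<Prod>i<k. \<phi> (g i)))
      = fact k * fdet k (\<lambda>i j. LINT x|std_normal_distribution. x ^ (2 * (i + j)) * \<phi> x)"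
proof -
  let ?P = "{p. p permutes {0..<k}}"
  let ?m = "\<lambda>j. LINT x|std_normal_distribution. x ^ (2 * j) * \<phi> x"
  let ?F = "\<lambda>p q g. \<Prod>i<k. g i ^ (2 * (p i + q i)) * \<phi> (g i)"
  have exp: "Wg k g * (\<Prod>i<k. \<phi> (g i)) = (\<Sum>p\<in>?P. \<Sum>q\<in>?P. of_int (sign p) * of_int (sign q) * ?F p q g)" for g
  proof -
    have "Wg k g = (\<Sum>p\<in>?P. \<Sum>q\<in>?P. (of_int (sign p) * (\<Prod>i<k. ((g i)\<^sup>2) ^ p i)) * (of_int (sign q) * (\<Prod>i<k. ((g i)\<^sup>2) ^ q i)))"
      unfolding Wg_eq_fdet fdet_leibniz power2_eq_square[of "sum _ _"] sum_product ..
    also have "\<dots> = (\<Sum>p\<in>?P. \<Sum>q\<in>?P. of_int (sign p) * of_int (sign q) * (\<Prod>i<k. g i ^ (2 * (p i + q i))))"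
    proof (intro sum.cong refl)
      fix p q
      have "(\<Prod>i<k. ((g i)\<^sup>2) ^ p i) * (\<Prod>i<k. ((g i)\<^sup>2) ^ q i) = (\<Prod>i<k. g i ^ (2 * (p i + q i)))"
        by (simp only: prod.distrib[symmetric] power_mult[symmetric] power_add[symmetric] distrib_left)
      then show "(of_int (sign p) * (\<Prod>i<k. ((g i)\<^sup>2) ^ p i)) * (of_int (sign q) * (\<Prod>i<k. ((g i)\<^sup>2) ^ q i)) = of_int (sign p) * of_int (sign q) * (\<Prod>i<k. g i ^ (2 * (p i + q i)))"
        by (simp only: mult_ac)
    qed
    finally show ?thesis by (simp add: sum_distrib_right prod.distrib mult.assoc)
  qed
  have intF: "integrable (gauss {..<k}) (?F p q)" for p q
    by (intro std_gauss.product_integrable_prod int) auto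
  have valF: "(LINT g|gauss {..<k}. ?F p q g) = (\<Prod>i<k. ?m (p i + q i))" for p q
    by (rule std_gauss.product_integral_prod) (simp, rule int)
  show "integrable (gauss {..<k}) (\<lambda>g. Wg k g * (\<Prod>i<k. \<phi> (g i)))"
    unfolding exp by (intro Bochner_Integration.integrable_sum integrable_mult_right intF)
  have "(LINT g|gauss {..<k}. Wg k g * (\<Prod>i<k. \<phi> (g i))) = (\<Sum>p\<in>?P. \<Sum>q\<in>?P. of_int (sign p) * of_int (sign q) * (\<Prod>i<k. ?m (p i + q i)))"
  proof -
    have "(LINT g|gauss {..<k}. (\<Sum>p\<in>?P. \<Sum>q\<in>?P. of_int (sign p) * of_int (sign q) * ?F p q g))
       = (\<Sum>p\<in>?P. (LINT g|gauss {..<k}. (\<Sum>q\<in>?P. of_int (sign p) * of_int (sign q) * ?F p q g)))"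
      by (intro Bochner_Integration.integral_sum Bochner_Integration.integrable_sum integrable_mult_right intF)
    also have "\<dots> = (\<Sum>p\<in>?P. \<Sum>q\<in>?P. (LINT g|gauss {..<k}. of_int (sign p) * of_int (sign q) * ?F p q g))"
      by (intro sum.cong refl Bochner_Integration.integral_sum integrable_mult_right intF)
    also have "\<dots> = (\<Sum>p\<in>?P. \<Sum>q\<in>?P. of_int (sign p) * of_int (sign q) * (\<Prod>i<k. ?m (p i + q i)))"
      by (simp only: integral_mult_right_zero valF)
    finally show ?thesis unfolding exp .
  qed
  also have "\<dots> = (\<Sum>p\<in>?P. fdet k (\<lambda>i j. ?m (i + j)))"
  proof (intro sum.cong refl)
    fix p assume p: "p \<in> ?P"
    then have pp: "p permutes {0..<k}" by simp
    have "(\<Sum>q\<in>?P. of_int (sign p) * of_int (sign q) * (\<Prod>i<k. ?m (p i + q i)))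
       = (\<Sum>q\<in>?P. of_int (sign p) * of_int (sign (q \<circ> p)) * (\<Prod>i<k. ?m (p i + (q \<circ> p) i)))"
      by (rule sum_permutations_compose_right[OF pp])
    also have "\<dots> = (\<Sum>q\<in>?P. of_int (sign q) * (\<Prod>i<k. ?m (i + q i)))"
    proof (intro sum.cong refl)
      fix q assume q: "q \<in> ?P"
      then have qq: "q permutes {0..<k}" by simp
      have sg: "sign (q \<circ> p) = sign q * sign p"
        using pp qq by (intro sign_compose) (auto intro: permutation_permutes[THEN iffD2])
      have "(\<Prod>i<k. ?m (p i + (q \<circ> p) i)) = (\<Prod>i<k. ?m (i + q i))"
        using prod.permute[OF pp, of "\<lambda>i. ?m (i + q i)"] by (simp add: atLeast0LessThan)
      moreover have "real_of_int (sign p) * of_int (sign (q \<circ> p)) = of_int (sign q)"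
        unfolding sg by (simp add: sign_def)
      ultimately show "of_int (sign p) * of_int (sign (q \<circ> p)) * (\<Prod>i<k. ?m (p i + (q \<circ> p) i)) = of_int (sign q) * (\<Prod>i<k. ?m (i + q i))"
        by (simp only:)
    qed
    finally show "(\<Sum>q\<in>?P. of_int (sign p) * of_int (sign q) * (\<Prod>i<k. ?m (p i + q i))) = fdet k (\<lambda>i j. ?m (i + j))"
      unfolding fdet_leibniz .
  qed
  also have "\<dots> = fact k * fdet k (\<lambda>i j. ?m (i + j))"
    using card_permutations[OF refl, of "{0..<k}"] by simp
  finally show "(LINT g|gauss {..<k}. Wg k g * (\<Prod>i<k. \<phi> (g i))) = fact k * fdet k (\<lambda>i j. ?m (i + j))" .
qed

text \<open>The substitution u = sqrt 2 * v turns the standard Gaussian weight into exp(-v^2) and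
  the condition into |v| > x. The two half-lines contribute equally.\<close>

lemma gauss_tail_moment:
  assumes x: "x \<ge> 0"
  shows "integrable std_normal_distribution (\<lambda>u. u ^ (2 * j) * (if u\<^sup>2 > 2 * x\<^sup>2 then 1 else 0))"
    and "(LINT u|std_normal_distribution. u ^ (2 * j) * (if u\<^sup>2 > 2 * x\<^sup>2 then 1 else 0)) = 2 / sqrt pi * 2 ^ j * gm j x"
proof -
  let ?f = "\<lambda>v::real. v ^ (2 * j) * exp (- v\<^sup>2)"
  show int: "integrable std_normal_distribution (\<lambda>u. u ^ (2 * j) * (if u\<^sup>2 > 2 * x\<^sup>2 then 1 else 0))"
    by (rule Bochner_Integration.integrable_bound[OF integrable_std_normal_power[of "2 * j"]]) auto
  have "(LINT u|std_normal_distribution. u ^ (2 * j) * (if u\<^sup>2 > 2 * x\<^sup>2 then 1 else 0))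
     = (LINT u|lborel. std_normal_density u * (u ^ (2 * j) * (if u\<^sup>2 > 2 * x\<^sup>2 then 1 else 0)))"
    by (rule integral_std_normal) measurable
  also have "\<dots> = \<bar>sqrt 2\<bar> *\<^sub>R (LINT v|lborel. std_normal_density (0 + sqrt 2 * v) * ((0 + sqrt 2 * v) ^ (2 * j) * (if (0 + sqrt 2 * v)\<^sup>2 > 2 * x\<^sup>2 then 1 else 0)))"
    by (rule lborel_integral_real_affine) simp
  also have "\<dots> = sqrt 2 * (LINT v|lborel. (2 ^ j / sqrt (2 * pi)) * (?f v * (if v\<^sup>2 > x\<^sup>2 then 1 else 0)))"
  proof -
    have s2: "sqrt 2 ^ (2 * j) = (2::real) ^ j" by (simp add: power_mult)
    have "std_normal_density (0 + sqrt 2 * v) * ((0 + sqrt 2 * v) ^ (2 * j) * (if (0 + sqrt 2 * v)\<^sup>2 > 2 * x\<^sup>2 then 1 else 0))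
       = (2 ^ j / sqrt (2 * pi)) * (?f v * (if v\<^sup>2 > x\<^sup>2 then 1 else 0))" for v
    proof -
      have a: "std_normal_density (0 + sqrt 2 * v) = exp (- v\<^sup>2) / sqrt (2 * pi)"
        by (simp add: std_normal_density_def power_mult_distrib)
      have b: "(0 + sqrt 2 * v) ^ (2 * j) = 2 ^ j * v ^ (2 * j)" by (simp only: add_0_left power_mult_distrib s2)
      have c: "(0 + sqrt 2 * v)\<^sup>2 > 2 * x\<^sup>2 \<longleftrightarrow> v\<^sup>2 > x\<^sup>2" by (simp add: power_mult_distrib)
      show ?thesis unfolding a b c by simp
    qed
    then show ?thesis by simp
  qed
  also have "\<dots> = 2 ^ j / sqrt pi * (LINT v|lborel. ?f v * (if v\<^sup>2 > x\<^sup>2 then 1 else 0))"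
    by (simp add: real_sqrt_mult)
  also have "(LINT v|lborel. ?f v * (if v\<^sup>2 > x\<^sup>2 then 1 else 0)) = (LINT v|lborel. indicator {x..} v * ?f v + indicator {x..} (0 + (- 1) * v) * ?f (0 + (- 1) * v))"
  proof (rule integral_cong_AE)
    show "AE v in lborel. ?f v * (if v\<^sup>2 > x\<^sup>2 then 1 else 0) = indicator {x..} v * ?f v + indicator {x..} (0 + (- 1) * v) * ?f (0 + (- 1) * v)"
      using AE_lborel_singleton[of x] AE_lborel_singleton[of "- x"]
    proof eventually_elim
      case (elim v)
      have "v\<^sup>2 > x\<^sup>2 \<longleftrightarrow> v > x \<or> v < - x"
      proof -
        have "v\<^sup>2 > x\<^sup>2 \<longleftrightarrow> \<bar>v\<bar> > \<bar>x\<bar>" using abs_le_square_iff[of v x] by (simp only: not_le[symmetric])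
        then show ?thesis using x by (simp only: abs_if) (auto split: if_splits)
      qed
      moreover have "\<not> (v > x \<and> v < - x)" using x by auto
      ultimately show ?case using elim by (auto simp: indicator_def)
    qed
  qed measurable
  also have "\<dots> = (LINT v|lborel. indicator {x..} v * ?f v) + (LINT v|lborel. indicator {x..} (0 + (- 1) * v) * ?f (0 + (- 1) * v))"
    using integrable_gm[of x j] lborel_integrable_real_affine[OF integrable_gm[of x j], of "- 1" 0]
    by (intro Bochner_Integration.integral_add) auto
  also have "(LINT v|lborel. indicator {x..} (0 + (- 1) * v) * ?f (0 + (- 1) * v)) = gm j x"
    unfolding gm_def using lborel_integral_real_affine[of "- 1" "\<lambda>v. indicator {x..} v * ?f v" 0] by simp
  also have "(LINT v|lborel. indicator {x..} v * ?f v) = gm j x" by (simp add: gm_def)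
  finally show "(LINT u|std_normal_distribution. u ^ (2 * j) * (if u\<^sup>2 > 2 * x\<^sup>2 then 1 else 0)) = 2 / sqrt pi * 2 ^ j * gm j x"
    by simp
qed

lemma W_tail:
  assumes x: "x \<ge> 0"
  shows "(LINT g|gauss {..<k}. Wg k g * (\<Prod>i<k. if (g i)\<^sup>2 > 2 * x\<^sup>2 then 1 else 0))
    = fact k * ((\<Prod>i<k. 2 / sqrt pi * 2 ^ i) * (\<Prod>j<k. 2 ^ j)) * HH k x"
proof -
  let ?\<phi> = "\<lambda>u. if u\<^sup>2 > 2 * x\<^sup>2 then 1 else 0 :: real"
  have "(LINT g|gauss {..<k}. Wg k g * (\<Prod>i<k. ?\<phi> (g i)))
      = fact k * fdet k (\<lambda>i j. LINT u|std_normal_distribution. u ^ (2 * (i + j)) * ?\<phi> u)"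
    by (rule andreief(2)[OF gauss_tail_moment(1)[OF x]])
  also have "fdet k (\<lambda>i j. LINT u|std_normal_distribution. u ^ (2 * (i + j)) * ?\<phi> u) = fdet k (\<lambda>i j. (2 / sqrt pi * 2 ^ i) * gm (i + j) x * 2 ^ j)"
    unfolding gauss_tail_moment(2)[OF x] by (intro fdet_cong) (simp add: power_add mult_ac)
  finally show ?thesis unfolding fdet_scale HH_def by simp
qed

lemma AE_gauss_nonzero: "AE g in gauss {..<k::nat}. \<forall>i<k. g i \<noteq> 0"
proof -
  have "AE g in gauss {..<k}. g i \<noteq> 0" if "i < k" for i
  proof -
    interpret product_prob_space "\<lambda>_. std_normal_distribution" "{..<k}"
      by (intro product_prob_spaceI prob_space_std_normal)
    have "AE x in std_normal_distribution. x \<noteq> 0"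
      using AE_lborel_singleton[of "0::real"] by (auto simp: AE_density)
    then show ?thesis using that by (intro AE_component) auto
  qed
  then have "AE g in gauss {..<k}. \<forall>i\<in>{..<k}. g i \<noteq> 0" by (intro AE_finite_allI) auto
  then show ?thesis by (simp only: lessThan_iff Ball_def)
qed

lemma T2_Nil: "T2 k [] = fact k * ((\<Prod>i<k. 2 / sqrt pi * 2 ^ i) * (\<Prod>j<k. 2 ^ j)) * HH k 0"
proof -
  have "T2 k [] = (LINT g|gauss {..<k}. Wg k g * (\<Prod>i<k. if (g i)\<^sup>2 > 2 * 0\<^sup>2 then 1 else 0))"
    unfolding T2_def
  proof (rule integral_cong_AE)
    show "AE g in gauss {..<k}. Wg k g * prod_list (map (\<lambda>q. Sg k q g) []) = Wg k g * (\<Prod>i<k. if (g i)\<^sup>2 > 2 * 0\<^sup>2 then 1 else 0)"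
      using AE_gauss_nonzero[of k]
    proof eventually_elim
      case (elim g)
      then have "(\<Prod>i<k. if (g i)\<^sup>2 > 2 * 0\<^sup>2 then 1 else 0 :: real) = 1" by (intro prod.neutral) auto
      then show ?case by simp
    qed
    show "(\<lambda>g. Wg k g * prod_list (map (\<lambda>q. Sg k q g) [])) \<in> borel_measurable (gauss {..<k})"
      using pf_integrable[OF pf_Wg] by auto
    show "(\<lambda>g. Wg k g * (\<Prod>i<k. if (g i)\<^sup>2 > 2 * 0\<^sup>2 then 1 else 0)) \<in> borel_measurable (gauss {..<k})"
      using andreief(1)[OF gauss_tail_moment(1)[of 0], of k] by auto
  qed
  also have "\<dots> = fact k * ((\<Prod>i<k. 2 / sqrt pi * 2 ^ i) * (\<Prod>j<k. 2 ^ j)) * HH k 0" by (rule W_tail) simp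
  finally show ?thesis .
qed

lemma T2_Nil_pos: "T2 k [] > 0"
  unfolding T2_Nil by (intro mult_pos_pos prod_pos HH_0_pos) auto

lemma Wg_nonneg: "Wg k g \<ge> 0"
  unfolding Wg_def case_prod_beta by (intro prod_nonneg) auto

text \<open>The standard normal density times exp(x^2/4) is sqrt 2 times the normal density of
  variance 2, so all moments stay finite.\<close>

lemma pf_exp_integrable:
  assumes "pf I f" "finite I" "e \<in> I"
  shows "integrable (gauss I) (\<lambda>g. f g * exp ((g e)\<^sup>2 / 4))"
  using assms
proof (induction rule: pf.induct)
  case (mono c m)
  have one: "integrable std_normal_distribution (\<lambda>x. x ^ n * exp (x\<^sup>2 / 4))" for n
  proof -
    have "integrable lborel (\<lambda>x. sqrt 2 * (normal_density 0 (sqrt 2) x * (x - 0) ^ n))"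
      by (intro integrable_mult_right integrable_normal_moment) simp
    also have "(\<lambda>x. sqrt 2 * (normal_density 0 (sqrt 2) x * (x - 0) ^ n)) = (\<lambda>x. std_normal_density x * (x ^ n * exp (x\<^sup>2 / 4)))"
    proof
      fix x :: real
      have "exp (- x\<^sup>2 / 2) * exp (x\<^sup>2 / 4) = exp (- x\<^sup>2 / 4)" by (simp add: exp_add[symmetric])
      then show "sqrt 2 * (normal_density 0 (sqrt 2) x * (x - 0) ^ n) = std_normal_density x * (x ^ n * exp (x\<^sup>2 / 4))"
      proof -
        have sq: "sqrt (2 * pi * (sqrt 2)\<^sup>2) = sqrt (2 * pi) * sqrt 2"
          by (simp only: real_sqrt_pow2 zero_le_numeral real_sqrt_mult)
        have "sqrt 2 * normal_density 0 (sqrt 2) x = exp (- x\<^sup>2 / 4) / sqrt (2 * pi)"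
          unfolding normal_density_def sq by simp
        also have "\<dots> = std_normal_density x * exp (x\<^sup>2 / 4)"
          using \<open>exp (- x\<^sup>2 / 2) * exp (x\<^sup>2 / 4) = exp (- x\<^sup>2 / 4)\<close> by (simp add: std_normal_density_def)
        finally show ?thesis by (simp add: mult_ac)
      qed
    qed
    finally show ?thesis by (subst integrable_std_normal_iff) auto
  qed
  let ?h = "\<lambda>i x. x ^ m i * (if i = e then exp (x\<^sup>2 / 4) else 1 :: real)"
  have "integrable (gauss I) (\<lambda>g. c * (\<Prod>i\<in>I. ?h i (g i)))"
  proof (intro integrable_mult_right std_gauss.product_integrable_prod)
    fix i show "integrable std_normal_distribution (?h i)"
      using one integrable_std_normal_power by (cases "i = e") auto
  qed (use mono in auto)
  also have "(\<lambda>g. c * (\<Prod>i\<in>I. ?h i (g i))) = (\<lambda>g. c * (\<Prod>i\<in>I. g i ^ m i) * exp ((g e)\<^sup>2 / 4))"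
    using mono by (auto simp: prod.distrib)
  finally show ?case .
next
  case (add f g)
  then show ?case by (simp add: distrib_right)
qed

lemma power_over_fact_le_exp:
  fixes y :: real
  assumes "y \<ge> 0"
  shows "y ^ P / fact P \<le> exp y"
proof -
  have "sum (\<lambda>n. y ^ n /\<^sub>R fact n) {P} \<le> exp y"
    unfolding exp_def using assms by (intro sum_le_suminf summable_exp_generic) auto
  then show ?thesis by (simp add: divide_inverse mult.commute)
qed

text \<open>The choice of 1/16 is explained here: (2 g^2/16)^P / P! = 2^(-P) (g^2/4)^P / P! \<le>
  2^(-P) exp(g^2/4), and the last factor is still integrable against the Gaussian weight.\<close>

lemma T2_growth: "(\<lambda>P. (1 / 16) ^ P / fact P * T2 k ((a + P) # qs)) \<longlonglongrightarrow> 0"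
proof -
  let ?Pi = "\<lambda>g. prod_list (map (\<lambda>q. Sg k q g) qs)"
  let ?C = "\<Sum>i<k. (LINT g|gauss {..<k}. (2 ^ (a + 1) * g i ^ (2 * a) * Wg k g * ?Pi g) * exp ((g i)\<^sup>2 / 4))"
  have pfP: "pf {..<k} ?Pi" by (intro pf_prod_list pf_Sg)
  have Pi0: "?Pi g \<ge> 0" for g
    by (induction qs) (auto simp: Sg_def Pp_def intro!: mult_nonneg_nonneg sum_nonneg)
  have pfi: "pf {..<k} (\<lambda>g. 2 ^ (a + 1) * g i ^ (2 * a) * Wg k g * ?Pi g)" if "i < k" for i
    using that by (intro pf_mult pf_const pf_power pf_coord pf_Wg pfP) auto
  have int: "integrable (gauss {..<k}) (\<lambda>g. (2 ^ (a + 1) * g i ^ (2 * a) * Wg k g * ?Pi g) * exp ((g i)\<^sup>2 / 4))" if "i < k" for i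
    using that by (intro pf_exp_integrable pfi) auto
  have intT: "integrable (gauss {..<k}) (\<lambda>g. Wg k g * prod_list (map (\<lambda>q. Sg k q g) qs'))" for qs'
    by (intro pf_integrable pf_mult pf_Wg pf_prod_list pf_Sg) auto
  have T0: "T2 k qs' \<ge> 0" for qs'
    unfolding T2_def
  proof (rule Bochner_Integration.integral_nonneg)
    fix g
    have "prod_list (map (\<lambda>q. Sg k q g) qs') \<ge> 0"
      by (induction qs') (auto simp: Sg_def Pp_def intro!: mult_nonneg_nonneg sum_nonneg)
    then show "0 \<le> Wg k g * prod_list (map (\<lambda>q. Sg k q g) qs')" using Wg_nonneg by (intro mult_nonneg_nonneg)
  qed
  have bound: "(1 / 16) ^ P / fact P * T2 k ((a + P) # qs) \<le> (1 / 2) ^ P * ?C" for P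
  proof -
    have pt: "(1 / 16) ^ P / fact P * (Wg k g * prod_list (map (\<lambda>q. Sg k q g) ((a + P) # qs)))
       \<le> (1 / 2) ^ P * (\<Sum>i<k. (2 ^ (a + 1) * g i ^ (2 * a) * Wg k g * ?Pi g) * exp ((g i)\<^sup>2 / 4))" for g
    proof -
      have trm1: "(1 / 16) ^ P / fact P * (2 ^ (a + P + 1) * g i ^ (2 * (a + P))) \<le> (1 / 2) ^ P * (2 ^ (a + 1) * g i ^ (2 * a) * exp ((g i)\<^sup>2 / 4))" for i
      proof -
        have "((g i)\<^sup>2 / 4) ^ P / fact P \<le> exp ((g i)\<^sup>2 / 4)"
          by (rule power_over_fact_le_exp) simp
        then have "(1 / 2) ^ P * (2 ^ (a + 1) * g i ^ (2 * a)) * (((g i)\<^sup>2 / 4) ^ P / fact P) \<le> (1 / 2) ^ P * (2 ^ (a + 1) * g i ^ (2 * a)) * exp ((g i)\<^sup>2 / 4)"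
          by (intro mult_left_mono) auto
        moreover have "(1 / 2) ^ P * (2 ^ (a + 1) * g i ^ (2 * a)) * (((g i)\<^sup>2 / 4) ^ P / fact P) = (1 / 16) ^ P / fact P * (2 ^ (a + P + 1) * g i ^ (2 * (a + P)))"
        proof -
          have h: "(1 / 2 :: real) ^ P * (1 / 4) ^ P = (1 / 16) ^ P * 2 ^ P"
            unfolding power_mult_distrib[symmetric] by simp
          have g1: "g i ^ (2 * (a + P)) = g i ^ (2 * a) * ((g i)\<^sup>2) ^ P" by (simp only: power_add power_mult distrib_left)
          have g2: "((g i)\<^sup>2 / 4) ^ P = (1 / 4) ^ P * ((g i)\<^sup>2) ^ P" by (simp add: power_divide)
          have g3: "(2::real) ^ (a + P + 1) = 2 ^ P * 2 ^ (a + 1)" by (simp add: power_add)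
          have gen: "u * (A * B) * (v * C / F) = w / F * ((z * A) * (B * C))" if "u * v = w * z" for u v w z A B C F :: real
          proof -
            have "u * (A * B) * (v * C / F) = (u * v) * (A * B * C / F)" by simp
            also have "\<dots> = w / F * ((z * A) * (B * C))" unfolding that by simp
            finally show ?thesis .
          qed
          show ?thesis unfolding g1 g2 g3 by (rule gen[OF h])
        qed
        ultimately show ?thesis by (simp only: mult.assoc)
      qed
      have "(1 / 16) ^ P / fact P * (Wg k g * prod_list (map (\<lambda>q. Sg k q g) ((a + P) # qs)))
         = (\<Sum>i<k. ((1 / 16) ^ P / fact P * (2 ^ (a + P + 1) * g i ^ (2 * (a + P)))) * (Wg k g * ?Pi g))"
        by (simp add: Sg_def Pp_def sum_distrib_left sum_distrib_right mult_ac)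
      also have "\<dots> \<le> (\<Sum>i<k. ((1 / 2) ^ P * (2 ^ (a + 1) * g i ^ (2 * a) * exp ((g i)\<^sup>2 / 4))) * (Wg k g * ?Pi g))"
        by (intro sum_mono mult_right_mono trm1 mult_nonneg_nonneg Wg_nonneg Pi0)
      also have "\<dots> = (1 / 2) ^ P * (\<Sum>i<k. (2 ^ (a + 1) * g i ^ (2 * a) * Wg k g * ?Pi g) * exp ((g i)\<^sup>2 / 4))"
        unfolding sum_distrib_left by (intro sum.cong refl) (simp only: mult_ac)
      finally show ?thesis .
    qed
    have "(1 / 16) ^ P / fact P * T2 k ((a + P) # qs) = (LINT g|gauss {..<k}. (1 / 16) ^ P / fact P * (Wg k g * prod_list (map (\<lambda>q. Sg k q g) ((a + P) # qs))))"
      unfolding T2_def by (rule integral_mult_right_zero[symmetric])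
    also have "\<dots> \<le> (LINT g|gauss {..<k}. (1 / 2) ^ P * (\<Sum>i<k. (2 ^ (a + 1) * g i ^ (2 * a) * Wg k g * ?Pi g) * exp ((g i)\<^sup>2 / 4)))"
      by (intro integral_mono integrable_mult_right intT Bochner_Integration.integrable_sum int pt) auto
    also have "\<dots> = (1 / 2) ^ P * ?C"
      using int by (simp add: Bochner_Integration.integral_sum)
    finally show ?thesis .
  qed
  show ?thesis
  proof (rule tendsto_sandwich[of "\<lambda>_. 0"])
    show "(\<lambda>P. (1 / 2) ^ P * ?C) \<longlonglongrightarrow> 0"
      using tendsto_mult_right[OF LIMSEQ_realpow_zero[of "1 / 2 :: real"], of ?C] by simp
    show "\<forall>\<^sub>F P in sequentially. 0 \<le> (1 / 16) ^ P / fact P * T2 k ((a + P) # qs)"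
      by (intro always_eventually allI mult_nonneg_nonneg T0) auto
    show "\<forall>\<^sub>F P in sequentially. (1 / 16) ^ P / fact P * T2 k ((a + P) # qs) \<le> (1 / 2) ^ P * ?C"
      by (intro always_eventually allI bound)
  qed auto
qed

definition M2 :: "nat \<Rightarrow> (nat \<Rightarrow> real) measure" where
  "M2 k = density (gauss {..<k}) (\<lambda>g. ennreal (Wg k g / T2 k []))"

text \<open>\<open>j div 2\<close> lists every point twice, so that both models have 2 k
  points.\<close>

definition X2 :: "nat \<Rightarrow> (nat \<Rightarrow> real) \<Rightarrow> real" where
  "X2 j g = 2 * (g (j div 2))\<^sup>2"

lemma sum_div2: "(\<Sum>j<2 * (k::nat). f (j div 2)) = 2 * (\<Sum>i<k. f i :: real)"
  by (induction k) auto

lemma X2_power_sum: "(\<Sum>j<2 * k. X2 j g ^ q) = Sg k q g"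
proof -
  have "(2 * (g i)\<^sup>2) ^ q = 2 ^ q * g i ^ (2 * q)" for i by (simp only: power_mult_distrib power_mult)
  then show ?thesis
    unfolding X2_def sum_div2[of "\<lambda>i. (2 * (g i)\<^sup>2) ^ q"] Sg_def Pp_def by (simp add: sum_distrib_left mult.assoc)
qed

lemma Wg_measurable [measurable]: "Wg k \<in> borel_measurable (gauss {..<k})"
  using pf_integrable[OF pf_Wg] by auto

lemma M2_integral:
  assumes "pf {..<k} f"
  shows "integrable (M2 k) f" "(LINT g|M2 k. f g) = (LINT g|gauss {..<k}. Wg k g * f g) / T2 k []"
proof -
  have [measurable]: "f \<in> borel_measurable (gauss {..<k})" using pf_integrable[OF assms] by auto
  have nn: "Wg k g / T2 k [] \<ge> 0" for g using Wg_nonneg T2_Nil_pos by (simp add: less_imp_le)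
  have "integrable (gauss {..<k}) (\<lambda>g. (1 / T2 k []) * (Wg k g * f g))"
    by (intro integrable_mult_right pf_integrable pf_mult pf_Wg assms) auto
  then show "integrable (M2 k) f"
    unfolding M2_def using nn by (subst integrable_density) auto
  show "(LINT g|M2 k. f g) = (LINT g|gauss {..<k}. Wg k g * f g) / T2 k []"
    unfolding M2_def using nn by (subst integral_density) auto
qed

lemma M2_prod: "(LINT g|M2 k. prod_list (map (\<lambda>q. \<Sum>j<2 * k. X2 j g ^ q) qs)) = T2 k qs / T2 k []"
  unfolding X2_power_sum T2_def[of k qs] by (rule M2_integral(2)) (intro pf_prod_list pf_Sg)

lemma pmodel_M2: "pmodel (M2 k) X2 (2 * k)"
proof (intro pmodel.intro pmodel_axioms.intro)
  show "prob_space (M2 k)"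
  proof
    have "emeasure (M2 k) (space (M2 k)) = (\<integral>\<^sup>+ g. ennreal (Wg k g / T2 k []) \<partial>gauss {..<k})"
      unfolding M2_def by (simp add: emeasure_density cong: nn_integral_cong)
    also have "\<dots> = ennreal (LINT g|gauss {..<k}. Wg k g / T2 k [])"
      using Wg_nonneg T2_Nil_pos[of k] pf_integrable[OF pf_Wg[of k]]
      by (intro nn_integral_eq_integral) (auto simp: less_imp_le)
    also have "(LINT g|gauss {..<k}. Wg k g / T2 k []) = 1" using T2_Nil_pos[of k] by (simp add: T2_def)
    finally show "emeasure (M2 k) (space (M2 k)) = 1" by simp
  qed
  show "X2 j g \<ge> 0" for j g by (simp add: X2_def)
  show "(\<lambda>g. \<Sum>j<2 * k. X2 j g ^ q) \<in> borel_measurable (M2 k)" for q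
    unfolding X2_power_sum using M2_integral(1)[OF pf_Sg] by (rule borel_measurable_integrable)
  show "integrable (M2 k) (\<lambda>g. prod_list (map (\<lambda>q. \<Sum>j<2 * k. X2 j g ^ q) qs))" for qs
    unfolding X2_power_sum by (intro M2_integral(1) pf_prod_list pf_Sg)
  show "(\<lambda>P. (1 / 16) ^ P / fact P * (LINT g|M2 k. (\<Sum>j<2 * k. X2 j g ^ (a + P)) * prod_list (map (\<lambda>q. \<Sum>j<2 * k. X2 j g ^ q) qs))) \<longlonglongrightarrow> 0" for a qs
  proof -
    have "(LINT g|M2 k. (\<Sum>j<2 * k. X2 j g ^ (a + P)) * prod_list (map (\<lambda>q. \<Sum>j<2 * k. X2 j g ^ q) qs)) = T2 k ((a + P) # qs) / T2 k []" for P
      using M2_prod[of k "(a + P) # qs"] by simp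
    then show ?thesis using tendsto_divide[OF T2_growth[of k a qs] tendsto_const[of "T2 k []"]] T2_Nil_pos[of k] by simp
  qed
qed

text \<open>The threshold \<open>4 * x\<^sup>2\<close> is chosen for \<open>X1\<close>, the square
  of twice an eigenvalue, where it means modulus greater than x. For X2 = 2 g^2 it reads g^2 > 2
  x^2, the event evaluated in \<open>W_tail\<close>.\<close>

lemma M2_void:
  assumes "x \<ge> 0"
  shows "measure (M2 k) {g \<in> space (M2 k). \<forall>j<2 * k. X2 j g > 4 * x\<^sup>2} = HH k x / HH k 0"
proof -
  let ?\<phi> = "\<lambda>u. if u\<^sup>2 > 2 * x\<^sup>2 then 1 else 0 :: real"
  define A where "A = {g \<in> space (M2 k). \<forall>j<2 * k. X2 j g > 4 * x\<^sup>2}"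
  have A: "A \<in> sets (M2 k)" unfolding A_def
    by (rule pmodel_void_eq(1)[OF pmodel_M2 pmodel_M2]) simp
  have sp: "space (M2 k) = space (gauss {..<k})" "sets (M2 k) = sets (gauss {..<k})" by (auto simp: M2_def)
  have all: "(\<forall>j<2 * k. X2 j g > 4 * x\<^sup>2) \<longleftrightarrow> (\<forall>i<k. (g i)\<^sup>2 > 2 * x\<^sup>2)" for g
  proof
    assume L: "\<forall>j<2 * k. X2 j g > 4 * x\<^sup>2"
    show "\<forall>i<k. (g i)\<^sup>2 > 2 * x\<^sup>2"
    proof (intro allI impI)
      fix i assume "i < k"
      then have "X2 (2 * i) g > 4 * x\<^sup>2" using L by simp
      then show "(g i)\<^sup>2 > 2 * x\<^sup>2" by (simp add: X2_def)
    qed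
  next
    assume "\<forall>i<k. (g i)\<^sup>2 > 2 * x\<^sup>2"
    then show "\<forall>j<2 * k. X2 j g > 4 * x\<^sup>2" by (auto simp: X2_def)
  qed
  have ind: "indicator A g = (\<Prod>i<k. ?\<phi> (g i))" if "g \<in> space (gauss {..<k})" for g
  proof (cases "\<forall>i<k. (g i)\<^sup>2 > 2 * x\<^sup>2")
    case True
    then have "(\<Prod>i<k. ?\<phi> (g i)) = 1" by (intro prod.neutral) auto
    then show ?thesis using True that by (simp add: A_def all sp)
  next
    case False
    then obtain i where "i < k" "\<not> (g i)\<^sup>2 > 2 * x\<^sup>2" by auto
    then have "(\<Prod>i<k. ?\<phi> (g i)) = 0" by (intro prod_zero) auto
    then show ?thesis using False by (simp add: A_def all)
  qed
  have Am [measurable]: "A \<in> sets (gauss {..<k})" using A sp by simp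
  have "measure (M2 k) A = (LINT g|M2 k. indicator A g)" by (rule measure_eq_LINT_indicator[OF A])
  also have "\<dots> = (LINT g|gauss {..<k}. (Wg k g / T2 k []) *\<^sub>R indicator A g)"
    unfolding M2_def using Wg_nonneg T2_Nil_pos[of k] by (intro integral_density) (auto simp: less_imp_le)
  also have "\<dots> = (LINT g|gauss {..<k}. (Wg k g * (\<Prod>i<k. ?\<phi> (g i))) / T2 k [])"
    by (intro Bochner_Integration.integral_cong refl) (simp add: ind)
  also have "\<dots> = (LINT g|gauss {..<k}. Wg k g * (\<Prod>i<k. ?\<phi> (g i))) / T2 k []" by simp
  also have "\<dots> = HH k x / HH k 0"
  proof -
    have "fact k * ((\<Prod>i<k. 2 / sqrt pi * 2 ^ i) * (\<Prod>j<k. 2 ^ j)) \<noteq> (0::real)" by auto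
    moreover have "y \<noteq> 0 \<Longrightarrow> (y * a) / (y * b) = a / b" for y a b :: real by simp
    ultimately show ?thesis unfolding W_tail[OF assms] T2_Nil by blast
  qed
  finally show ?thesis unfolding A_def .
qed

section \<open>Eigenvalues of aGUE matrices\<close>

text \<open>An arbitrary choice among the orderings of the roots with multiplicity, made separately
  for every Y. No measurability of a single entry is claimed, which is why the moment argument rests
  on power sums alone.\<close>

definition eigs :: "nat \<Rightarrow> (nat \<times> nat \<Rightarrow> real) \<Rightarrow> complex list" where
  "eigs l Y = (SOME es. char_poly (aGUE_mat l Y) = (\<Prod>a\<leftarrow>es. [:- a, 1:]) \<and> length es = l)"

lemma aGUE_carrier: "aGUE_mat l Y \<in> carrier_mat l l"
  by (simp add: aGUE_mat_def)

lemma eigs: "char_poly (aGUE_mat l Y) = (\<Prod>a\<leftarrow>eigs l Y. [:- a, 1:])" "length (eigs l Y) = l"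
  using someI_ex[OF char_poly_factorized[OF aGUE_carrier]] unfolding eigs_def by blast+

lemma eigenvalue_iff: "eigenvalue (aGUE_mat l Y) e \<longleftrightarrow> e \<in> set (eigs l Y)"
  unfolding eigenvalue_root_char_poly[OF aGUE_carrier] eigs(1) poly_prod_list
  by (induction "eigs l Y") (auto simp: prod_list_zero_iff)

lemma aGUE_entry: "i < l \<Longrightarrow> j < l \<Longrightarrow> aGUE_mat l Y $$ (i, j) = \<i> / 2 * complex_of_real (Zm Y i j)"
  by (simp add: aGUE_mat_def Zm_def)

lemma eigenvector_aGUE:
  assumes "eigenvector (aGUE_mat l Y) v e" "i < l"
  shows "(\<Sum>j<l. \<i> / 2 * complex_of_real (Zm Y i j) * v $ j) = e * v $ i"
proof -
  have v: "v \<in> carrier_vec l" and eq: "aGUE_mat l Y *\<^sub>v v = e \<cdot>\<^sub>v v"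
    using assms(1) aGUE_carrier[of l Y] by (auto simp: eigenvector_def)
  have "(aGUE_mat l Y *\<^sub>v v) $ i = (\<Sum>j<l. aGUE_mat l Y $$ (i, j) * v $ j)"
    using assms(2) v aGUE_carrier[of l Y] by (auto simp: scalar_prod_def atLeast0LessThan intro!: sum.cong)
  also have "\<dots> = (\<Sum>j<l. \<i> / 2 * complex_of_real (Zm Y i j) * v $ j)"
    using assms(2) by (intro sum.cong refl) (simp add: aGUE_entry)
  finally show ?thesis using eq v assms(2) by simp
qed

lemma eigenvalue_real:
  assumes "eigenvalue (aGUE_mat l Y) e"
  shows "e \<in> \<real>"
proof -
  obtain v where v: "eigenvector (aGUE_mat l Y) v e" using assms by (auto simp: eigenvalue_def)
  have vc: "v \<in> carrier_vec l" "v \<noteq> 0\<^sub>v l" using v aGUE_carrier[of l Y] by (auto simp: eigenvector_def)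
  let ?a = "\<lambda>i j. \<i> / 2 * complex_of_real (Zm Y i j)"
  define Q where "Q = (\<Sum>i<l. \<Sum>j<l. cnj (v $ i) * (?a i j * v $ j))"
  define nn where "nn = (\<Sum>i<l. (cmod (v $ i))\<^sup>2)"
  have Q1: "Q = e * complex_of_real nn"
  proof -
    have "Q = (\<Sum>i<l. cnj (v $ i) * (e * v $ i))"
      unfolding Q_def sum_distrib_left[symmetric]
      by (intro sum.cong refl arg_cong[where f = "\<lambda>y. _ * y"] eigenvector_aGUE[OF v]) simp
    also have "\<dots> = (\<Sum>i<l. e * complex_of_real ((cmod (v $ i))\<^sup>2))"
      by (intro sum.cong refl) (simp only: complex_norm_square mult_ac)
    finally show ?thesis by (simp add: nn_def sum_distrib_left)
  qed
  have a: "cnj (?a i j) = ?a j i" for i j by (simp add: Zm_def algebra_simps)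
  have "cnj Q = (\<Sum>i<l. \<Sum>j<l. v $ i * (?a j i * cnj (v $ j)))"
    unfolding Q_def cnj_sum
  proof (intro sum.cong refl)
    fix i j
    show "cnj (cnj (v $ i) * (?a i j * v $ j)) = v $ i * (?a j i * cnj (v $ j))"
      unfolding complex_cnj_mult[of "cnj (v $ i)"] complex_cnj_mult[of "?a i j"] a complex_cnj_cnj ..
  qed
  also have "\<dots> = (\<Sum>j<l. \<Sum>i<l. v $ i * (?a j i * cnj (v $ j)))" by (rule sum.swap)
  also have "\<dots> = Q" unfolding Q_def by (simp add: mult_ac)
  finally have "cnj Q = Q" .
  then have "cnj e * complex_of_real nn = e * complex_of_real nn" unfolding Q1 by simp
  moreover have "nn \<noteq> 0"
  proof
    assume "nn = 0"
    then have "\<forall>i<l. v $ i = 0" unfolding nn_def by (subst (asm) sum_nonneg_eq_0_iff) auto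
    then have "v = 0\<^sub>v l" using vc by (intro eq_vecI) auto
    with vc show False by simp
  qed
  ultimately have "cnj e = e" by simp
  then show ?thesis by (simp add: Reals_cnj_iff)
qed

text \<open>All entries are purely imaginary, so entrywise conjugation changes the sign of the
  matrix. Conjugating an eigenvector for the real number e yields one for -e.\<close>

lemma eigenvalue_uminus:
  assumes "eigenvalue (aGUE_mat l Y) e"
  shows "eigenvalue (aGUE_mat l Y) (- e)"
proof -
  obtain v where v: "eigenvector (aGUE_mat l Y) v e" using assms by (auto simp: eigenvalue_def)
  have vc: "v \<in> carrier_vec l" "v \<noteq> 0\<^sub>v l" using v aGUE_carrier[of l Y] by (auto simp: eigenvector_def)
  have re: "cnj e = e" using eigenvalue_real[OF assms] by (simp add: Reals_cnj_iff)
  define w where "w = vec l (\<lambda>i. cnj (v $ i))"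
  have "w \<noteq> 0\<^sub>v l"
  proof
    assume w0: "w = 0\<^sub>v l"
    have "v $ i = 0" if "i < l" for i
      using arg_cong[OF w0, of "\<lambda>u. u $ i"] that by (simp add: w_def)
    then have "v = 0\<^sub>v l" using vc by (intro eq_vecI) auto
    with vc show False by simp
  qed
  moreover have "aGUE_mat l Y *\<^sub>v w = (- e) \<cdot>\<^sub>v w"
  proof (rule eq_vecI)
    fix i assume "i < dim_vec ((- e) \<cdot>\<^sub>v w)"
    then have i: "i < l" by (simp add: w_def)
    have "(aGUE_mat l Y *\<^sub>v w) $ i = (\<Sum>j<l. aGUE_mat l Y $$ (i, j) * w $ j)"
      using i aGUE_carrier[of l Y] by (auto simp: scalar_prod_def w_def atLeast0LessThan intro!: sum.cong)
    also have "\<dots> = (\<Sum>j<l. - cnj (\<i> / 2 * complex_of_real (Zm Y i j) * v $ j))"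
      using i by (intro sum.cong refl) (simp add: aGUE_entry w_def)
    also have "\<dots> = - cnj (\<Sum>j<l. \<i> / 2 * complex_of_real (Zm Y i j) * v $ j)" by (simp add: sum_negf)
    also have "\<dots> = - (e * cnj (v $ i))" unfolding eigenvector_aGUE[OF v i] by (simp add: re)
    finally show "(aGUE_mat l Y *\<^sub>v w) $ i = ((- e) \<cdot>\<^sub>v w) $ i" using i by (simp add: w_def)
  qed (use aGUE_carrier[of l Y] in \<open>auto simp: w_def\<close>)
  ultimately have "eigenvector (aGUE_mat l Y) w (- e)"
    using aGUE_carrier[of l Y] by (auto simp: eigenvector_def w_def)
  then show ?thesis by (auto simp: eigenvalue_def)
qed

lemma mat_trace_comm:
  fixes A B :: "complex Matrix.mat"
  assumes "A \<in> carrier_mat n n" "B \<in> carrier_mat n n"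
  shows "(\<Sum>i<n. (A * B) $$ (i, i)) = (\<Sum>i<n. (B * A) $$ (i, i))"
proof -
  have "(\<Sum>i<n. (A * B) $$ (i, i)) = (\<Sum>i<n. \<Sum>j<n. A $$ (i, j) * B $$ (j, i))"
    using assms by (intro sum.cong refl) (auto simp: scalar_prod_def atLeast0LessThan)
  also have "\<dots> = (\<Sum>j<n. \<Sum>i<n. A $$ (i, j) * B $$ (j, i))" by (rule sum.swap)
  also have "\<dots> = (\<Sum>j<n. (B * A) $$ (j, j))"
    using assms by (intro sum.cong refl) (auto simp: scalar_prod_def atLeast0LessThan mult.commute)
  finally show ?thesis .
qed

lemma upper_triangular_pow:
  fixes B :: "complex Matrix.mat"
  assumes B: "B \<in> carrier_mat n n" "upper_triangular B"
  shows "(\<forall>i<n. \<forall>j<i. (B ^\<^sub>m q) $$ (i, j) = 0) \<and> (\<forall>i<n. (B ^\<^sub>m q) $$ (i, i) = (B $$ (i, i)) ^ q)"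
proof (induction q)
  case (Suc q)
  have C: "B ^\<^sub>m q \<in> carrier_mat n n" using B by simp
  have entry: "(B ^\<^sub>m Suc q) $$ (i, j) = (\<Sum>r<n. (B ^\<^sub>m q) $$ (i, r) * B $$ (r, j))" if "i < n" "j < n" for i j
    using that B C by (auto simp: scalar_prod_def atLeast0LessThan)
  have ut: "B $$ (r, j) = 0" if "j < r" "r < n" for r j using B that by auto
  have "(B ^\<^sub>m Suc q) $$ (i, j) = 0" if "i < n" "j < i" for i j
  proof -
    have "(B ^\<^sub>m q) $$ (i, r) * B $$ (r, j) = 0" if "r < n" for r
      using Suc ut[of j r] that \<open>i < n\<close> \<open>j < i\<close> by (cases "r < i") auto
    moreover have "j < n" using that by simp
    ultimately show ?thesis unfolding entry[OF that(1) \<open>j < n\<close>] by (intro sum.neutral) blast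
  qed
  moreover have "(B ^\<^sub>m Suc q) $$ (i, i) = (B $$ (i, i)) ^ Suc q" if i: "i < n" for i
  proof -
    have "(B ^\<^sub>m Suc q) $$ (i, i) = (\<Sum>r\<in>{i}. (B ^\<^sub>m q) $$ (i, r) * B $$ (r, i))"
      unfolding entry[OF i i]
    proof (intro sum.mono_neutral_right ballI)
      fix r assume "r \<in> {..<n} - {i}"
      then show "(B ^\<^sub>m q) $$ (i, r) * B $$ (r, i) = 0"
        using Suc ut[of i r] i by (cases "r < i") auto
    qed (use i in auto)
    then show ?thesis using Suc i by (simp add: mult.commute)
  qed
  ultimately show ?case by blast
qed (use B in auto)

text \<open>In a Schur form the diagonal of the q-th power consists of the q-th powers of the
  diagonal, and the trace is invariant under similarity. Working with the list keeps multiplicities,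
  which a sum over the set of eigenvalues would lose.\<close>

lemma trace_pow_eigs: "(\<Sum>i<l. (aGUE_mat l Y ^\<^sub>m q) $$ (i, i)) = (\<Sum>i<l. (eigs l Y ! i) ^ q)"
proof -
  let ?A = "aGUE_mat l Y"
  obtain B P Q where sd: "schur_decomposition ?A (eigs l Y) = (B, P, Q)" by (metis prod_cases3)
  from schur_decomposition[OF aGUE_carrier eigs(1) sd]
  have wit: "similar_mat_wit ?A B P Q" and ut: "upper_triangular B" and diag: "diag_mat B = eigs l Y" by auto
  note D = similar_mat_witD2[OF aGUE_carrier wit]
  note E = similar_mat_witD2[OF _ similar_mat_wit_pow[OF wit, of q], of l l]
  have Aq: "?A ^\<^sub>m q \<in> carrier_mat l l" using aGUE_carrier[of l Y] by simp
  have Bq: "B ^\<^sub>m q \<in> carrier_mat l l" using D by simp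
  have "(\<Sum>i<l. (?A ^\<^sub>m q) $$ (i, i)) = (\<Sum>i<l. (P * (B ^\<^sub>m q) * Q) $$ (i, i))"
    using E(3)[OF Aq] by simp
  also have "\<dots> = (\<Sum>i<l. (Q * (P * (B ^\<^sub>m q))) $$ (i, i))"
    using D Bq by (intro mat_trace_comm) auto
  also have "Q * (P * (B ^\<^sub>m q)) = B ^\<^sub>m q"
    using D Bq by (simp add: assoc_mult_mat[symmetric, of Q l l P l _ l])
  also have "(\<Sum>i<l. (B ^\<^sub>m q) $$ (i, i)) = (\<Sum>i<l. (eigs l Y ! i) ^ q)"
  proof (intro sum.cong refl)
    fix i assume i: "i \<in> {..<l}"
    have "B $$ (i, i) = eigs l Y ! i" unfolding diag[symmetric] using i D by (simp add: diag_mat_def)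
    then show "(B ^\<^sub>m q) $$ (i, i) = (eigs l Y ! i) ^ q" using upper_triangular_pow[OF D(5) ut, of q] i by auto
  qed
  finally show ?thesis .
qed

lemma aGUE_pow_entry:
  "i < l \<Longrightarrow> j < l \<Longrightarrow> (aGUE_mat l Y ^\<^sub>m q) $$ (i, j) = (\<i> / 2) ^ q * complex_of_real (mp l (Zm Y) q i j)"
proof (induction q arbitrary: j)
  case (Suc q)
  have C: "aGUE_mat l Y ^\<^sub>m q \<in> carrier_mat l l" using aGUE_carrier[of l Y] by simp
  have "(aGUE_mat l Y ^\<^sub>m Suc q) $$ (i, j) = (\<Sum>r<l. (aGUE_mat l Y ^\<^sub>m q) $$ (i, r) * aGUE_mat l Y $$ (r, j))"
    using Suc.prems C aGUE_carrier[of l Y] by (auto simp: scalar_prod_def atLeast0LessThan)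
  also have "\<dots> = (\<Sum>r<l. (\<i> / 2) ^ Suc q * complex_of_real (mp l (Zm Y) q i r * mp l (Zm Y) (Suc 0) r j))"
  proof (intro sum.cong refl)
    fix r assume "r \<in> {..<l}"
    then show "(aGUE_mat l Y ^\<^sub>m q) $$ (i, r) * aGUE_mat l Y $$ (r, j) = (\<i> / 2) ^ Suc q * complex_of_real (mp l (Zm Y) q i r * mp l (Zm Y) (Suc 0) r j)"
      using Suc mp_1[of r l j "Zm Y"] by (simp add: aGUE_entry del: mp.simps)
  qed
  also have "\<dots> = (\<i> / 2) ^ Suc q * complex_of_real (mp l (Zm Y) (q + Suc 0) i j)"
    unfolding mp_add[OF Suc.prems(1)] by (simp add: sum_distrib_left)
  finally show ?case by simp
qed (use aGUE_carrier[of l Y] in simp)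

definition X1 :: "nat \<Rightarrow> nat \<Rightarrow> (nat \<times> nat \<Rightarrow> real) \<Rightarrow> real" where
  "X1 l j Y = (2 * Re (eigs l Y ! j))\<^sup>2"

lemma eigs_real: "j < l \<Longrightarrow> eigs l Y ! j = complex_of_real (Re (eigs l Y ! j))"
  using eigenvalue_real[of l Y "eigs l Y ! j"] eigs(2)[of l Y] by (simp add: eigenvalue_iff)

lemma X1_power_sum: "(\<Sum>j<l. X1 l j Y ^ q) = Sm l q Y"
proof -
  have "complex_of_real (\<Sum>j<l. X1 l j Y ^ q) = (\<Sum>j<l. 4 ^ q * (eigs l Y ! j) ^ (2 * q))"
    unfolding of_real_sum
  proof (intro sum.cong refl)
    fix j assume "j \<in> {..<l}"
    then have e: "eigs l Y ! j = complex_of_real (Re (eigs l Y ! j))" by (intro eigs_real) auto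
    have "X1 l j Y ^ q = 4 ^ q * Re (eigs l Y ! j) ^ (2 * q)"
      by (simp add: X1_def power_mult_distrib power_mult)
    then show "complex_of_real (X1 l j Y ^ q) = 4 ^ q * (eigs l Y ! j) ^ (2 * q)"
      by (subst e) simp
  qed
  also have "\<dots> = 4 ^ q * (\<Sum>i<l. (aGUE_mat l Y ^\<^sub>m (2 * q)) $$ (i, i))"
    unfolding trace_pow_eigs by (simp add: sum_distrib_left)
  also have "\<dots> = 4 ^ q * ((\<i> / 2) ^ (2 * q) * complex_of_real (trm l (2 * q) Y))"
    unfolding trm_def by (simp add: aGUE_pow_entry sum_distrib_left)
  also have "(4::complex) ^ q * ((\<i> / 2) ^ (2 * q) * complex_of_real (trm l (2 * q) Y)) = complex_of_real (Sm l q Y)"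
  proof -
    have "(4::complex) ^ q * (\<i> / 2) ^ (2 * q) = (4 * (\<i> / 2)\<^sup>2) ^ q" by (simp only: power_mult power_mult_distrib)
    also have "4 * (\<i> / 2)\<^sup>2 = (- 1 :: complex)" by (simp add: power_divide)
    finally show ?thesis by (simp add: Sm_def mult.assoc[symmetric])
  qed
  finally show ?thesis by (simp only: of_real_eq_iff)
qed

section \<open>Comparison of the matrix model with the weighted Gaussian points\<close>

lemma gauss_entries_eq: "gauss_entries l = gauss (sq l)"
  by (simp add: gauss_entries_def)

lemma M1_prod: "(LINT Y|gauss (sq l). prod_list (map (\<lambda>q. \<Sum>j<l. X1 l j Y ^ q) qs)) = T1 l qs"
  unfolding X1_power_sum T1_def ..

lemma pmodel_M1: "pmodel (gauss (sq (2 * k))) (X1 (2 * k)) (2 * k)"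
proof (intro pmodel.intro pmodel_axioms.intro)
  show "prob_space (gauss (sq (2 * k)))" by (rule prob_space_gauss)
  show "X1 (2 * k) j Y \<ge> 0" for j Y by (simp add: X1_def)
  show "(\<lambda>Y. \<Sum>j<2 * k. X1 (2 * k) j Y ^ q) \<in> borel_measurable (gauss (sq (2 * k)))" for q
    unfolding X1_power_sum using pf_integrable[OF pf_Sm] by auto
  show "integrable (gauss (sq (2 * k))) (\<lambda>Y. prod_list (map (\<lambda>q. \<Sum>j<2 * k. X1 (2 * k) j Y ^ q) qs))" for qs
    unfolding X1_power_sum by (intro pf_integrable pf_prod_list pf_Sm) auto
  show "(\<lambda>P. (1 / 16) ^ P / fact P * (LINT Y|gauss (sq (2 * k)). (\<Sum>j<2 * k. X1 (2 * k) j Y ^ (a + P)) * prod_list (map (\<lambda>q. \<Sum>j<2 * k. X1 (2 * k) j Y ^ q) qs))) \<longlonglongrightarrow> 0" for a qs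
  proof -
    have "(LINT Y|gauss (sq (2 * k)). (\<Sum>j<2 * k. X1 (2 * k) j Y ^ (a + P)) * prod_list (map (\<lambda>q. \<Sum>j<2 * k. X1 (2 * k) j Y ^ q) qs)) = T2 k ((a + P) # qs) / T2 k []" for P
      using M1_prod[of "2 * k" "(a + P) # qs"] T1_eq_T2[of k "(a + P) # qs"] T2_Nil_pos[of k] by simp
    then show ?thesis using tendsto_divide[OF T2_growth[of k a qs] tendsto_const[of "T2 k []"]] T2_Nil_pos[of k] by simp
  qed
qed

lemma M1_M2_moments:
  "(LINT Y|gauss (sq (2 * k)). prod_list (map (\<lambda>q. \<Sum>j<2 * k. X1 (2 * k) j Y ^ q) qs))
    = (LINT g|M2 k. prod_list (map (\<lambda>q. \<Sum>j<2 * k. X2 j g ^ q) qs))"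
  unfolding M1_prod M2_prod using T1_eq_T2[of k] T2_Nil_pos[of k] by simp

lemma M1_void:
  assumes "x \<ge> 0"
  shows "{Y \<in> space (gauss (sq (2 * k))). \<forall>j<2 * k. X1 (2 * k) j Y > 4 * x\<^sup>2} \<in> sets (gauss (sq (2 * k)))"
    and "measure (gauss (sq (2 * k))) {Y \<in> space (gauss (sq (2 * k))). \<forall>j<2 * k. X1 (2 * k) j Y > 4 * x\<^sup>2} = HH k x / HH k 0"
proof -
  show "{Y \<in> space (gauss (sq (2 * k))). \<forall>j<2 * k. X1 (2 * k) j Y > 4 * x\<^sup>2} \<in> sets (gauss (sq (2 * k)))"
    by (rule pmodel_void_eq(1)[OF pmodel_M1 pmodel_M2 M1_M2_moments])
  show "measure (gauss (sq (2 * k))) {Y \<in> space (gauss (sq (2 * k))). \<forall>j<2 * k. X1 (2 * k) j Y > 4 * x\<^sup>2} = HH k x / HH k 0"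
    using pmodel_void_eq(2)[OF pmodel_M1 pmodel_M2 M1_M2_moments] M2_void[OF assms, of k] by (rule trans)
qed

lemma pos_eigs_eq:
  "{x::real. x > 0 \<and> eigenvalue (aGUE_mat l Y) (complex_of_real x)} = {\<bar>Re (eigs l Y ! j)\<bar> |j. j < l \<and> Re (eigs l Y ! j) \<noteq> 0}"
proof (rule Set.set_eqI, rule iffI)
  fix x :: real
  assume "x \<in> {x. x > 0 \<and> eigenvalue (aGUE_mat l Y) (complex_of_real x)}"
  then have x: "x > 0" "complex_of_real x \<in> set (eigs l Y)" by (auto simp: eigenvalue_iff)
  then obtain j where "j < l" "eigs l Y ! j = complex_of_real x" using eigs(2)[of l Y] by (auto simp: in_set_conv_nth)
  then show "x \<in> {\<bar>Re (eigs l Y ! j)\<bar> |j. j < l \<and> Re (eigs l Y ! j) \<noteq> 0}" using x by (auto intro!: exI[of _ j])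
next
  fix x :: real
  assume "x \<in> {\<bar>Re (eigs l Y ! j)\<bar> |j. j < l \<and> Re (eigs l Y ! j) \<noteq> 0}"
  then obtain j where j: "x = \<bar>Re (eigs l Y ! j)\<bar>" "j < l" "Re (eigs l Y ! j) \<noteq> 0" by auto
  let ?r = "Re (eigs l Y ! j)"
  have e: "eigenvalue (aGUE_mat l Y) (complex_of_real ?r)"
    using eigs_real[OF j(2), of Y] j(2) eigs(2)[of l Y] by (metis eigenvalue_iff nth_mem)
  have "eigenvalue (aGUE_mat l Y) (complex_of_real \<bar>?r\<bar>)"
    using e eigenvalue_uminus[OF e] by (cases "?r \<ge> 0") auto
  then show "x \<in> {x. x > 0 \<and> eigenvalue (aGUE_mat l Y) (complex_of_real x)}" using j by auto
qed

text \<open>The infimum of the empty set is an unspecified real; this case and zero eigenvalues are confined to a null set.\<close>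
theorem TFS_tail_eq:
  assumes k: "k \<ge> 1" and x: "x > 0"
  shows "TFS_tail k x = HH k x / HH k 0"
proof -
  let ?l = "2 * k" and ?M = "gauss (sq (2 * k))"
  let ?r = "\<lambda>Y j. \<bar>Re (eigs ?l Y ! j)\<bar>"
  let ?E = "\<lambda>Y. {?r Y j |j. j < ?l \<and> Re (eigs ?l Y ! j) \<noteq> 0}"
  interpret prob_space ?M by (rule prob_space_gauss)
  define Ev where "Ev = {Y \<in> space ?M. smallest_pos_eig (aGUE_mat ?l Y) > x}"
  define V where "V = (\<lambda>y. {Y \<in> space ?M. \<forall>j<?l. X1 ?l j Y > 4 * y\<^sup>2})"
  have spe: "smallest_pos_eig (aGUE_mat ?l Y) = Inf (?E Y)" for Y
    unfolding smallest_pos_eig_def pos_eigs_eq ..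
  have finE: "finite (?E Y)" for Y by (rule finite_subset[of _ "?r Y ` {..<?l}"]) auto
  have X1r: "X1 ?l j Y \<le> 4 * y\<^sup>2 \<longleftrightarrow> ?r Y j \<le> y" if "y \<ge> 0" for j Y y
    unfolding X1_def power_mult_distrib using that abs_le_square_iff[of "Re (eigs ?l Y ! j)" y] by simp
  have X1z: "X1 ?l j Y \<le> 4 * 0\<^sup>2 \<longleftrightarrow> Re (eigs ?l Y ! j) = 0" for j Y by (simp add: X1_def)
  have nonempty: "Inf (?E Y) > x \<longleftrightarrow> (\<forall>j<?l. Re (eigs ?l Y ! j) \<noteq> 0 \<longrightarrow> ?r Y j > x)" if "?E Y \<noteq> {}" for Y
  proof -
    have "Inf (?E Y) = Min (?E Y)" using finE that by (intro cInf_eq_Min)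
    then show ?thesis using Min_gr_iff[OF finE that, of x] by auto
  qed
  have cntm: "cnt (X1 ?l) ?l y \<in> borel_measurable ?M" for y
    by (rule pmodel_cnt_eq(1)[OF pmodel_M1 pmodel_M2 M1_M2_moments])
  \<comment> \<open>The event has to be expressed by counting functions, the measurable quantities
    at hand: no eigenvalue has modulus in (0, x], so the counts at x and at 0 agree. The disjunction
    covers the case that every eigenvalue is 0.\<close>
  have Evm: "Ev \<in> sets ?M"
  proof -
    have "Ev = {Y \<in> space ?M. cnt (X1 ?l) ?l (4 * x\<^sup>2) Y = cnt (X1 ?l) ?l (4 * 0\<^sup>2) Y \<and> (cnt (X1 ?l) ?l (4 * 0\<^sup>2) Y < real ?l \<or> Inf ({}::real set) > x)}"
    proof -
      have "smallest_pos_eig (aGUE_mat ?l Y) > x \<longleftrightarrow> cnt (X1 ?l) ?l (4 * x\<^sup>2) Y = cnt (X1 ?l) ?l (4 * 0\<^sup>2) Y \<and> (cnt (X1 ?l) ?l (4 * 0\<^sup>2) Y < real ?l \<or> Inf ({}::real set) > x)" for Y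
      proof -
        let ?A = "{j\<in>{..<?l}. ?r Y j \<le> x}" and ?B = "{j\<in>{..<?l}. Re (eigs ?l Y ! j) = 0}"
        have cA: "cnt (X1 ?l) ?l (4 * x\<^sup>2) Y = real (card ?A)" unfolding cnt_eq_card using X1r[of x] x by simp
        have cB: "cnt (X1 ?l) ?l (4 * 0\<^sup>2) Y = real (card ?B)" unfolding cnt_eq_card X1z ..
        have BA: "?B \<subseteq> ?A" using x by auto
        have eqc: "card ?A = card ?B \<longleftrightarrow> ?A = ?B" using BA card_subset_eq[of ?A ?B] by auto
        show ?thesis
        proof (cases "?E Y = {}")
          case True
          then have z: "Re (eigs ?l Y ! j) = 0" if "j < ?l" for j using that by auto
          then have "?A = {..<?l}" "?B = {..<?l}" using x by auto
          then show ?thesis unfolding spe cA cB True by simp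
        next
          case False
          then obtain j where "j < ?l" "Re (eigs ?l Y ! j) \<noteq> 0" by auto
          then have "?B \<subset> {..<?l}" by auto
          then have "card ?B < ?l" using psubset_card_mono[of "{..<?l}" ?B] by simp
          moreover have "Inf (?E Y) > x \<longleftrightarrow> ?A = ?B" unfolding nonempty[OF False] using BA by (auto simp: not_le[symmetric])
          ultimately show ?thesis unfolding spe cA cB using eqc by simp
        qed
      qed
      then show ?thesis unfolding Ev_def by simp
    qed
    also have "\<dots> \<in> sets ?M"
    proof -
      have c1: "{Y \<in> space ?M. cnt (X1 ?l) ?l (4 * x\<^sup>2) Y = cnt (X1 ?l) ?l (4 * 0\<^sup>2) Y} \<in> sets ?M"
        by (rule borel_measurable_eq[OF cntm cntm])
      have c2: "{Y \<in> space ?M. cnt (X1 ?l) ?l (4 * 0\<^sup>2) Y < real ?l} \<in> sets ?M"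
        by (rule borel_measurable_less[OF cntm borel_measurable_const])
      have c3: "{Y \<in> space ?M. Inf ({}::real set) > x} \<in> sets ?M"
        by (rule sets.sets_Collect_const)
      show ?thesis
        by (rule back_subst[of "\<lambda>S. S \<in> sets ?M", OF sets.Int[OF c1 sets.Un[OF c2 c3]]]) blast
    qed
    finally show ?thesis .
  qed
  have Vm: "V y \<in> sets ?M" "measure ?M (V y) = HH k y / HH k 0" if "y \<ge> 0" for y
    unfolding V_def by (rule M1_void(1)[OF that], rule M1_void(2)[OF that])
  have Vmem: "Y \<in> V y \<longleftrightarrow> Y \<in> space ?M \<and> (\<forall>j<?l. ?r Y j > y)" if "y \<ge> 0" for Y y
    unfolding V_def mem_Collect_eq not_le[symmetric] X1r[OF that] ..
  \<comment> \<open>The void formula at 0 has the value 1: almost surely 0 is not an eigenvalue, so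
    the exceptional cases of the infimum form a null set.\<close>
  have V0: "measure ?M (V 0) = 1" using Vm(2)[of 0] HH_0_pos[of k] by simp
  have l0: "0 < ?l" using k by simp
  have inter: "Ev \<inter> V 0 = V x"
  proof (rule Set.set_eqI, rule iffI)
    fix Y assume Y: "Y \<in> Ev \<inter> V 0"
    then have nz: "Re (eigs ?l Y ! j) \<noteq> 0" if "j < ?l" for j using that Vmem[of 0 Y] by auto
    have "?E Y \<noteq> {}" using nz[OF l0] l0 by blast
    moreover have "Inf (?E Y) > x" "Y \<in> space ?M" using Y unfolding Ev_def spe by blast+
    ultimately have "\<forall>j<?l. ?r Y j > x" using nz nonempty[of Y] by blast
    then show "Y \<in> V x" using \<open>Y \<in> space ?M\<close> Vmem[of x Y] x by simp
  next
    fix Y assume "Y \<in> V x"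
    then have Y: "Y \<in> space ?M" and gr: "\<forall>j<?l. ?r Y j > x" using Vmem[of x Y] x by simp_all
    have nz: "\<bar>Re (eigs ?l Y ! j)\<bar> > 0" if "j < ?l" for j using gr that x less_trans[of 0 x] by blast
    then have "Y \<in> V 0" using Y Vmem[of 0 Y] by blast
    moreover have "?E Y \<noteq> {}" using nz[OF l0] l0 zero_less_abs_iff by blast
    then have "Inf (?E Y) > x" using nonempty[of Y] gr by blast
    then have "Y \<in> Ev" using Y unfolding Ev_def spe by blast
    ultimately show "Y \<in> Ev \<inter> V 0" by blast
  qed
  have ae: "AE Y in ?M. Y \<in> V 0" using V0 Vm(1)[of 0] by (intro AE_prob_1) auto
  have "AE Y in ?M. Y \<in> Ev \<longleftrightarrow> Y \<in> V x"
    using ae by eventually_elim (use inter in blast)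
  then have "measure ?M Ev = measure ?M (V x)"
    by (rule finite_measure_eq_AE[OF _ Evm Vm(1)[OF less_imp_le[OF x]]])
  also have "\<dots> = HH k x / HH k 0" using Vm(2)[of x] x by simp
  finally show ?thesis unfolding TFS_tail_def gauss_entries_eq Ev_def .
qed

section \<open>Stationarity and the gap law\<close>

definition rot :: "nat \<Rightarrow> nat list \<Rightarrow> nat list" where
  "rot n s = tl s @ [n - hd s]"

lemma net_prod_append: "net_prod (u @ v) = net_prod u \<circ> net_prod v"
  by (induction u) (simp_all only: append.simps net_prod_simps id_comp comp_assoc)

lemma rev_perm_tau:
  assumes "1 \<le> i" "i < n"
  shows "rev_perm n (tau (n - i) j) = tau i (rev_perm n j)"
  using assms by (auto simp: rev_perm_def Transposition.transpose_def)

lemma choose_two_pos: "n \<ge> 2 \<Longrightarrow> n choose 2 > 0"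
  by (simp add: zero_less_binomial_iff)

lemma sorting_networks_Cons:
  assumes "n \<ge> 2" "s \<in> sorting_networks n"
  obtains i u where "s = i # u" "1 \<le> i" "i < n"
proof (cases s)
  case Nil
  then show ?thesis using assms choose_two_pos[of n] by (auto simp: sorting_networks_def)
next
  case (Cons i u)
  then have "1 \<le> i" "i \<le> n - 1" using assms by (auto simp: sorting_networks_def)
  then show ?thesis using that[OF Cons] assms(1) by simp
qed

text \<open>Moving the first factor \<open>tau i\<close> of the product to the other side of the
  reversal turns it into \<open>tau (n - i)\<close>, which is the letter appended at the
  end.\<close>

lemma rot_sorting_networks:
  assumes "n \<ge> 2" "s \<in> sorting_networks n"
  shows "rot n s \<in> sorting_networks n"
proof -
  obtain i u where s: "s = i # u" "1 \<le> i" "i < n" using sorting_networks_Cons[OF assms] by blast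
  have len: "length u + 1 = n choose 2" and el: "\<forall>j\<in>set u. 1 \<le> j \<and> j \<le> n - 1"
    and np: "net_prod (i # u) = rev_perm n" using assms(2) s(1) by (auto simp: sorting_networks_def)
  have u: "net_prod u x = tau i (rev_perm n x)" for x
    unfolding np[symmetric] net_prod_simps comp_apply by simp
  have "net_prod (u @ [n - i]) x = rev_perm n x" for x
    unfolding net_prod_append net_prod_simps comp_apply u id_apply rev_perm_tau[OF s(2,3)] by simp
  then have "net_prod (u @ [n - i]) = rev_perm n" by blast
  moreover have "rot n s = u @ [n - i]" by (simp add: rot_def s(1))
  moreover have "1 \<le> n - i" "n - i \<le> n - 1" using s(2,3) by simp_all
  ultimately show ?thesis using len el unfolding sorting_networks_def by simp
qed

lemma rot_inj_on:
  assumes "n \<ge> 2"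
  shows "inj_on (rot n) (sorting_networks n)"
proof (rule inj_onI)
  fix s t assume st: "s \<in> sorting_networks n" "t \<in> sorting_networks n" "rot n s = rot n t"
  obtain i u where s: "s = i # u" "1 \<le> i" "i < n" using sorting_networks_Cons[OF assms st(1)] by blast
  obtain j v where t: "t = j # v" "1 \<le> j" "j < n" using sorting_networks_Cons[OF assms st(2)] by blast
  have "n - i = n - j" "u = v" using st(3) s(1) t(1) by (auto simp: rot_def)
  moreover have "i = j" using \<open>n - i = n - j\<close> s(3) t(3) by linarith
  ultimately show "s = t" using s(1) t(1) by simp
qed

lemma per_ext_eq:
  assumes "t - 1 = int (n choose 2) * q + int r" "r < n choose 2"
  shows "per_ext n s t = (if even q then int (s ! r) else int n - int (s ! r))"
proof -
  have "(t - 1) div int (n choose 2) = q" using assms by (intro int_div_pos_eq[of _ _ _ "int r"]) auto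
  moreover have "(t - 1) mod int (n choose 2) = int r" using assms by (intro int_mod_pos_eq[of _ _ q]) auto
  ultimately show ?thesis unfolding per_ext_def Let_def by simp
qed

lemma div_rem_exists:
  assumes "n \<ge> 2"
  obtains q r where "t - 1 = int (n choose 2) * q + int r" "r < n choose 2"
proof -
  let ?N = "int (n choose 2)"
  have N: "?N > 0" using choose_two_pos[OF assms] by simp
  have "t - 1 = ?N * ((t - 1) div ?N) + int (nat ((t - 1) mod ?N))" using N by simp
  moreover have "nat ((t - 1) mod ?N) < n choose 2"
    using pos_mod_bound[OF N, of "t - 1"] pos_mod_sign[OF N, of "t - 1"] by linarith
  ultimately show ?thesis using that by blast
qed

lemma per_ext_rot:
  assumes "n \<ge> 2" "s \<in> sorting_networks n"
  shows "per_ext n (rot n s) t = per_ext n s (t + 1)"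
proof -
  obtain i u where s: "s = i # u" "1 \<le> i" "i < n" using sorting_networks_Cons[OF assms] by blast
  have len: "n choose 2 = Suc (length u)" using assms(2) s(1) by (auto simp: sorting_networks_def)
  have rt: "rot n s = u @ [n - i]" by (simp add: rot_def s(1))
  obtain q r where qr: "t - 1 = int (n choose 2) * q + int r" "r < n choose 2"
    using div_rem_exists[OF assms(1)] by blast
  note L = per_ext_eq[OF qr, of "rot n s"]
  show ?thesis
  proof (cases "r < length u")
    case True
    have "t + 1 - 1 = int (n choose 2) * q + int (Suc r)" using qr(1) by simp
    note R = per_ext_eq[OF this, of s]
    have "rot n s ! r = s ! Suc r" using True unfolding rt unfolding s(1) by (simp add: nth_append)
    then show ?thesis unfolding L using R True len by simp
  next
    case False
    then have r: "r = length u" using qr(2) len by simp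
    have "t + 1 - 1 = int (n choose 2) * (q + 1) + int 0" using qr(1) r by (simp add: len algebra_simps)
    note R = per_ext_eq[OF this, of s]
    have "rot n s ! r = n - i" "s ! 0 = i" unfolding rt unfolding s(1) r by simp_all
    then show ?thesis unfolding L using R len s(3) by simp
  qed
qed

lemma per_ext_period:
  assumes "n \<ge> 2"
  shows "per_ext n s (t + int (2 * (n choose 2))) = per_ext n s t"
proof -
  obtain q r where qr: "t - 1 = int (n choose 2) * q + int r" "r < n choose 2"
    using div_rem_exists[OF assms] by blast
  have "t + int (2 * (n choose 2)) - 1 = int (n choose 2) * (q + 2) + int r" using qr(1) by (simp add: algebra_simps)
  from per_ext_eq[OF this qr(2)] per_ext_eq[OF qr] show ?thesis by simp
qed

lemma per_ext_nth:
  assumes "i < n choose 2"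
  shows "per_ext n s (int (Suc i)) = int (s ! i)"
  using per_ext_eq[of "int (Suc i)" n 0 i s] assms by simp

text \<open>Rotation is an injection of the finite set of networks into itself, hence a permutation
  of it, and it shifts the periodic extension by one. The predicate \<open>\<Phi>\<close> stands for
  an arbitrary event of the two-sided sequence, so this is stationarity.\<close>

lemma card_networks_shift_1:
  assumes "n \<ge> 2"
  shows "card {s \<in> sorting_networks n. \<Phi> (\<lambda>t. per_ext n s (t + 1))} = card {s \<in> sorting_networks n. \<Phi> (per_ext n s)}"
proof -
  let ?S = "sorting_networks n"
  have surj: "rot n ` ?S = ?S"
    using rot_sorting_networks[OF assms] by (intro endo_inj_surj rot_inj_on[OF assms]) auto
  have e: "per_ext n (rot n s) = (\<lambda>t. per_ext n s (t + 1))" if "s \<in> ?S" for s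
    using per_ext_rot[OF assms that] by blast
  have "{s \<in> ?S. \<Phi> (per_ext n s)} = rot n ` {s \<in> ?S. \<Phi> (\<lambda>t. per_ext n s (t + 1))}"
  proof (rule Set.set_eqI, rule iffI)
    fix s assume s: "s \<in> {s \<in> ?S. \<Phi> (per_ext n s)}"
    then obtain s' where "s' \<in> ?S" "s = rot n s'" using surj by blast
    then show "s \<in> rot n ` {s \<in> ?S. \<Phi> (\<lambda>t. per_ext n s (t + 1))}" using s e[of s'] by auto
  next
    fix s assume "s \<in> rot n ` {s \<in> ?S. \<Phi> (\<lambda>t. per_ext n s (t + 1))}"
    then obtain s' where "s' \<in> ?S" "\<Phi> (\<lambda>t. per_ext n s' (t + 1))" "s = rot n s'" by blast
    then show "s \<in> {s \<in> ?S. \<Phi> (per_ext n s)}" using e[of s'] rot_sorting_networks[OF assms] by auto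
  qed
  then show ?thesis using card_image[OF inj_on_subset[OF rot_inj_on[OF assms]]] by force
qed

lemma card_networks_shift:
  assumes "n \<ge> 2"
  shows "card {s \<in> sorting_networks n. \<Phi> (\<lambda>t. per_ext n s (t + c))} = card {s \<in> sorting_networks n. \<Phi> (per_ext n s)}"
proof (induction c rule: int_induct[where k = 0])
  case base
  then show ?case by simp
next
  case (step1 i)
  have "card {s \<in> sorting_networks n. \<Phi> (\<lambda>t. per_ext n s (t + i + 1))} = card {s \<in> sorting_networks n. \<Phi> (\<lambda>t. per_ext n s (t + i))}"
    by (rule card_networks_shift_1[OF assms, of "\<lambda>g. \<Phi> (\<lambda>t. g (t + i))"])
  then show ?case using step1 by (simp add: add.assoc)
next
  case (step2 i)
  have "card {s \<in> sorting_networks n. \<Phi> (\<lambda>t. per_ext n s (t + (i - 1) + 1))} = card {s \<in> sorting_networks n. \<Phi> (\<lambda>t. per_ext n s (t + (i - 1)))}"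
    by (rule card_networks_shift_1[OF assms, of "\<lambda>g. \<Phi> (\<lambda>t. g (t + (i - 1)))"])
  then show ?case using step2 by simp
qed

lemma first_count_per_ext:
  assumes "m \<le> n choose 2"
  shows "first_count n k m = card {s \<in> sorting_networks n. \<forall>j\<in>{1..m}. per_ext n s (int j) \<noteq> int k}"
proof -
  have "k \<notin> set (take m s) \<longleftrightarrow> (\<forall>j\<in>{1..m}. per_ext n s (int j) \<noteq> int k)" if "s \<in> sorting_networks n" for s
  proof -
    have len: "length s = n choose 2" using that by (simp add: sorting_networks_def)
    have "k \<notin> set (take m s) \<longleftrightarrow> (\<forall>i<m. s ! i \<noteq> k)"
      using assms len by (auto simp: in_set_conv_nth)
    also have "\<dots> \<longleftrightarrow> (\<forall>i<m. per_ext n s (int (Suc i)) \<noteq> int k)"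
      using assms per_ext_nth[of _ n s] by (simp del: of_nat_Suc)
    also have "\<dots> \<longleftrightarrow> (\<forall>j\<in>{1..m}. per_ext n s (int j) \<noteq> int k)"
      unfolding image_Suc_lessThan[symmetric] ball_simps Ball_def lessThan_iff by blast
    finally show ?thesis .
  qed
  then show ?thesis unfolding first_count_def by (metis (no_types, lifting) Collect_cong)
qed

definition gap_count :: "nat \<Rightarrow> nat \<Rightarrow> int \<Rightarrow> nat \<Rightarrow> nat" where
  "gap_count n k a m = card {s \<in> sorting_networks n. per_ext n s a = int k \<and> (\<forall>j\<in>{1..m}. per_ext n s (a + int j) \<noteq> int k)}"

text \<open>Networks without k at times 2, ..., m + 1 are as many as those without k at times 1,
  ..., m. They split according to whether time 1 carries k, and by stationarity the first class is
  counted by the gaps starting at a.\<close>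

lemma gap_count_first_count:
  assumes "n \<ge> 2" "Suc m \<le> n choose 2"
  shows "gap_count n k a m + first_count n k (Suc m) = first_count n k m"
proof -
  let ?S = "sorting_networks n"
  let ?A = "{s \<in> ?S. per_ext n s 1 = int k \<and> (\<forall>j\<in>{1..m}. per_ext n s (int j + 1) \<noteq> int k)}"
  let ?B = "{s \<in> ?S. \<forall>j\<in>{1..Suc m}. per_ext n s (int j) \<noteq> int k}"
  let ?C = "{s \<in> ?S. \<forall>j\<in>{1..m}. per_ext n s (int j + 1) \<noteq> int k}"
  have "gap_count n k a m = card ?A"
    using card_networks_shift[OF assms(1), of "\<lambda>g. g 1 = int k \<and> (\<forall>j\<in>{1..m}. g (int j + 1) \<noteq> int k)" "a - 1"]
    unfolding gap_count_def by (simp add: add_ac)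
  moreover have "first_count n k (Suc m) = card ?B" by (rule first_count_per_ext[OF assms(2)])
  moreover have "first_count n k m = card ?C"
    using first_count_per_ext[of m n k] assms(2)
      card_networks_shift_1[OF assms(1), of "\<lambda>g. \<forall>j\<in>{1..m}. g (int j) \<noteq> int k"] by simp
  moreover have "?C = ?A \<union> ?B"
  proof -
    have "(\<forall>j\<in>{1..Suc m}. g (int j) \<noteq> int k) \<longleftrightarrow> g 1 \<noteq> int k \<and> (\<forall>j\<in>{1..m}. g (int j + 1) \<noteq> int k)" for g :: "int \<Rightarrow> int"
    proof
      assume L: "\<forall>j\<in>{1..Suc m}. g (int j) \<noteq> int k"
      have "g (int j + 1) \<noteq> int k" if "j \<in> {1..m}" for j
        using L[rule_format, of "Suc j"] that by (simp add: add.commute)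
      then show "g 1 \<noteq> int k \<and> (\<forall>j\<in>{1..m}. g (int j + 1) \<noteq> int k)"
        using L[rule_format, of 1] by simp
    next
      assume R: "g 1 \<noteq> int k \<and> (\<forall>j\<in>{1..m}. g (int j + 1) \<noteq> int k)"
      have "g (int j) \<noteq> int k" if "j \<in> {1..Suc m}" for j
      proof (cases "j = 1")
        case False
        then have "j - 1 \<in> {1..m}" "int (j - 1) + 1 = int j" using that by auto
        then show ?thesis using R by metis
      qed (use R in simp)
      then show "\<forall>j\<in>{1..Suc m}. g (int j) \<noteq> int k" by blast
    qed
    then show ?thesis by auto
  qed
  moreover have "?A \<inter> ?B = {}" by force
  moreover have "finite ?A" "finite ?B" by (auto intro: finite_subset[OF _ finite_sorting_networks[of n]])
  ultimately show ?thesis using card_Un_disjoint[of ?A ?B] by presburger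
qed

lemma gap_count_antimono: "m \<le> m' \<Longrightarrow> gap_count n k a m' \<le> gap_count n k a m"
  unfolding gap_count_def by (intro card_mono) (auto intro: finite_subset[OF _ finite_sorting_networks[of n]])

lemma less_next_gap_iff:
  assumes "n \<ge> 2" "per_ext n s a = int k"
  shows "m < next_gap n k a s \<longleftrightarrow> (\<forall>j\<in>{1..m}. per_ext n s (a + int j) \<noteq> int k)"
proof -
  let ?P = "\<lambda>m. m > 0 \<and> per_ext n s (a + int m) = int k"
  \<comment> \<open>Two half-periods bring back the letter at time a; hence the set under
    \<open>LEAST\<close> is not empty and the least element is attained.\<close>
  have "?P (2 * (n choose 2))" using assms per_ext_period[of n s a] choose_two_pos[of n] by simp
  then have P: "?P (next_gap n k a s)" unfolding next_gap_def by (rule LeastI)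
  have nl: "\<not> ?P j" if "j < next_gap n k a s" for j using that unfolding next_gap_def by (rule not_less_Least)
  show ?thesis
  proof
    assume "m < next_gap n k a s"
    then have "\<not> ?P j" if "j \<in> {1..m}" for j using that by (intro nl) simp
    then show "\<forall>j\<in>{1..m}. per_ext n s (a + int j) \<noteq> int k" by simp
  next
    assume "\<forall>j\<in>{1..m}. per_ext n s (a + int j) \<noteq> int k"
    then have "\<not> next_gap n k a s \<le> m" using P by auto
    then show "m < next_gap n k a s" by simp
  qed
qed

lemma cdf_scaled_gap_law:
  assumes n: "n \<ge> 2" and pos: "gap_count n k a 0 > 0" and x: "x \<ge> 0"
  shows "cdf (scaled_gap_law k a n) x = 1 - real (gap_count n k a (nat \<lfloor>x * real n powr (3/2)\<rfloor>)) / real (gap_count n k a 0)"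
proof -
  let ?p = "real n powr (3/2)"
  let ?m = "nat \<lfloor>x * ?p\<rfloor>"
  let ?S = "{s \<in> sorting_networks n. per_ext n s a = int k}"
  let ?T = "{s \<in> sorting_networks n. per_ext n s a = int k \<and> (\<forall>j\<in>{1..?m}. per_ext n s (a + int j) \<noteq> int k)}"
  have fin: "finite ?S" by (auto intro: finite_subset[OF _ finite_sorting_networks[of n]])
  have c0: "card ?S = gap_count n k a 0" by (simp add: gap_count_def)
  then have ne: "?S \<noteq> {}" using pos by (metis card.empty less_irrefl)
  have p: "?p > 0" using n by simp
  have iff: "real (next_gap n k a s) / ?p \<le> x \<longleftrightarrow> \<not> ?m < next_gap n k a s" for s
  proof -
    have "real (next_gap n k a s) / ?p \<le> x \<longleftrightarrow> real (next_gap n k a s) \<le> x * ?p" using p by (simp add: pos_divide_le_eq)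
    also have "\<dots> \<longleftrightarrow> next_gap n k a s \<le> ?m" using x by (simp add: le_nat_floor le_nat_iff le_floor_iff)
    finally show ?thesis by (simp add: not_less)
  qed
  have "cdf (scaled_gap_law k a n) x = measure (measure_pmf (pmf_of_set ?S)) {s. real (next_gap n k a s) / ?p \<le> x}"
    unfolding cdf_def scaled_gap_law_def by (subst measure_distr) (auto intro!: arg_cong[where f = "measure _"])
  also have "\<dots> = real (card (?S \<inter> {s. real (next_gap n k a s) / ?p \<le> x})) / real (card ?S)"
    by (rule measure_pmf_of_set[OF ne fin])
  also have "?S \<inter> {s. real (next_gap n k a s) / ?p \<le> x} = ?S - ?T"
    unfolding iff using less_next_gap_iff[OF n, of _ a k ?m] by auto
  also have "card (?S - ?T) = card ?S - card ?T" using fin by (intro card_Diff_subset) (auto intro: finite_subset)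
  also have "card ?T = gap_count n k a ?m" by (simp add: gap_count_def)
  also have "real (card ?S - gap_count n k a ?m) = real (card ?S) - real (gap_count n k a ?m)"
    using gap_count_antimono[of 0 ?m n k a] c0 by simp
  finally show ?thesis using pos unfolding c0 by (simp add: diff_divide_distrib)
qed

lemma cdf_scaled_gap_law_neg: "x < 0 \<Longrightarrow> cdf (scaled_gap_law k a n) x = 0"
proof -
  assume x: "x < 0"
  have e: "(\<lambda>s. real (next_gap n k a s) / real n powr (3/2)) -` {..x} = {}"
  proof -
    have "\<not> real (next_gap n k a s) / real n powr (3/2) \<le> x" for s
      using x by (simp add: not_le less_le_trans[of x 0])
    then show ?thesis by auto
  qed
  show ?thesis unfolding cdf_def scaled_gap_law_def by (subst measure_distr) (simp_all add: e)
qed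

text \<open>For m < N this is the probability that a fixed time carries k and the next m times do
  not. It is written as a difference of \<open>Fr\<close> because that is where the limit is
  known.\<close>

definition bstep :: "nat \<Rightarrow> nat \<Rightarrow> nat \<Rightarrow> real" where
  "bstep n k m = Fr n k m - Fr n k (Suc m)"

lemma bstep_gap_count:
  assumes "n \<ge> 2" "Suc m \<le> n choose 2"
  shows "bstep n k m = real (gap_count n k a m) / real (card (sorting_networks n))"
  unfolding bstep_def Fr_def gap_count_first_count[OF assms, of k a, symmetric]
  by (simp add: add_divide_distrib)

text \<open>Convexity of \<open>Fr\<close> in m: as gap probabilities, its decrements belong to
  shrinking events.\<close>

lemma bstep_antimono:
  assumes "n \<ge> 2" "Suc m' \<le> n choose 2" "m \<le> m'"
  shows "bstep n k m' \<le> bstep n k m"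
  using assms gap_count_antimono[OF assms(3), of n k 0]
  by (simp add: bstep_gap_count[of n _ k 0] divide_right_mono)

lemma Fr_diff_sum: "Fr n k m - Fr n k (m + M) = (\<Sum>i<M. bstep n k (m + i))"
  by (induction M) (simp_all add: bstep_def)

lemma Fr_diff_le:
  assumes "n \<ge> 2" "m + M \<le> n choose 2"
  shows "Fr n k m - Fr n k (m + M) \<le> real M * bstep n k m"
proof -
  have "(\<Sum>i<M. bstep n k (m + i)) \<le> (\<Sum>i<M. bstep n k m)"
    using assms by (intro sum_mono bstep_antimono) auto
  then show ?thesis unfolding Fr_diff_sum by simp
qed

lemma Fr_diff_ge:
  assumes "n \<ge> 2" "Suc (m + M) \<le> n choose 2"
  shows "real M * bstep n k (m + M) \<le> Fr n k m - Fr n k (m + M)"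
proof -
  have "(\<Sum>i<M. bstep n k (m + M)) \<le> (\<Sum>i<M. bstep n k (m + i))"
    using assms by (intro sum_mono bstep_antimono) auto
  then show ?thesis unfolding Fr_diff_sum by simp
qed

lemma floor_scale_tendsto:
  assumes x: "x \<ge> 0"
  shows "(\<lambda>n. real (nat \<lfloor>x * real n powr (3/2)\<rfloor>) / real n powr (3/2)) \<longlonglongrightarrow> x"
proof (rule tendsto_sandwich)
  show "(\<lambda>n. x - 1 / real n powr (3/2)) \<longlonglongrightarrow> x" by real_asymp
  show "(\<lambda>n. x) \<longlonglongrightarrow> x" by simp
  have fl: "real (nat \<lfloor>x * real n powr (3/2)\<rfloor>) = of_int \<lfloor>x * real n powr (3/2)\<rfloor>" for n using x by simp
  show "\<forall>\<^sub>F n in sequentially. x - 1 / real n powr (3/2) \<le> real (nat \<lfloor>x * real n powr (3/2)\<rfloor>) / real n powr (3/2)"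
    using eventually_gt_at_top[of 0]
  proof eventually_elim
    case (elim n)
    let ?p = "real n powr (3/2)"
    have p: "?p > 0" using elim by simp
    have "x * ?p - 1 \<le> of_int \<lfloor>x * ?p\<rfloor>" by linarith
    then have "(x * ?p - 1) / ?p \<le> of_int \<lfloor>x * ?p\<rfloor> / ?p" using p by (intro divide_right_mono) auto
    then show ?case unfolding fl using p by (simp add: diff_divide_distrib)
  qed
  show "\<forall>\<^sub>F n in sequentially. real (nat \<lfloor>x * real n powr (3/2)\<rfloor>) / real n powr (3/2) \<le> x"
    using eventually_gt_at_top[of 0]
  proof eventually_elim
    case (elim n)
    then show ?case unfolding fl by (simp add: pos_divide_le_eq)
  qed
qed

text \<open>N has order n^2, so on the scale n^(3/2) all times stay within the first N letters,
  where \<open>Fr\<close> and the gap counts are related.\<close>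

lemma choose_two_large:
  assumes M: "(\<lambda>n. real (M n) / real n powr (3/2)) \<longlonglongrightarrow> y"
  shows "\<forall>\<^sub>F n in sequentially. Suc (M n) \<le> n choose 2"
proof -
  have "filterlim (\<lambda>n. (real n * (real n - 1) / 2) / real n powr (3/2)) at_top sequentially" by real_asymp
  then have "\<forall>\<^sub>F n in sequentially. (real n * (real n - 1) / 2) / real n powr (3/2) > y + 1"
    by (auto simp: filterlim_at_top_dense)
  moreover have "\<forall>\<^sub>F n in sequentially. real (M n) / real n powr (3/2) < y + 1"
    using M by (rule order_tendstoD) simp
  ultimately show ?thesis using eventually_ge_at_top[of 2]
  proof eventually_elim
    case (elim n)
    have p: "real n powr (3/2) > 0" using elim by simp
    have "real (M n) / real n powr (3/2) < (real n * (real n - 1) / 2) / real n powr (3/2)" using elim by simp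
    then have "real (M n) < real n * (real n - 1) / 2" using p unfolding divide_less_cancel by simp
    also have "\<dots> = real (n choose 2)" using elim by (simp add: choose_two real_of_nat_div field_simps of_nat_diff)
    finally show ?case by simp
  qed
qed

text \<open>By convexity one step lies between the average steps over macroscopic windows of width h
  to its right and to its left. These converge to difference quotients of y -> G(2 y), and h -> 0
  gives the derivative; the factor 2 is the chain rule.\<close>

theorem bstep_tendsto:
  assumes k: "k \<ge> 1" and x: "x > 0"
    and D: "((\<lambda>y. HH k y / HH k 0) has_real_derivative D) (at (2 * x))"
  shows "(\<lambda>n. real n powr (3/2) * bstep n k (nat \<lfloor>x * real n powr (3/2)\<rfloor>)) \<longlonglongrightarrow> - 2 * D"
proof -
  define p where "p = (\<lambda>n. real n powr (3/2))"
  define fl where "fl = (\<lambda>y n. nat \<lfloor>y * p n\<rfloor>)"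
  define g where "g = (\<lambda>y. HH k (2 * y) / HH k 0)"
  have H0: "HH k 0 \<noteq> 0" using HH_0_pos[of k] by simp
  have Dg: "(g has_real_derivative 2 * D) (at x)"
  proof -
    have "((\<lambda>y. 2 * y) has_real_derivative 2) (at x)" by (auto intro!: derivative_eq_intros)
    from DERIV_chain2[OF D this] show ?thesis by (simp add: g_def mult.commute)
  qed
  have quot: "((\<lambda>h. - ((g (x + h) - g x) / h)) \<longlongrightarrow> - 2 * D) (at 0)"
    using tendsto_minus[OF Dg[unfolded DERIV_def]] by simp
  have fl: "(\<lambda>n. real (fl y n) / p n) \<longlonglongrightarrow> y" if "y \<ge> 0" for y
    using floor_scale_tendsto[OF that] by (simp add: fl_def p_def)
  have Frg: "(\<lambda>n. Fr n k (M n)) \<longlonglongrightarrow> g y" if "(\<lambda>n. real (M n) / p n) \<longlonglongrightarrow> y" "y \<ge> 0" for M y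
    using Fr_tendsto[OF k H0 _ that(2), of M] that(1) by (simp add: g_def p_def)
  have ppos: "\<forall>\<^sub>F n in sequentially. p n > 0 \<and> n \<ge> 2"
    using eventually_ge_at_top[of 2] by eventually_elim (simp add: p_def)
  have flpos: "\<forall>\<^sub>F n in sequentially. real (fl y n) / p n > 0" if "y > 0" for y
    using fl[of y] that by (intro order_tendstoD(1)) auto
  have "(\<lambda>n. p n * bstep n k (fl x n)) \<longlonglongrightarrow> - 2 * D"
  proof (rule order_tendstoI)
    fix c assume "c < - 2 * D"
    then have "\<forall>\<^sub>F h in at 0. - ((g (x + h) - g x) / h) > c" using quot by (rule order_tendstoD(1)[rotated])
    then obtain d where d: "d > 0" "\<And>h. h \<noteq> 0 \<Longrightarrow> \<bar>h\<bar> < d \<Longrightarrow> - ((g (x + h) - g x) / h) > c"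
      unfolding eventually_at by (auto simp: dist_real_def)
    define h where "h = d / 2"
    have h: "h > 0" "(g x - g (x + h)) / h > c" using d(1) d(2)[of h] by (auto simp: h_def minus_divide_left)
    have sum: "(\<lambda>n. real (fl x n + fl h n) / p n) \<longlonglongrightarrow> x + h"
      using tendsto_add[OF fl[of x] fl[of h]] x h by (simp add: add_divide_distrib)
    have "(\<lambda>n. (Fr n k (fl x n) - Fr n k (fl x n + fl h n)) / (real (fl h n) / p n)) \<longlonglongrightarrow> (g x - g (x + h)) / h"
      using x h by (intro tendsto_divide tendsto_diff Frg[OF fl] Frg[OF sum] fl) auto
    then have "\<forall>\<^sub>F n in sequentially. (Fr n k (fl x n) - Fr n k (fl x n + fl h n)) / (real (fl h n) / p n) > c"
      using h(2) by (rule order_tendstoD(1))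
    then show "\<forall>\<^sub>F n in sequentially. c < p n * bstep n k (fl x n)"
      using choose_two_large[OF sum[unfolded p_def]] ppos flpos[OF h(1)]
    proof eventually_elim
      case (elim n)
      have M: "real (fl h n) > 0" "p n > 0" using elim by (auto simp: zero_less_divide_iff)
      have "(Fr n k (fl x n) - Fr n k (fl x n + fl h n)) / (real (fl h n) / p n) \<le> (real (fl h n) * bstep n k (fl x n)) / (real (fl h n) / p n)"
        using elim M by (intro divide_right_mono Fr_diff_le) auto
      also have "\<dots> = p n * bstep n k (fl x n)" using M by simp
      finally show ?case using elim by simp
    qed
  next
    fix c assume "- 2 * D < c"
    then have "\<forall>\<^sub>F h in at 0. - ((g (x + h) - g x) / h) < c" using quot by (rule order_tendstoD(2)[rotated])
    then obtain d where d: "d > 0" "\<And>h. h \<noteq> 0 \<Longrightarrow> \<bar>h\<bar> < d \<Longrightarrow> - ((g (x + h) - g x) / h) < c"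
      unfolding eventually_at by (auto simp: dist_real_def)
    \<comment> \<open>The bound by x keeps the left window inside the nonnegative times, where the
      limit of \<open>Fr\<close> is known.\<close>
    define h where "h = min d x / 2"
    have h: "h > 0" "h \<le> x" "(g (x - h) - g x) / h < c" using d(1) x d(2)[of "- h"] by (auto simp: h_def min_def)
    have mono: "fl h n \<le> fl x n" for n unfolding fl_def using h x by (intro nat_mono floor_mono mult_right_mono) (auto simp: p_def)
    have diff: "(\<lambda>n. real (fl x n - fl h n) / p n) \<longlonglongrightarrow> x - h"
      using tendsto_diff[OF fl[of x] fl[of h]] x h mono by (simp add: diff_divide_distrib of_nat_diff)
    have "(\<lambda>n. (Fr n k (fl x n - fl h n) - Fr n k (fl x n)) / (real (fl h n) / p n)) \<longlonglongrightarrow> (g (x - h) - g x) / h"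
      using x h by (intro tendsto_divide tendsto_diff Frg[OF fl] Frg[OF diff] fl) auto
    then have "\<forall>\<^sub>F n in sequentially. (Fr n k (fl x n - fl h n) - Fr n k (fl x n)) / (real (fl h n) / p n) < c"
      using h(3) by (rule order_tendstoD(2))
    then show "\<forall>\<^sub>F n in sequentially. p n * bstep n k (fl x n) < c"
      using choose_two_large[OF fl[OF less_imp_le[OF x], unfolded p_def]] ppos flpos[OF h(1)]
    proof eventually_elim
      case (elim n)
      have M: "real (fl h n) > 0" "p n > 0" using elim by (auto simp: zero_less_divide_iff)
      have e: "fl x n - fl h n + fl h n = fl x n" using mono by simp
      have "real (fl h n) * bstep n k (fl x n) \<le> Fr n k (fl x n - fl h n) - Fr n k (fl x n)"
        using Fr_diff_ge[of n "fl x n - fl h n" "fl h n" k] elim unfolding e by blast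
      then have "(real (fl h n) * bstep n k (fl x n)) / (real (fl h n) / p n) \<le> (Fr n k (fl x n - fl h n) - Fr n k (fl x n)) / (real (fl h n) / p n)"
        using M by (intro divide_right_mono) auto
      moreover have "(real (fl h n) * bstep n k (fl x n)) / (real (fl h n) / p n) = p n * bstep n k (fl x n)" using M by simp
      ultimately show ?case using elim by simp
    qed
  qed
  then show ?thesis by (simp add: fl_def p_def)
qed

lemma bstep_0_tendsto:
  assumes k: "k \<ge> 1"
  shows "(\<lambda>n. real n powr (3/2) * bstep n k 0) \<longlonglongrightarrow> 2 / ck k"
  using Fr_first_step[OF k] HH_0_pos[of k] e0_ratio[OF k] by (simp add: bstep_def)

text \<open>Conditioning on the letter k at time a divides by the step at m = 0, so the factor
  n^(3/2) cancels between numerator and denominator. The quotient of -2 D by 2 / \<open>ck k\<close>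
  is the limiting tail. At 0 the distribution function is exactly 0, as every gap is at least
  1.\<close>

theorem cdf_scaled_gap_law_tendsto:
  assumes k: "k \<ge> 1" and x: "x > 0"
    and D: "((\<lambda>y. HH k y / HH k 0) has_real_derivative D) (at (2 * x))"
  shows "(\<lambda>n. cdf (scaled_gap_law k a n) x) \<longlonglongrightarrow> 1 + ck k * D"
    and "(\<lambda>n. cdf (scaled_gap_law k a n) 0) \<longlonglongrightarrow> 0"
proof -
  let ?p = "\<lambda>n::nat. real n powr (3/2)" and ?m = "\<lambda>n::nat. nat \<lfloor>x * real n powr (3/2)\<rfloor>"
  have ck: "ck k > 0" by (rule ck_pos[OF k])
  have "\<forall>\<^sub>F n in sequentially. ?p n * bstep n k 0 > 0"
    by (rule order_tendstoD(1)[OF bstep_0_tendsto[OF k]]) (use ck in simp)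
  moreover have "\<forall>\<^sub>F n in sequentially. Suc (?m n) \<le> n choose 2"
    by (rule choose_two_large[OF floor_scale_tendsto[OF less_imp_le[OF x]]])
  ultimately have ev: "\<forall>\<^sub>F n in sequentially. n \<ge> 2 \<and> gap_count n k a 0 > 0 \<and> Suc (?m n) \<le> n choose 2"
    using eventually_ge_at_top[of 2]
  proof eventually_elim
    case (elim n)
    have "bstep n k 0 > 0" using elim(1) by (simp add: zero_less_mult_iff)
    then show ?case using elim bstep_gap_count[of n 0 k a] by (auto simp: zero_less_divide_iff)
  qed
  have lim: "(\<lambda>n. 1 - (?p n * bstep n k (?m n)) / (?p n * bstep n k 0)) \<longlonglongrightarrow> 1 - (- 2 * D) / (2 / ck k)"
    using ck by (intro tendsto_diff tendsto_const tendsto_divide bstep_tendsto[OF k x D] bstep_0_tendsto[OF k]) simp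
  have val: "1 - (- 2 * D) / (2 / ck k) = 1 + ck k * D" using ck by (simp add: field_simps)
  have "\<forall>\<^sub>F n in sequentially. 1 - (?p n * bstep n k (?m n)) / (?p n * bstep n k 0) = cdf (scaled_gap_law k a n) x"
    using ev
  proof eventually_elim
    case (elim n)
    then have n: "n \<ge> 2" and g: "gap_count n k a 0 > 0" and N: "Suc (?m n) \<le> n choose 2" "Suc 0 \<le> n choose 2" by auto
    have "(?p n * bstep n k (?m n)) / (?p n * bstep n k 0) = real (gap_count n k a (?m n)) / real (gap_count n k a 0)"
      unfolding bstep_gap_count[OF n N(1), of k a] bstep_gap_count[OF n N(2), of k a]
      using n sorting_networks_nonempty[of n] by simp
    then show ?case unfolding cdf_scaled_gap_law[OF n g less_imp_le[OF x]] by simp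
  qed
  then show "(\<lambda>n. cdf (scaled_gap_law k a n) x) \<longlonglongrightarrow> 1 + ck k * D"
    by (rule Lim_transform_eventually[OF lim[unfolded val]])
  have "\<forall>\<^sub>F n in sequentially. 0 = cdf (scaled_gap_law k a n) 0"
    using ev
  proof eventually_elim
    case (elim n)
    then show ?case using cdf_scaled_gap_law[of n k a 0] by simp
  qed
  then show "(\<lambda>n. cdf (scaled_gap_law k a n) 0) \<longlonglongrightarrow> 0" by (rule Lim_transform_eventually[OF tendsto_const])
qed

section \<open>The limit law\<close>

definition rowm :: "nat \<Rightarrow> real \<Rightarrow> nat \<Rightarrow> nat \<Rightarrow> real" where
  "rowm r x = (\<lambda>i j. if i = r then - (x ^ (2 * (i + j)) * exp (- x\<^sup>2)) else gm (i + j) x)"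

definition HH1 :: "nat \<Rightarrow> real \<Rightarrow> real" where
  "HH1 k x = (\<Sum>r<k. fdet k (rowm r x))"

lemma HH_has_derivative: "(HH k has_real_derivative HH1 k x) (at x)"
proof -
  have "((\<lambda>x. fdet k (\<lambda>i j. gm (i + j) x)) has_real_derivative
      (\<Sum>r<k. fdet k ((\<lambda>i j. gm (i + j) x)(r := (\<lambda>j. - (x ^ (2 * (r + j)) * exp (- x\<^sup>2))))))) (at x)"
    by (rule fdet_has_derivative[where a' = "\<lambda>i j. - (x ^ (2 * (i + j)) * exp (- x\<^sup>2))"]) (rule gm_has_derivative)
  moreover have "(\<lambda>i j. gm (i + j) x)(r := (\<lambda>j. - (x ^ (2 * (r + j)) * exp (- x\<^sup>2)))) = rowm r x" for r
    by (rule ext)+ (simp add: rowm_def)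
  ultimately show ?thesis unfolding HH1_def HH_def by (simp only:)
qed

text \<open>Existence is enough: sign and total mass of the second derivative come later from the
  monotonicity and the boundary values of \<open>G1\<close>.\<close>

lemma HH1_differentiable: "\<exists>D. (HH1 k has_real_derivative D) (at x)"
proof -
  have "\<exists>D. ((\<lambda>x. fdet k (rowm r x)) has_real_derivative D) (at x)" for r
  proof -
    define a' where "a' = (\<lambda>i j. if i = r then - (real (2 * (i + j)) * x ^ (2 * (i + j) - 1) * exp (- x\<^sup>2) + x ^ (2 * (i + j)) * (exp (- x\<^sup>2) * (- (2 * x)))) else - (x ^ (2 * (i + j)) * exp (- x\<^sup>2)))"
    have D: "((\<lambda>x. rowm r x i j) has_real_derivative a' i j) (at x)" for i j
    proof (cases "i = r")
      case True
      have "((\<lambda>x. - (x ^ m * exp (- x\<^sup>2))) has_real_derivative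
          - (real m * x ^ (m - 1) * exp (- x\<^sup>2) + x ^ m * (exp (- x\<^sup>2) * (- (2 * x))))) (at x)" for m
        by (auto intro!: derivative_eq_intros)
      from this[of "2 * (i + j)"] True show ?thesis unfolding rowm_def a'_def by simp
    next
      case False
      then show ?thesis using gm_has_derivative[of "i + j" x] by (simp add: rowm_def a'_def)
    qed
    show ?thesis by (rule exI, rule fdet_has_derivative[of k "\<lambda>x. rowm r x" a'], rule D)
  qed
  then obtain D where "\<And>r. ((\<lambda>x. fdet k (rowm r x)) has_real_derivative D r) (at x)" by metis
  then have "((\<lambda>x. \<Sum>r<k. fdet k (rowm r x)) has_real_derivative (\<Sum>r<k. D r)) (at x)" by (intro DERIV_sum)
  then show ?thesis unfolding HH1_def by blast
qed

lemma HH1_0: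
  assumes "k \<ge> 1"
  shows "HH1 k 0 = - fdet k (e0row (\<lambda>i j. gm (i + j) 0))"
proof -
  let ?a = "\<lambda>i j. gm (i + j) 0"
  have r0: "fdet k (rowm r 0) = 0" if "r < k" "r \<noteq> 0" for r
  proof -
    have "fdet k (rowm r 0) = fdet k ((rowm r 0)(r := (\<lambda>j. 0)))"
      by (rule fdet_cong) (use that in \<open>auto simp: rowm_def\<close>)
    then show ?thesis using fdet_row_zero[OF that(1)] by simp
  qed
  have "HH1 k 0 = (\<Sum>r\<in>{0}. fdet k (rowm r 0))"
    unfolding HH1_def using assms r0 by (intro sum.mono_neutral_right) auto
  also have "\<dots> = fdet k (rowm 0 0)" by simp
  also have "\<dots> = fdet k (?a(0 := (\<lambda>j. - 1 * (if j = 0 then 1 else 0) + 0 * 0)))"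
    by (rule fdet_cong) (auto simp: rowm_def)
  also have "\<dots> = - 1 * fdet k (?a(0 := (\<lambda>j. if j = 0 then 1 else 0))) + 0 * fdet k (?a(0 := (\<lambda>j. 0)))"
    by (rule fdet_row_linear) (use assms in simp)
  finally show ?thesis unfolding e0row_def by simp
qed

lemma power_gauss_tendsto_0: "((\<lambda>x::real. x ^ (2 * m) * exp (- x\<^sup>2)) \<longlongrightarrow> 0) at_top"
proof -
  have "filterlim (\<lambda>x::real. x\<^sup>2) at_top at_top" by real_asymp
  from filterlim_compose[OF tendsto_power_div_exp_0[of m] this]
  show ?thesis by (simp add: exp_minus power_mult divide_inverse)
qed

lemma gm_tendsto_0: "(gm j \<longlongrightarrow> 0) at_top"
proof -
  let ?f = "\<lambda>v::real. v ^ (2 * j) * exp (- v\<^sup>2)"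
  have "((\<lambda>t. LINT v|lborel. indicator {t..} v * ?f v) \<longlongrightarrow> integral\<^sup>L lborel (\<lambda>v::real. 0::real)) at_top"
  proof (rule integral_dominated_convergence_at_top[where w = "\<lambda>v. indicator {0..} v * ?f v"])
    show "integrable lborel (\<lambda>v. indicator {0..} v * ?f v)" by (rule integrable_gm)
    show "\<forall>\<^sub>F t in at_top. AE v in lborel. norm (indicator {t..} v * ?f v) \<le> indicator {0..} v * ?f v"
      using eventually_ge_at_top[of 0]
      by eventually_elim (intro AE_I2, auto simp: indicator_def abs_mult power_mult)
    show "AE v in lborel. ((\<lambda>t. indicator {t..} v * ?f v) \<longlongrightarrow> 0) at_top"
    proof (intro AE_I2)
      fix v :: real
      have "\<forall>\<^sub>F t in at_top. indicator {t..} v * ?f v = 0"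
        using eventually_gt_at_top[of v] by eventually_elim (simp add: indicator_def)
      then show "((\<lambda>t. indicator {t..} v * ?f v) \<longlongrightarrow> 0) at_top" by (rule tendsto_eventually)
    qed
  qed auto
  then show ?thesis unfolding gm_def by simp
qed

lemma HH1_tendsto_0: "(HH1 k \<longlongrightarrow> 0) at_top"
proof -
  have "((\<lambda>x. fdet k (rowm r x)) \<longlongrightarrow> 0) at_top" if "r < k" for r
  proof -
    have "((\<lambda>x. rowm r x i j) \<longlongrightarrow> 0) at_top" for i j
      using tendsto_minus[OF power_gauss_tendsto_0[of "i + j"]] gm_tendsto_0[of "i + j"] by (cases "i = r") (simp_all add: rowm_def)
    then have "((\<lambda>x. fdet k (rowm r x)) \<longlongrightarrow> fdet k (\<lambda>i j. 0)) at_top" by (rule fdet_tendsto)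
    moreover have "fdet k (\<lambda>i j. 0) = fdet k ((\<lambda>i j. 0)(r := (\<lambda>j. 0)))" by (rule fdet_cong) simp
    ultimately show ?thesis using fdet_row_zero[OF that] by simp
  qed
  then have "((\<lambda>x. \<Sum>r<k. fdet k (rowm r x)) \<longlongrightarrow> (\<Sum>r<k. 0)) at_top" by (intro tendsto_sum) simp
  then show ?thesis unfolding HH1_def by simp
qed

definition G1 :: "nat \<Rightarrow> real \<Rightarrow> real" where "G1 k x = HH1 k x / HH k 0"

lemma G_has_derivative: "((\<lambda>y. HH k y / HH k 0) has_real_derivative G1 k x) (at x)"
  unfolding G1_def by (rule DERIV_cdivide[OF HH_has_derivative])

lemma G1_has_derivative: "(G1 k has_real_derivative deriv (G1 k) x) (at x)"
proof -
  obtain D where "(HH1 k has_real_derivative D) (at x)" using HH1_differentiable by blast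
  then have "((\<lambda>x. HH1 k x / HH k 0) has_real_derivative D / HH k 0) (at x)" by (rule DERIV_cdivide)
  then have D: "(G1 k has_real_derivative D / HH k 0) (at x)" unfolding G1_def .
  show ?thesis using D unfolding DERIV_imp_deriv[OF D] .
qed

lemma G1_0:
  assumes "k \<ge> 1"
  shows "G1 k 0 = - 1 / ck k"
  using e0_ratio[OF assms] by (simp add: G1_def HH1_0[OF assms])

lemma G1_tendsto_0: "(G1 k \<longlongrightarrow> 0) at_top"
  unfolding G1_def using tendsto_divide[OF HH1_tendsto_0[of k] tendsto_const[of "HH k 0"]] HH_0_pos[of k] by simp

text \<open>The discrete tail is convex in the number of steps, by stationarity, and convexity survives in the limit.\<close>
lemma G1_mono_pos:
  assumes k: "k \<ge> 1" and xy: "0 < x" "x \<le> y"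
  shows "G1 k x \<le> G1 k y"
proof -
  let ?s = "\<lambda>x n. real n powr (3/2) * bstep n k (nat \<lfloor>x * real n powr (3/2)\<rfloor>)"
  have lim: "?s (z / 2) \<longlonglongrightarrow> - 2 * G1 k z" if "z > 0" for z
    using bstep_tendsto[OF k, of "z / 2"] that G_has_derivative[of k z] by simp
  have y: "y / 2 \<ge> 0" using xy by simp
  have "\<forall>\<^sub>F n in sequentially. ?s (y / 2) n \<le> ?s (x / 2) n"
    using choose_two_large[OF floor_scale_tendsto[OF y]] eventually_ge_at_top[of 2]
  proof eventually_elim
    case (elim n)
    have "nat \<lfloor>x / 2 * real n powr (3/2)\<rfloor> \<le> nat \<lfloor>y / 2 * real n powr (3/2)\<rfloor>"
      using xy by (intro nat_mono floor_mono mult_right_mono) auto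
    then show ?case using elim xy by (intro mult_left_mono bstep_antimono) auto
  qed
  then have "- 2 * G1 k y \<le> - 2 * G1 k x"
    using xy by (intro tendsto_le[OF _ lim lim]) auto
  then show ?thesis by simp
qed

lemma G1_mono:
  assumes k: "k \<ge> 1" and xy: "0 \<le> x" "x \<le> y"
  shows "G1 k x \<le> G1 k y"
proof (cases "x = 0 \<and> y > 0")
  case True
  have "(G1 k \<longlongrightarrow> G1 k 0) (at_right 0)"
    using DERIV_isCont[OF G1_has_derivative[of k 0]] by (simp add: isCont_def filterlim_at_split)
  moreover have "\<forall>\<^sub>F z in at_right 0. G1 k z \<le> G1 k y"
    unfolding eventually_at_right_field using True G1_mono_pos[OF k] by (intro exI[of _ y]) auto
  ultimately show ?thesis using True by (auto intro: tendsto_upperbound)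
next
  case False
  then show ?thesis using xy G1_mono_pos[OF k, of x y] by (cases "x = y") auto
qed

lemma deriv_G1_nonneg:
  assumes k: "k \<ge> 1" and x: "0 \<le> x"
  shows "deriv (G1 k) x \<ge> 0"
proof (rule ccontr)
  assume "\<not> deriv (G1 k) x \<ge> 0"
  then obtain d where d: "d > 0" "\<And>h. h > 0 \<Longrightarrow> h < d \<Longrightarrow> G1 k (x + h) < G1 k x"
    using DERIV_neg_dec_right[OF G1_has_derivative[of k x]] by auto
  have "G1 k x \<le> G1 k (x + d / 2)" using d(1) by (intro G1_mono[OF k x]) simp
  moreover have "G1 k (x + d / 2) < G1 k x" using d(1) by (intro d(2)) simp_all
  ultimately show False by simp
qed

text \<open>Measurability of the derivative as a pointwise limit of continuous difference quotients,
  without a formula for it.\<close>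

lemma deriv_G1_measurable: "deriv (G1 k) \<in> borel_measurable borel"
proof (rule borel_measurable_LIMSEQ_real)
  have cont: "continuous_on UNIV (G1 k)"
    by (intro continuous_at_imp_continuous_on ballI DERIV_isCont[OF G1_has_derivative])
  then have [measurable]: "G1 k \<in> borel_measurable borel" by (rule borel_measurable_continuous_onI)
  show "(\<lambda>x. (G1 k (x + 1 / real (Suc n)) - G1 k x) / (1 / real (Suc n))) \<in> borel_measurable borel" for n
    by measurable
  fix x
  have "filterlim (\<lambda>n. 1 / real (Suc n)) (at 0) sequentially"
    unfolding filterlim_at using LIMSEQ_inverse_real_of_nat by (simp add: inverse_eq_divide)
  with G1_has_derivative[of k x, unfolded DERIV_def]
  show "(\<lambda>n. (G1 k (x + 1 / real (Suc n)) - G1 k x) / (1 / real (Suc n))) \<longlonglongrightarrow> deriv (G1 k) x"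
    by (rule filterlim_compose)
qed

text \<open>\<open>TFS_tail\<close> is identified with the Hankel quotient only at positive
  arguments, so both derivatives are transferred inside the open half-line.\<close>

lemma ghat_eq:
  assumes k: "k \<ge> 1" and x: "x > 0"
  shows "ghat k x = ck k * deriv (G1 k) x"
proof -
  have T: "(TFS_tail k has_real_derivative G1 k y) (at y)" if "y \<in> {0<..}" for y
    using that TFS_tail_eq[OF k]
    by (intro has_field_derivative_transform_within_open[OF G_has_derivative[of k y], of "{0<..}"]) auto
  have "(deriv (TFS_tail k) has_real_derivative deriv (G1 k) x) (at x)"
    using x DERIV_imp_deriv[OF T]
    by (intro has_field_derivative_transform_within_open[OF G1_has_derivative[of k x], of "{0<..}"]) auto
  then have "deriv (deriv (TFS_tail k)) x = deriv (G1 k) x" by (rule DERIV_imp_deriv)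
  then show ?thesis using x by (simp add: ghat_def ck_def)
qed

lemma ghat_measurable [measurable]:
  assumes k: "k \<ge> 1"
  shows "ghat k \<in> borel_measurable borel"
proof -
  have "ghat k = (\<lambda>x. if x > 0 then ck k * deriv (G1 k) x else 0)"
    using ghat_eq[OF k] by (intro ext) (simp add: ghat_def)
  moreover note [measurable] = deriv_G1_measurable[of k]
  have "(\<lambda>x. if x > 0 then ck k * deriv (G1 k) x else 0) \<in> borel_measurable borel" by measurable
  ultimately show ?thesis by simp
qed

text \<open>The two integrands can differ only at 0, a null set. This exchanges \<open>ghat\<close>,
  cut off at 0, for a derivative that exists everywhere, so that the fundamental theorem applies on
  closed intervals starting at 0.\<close>

lemma nn_integral_ghat:
  assumes k: "k \<ge> 1" and AB: "\<And>x. x > 0 \<Longrightarrow> x \<in> A \<longleftrightarrow> x \<in> B" and B: "B \<subseteq> {0..}"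
  shows "(\<integral>\<^sup>+x. ennreal (ghat k x) * indicator A x \<partial>lborel) = (\<integral>\<^sup>+x. ennreal (ck k * deriv (G1 k) x) * indicator B x \<partial>lborel)"
proof (rule nn_integral_cong_AE)
  show "AE x in lborel. ennreal (ghat k x) * indicator A x = ennreal (ck k * deriv (G1 k) x) * indicator B x"
    using AE_lborel_singleton[of "0::real"]
  proof eventually_elim
    case (elim x)
    show ?case
    proof (cases "x > 0")
      case True
      then show ?thesis using AB[OF True] ghat_eq[OF k True] by (simp add: indicator_def)
    next
      case False
      then have "x \<notin> B" using elim B by auto
      then show ?thesis using False by (simp add: ghat_def)
    qed
  qed
qed

lemma scaled_G1_properties:
  assumes k: "k \<ge> 1"
  shows "(\<lambda>x. ck k * deriv (G1 k) x) \<in> borel_measurable borel"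
    and "((\<lambda>x. ck k * G1 k x) has_real_derivative ck k * deriv (G1 k) x) (at x)"
    and "x \<ge> 0 \<Longrightarrow> ck k * deriv (G1 k) x \<ge> 0"
    and "((\<lambda>x. ck k * G1 k x) \<longlongrightarrow> 0) at_top"
    and "ck k * G1 k 0 = - 1"
proof -
  note [measurable] = deriv_G1_measurable[of k]
  show "(\<lambda>x. ck k * deriv (G1 k) x) \<in> borel_measurable borel" by measurable
  show "((\<lambda>x. ck k * G1 k x) has_real_derivative ck k * deriv (G1 k) x) (at x)"
    by (rule DERIV_cmult[OF G1_has_derivative])
  show "x \<ge> 0 \<Longrightarrow> ck k * deriv (G1 k) x \<ge> 0"
    using deriv_G1_nonneg[OF k, of x] ck_pos[OF k] by simp
  show "((\<lambda>x. ck k * G1 k x) \<longlongrightarrow> 0) at_top" using tendsto_mult_left[OF G1_tendsto_0, of "ck k"] by simp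
  show "ck k * G1 k 0 = - 1" using ck_pos[OF k] by (simp add: G1_0[OF k])
qed

text \<open>The mass is the increment of \<open>ck k * G1 k\<close> over the half-line, from -1 at 0
  to 0 at infinity.\<close>

lemma prob_space_ghat:
  assumes k: "k \<ge> 1"
  shows "prob_space (density lborel (ghat k))"
proof
  note [measurable] = ghat_measurable[OF k]
  have "emeasure (density lborel (ghat k)) (space (density lborel (ghat k))) = (\<integral>\<^sup>+x. ennreal (ghat k x) * indicator UNIV x \<partial>lborel)"
    by (simp add: emeasure_density)
  also have "\<dots> = (\<integral>\<^sup>+x. ennreal (ck k * deriv (G1 k) x) * indicator {0..} x \<partial>lborel)"
    by (rule nn_integral_ghat[OF k]) auto
  also have "\<dots> = ennreal (0 - ck k * G1 k 0)"
    by (rule nn_integral_FTC_atLeast[OF scaled_G1_properties(1,2,3,4)[OF k]])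
  finally show "emeasure (density lborel (ghat k)) (space (density lborel (ghat k))) = 1"
    unfolding scaled_G1_properties(5)[OF k] by simp
qed

lemma cdf_half_ghat:
  assumes k: "k \<ge> 1"
  shows "cdf (distr (density lborel (ghat k)) borel (\<lambda>x. x / 2)) x = (if x > 0 then 1 + ck k * G1 k (2 * x) else 0)"
proof -
  note [measurable] = ghat_measurable[OF k]
  have vi: "(\<lambda>x::real. x / 2) -` {..x} = {..2 * x}" by auto
  have "cdf (distr (density lborel (ghat k)) borel (\<lambda>x. x / 2)) x = measure (density lborel (ghat k)) {..2 * x}"
    unfolding cdf_def by (subst measure_distr) (simp_all add: vi)
  also have "\<dots> = enn2real (\<integral>\<^sup>+y. ennreal (ghat k y) * indicator {..2 * x} y \<partial>lborel)"
    unfolding measure_def by (simp add: emeasure_density)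
  also have "\<dots> = (if x > 0 then 1 + ck k * G1 k (2 * x) else 0)"
  proof (cases "x > 0")
    case True
    have "(\<integral>\<^sup>+y. ennreal (ghat k y) * indicator {..2 * x} y \<partial>lborel) = (\<integral>\<^sup>+y. ennreal (ck k * deriv (G1 k) y) * indicator {0..2 * x} y \<partial>lborel)"
      by (rule nn_integral_ghat[OF k]) auto
    also have "\<dots> = ennreal (ck k * G1 k (2 * x) - ck k * G1 k 0)"
      using True by (intro nn_integral_FTC_Icc scaled_G1_properties[OF k]) auto
    finally have "(\<integral>\<^sup>+y. ennreal (ghat k y) * indicator {..2 * x} y \<partial>lborel) = ennreal (1 + ck k * G1 k (2 * x))"
      unfolding scaled_G1_properties(5)[OF k] by (simp add: add.commute)
    moreover have "1 + ck k * G1 k (2 * x) \<ge> 0"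
    proof -
      have "ck k * G1 k 0 \<le> ck k * G1 k (2 * x)"
        using G1_mono[OF k, of 0 "2 * x"] True ck_pos[OF k] by (intro mult_left_mono) auto
      then show ?thesis unfolding scaled_G1_properties(5)[OF k] by simp
    qed
    ultimately show ?thesis using True by simp
  next
    case False
    have "(\<integral>\<^sup>+y. ennreal (ghat k y) * indicator {..2 * x} y \<partial>lborel) = (\<integral>\<^sup>+y. ennreal (ck k * deriv (G1 k) y) * indicator {} y \<partial>lborel)"
      by (rule nn_integral_ghat[OF k]) (use False in auto)
    then show ?thesis using False by simp
  qed
  finally show ?thesis .
qed

text \<open>Nonnegativity is part of the claim because the coercion of \<open>ghat k\<close> to
  \<open>ennreal\<close> would silently cut off negative values. The index \<open>m + k + 1\<close>
  lets n run through all integers above k, and the limit is the law of half the variable, written as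
  a push-forward.\<close>

theorem theorem1p14:
  fixes k :: nat and a :: int
  assumes "k \<ge> 1"
  shows "(\<forall>x>0. ghat k x \<ge> 0)
    \<and> prob_space (density lborel (ghat k))
    \<and> weak_conv_m (\<lambda>m. scaled_gap_law k a (m + k + 1))
        (distr (density lborel (ghat k)) borel (\<lambda>x. x / 2))"
proof (intro conjI)
  show "\<forall>x>0. ghat k x \<ge> 0"
    using ghat_eq[OF assms] scaled_G1_properties(3)[OF assms] by simp
  show "prob_space (density lborel (ghat k))" by (rule prob_space_ghat[OF assms])
  have "(\<lambda>n. cdf (scaled_gap_law k a n) x) \<longlonglongrightarrow> cdf (distr (density lborel (ghat k)) borel (\<lambda>x. x / 2)) x" for x
  proof -
    consider "x > 0" | "x = 0" | "x < 0" by linarith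
    then show ?thesis
    proof cases
      case 1
      then show ?thesis
        using cdf_scaled_gap_law_tendsto(1)[OF assms 1 G_has_derivative] unfolding cdf_half_ghat[OF assms] by simp
    next
      \<comment> \<open>The value at 0 does not involve the point of differentiation, so x = 1
        serves as an arbitrary positive witness.\<close>
      case 2
      then show ?thesis
        using cdf_scaled_gap_law_tendsto(2)[OF assms _ G_has_derivative[of k "2 * 1"]] unfolding cdf_half_ghat[OF assms] by simp
    next
      case 3
      then show ?thesis unfolding cdf_half_ghat[OF assms] cdf_scaled_gap_law_neg[OF 3] by simp
    qed
  qed
  from LIMSEQ_ignore_initial_segment[OF this, of "k + 1"]
  show "weak_conv_m (\<lambda>m. scaled_gap_law k a (m + k + 1)) (distr (density lborel (ghat k)) borel (\<lambda>x. x / 2))"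
    unfolding weak_conv_m_def weak_conv_def by (simp add: add.assoc)
qed

end
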